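(* Let $d\in\{1,2,3\}$, $\nu>0$. Assume all of the following. (1) $m_j\in \mathcal W_2^{\nu+d/2}(\mathcal S)$ for $j=1,\ldots,p$, and $M_n$ has rank $p$ for all $n\ge p$. (2) $\Omega_\beta$ is symmetric positive semidefinite; $\pi(\theta|\alpha)$ is a proper density in $\theta\in(0,\infty)$, continuously differentiable in $\theta$, continuous in $\alpha$, finite for all $\theta,\alpha\in(0,\infty)$, not depending on $n$, with $\pi(\theta_0|\alpha)>0$ for all $\alpha>0$. (3) There exist positive constants $C_{\pi,1},C_{\pi,2},C_{\pi,3}$ (which may depend on $\nu,d,T,\alpha_0,\theta_0$) with $C_{\pi,1}+C_{\pi,2}<1/2$ and $C_{\pi,3}<1$ such that for all sufficiently large $n$, $$\sup_{\alpha\in[\underline\alpha_n,\overline\alpha_n]}\ \sup_{\theta\in(\theta_0/2,2\theta_0)}\Big|\frac{\partial\log\pi(\theta|\alpha)}{\partial\theta}\Big|\le n^{C_{\pi,1}},\quad \sup_{\alpha\in[\underline\alpha_n,\overline\alpha_n]}\ \sup_{\theta\in(\theta_0/2,2\theta_0)}\frac{\pi(\theta|\alpha)}{\pi(\theta_0|\alpha)}\le n^{C_{\pi,2}},\quad \inf_{\alpha\in[\underline\alpha_n,\overline\alpha_n]}\log\pi(\theta_0|\alpha)\ge -n^{C_{\pi,3}}.$$ (4) $\pi(\alpha)$ is a proper continuous density on $(0,\infty)$ not depending on $n$, $\pi(\alpha_0)>0$, $\int_0^\infty\pi(\theta_0|\alpha)\pi(\alpha)d\alpha<\infty$, and there exist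 positive constants $\underline{c_\pi}<(\nu+d/2)\underline\kappa$ and $\overline{c_\pi}<(\nu+d/2)\overline\kappa$ such that for all sufficiently large $n$, $$\max\Big\{\int_0^{\underline\alpha_n}\alpha^{-n(\nu+d/2)}\pi(\alpha)d\alpha,\ \int_0^{\underline\alpha_n}\alpha^{-n(\nu+d/2)}\pi(\theta_0|\alpha)\pi(\alpha)d\alpha\Big\}\le\exp(\underline{c_\pi}\,n\log n),$$ $$\max\Big\{\int_{\overline\alpha_n}^\infty\alpha^{n(\nu+d/2)}\pi(\alpha)d\alpha,\ \int_{\overline\alpha_n}^\infty\alpha^{n(\nu+d/2)}\pi(\theta_0|\alpha)\pi(\alpha)d\alpha\Big\}\le\exp(\overline{c_\pi}\,n\log n).$$ Then, as $n\to\infty$, almost surely $P_{(\beta_0,\sigma_0^2,\alpha_0)}$, $$\Big\|\Pi(d\theta,d\alpha|Y_n)-\mathcal N\big(d\theta\,\big|\,\widetilde\theta_{\alpha_0},2\theta_0^2/n\big)\times\widetilde\Pi(d\alpha|Y_n)\Big\|_{TV}\to0,$$ where $\widetilde\Pi(d\alpha|Y_n)$ is the profile posterior distribution with density $$\widetilde\pi(\alpha|Y_n)=\frac{\exp\{\widetilde{\mathcal L}_n(\alpha)\}\,\pi(\alpha|\theta_0)}{\int_0^\infty\exp\{\widetilde{\mathcal L}_n(\alpha')\}\,\pi(\alpha'|\theta_0)\,d\alpha'} ,$$ and $\pi(\alpha|\theta_0)\propto\pi(\theta_0|\alpha)\pi(\alpha)$ is the conditional prior density of $\alpha$ given $\theta=\theta_0$.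 Furthermore, for every given $n\ge p$ the profile posterior density $\widetilde\pi(\alpha|Y_n)$ is well defined almost surely $P_{(\beta_0,\sigma_0^2,\alpha_0)}$. As a result, as $n\to\infty$ almost surely $P_{(\beta_0,\sigma_0^2,\alpha_0)}$, the total variation distance between the marginal posterior $\Pi(d\theta|Y_n)$ and $\mathcal N(d\theta|\widetilde\theta_{\alpha_0},2\theta_0^2/n)$ converges to zero, and the total variation distance between the marginal posterior $\Pi(d\alpha|Y_n)$ and $\widetilde\Pi(d\alpha|Y_n)$ converges to zero.
   Context: Setup. $0<T<\infty$, $\mathcal S=[0,T]^d$, $\nu>0$ is known, $p\ge 1$ is fixed, and $m=(m_1,\ldots,m_p)^\top$ are known functions on $\mathcal S$. For $\alpha>0$ the Matérn correlation function is $K_{\alpha,\nu}(x)=\frac{2^{1-\nu}}{\Gamma(\nu)}(\alpha\|x\|)^{\nu}\mathcal K_\nu(\alpha\|x\|)$ with $K_{\alpha,\nu}(0)=1$, where $\mathcal K_\nu$ is the modified Bessel function of the second kind. The true process is $Y(s)=m(s)^\top\beta_0+X(s)$, $s\in\mathcal S$, where $X$ is a mean-zero Gaussian process with covariance $\sigma_0^2K_{\alpha_0,\nu}(s-t)$; $\beta_0\in\mathbb R^p$, $\sigma_0^2>0$, $\alpha_0>0$ are the fixed true values, $P_{(\beta_0,\sigma_0^2,\alpha_0)}$ is the law of $Y$, and $\theta_0=\sigma_0^2\alpha_0^{2\nu}$. For each $n$, $\mathcal S_n=\{s_1,\ldots,s_n\}\subset\mathcal S$ consists of $n$ distinct points (otherwise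 arbitrary), $Y_n=(Y(s_1),\ldots,Y(s_n))^\top$, $M_n$ is the $n\times p$ matrix with rows $m(s_i)^\top$, and $R_\alpha$ is the $n\times n$ matrix with entries $K_{\alpha,\nu}(s_i-s_j)$. $\Omega_\beta$ is a fixed symmetric positive semidefinite $p\times p$ matrix, the scaled precision of the prior $\beta|\sigma^2,\alpha\sim\mathcal N(0_p,\sigma^2\Omega_\beta^{-1})$ ($\Omega_\beta=0$ means the flat prior). The restricted log-likelihood (with $\beta$ integrated out) is $$\mathcal L_n(\sigma^2,\alpha)=-\tfrac{1}{2\sigma^2}Y_n^\top Q_\alpha Y_n-\tfrac{n-p}{2}\log\sigma^2-\tfrac12\log|R_\alpha|-\tfrac12\log|M_n^\top R_\alpha^{-1}M_n+\Omega_\beta|,$$ $Q_\alpha=R_\alpha^{-1}-R_\alpha^{-1}M_n(M_n^\top R_\alpha^{-1}M_n+\Omega_\beta)^{-1}M_n^\top R_\alpha^{-1}$. With $\theta=\sigma^2\alpha^{2\nu}$, the REML is $\widetilde\theta_\alpha=\frac{\alpha^{2\nu}}{n-p}Y_n^\top Q_\alpha Y_n$ and the profile restricted log-likelihood is $$\widetilde{\mathcal L}_n(\alpha)=\mathcal L_n(\alpha^{-2\nu}\widetilde\theta_\alpha,\alpha)=-\tfrac{n-p}{2}\log\tfrac{Y_n^\top Q_\alpha Y_n}{n-p}-\tfrac12\log|R_\alpha|-\tfrac12\log|M_n^\top R_\alpha^{-1}M_n+\Omega_\beta|-\tfrac{n-p}{2}$$ (for $n=p$ the terms with factor $n-p$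 are read as $0$). The prior on $(\theta,\alpha)$ has density $\pi(\theta|\alpha)\pi(\alpha)$, and the joint posterior $\Pi(d\theta,d\alpha|Y_n)$ on $(0,\infty)^2$ has density proportional to $\exp\{\mathcal L_n(\theta/\alpha^{2\nu},\alpha)\}\pi(\theta|\alpha)\pi(\alpha)$. Constants: $\underline\alpha_n=n^{-\underline\kappa}$, $\overline\alpha_n=n^{\overline\kappa}$, with $$\underline\kappa=\tfrac12\min\Big\{\tfrac{0.9}{(2d+0.94)(8\nu+3d-0.9)},\tfrac{1}{4(3\nu+d)},0.01\Big\},\qquad \overline\kappa=\tfrac12\min\Big\{\tfrac{0.9}{(2d+0.94)(8\nu+5d+0.9)},\tfrac{1}{2(2\nu+d)},0.01\Big\}.$$ $\|P_1-P_2\|_{TV}=\sup_A|P_1(A)-P_2(A)|$. $\mathcal N(d\theta|\mu,v)$ is the normal measure with mean $\mu$, variance $v$. $\mathcal W_2^{k}(\mathcal S)$ is the $L_2$-Sobolev space of order $k$ on $\mathcal S$: for integer $k$, functions whose partial derivatives of order $\le k$ lie in $L_2(\mathcal S)$; for general real $k>0$, restrictions to $\mathcal S$ of $g\in L_2(\mathbb R^d)$ with $\int(1+\|\omega\|^2)^k|\widehat g(\omega)|^2d\omega<\infty$. *)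

theory Defs
  imports
    "HOL-Probability.Probability"
    "Jordan_Normal_Form.Determinant"
    "Jordan_Normal_Form.Gauss_Jordan_Elimination"
    "Jordan_Normal_Form.DL_Rank"
begin

section \<open>Matern correlation\<close>

text \<open>The modified Bessel function of the second kind, for positive argument, by the integral
  formula that holds for every real order (DLMF 10.32.9).\<close>

definition bessel_K :: "real \<Rightarrow> real \<Rightarrow> real" where
  "bessel_K \<nu> x = (LINT t:{0<..}|lborel. exp (- x * cosh t) * cosh (\<nu> * t))"

definition matern :: "real \<Rightarrow> real \<Rightarrow> 'a::real_normed_vector \<Rightarrow> real" where
  "matern \<nu> \<alpha> x =
     (if x = 0 then 1
      else 2 powr (1 - \<nu>) / Gamma \<nu> * (\<alpha> * norm x) powr \<nu> * bessel_K \<nu> (\<alpha> * norm x))"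

section \<open>Gaussian processes\<close>

text \<open>Variance 0 is allowed; the normal law is then a point mass.\<close>

definition normal_law :: "real \<Rightarrow> real \<Rightarrow> real measure" where
  "normal_law \<mu> v =
     (if v > 0 then density lborel (\<lambda>x. ennreal (normal_density \<mu> (sqrt v) x)) else return borel \<mu>)"

definition gaussian_process :: "'w measure \<Rightarrow> 'a set \<Rightarrow> ('a \<Rightarrow> 'w \<Rightarrow> real) \<Rightarrow> bool" where
  "gaussian_process P S X \<longleftrightarrow>
     (\<forall>x\<in>S. X x \<in> borel_measurable P) \<and>
     (\<forall>I c. finite I \<and> I \<subseteq> S \<longrightarrow>
        (\<exists>\<mu> v. 0 \<le> v \<and> distr P borel (\<lambda>\<omega>. \<Sum>x\<in>I. c x * X x \<omega>) = normal_law \<mu> v))"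

definition centered_gaussian_process ::
    "'w measure \<Rightarrow> 'a set \<Rightarrow> ('a \<Rightarrow> 'a \<Rightarrow> real) \<Rightarrow> ('a \<Rightarrow> 'w \<Rightarrow> real) \<Rightarrow> bool" where
  "centered_gaussian_process P S C X \<longleftrightarrow>
     gaussian_process P S X \<and>
     (\<forall>x\<in>S. (LINT \<omega>|P. X x \<omega>) = 0) \<and>
     (\<forall>x\<in>S. \<forall>y\<in>S. (LINT \<omega>|P. X x \<omega> * X y \<omega>) = C x y)"

section \<open>Sobolev spaces\<close>

definition square_integrable :: "('a::euclidean_space \<Rightarrow> complex) \<Rightarrow> bool" where
  "square_integrable g \<longleftrightarrow>
     g \<in> borel_measurable lborel \<and> integrable lborel (\<lambda>x. (norm (g x))\<^sup>2)"

text \<open>The Fourier-Plancherel transform on \<open>L\<^sub>2\<close>: the limit in \<open>L\<^sub>2\<close> of the transforms of the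
  truncations of \<open>g\<close> to balls. It is determined up to null sets, and the normalisation does not
  affect membership in a Sobolev space.\<close>

definition is_fourier_L2 :: "('a::euclidean_space \<Rightarrow> complex) \<Rightarrow> ('a \<Rightarrow> complex) \<Rightarrow> bool" where
  "is_fourier_L2 g h \<longleftrightarrow> square_integrable h \<and>
     ((\<lambda>r. \<integral>\<^sup>+ w. ennreal ((norm (h w - (LINT x:cball 0 r|lborel. g x * cis (- inner w x))))\<^sup>2) \<partial>lborel)
        \<longlongrightarrow> 0) at_top"

text \<open>The space \<open>W\<^sub>2\<^sup>k(S)\<close>, used for \<open>k\<close> above half the dimension. Its elements are then continuous
  up to null sets, and the values at points (which enter the regression design) are those of the
  continuous representative; hence the continuity clause.\<close>

definition in_sobolev_W2 :: "real \<Rightarrow> 'a::euclidean_space set \<Rightarrow> ('a \<Rightarrow> real) \<Rightarrow> bool" where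
  "in_sobolev_W2 k S f \<longleftrightarrow> continuous_on S f \<and>
     (\<exists>g h. square_integrable g \<and> is_fourier_L2 g h \<and>
        (\<integral>\<^sup>+ w. ennreal ((1 + (norm w)\<^sup>2) powr k * (norm (h w))\<^sup>2) \<partial>lborel) < \<infinity> \<and>
        (\<forall>x\<in>S. g x = complex_of_real (f x)))"

section \<open>Restricted likelihood\<close>

text \<open>Indices start at 0: the design points are \<open>s 0, \<dots>, s (n - 1)\<close> and the regression functions
  are \<open>m 0, \<dots>, m (p - 1)\<close>.\<close>

definition psd_mat :: "nat \<Rightarrow> real mat \<Rightarrow> bool" where
  "psd_mat p A \<longleftrightarrow> A \<in> carrier_mat p p \<and> transpose_mat A = A \<and>
     (\<forall>v\<in>carrier_vec p. 0 \<le> scalar_prod v (mult_mat_vec A v))"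

text \<open>Only ever applied to invertible matrices; the value is unspecified otherwise.\<close>

definition mat_inv :: "real mat \<Rightarrow> real mat" where
  "mat_inv A = the (mat_inverse A)"

definition corr_mat :: "real \<Rightarrow> nat \<Rightarrow> (nat \<Rightarrow> 'a::real_normed_vector) \<Rightarrow> real \<Rightarrow> real mat" where
  "corr_mat \<nu> n s \<alpha> = Matrix.mat n n (\<lambda>(i, j). matern \<nu> \<alpha> (s i - s j))"

definition design_mat :: "nat \<Rightarrow> (nat \<Rightarrow> 'a \<Rightarrow> real) \<Rightarrow> nat \<Rightarrow> (nat \<Rightarrow> 'a) \<Rightarrow> real mat" where
  "design_mat p m n s = Matrix.mat n p (\<lambda>(i, j). m j (s i))"

definition gls_mat ::
    "real \<Rightarrow> nat \<Rightarrow> (nat \<Rightarrow> 'a::real_normed_vector \<Rightarrow> real) \<Rightarrow> real mat \<Rightarrow> nat \<Rightarrow> (nat \<Rightarrow> 'a) \<Rightarrow> real \<Rightarrow> real mat"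
  where
  "gls_mat \<nu> p m \<Omega> n s \<alpha> =
     (let M = design_mat p m n s
      in transpose_mat M * mat_inv (corr_mat \<nu> n s \<alpha>) * M + \<Omega>)"

definition Q_mat ::
    "real \<Rightarrow> nat \<Rightarrow> (nat \<Rightarrow> 'a::real_normed_vector \<Rightarrow> real) \<Rightarrow> real mat \<Rightarrow> nat \<Rightarrow> (nat \<Rightarrow> 'a) \<Rightarrow> real \<Rightarrow> real mat"
  where
  "Q_mat \<nu> p m \<Omega> n s \<alpha> =
     (let M = design_mat p m n s; Ri = mat_inv (corr_mat \<nu> n s \<alpha>)
      in Ri - Ri * M * mat_inv (gls_mat \<nu> p m \<Omega> n s \<alpha>) * transpose_mat M * Ri)"

definition quad_form ::
    "real \<Rightarrow> nat \<Rightarrow> (nat \<Rightarrow> 'a::real_normed_vector \<Rightarrow> real) \<Rightarrow> real mat \<Rightarrow> nat \<Rightarrow> (nat \<Rightarrow> 'a) \<Rightarrow> real vec \<Rightarrow> real \<Rightarrow> real"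
  where
  "quad_form \<nu> p m \<Omega> n s y \<alpha> = scalar_prod y (mult_mat_vec (Q_mat \<nu> p m \<Omega> n s \<alpha>) y)"

definition restricted_loglik ::
    "real \<Rightarrow> nat \<Rightarrow> (nat \<Rightarrow> 'a::real_normed_vector \<Rightarrow> real) \<Rightarrow> real mat \<Rightarrow> nat \<Rightarrow> (nat \<Rightarrow> 'a) \<Rightarrow> real vec
      \<Rightarrow> real \<Rightarrow> real \<Rightarrow> real"
  where
  "restricted_loglik \<nu> p m \<Omega> n s y \<sigma>2 \<alpha> =
     - (1 / (2 * \<sigma>2)) * quad_form \<nu> p m \<Omega> n s y \<alpha>
     - (real n - real p) / 2 * ln \<sigma>2
     - 1 / 2 * ln (Determinant.det (corr_mat \<nu> n s \<alpha>))
     - 1 / 2 * ln (Determinant.det (gls_mat \<nu> p m \<Omega> n s \<alpha>))"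

definition reml ::
    "real \<Rightarrow> nat \<Rightarrow> (nat \<Rightarrow> 'a::real_normed_vector \<Rightarrow> real) \<Rightarrow> real mat \<Rightarrow> nat \<Rightarrow> (nat \<Rightarrow> 'a) \<Rightarrow> real vec \<Rightarrow> real \<Rightarrow> real"
  where
  "reml \<nu> p m \<Omega> n s y \<alpha> = \<alpha> powr (2 * \<nu>) / (real n - real p) * quad_form \<nu> p m \<Omega> n s y \<alpha>"

text \<open>The explicit formula also covers \<open>n = p\<close>, where the terms with factor \<open>n - p\<close> vanish.\<close>

definition profile_loglik ::
    "real \<Rightarrow> nat \<Rightarrow> (nat \<Rightarrow> 'a::real_normed_vector \<Rightarrow> real) \<Rightarrow> real mat \<Rightarrow> nat \<Rightarrow> (nat \<Rightarrow> 'a) \<Rightarrow> real vec \<Rightarrow> real \<Rightarrow> real"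
  where
  "profile_loglik \<nu> p m \<Omega> n s y \<alpha> =
     - (real n - real p) / 2 * ln (quad_form \<nu> p m \<Omega> n s y \<alpha> / (real n - real p))
     - 1 / 2 * ln (Determinant.det (corr_mat \<nu> n s \<alpha>))
     - 1 / 2 * ln (Determinant.det (gls_mat \<nu> p m \<Omega> n s \<alpha>))
     - (real n - real p) / 2"

lemma profile_loglik_eq_restricted_loglik:
  assumes "p < n" "0 < \<alpha>" "0 < quad_form \<nu> p m \<Omega> n s y \<alpha>"
  shows "profile_loglik \<nu> p m \<Omega> n s y \<alpha> =
    restricted_loglik \<nu> p m \<Omega> n s y (\<alpha> powr (- 2 * \<nu>) * reml \<nu> p m \<Omega> n s y \<alpha>) \<alpha>"
proof -
  have "\<alpha> powr (- 2 * \<nu>) * \<alpha> powr (2 * \<nu>) = 1"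
    using assms by (simp add: powr_add [symmetric])
  then have *: "\<alpha> powr (- 2 * \<nu>) * reml \<nu> p m \<Omega> n s y \<alpha> =
      quad_form \<nu> p m \<Omega> n s y \<alpha> / (real n - real p)"
    by (simp add: reml_def)
  have "1 / (2 * (q / k)) * q = k / 2" if "0 < q" for q k :: real
    using that by simp
  then show ?thesis
    unfolding * profile_loglik_def restricted_loglik_def using assms(3)
    by (simp only: minus_mult_left [symmetric] minus_divide_left [symmetric])
qed

section \<open>Posterior distributions\<close>

text \<open>If \<open>f\<close> is not integrable, the Bochner integral is 0 and the result is the zero measure. That
  has distance 1 from every probability measure, so an improper posterior is not close to one.\<close>

definition normalized_measure :: "'b measure \<Rightarrow> ('b \<Rightarrow> real) \<Rightarrow> 'b measure" where
  "normalized_measure N f = density N (\<lambda>x. ennreal (f x / (LINT x|N. f x)))"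

text \<open>In the following, \<open>\<pi>\<^sub>c \<theta> \<alpha>\<close> is the conditional prior density of \<open>\<theta>\<close> given \<open>\<alpha>\<close>, and
  \<open>\<pi>\<^sub>a\<close> is the prior density of \<open>\<alpha>\<close>.\<close>

definition joint_posterior ::
    "real \<Rightarrow> nat \<Rightarrow> (nat \<Rightarrow> 'a::real_normed_vector \<Rightarrow> real) \<Rightarrow> real mat
      \<Rightarrow> (real \<Rightarrow> real \<Rightarrow> real) \<Rightarrow> (real \<Rightarrow> real) \<Rightarrow> nat \<Rightarrow> (nat \<Rightarrow> 'a) \<Rightarrow> real vec \<Rightarrow> (real \<times> real) measure"
  where
  "joint_posterior \<nu> p m \<Omega> \<pi>\<^sub>c \<pi>\<^sub>a n s y =
     normalized_measure (lborel \<Otimes>\<^sub>M lborel)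
       (\<lambda>(\<theta>, \<alpha>). indicat_real ({0<..} \<times> {0<..}) (\<theta>, \<alpha>) *
          (exp (restricted_loglik \<nu> p m \<Omega> n s y (\<theta> / \<alpha> powr (2 * \<nu>)) \<alpha>) * \<pi>\<^sub>c \<theta> \<alpha> * \<pi>\<^sub>a \<alpha>))"

definition cond_prior_alpha ::
    "(real \<Rightarrow> real \<Rightarrow> real) \<Rightarrow> (real \<Rightarrow> real) \<Rightarrow> real \<Rightarrow> real \<Rightarrow> real" where
  "cond_prior_alpha \<pi>\<^sub>c \<pi>\<^sub>a \<theta> \<alpha> = \<pi>\<^sub>c \<theta> \<alpha> * \<pi>\<^sub>a \<alpha> / (LINT a:{0<..}|lborel. \<pi>\<^sub>c \<theta> a * \<pi>\<^sub>a a)"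

definition profile_weight ::
    "real \<Rightarrow> nat \<Rightarrow> (nat \<Rightarrow> 'a::real_normed_vector \<Rightarrow> real) \<Rightarrow> real mat
      \<Rightarrow> (real \<Rightarrow> real \<Rightarrow> real) \<Rightarrow> (real \<Rightarrow> real) \<Rightarrow> real \<Rightarrow> nat \<Rightarrow> (nat \<Rightarrow> 'a) \<Rightarrow> real vec \<Rightarrow> real \<Rightarrow> real"
  where
  "profile_weight \<nu> p m \<Omega> \<pi>\<^sub>c \<pi>\<^sub>a \<theta>\<^sub>0 n s y \<alpha> =
     indicat_real {0<..} \<alpha> *
       (exp (profile_loglik \<nu> p m \<Omega> n s y \<alpha>) * cond_prior_alpha \<pi>\<^sub>c \<pi>\<^sub>a \<theta>\<^sub>0 \<alpha>)"

definition profile_posterior ::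
    "real \<Rightarrow> nat \<Rightarrow> (nat \<Rightarrow> 'a::real_normed_vector \<Rightarrow> real) \<Rightarrow> real mat
      \<Rightarrow> (real \<Rightarrow> real \<Rightarrow> real) \<Rightarrow> (real \<Rightarrow> real) \<Rightarrow> real \<Rightarrow> nat \<Rightarrow> (nat \<Rightarrow> 'a) \<Rightarrow> real vec \<Rightarrow> real measure"
  where
  "profile_posterior \<nu> p m \<Omega> \<pi>\<^sub>c \<pi>\<^sub>a \<theta>\<^sub>0 n s y =
     normalized_measure lborel (profile_weight \<nu> p m \<Omega> \<pi>\<^sub>c \<pi>\<^sub>a \<theta>\<^sub>0 n s y)"

text \<open>The density is well defined if the logarithm in the profile likelihood has a positive argument
  (for \<open>n = p\<close> that term is absent) and the normalising constant is positive and finite.\<close>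

definition profile_posterior_well_defined ::
    "real \<Rightarrow> nat \<Rightarrow> (nat \<Rightarrow> 'a::real_normed_vector \<Rightarrow> real) \<Rightarrow> real mat
      \<Rightarrow> (real \<Rightarrow> real \<Rightarrow> real) \<Rightarrow> (real \<Rightarrow> real) \<Rightarrow> real \<Rightarrow> nat \<Rightarrow> (nat \<Rightarrow> 'a) \<Rightarrow> real vec \<Rightarrow> bool"
  where
  "profile_posterior_well_defined \<nu> p m \<Omega> \<pi>\<^sub>c \<pi>\<^sub>a \<theta>\<^sub>0 n s y \<longleftrightarrow>
     (p < n \<longrightarrow> (\<forall>\<alpha>>0. 0 < quad_form \<nu> p m \<Omega> n s y \<alpha>)) \<and>
     integrable lborel (profile_weight \<nu> p m \<Omega> \<pi>\<^sub>c \<pi>\<^sub>a \<theta>\<^sub>0 n s y) \<and>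
     0 < (LINT \<alpha>|lborel. profile_weight \<nu> p m \<Omega> \<pi>\<^sub>c \<pi>\<^sub>a \<theta>\<^sub>0 n s y \<alpha>)"

text \<open>Meant for finite measures on the same sigma-algebra, so that the supremum is over a bounded
  set.\<close>

definition tv_dist :: "'b measure \<Rightarrow> 'b measure \<Rightarrow> real" where
  "tv_dist P Q = (SUP A\<in>sets P. \<bar>measure P A - measure Q A\<bar>)"

section \<open>Range of the inverse length scale\<close>

definition kappa_lower :: "nat \<Rightarrow> real \<Rightarrow> real" where
  "kappa_lower d \<nu> =
     1 / 2 * Min {0.9 / ((2 * real d + 0.94) * (8 * \<nu> + 3 * real d - 0.9)),
                  1 / (4 * (3 * \<nu> + real d)), 0.01}"

definition kappa_upper :: "nat \<Rightarrow> real \<Rightarrow> real" where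
  "kappa_upper d \<nu> =
     1 / 2 * Min {0.9 / ((2 * real d + 0.94) * (8 * \<nu> + 5 * real d + 0.9)),
                  1 / (2 * (2 * \<nu> + real d)), 0.01}"

definition alpha_lower :: "nat \<Rightarrow> real \<Rightarrow> nat \<Rightarrow> real" where
  "alpha_lower d \<nu> n = real n powr (- kappa_lower d \<nu>)"

definition alpha_upper :: "nat \<Rightarrow> real \<Rightarrow> nat \<Rightarrow> real" where
  "alpha_upper d \<nu> n = real n powr (kappa_upper d \<nu>)"

end

theory Submission
  imports Defs "HOL-Real_Asymp.Real_Asymp"
begin

text \<open>Write \<open>\<theta> = \<sigma>\<^sup>2 \<alpha>\<^sup>2\<^sup>\<nu>\<close> and \<open>h x = x - 1 - ln x\<close>. In these coordinates the restricted likelihood is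
  \<open>exp (l \<alpha>) * exp (- (n - p) / 2 * h (t \<alpha> / \<theta>))\<close>, with \<open>l\<close> the profile restricted log-likelihood and
  \<open>t \<alpha>\<close> the REML of \<open>\<theta>\<close>. Hence \<open>\<theta>\<close> is asymptotically normal around \<open>t \<alpha>\<close>, and the posterior factorises
  once \<open>t \<alpha> - t \<alpha>\<^sub>0 = O(n\<^bsup>-25/48\<^esup>)\<close> uniformly over \<open>n\<^bsup>-k\<^esup> \<le> \<alpha> \<le> n\<^bsup>k'\<^esup>\<close>.

  The quadratic form of \<open>S \<alpha> = \<alpha>\<^bsup>-2\<nu>\<^esup> R \<alpha>\<close> is, up to a constant, the integral of
  \<open>\<bar>\<Sum> c\<^sub>j exp (i w x\<^sub>j)\<bar>\<^sup>2\<close> against \<open>(\<alpha>\<^sup>2 + \<bar>w\<bar>\<^sup>2)\<^bsup>-(\<nu> + d/2)\<^esup>\<close>; it decreases in \<open>\<alpha>\<close>, so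
  \<open>(n - p) t \<alpha>\<close> lies between quadratic forms of the data that depend only on the endpoints of the range. The trace
  of their difference under the true covariance is at most \<open>p + O(n\<^bsup>11/24\<^esup>)\<close>: on a basis orthonormal for
  \<open>S b\<close> the sum of the squared trigonometric polynomials is bounded pointwise by a reproducing kernel
  argument, which controls the frequencies below \<open>n\<^bsup>1/3\<^esup>\<close>, while above them the two weights nearly agree.
  Gaussian tail bounds and Borel-Cantelli then give the estimate almost surely.

  For \<open>\<alpha>\<close> outside the range, \<open>\<bar>l \<alpha> - l \<alpha>'\<bar> \<le> n (\<nu> + d/2) \<bar>ln (\<alpha> / \<alpha>')\<bar>\<close> and the tail conditions on the prior
  make the posterior mass exponentially small.\<close>

section \<open>Fourier representation of the Matern form\<close>

no_notation inner (infix "\<bullet>" 70)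
no_notation vec_nth (infixl "$" 90)

text \<open>The obstacle is uniformity in \<open>al\<close> over a range that widens with n, for
  arbitrary design points. Besides the monotonicity of \<open>S al\<close> there is an opposite one,
  that of \<open>al^d R al\<close>, and the order of forms passes through inverses, through
  \<open>Q\<close> and through the product of the two determinants. So probability is needed only at
  the endpoints of the range and at \<open>al0\<close>, and there traces suffice; no eigenvalues
  enter. The fluctuation of the quadratic form has to be o(n^(1/2)). A frequency cut at W costs n /
  W^2 above and W below (here dimension at most 3 enters), whence W = n^(1/3). The ratio of the two
  inverse length scales costs at most a constant times n^(1/8), because the kappas are small and
  each trace has one of its points fixed. Thus 1/3 + 1/8 = 11/24; the logarithm of the tail bounds
  lifts it to 23/48, and division by n gives -25/48. The two monotonicities are also the origin of
  the Lipschitz constant of the log-likelihood, which is exactly the power of \<open>al\<close> in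
  the tail conditions on the prior.\<close>

lemma power2_powr: "0 < a \<Longrightarrow> (a\<^sup>2) powr b = a powr (2 * b)" for a b :: real
  by (simp add: powr_powr flip: powr_numeral)

section \<open>The Matern correlation as a Gamma mixture of Gaussian kernels\<close>

lemma nn_integral_Gamma_scaled:
  fixes s a :: real
  assumes "0 < s" "0 < a"
  shows "(\<integral>\<^sup>+t. ennreal (indicat_real {0<..} t * (t powr (s - 1) * exp (- a * t))) \<partial>lborel) = ennreal (Gamma s * a powr (- s))" (is "?I = _")
proof -
  let ?f = "\<lambda>t::real. ennreal (indicator {0..} t * t powr (s - 1) / exp t)"
  have eq: "?f (0 + a * t) = ennreal (a powr (s - 1)) * ennreal (indicat_real {0<..} t * (t powr (s - 1) * exp (- a * t)))" for t
    using assms by (auto simp: indicator_def ennreal_mult' [symmetric] powr_mult exp_minus field_simps zero_le_mult_iff)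
  have "ennreal (Gamma s) = ennreal \<bar>a\<bar> * (\<integral>\<^sup>+t. ?f (0 + a * t) \<partial>lborel)"
    unfolding Gamma_conv_nn_integral_real[OF assms(1)]
    using assms by (intro nn_integral_real_affine) auto
  also have "\<dots> = ennreal a * (ennreal (a powr (s - 1)) * ?I)"
    unfolding eq using assms by (subst nn_integral_cmult) auto
  also have "\<dots> = ennreal (a powr s) * ?I"
    using assms by (simp add: mult.assoc[symmetric] ennreal_mult'[symmetric] powr_diff)
  finally have "ennreal (a powr (- s)) * ennreal (Gamma s) = ennreal (a powr (- s)) * ennreal (a powr s) *
     ?I"
    by (simp add: mult.assoc)
  also have "ennreal (a powr (- s)) * ennreal (a powr s) = 1"
    using assms by (simp add: ennreal_mult'[symmetric] powr_add[symmetric])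
  finally show ?thesis using assms
    by (simp add: ennreal_mult'[symmetric] mult.commute)
qed

lemma set_integrable_Gamma_mixture:
  fixes nu al r :: real
  assumes "0 < nu" "0 < al" "0 \<le> r"
  shows "set_integrable lborel {0<..} (\<lambda>t. t powr (nu - 1) * exp (- al\<^sup>2 * t - r / (4 * t)))"
proof -
  have 1: "integrable lborel (\<lambda>t. indicat_real {0<..} t * (t powr (nu - 1) * exp (- al\<^sup>2 * t)))"
    using nn_integral_Gamma_scaled[of nu "al\<^sup>2"] assms
    by (intro integrableI_nn_integral_finite[where x="Gamma nu * (al\<^sup>2) powr (- nu)"]) (auto)
  show ?thesis unfolding set_integrable_def
    by (rule Bochner_Integration.integrable_bound[OF 1])
       (use assms in \<open>auto simp: indicator_def abs_mult intro!: mult_left_mono\<close>)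
qed

text \<open>The substitution \<open>t = ln (2 * al * u / r)\<close> turns
  \<open>al * r * cosh t\<close> into \<open>al^2 * u + r^2 / (4 * u)\<close>. It maps the half line
  onto the whole line, where by symmetry \<open>cosh (nu * t)\<close> may be traded for
  \<open>exp (nu * t)\<close>.\<close>

lemma bessel_K_mixture:
  fixes nu al r :: real
  assumes "0 < nu" "0 < al" "0 < r"
  shows "bessel_K nu (al * r) = 1 / 2 * (2 * al / r) powr nu *
     (LINT t:{0<..}|lborel. t powr (nu - 1) * exp (- al\<^sup>2 * t - r\<^sup>2 / (4 * t)))"
proof -
  define z where "z = al * r"
  have z: "0 < z" using assms by (simp add: z_def)
  define f where "f = (\<lambda>t. exp (- z * cosh t) * exp (nu * t))"
  define g where "g = (\<lambda>t::real. t powr (nu - 1) * exp (- al\<^sup>2 * t - r\<^sup>2 / (4 * t)))"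
  define h where "h = (\<lambda>u. ln (2 * al * u / r))"
  define J where "J = (LINT t:{0<..}|lborel. g t)"
  have gint: "set_integrable lborel {0<..} g"
    unfolding g_def using set_integrable_Gamma_mixture assms by simp
  have sub: "\<bar>1 / u\<bar> * f (h u) = (2 * al / r) powr nu * g u" if "u \<in> {0<..}" for u
  proof -
    have u: "u > 0" using that by simp
    have p: "0 < 2 * al * u / r" using u assms by simp
    have e: "exp (h u) = 2 * al * u / r" unfolding h_def using p by (simp)
    have e2: "exp (- h u) = r / (2 * al * u)" unfolding exp_minus e by simp
    have "z * cosh (h u) = al\<^sup>2 * u + r\<^sup>2 / (4 * u)"
      unfolding cosh_def e e2 z_def using assms u by (simp add: field_simps power2_eq_square)
    moreover have "exp (nu * h u) = (2 * al / r) powr nu * u powr nu"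
      using p assms u by (simp add: h_def powr_def[symmetric] powr_mult[symmetric] mult.commute)
         (simp add: powr_def mult.commute)
    ultimately show ?thesis using u
      by (simp add: f_def g_def powr_diff field_simps)
  qed
  have hder: "(h has_field_derivative 1 / u) (at u within {0<..})" if "u \<in> {0<..}" for u
    unfolding h_def using that assms by (auto intro!: derivative_eq_intros simp: field_simps)
  have hinj: "inj_on h {0<..}"
    unfolding h_def using assms by (auto intro!: inj_onI)
  have him: "h ` {0<..} = UNIV"
  proof -
    have "x \<in> h ` {0<..}" for x
      by (rule image_eqI[where x="r * exp x / (2 * al)"]) (use assms in \<open>auto simp: h_def\<close>)
    then show ?thesis by auto
  qed
  have "(\<lambda>u. \<bar>1 / u\<bar> * f (h u)) absolutely_integrable_on {0<..} \<and>
        integral {0<..} (\<lambda>u. \<bar>1 / u\<bar> * f (h u)) = (2 * al / r) powr nu * J"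
  proof -
    have gi: "set_integrable lebesgue {0<..} g"
      using gint unfolding set_integrable_def by (auto intro: integrable_completion[THEN iffD2] borel_measurable_integrable)
    have gJ: "integral {0<..} g = J"
      unfolding J_def using set_borel_integral_eq_integral(2)[OF gint] by simp
    have 1: "(\<lambda>u. (2 * al / r) powr nu * g u) absolutely_integrable_on {0<..}"
      using gi by simp
    have 2: "integral {0<..} (\<lambda>u. (2 * al / r) powr nu * g u) = (2 * al / r) powr nu * J"
      by (simp add: gJ)
    have "(\<lambda>u. \<bar>1 / u\<bar> * f (h u)) absolutely_integrable_on {0<..} \<longleftrightarrow>
        (\<lambda>u. (2 * al / r) powr nu * g u) absolutely_integrable_on {0<..}"
      by (intro set_integrable_cong refl sub)
    moreover have "integral {0<..} (\<lambda>u. \<bar>1 / u\<bar> * f (h u)) = integral {0<..} (\<lambda>u. (2 * al / r) powr nu * g u)"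
      by (intro integral_cong sub)
    ultimately show ?thesis using 1 2 by argo
  qed
  then have F: "f absolutely_integrable_on UNIV \<and> integral UNIV f = (2 * al / r) powr nu * J"
    using has_absolute_integral_change_of_variables_1'[of "{0<..}" h "\<lambda>u. 1/u" f] hder hinj him by auto
  have fm: "f \<in> borel_measurable borel" unfolding f_def by (auto simp: cosh_def)
  have fi: "integrable lborel f"
    using F fm by (simp add: set_integrable_def integrable_completion)
  have fI: "integral\<^sup>L lborel f = (2 * al / r) powr nu * J"
    using F integral_lborel[OF fi] by simp
  \<comment> \<open>Averaging with the reflected function changes \<open>exp (nu * t)\<close> into
    \<open>cosh (nu * t)\<close> and keeps the integral over the line; evenness then gives twice the
    half-line integral that defines \<open>bessel_K\<close>.\<close>
  define k where "k = (\<lambda>t. exp (- z * cosh t) * cosh (nu * t))"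
  have ke: "k t = 1/2 * (f t + f (0 + (-1) * t))" for t
    by (simp add: k_def f_def cosh_def[of "nu * t"] field_simps)
  have fi2: "integrable lborel (\<lambda>t. f (0 + (-1) * t))"
    using lborel_integrable_real_affine[OF fi, of "-1" 0] by simp
  have fI2: "(LINT t|lborel. f (0 + (-1) * t)) = (2 * al / r) powr nu * J"
    using lborel_integral_real_affine[of "-1" f 0] fI by simp
  have ki: "integrable lborel k"
    unfolding ke[abs_def] using fi fi2 by auto
  have kI: "integral\<^sup>L lborel k = (2 * al / r) powr nu * J"
    unfolding ke[abs_def] using fi fi2 fI fI2 by (simp add: Bochner_Integration.integral_add)
  have km: "k \<in> borel_measurable borel" unfolding k_def by (auto simp: cosh_def)
  have ki2: "integrable lborel (\<lambda>x. indicator {0..} x *\<^sub>R k x)"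
    using ki by (intro integrable_mult_indicator) auto
  have "has_bochner_integral lborel (\<lambda>x. indicator {0..} x *\<^sub>R k x) (LINT x:{0..}|lborel. k x)"
    using ki2 unfolding set_lebesgue_integral_def by (simp add: has_bochner_integral_integrable)
  from has_bochner_integral_even_function[OF this]
  have "integral\<^sup>L lborel k = 2 * (LINT x:{0..}|lborel. k x)"
    by (auto simp: k_def has_bochner_integral_iff)
  also have "(LINT x:{0..}|lborel. k x) = (LINT x:{0<..}|lborel. k x)"
    using AE_lborel_singleton[of "0::real"]
    unfolding set_lebesgue_integral_def
    by (intro integral_cong_AE) (use km in \<open>auto simp: indicator_def\<close>)
  finally have "2 * bessel_K nu z = (2 * al / r) powr nu * J"
    using kI by (simp add: bessel_K_def k_def z_def)
  then show ?thesis by (simp add: z_def J_def g_def)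
qed

text \<open>The powers of 2, of \<open>al\<close> and of the norm collect into
  \<open>al powr (2 * nu)\<close>. At 0 the mixture is a Gamma integral, which yields the
  conventional value 1. As a mixture of Gaussian kernels the correlation inherits their Fourier
  transform.\<close>

lemma matern_eq_mixture:
  assumes "0 < nu" "0 < al"
  shows "matern nu al x = al powr (2 * nu) / Gamma nu *
     (LINT t:{0<..}|lborel. t powr (nu - 1) * exp (- al\<^sup>2 * t - (norm x)\<^sup>2 / (4 * t)))"
proof (cases "x = 0")
  case True
  have "(LINT t:{0<..}|lborel. t powr (nu - 1) * exp (- al\<^sup>2 * t)) = Gamma nu * (al\<^sup>2) powr (- nu)"
    unfolding set_lebesgue_integral_def
    using nn_integral_Gamma_scaled[of nu "al\<^sup>2"] assms
    by (intro integral_eq_nn_integral[THEN trans]) (auto simp: indicator_def enn2real_ennreal Gamma_real_nonneg)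
  moreover have "(al\<^sup>2) powr (- nu) = al powr (- (2 * nu))"
    using assms by (simp add: power2_powr)
  moreover have "al powr (2 * nu) * al powr (- (2 * nu)) = 1"
    using assms by (simp add: powr_add[symmetric])
  moreover have "Gamma nu \<noteq> 0" using Gamma_real_pos[OF assms(1)] by linarith
  ultimately show ?thesis using True by (simp add: matern_def)
next
  case False
  let ?r = "norm x"
  have r: "0 < ?r" using False by simp
  have "2 powr (1 - nu) * (al * ?r) powr nu * (1 / 2 * (2 * al / ?r) powr nu) = al powr (2 * nu)"
  proof -
    have "2 powr (1 - nu) * (al * ?r) powr nu * (1 / 2 * (2 * al / ?r) powr nu) =
       2 powr (1 - nu) * (1/2) * ((al * ?r) * (2 * al / ?r)) powr nu"
      using assms r by (simp add: powr_mult powr_divide)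
    also have "(al * ?r) * (2 * al / ?r) = 2 * al\<^sup>2" using r by (simp add: power2_eq_square)
    also have "(2 * al\<^sup>2) powr nu = 2 powr nu * al powr (2 * nu)"
      using assms by (simp add: powr_mult power2_powr)
    also have "2 powr (1 - nu) * (1/2) * (2 powr nu * al powr (2 * nu)) = (2 powr (1 - nu) * 2 powr nu) * (1/2) * al powr (2 * nu)"
      by simp
    also have "2 powr (1 - nu) * 2 powr nu = (2::real)" by (simp add: powr_add[symmetric])
    finally show ?thesis by simp
  qed
  note key = this
  have gen: "a / G * b * (h * c * J) = (a * b * (h * c)) / G * J" for a b c h G J :: real
    by (simp only: divide_inverse ac_simps)
  define A B C J where "A = 2 powr (1 - nu)" and "B = (al * ?r) powr nu" and "C = (2 * al / ?r) powr nu"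
    and "J = (LINT t:{0<..}|lborel. t powr (nu - 1) * exp (- al\<^sup>2 * t - ?r\<^sup>2 / (4 * t)))"
  have 1: "bessel_K nu (al * ?r) = 1 / 2 * C * J"
    unfolding C_def J_def by (rule bessel_K_mixture[OF assms r])
  have 2: "matern nu al x = A / Gamma nu * B * bessel_K nu (al * ?r)"
    using False by (simp add: matern_def A_def B_def)
  have 3: "A * B * (1 / 2 * C) = al powr (2 * nu)"
    unfolding A_def B_def C_def by (rule key)
  have "matern nu al x = (A * B * (1 / 2 * C)) / Gamma nu * J"
    unfolding 2 1 by (rule gen)
  then show ?thesis unfolding 3 J_def .
qed

section \<open>Fourier integrals of Gaussians and trigonometric sums\<close>

lemma
  fixes f :: "'a::euclidean_space \<Rightarrow> real \<Rightarrow> 'b::{real_normed_field,banach,second_countable_topology}"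
  assumes f: "\<And>b. b \<in> Basis \<Longrightarrow> integrable lborel (f b)"
  shows lborel_integrable_prod: "integrable lborel (\<lambda>x::'a. \<Prod>b\<in>Basis. f b (inner x b))"
    and lborel_integral_prod: "(LINT x|lborel. (\<Prod>b\<in>Basis. f b (inner x b))) = (\<Prod>b\<in>Basis. integral\<^sup>L lborel (f b))"
proof -
  interpret product_sigma_finite "\<lambda>_::'a. lborel :: real measure" ..
  have fm [measurable]: "f b \<in> borel_measurable borel" if "b \<in> Basis" for b
    using f[OF that] by (auto dest: borel_measurable_integrable)
  let ?T = "\<lambda>g::'a \<Rightarrow> real. \<Sum>b\<in>Basis. g b *\<^sub>R b"
  have T: "?T \<in> measurable (Pi\<^sub>M Basis (\<lambda>_. lborel)) borel" by measurable
  have m: "(\<lambda>x::'a. \<Prod>b\<in>Basis. f b (inner x b)) \<in> borel_measurable borel" by measurable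
  have e: "(\<Prod>b\<in>Basis. f b (inner (?T g) b)) = (\<Prod>b\<in>Basis. f b (g b))" for g
    by (intro prod.cong refl) simp
  show "integrable lborel (\<lambda>x::'a. \<Prod>b\<in>Basis. f b (inner x b))"
    using product_integrable_prod[OF finite_Basis f]
    by (subst lborel_eq, subst integrable_distr_eq[OF T m]) (simp add: e)
  show "(LINT x|lborel. (\<Prod>b\<in>Basis. f b (inner x b))) = (\<Prod>b\<in>Basis. integral\<^sup>L lborel (f b))"
    using product_integral_prod[OF finite_Basis f]
    by (subst lborel_eq, subst integral_distr[OF T m]) (simp add: e)
qed

text \<open>The characteristic function of the standard normal law, rescaled by
  \<open>y = sqrt (2 * t) * w\<close>.\<close>

lemma
  fixes t x :: real
  assumes "0 < t"
  shows integrable_cis_gauss: "integrable lborel (\<lambda>w. cis (w * x) * of_real (exp (- t * w\<^sup>2)))"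
    and integral_cis_gauss: "(LINT w|lborel. cis (w * x) * of_real (exp (- t * w\<^sup>2))) = of_real (sqrt (pi / t) * exp (- x\<^sup>2 / (4 * t)))"
proof -
  let ?f = "\<lambda>w. cis (w * x) * complex_of_real (exp (- t * w\<^sup>2))"
  define u where "u = x / sqrt (2 * t)"
  have q: "sqrt (2 * t) > 0" using assms by simp
  let ?g = "\<lambda>y. std_normal_density y *\<^sub>R iexp (u * y)"
  have gi: "integrable lborel ?g"
    by (rule Bochner_Integration.integrable_bound[OF integrable_normal_density[of 1 0]]) auto
  have "char std_normal_distribution u = (LINT y|lborel. ?g y)"
    unfolding char_def by (subst integral_density) auto
  then have gI: "(LINT y|lborel. ?g y) = of_real (exp (- (u\<^sup>2) / 2))"
    unfolding char_std_normal_distribution by simp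
  have ge: "?g (0 + sqrt (2 * t) * w) = of_real (1 / sqrt (2 * pi)) * (?f w)" for w
    using q assms by (simp add: normal_density_def u_def cis_conv_exp power_mult_distrib mult.commute scaleR_conv_of_real)
  have i: "integrable lborel (\<lambda>w. of_real (1 / sqrt (2 * pi)) * (?f w))"
    using lborel_integrable_real_affine[OF gi, of "sqrt (2 * t)" 0] q unfolding ge by simp
  have "integrable lborel (\<lambda>w. of_real (sqrt (2 * pi)) * (of_real (1 / sqrt (2 * pi)) * (?f w)))"
    by (rule integrable_mult_right[OF i])
  then show "integrable lborel (\<lambda>w. ?f w)"
    by simp
  have "of_real (exp (- (u\<^sup>2) / 2)) = sqrt (2 * t) *\<^sub>R (LINT w|lborel. ?g (0 + sqrt (2 * t) * w))"
    unfolding gI[symmetric] using lborel_integral_real_affine[of "sqrt (2 * t)" ?g 0] q by simp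
  also have "\<dots> = of_real (sqrt (2 * t) / sqrt (2 * pi)) * (LINT w|lborel. ?f w)"
    unfolding ge by (subst integral_mult_right_zero) (simp add: scaleR_conv_of_real)
  finally have "of_real (sqrt (2 * pi) / sqrt (2 * t)) * (of_real (exp (- (u\<^sup>2) / 2)) :: complex) =
     of_real (sqrt (2 * pi) / sqrt (2 * t)) * of_real (sqrt (2 * t) / sqrt (2 * pi)) * (LINT w|lborel. ?f w)"
    by (simp only: mult.assoc)
  also have "of_real (sqrt (2 * pi) / sqrt (2 * t)) * of_real (sqrt (2 * t) / sqrt (2 * pi)) = (1::complex)"
    unfolding of_real_mult[symmetric] using q by simp
  also have "of_real (sqrt (2 * pi) / sqrt (2 * t)) * (of_real (exp (- (u\<^sup>2) / 2)) :: complex) = of_real (sqrt (pi / t) * exp (- x\<^sup>2 / (4 * t)))"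
    unfolding of_real_mult[symmetric] using assms
    by (simp add: u_def real_sqrt_divide power_divide) (simp add: real_sqrt_mult)
  finally show "(LINT w|lborel. ?f w) = of_real (sqrt (pi / t) * exp (- x\<^sup>2 / (4 * t)))"
    by simp
qed

lemma cis_inner_eq_prod: "cis (inner w x) = (\<Prod>b\<in>Basis. cis (inner w b * inner x b))"
  for w x :: "'a::euclidean_space"
proof -
  have "(\<Prod>b\<in>Basis. cis (inner w b * inner x b)) = exp (\<Sum>b\<in>Basis. \<i> * of_real (inner w b * inner x b))"
    by (simp add: cis_conv_exp exp_sum)
  also have "(\<Sum>b\<in>Basis. \<i> * of_real (inner w b * inner x b)) = \<i> * of_real (inner w x)"
    by (simp add: euclidean_inner[of w x] sum_distrib_left)
  finally show ?thesis by (simp add: cis_conv_exp)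
qed

lemma exp_norm2_eq_prod: "exp (a * (norm w)\<^sup>2) = (\<Prod>b\<in>Basis. exp (a * (inner w b)\<^sup>2))"
  for w :: "'a::euclidean_space"
  by (simp add: norm_eq_sqrt_inner euclidean_inner[of w w] power2_eq_square sum_nonneg
     sum_distrib_left flip: exp_sum)

lemma
  fixes x :: "'a::euclidean_space"
  assumes "0 < t"
  shows integrable_cis_inner_gauss: "integrable lborel (\<lambda>w. cis (inner w x) * of_real (exp (- t * (norm w)\<^sup>2)))"
    and integral_cis_inner_gauss: "(LINT w|lborel. cis (inner w x) * of_real (exp (- t * (norm w)\<^sup>2))) =
      of_real (sqrt (pi / t) ^ DIM('a) * exp (- (norm x)\<^sup>2 / (4 * t)))"
proof -
  let ?f = "\<lambda>b w. cis (w * inner x b) * complex_of_real (exp (- t * w\<^sup>2))"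
  have e: "cis (inner w x) * of_real (exp (- t * (norm w)\<^sup>2)) = (\<Prod>b\<in>Basis. ?f b (inner w b))" for w
    unfolding prod.distrib exp_norm2_eq_prod of_real_prod cis_inner_eq_prod[of w x]
    by (simp add: mult.commute)
  have i: "integrable lborel (?f b)" for b
    by (rule integrable_cis_gauss[OF assms])
  show "integrable lborel (\<lambda>w. cis (inner w x) * of_real (exp (- t * (norm w)\<^sup>2)))"
    unfolding e by (rule lborel_integrable_prod[OF i])
  have "(LINT w|lborel. cis (inner w x) * of_real (exp (- t * (norm w)\<^sup>2))) =
    (\<Prod>b\<in>Basis. of_real (sqrt (pi / t) * exp (- (inner x b)\<^sup>2 / (4 * t))))"
    unfolding e lborel_integral_prod[OF i] integral_cis_gauss[OF assms] ..
  also have "\<dots> = of_real (sqrt (pi / t) ^ DIM('a) * exp (- (norm x)\<^sup>2 / (4 * t)))"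
    unfolding of_real_prod[symmetric] prod.distrib
    using exp_norm2_eq_prod[of "- 1 / (4 * t)" x] by simp
  finally show "(LINT w|lborel. cis (inner w x) * of_real (exp (- t * (norm w)\<^sup>2))) =
      of_real (sqrt (pi / t) ^ DIM('a) * exp (- (norm x)\<^sup>2 / (4 * t)))" .
qed

definition trig_sum :: "nat \<Rightarrow> (nat \<Rightarrow> 'a::real_inner) \<Rightarrow> (nat \<Rightarrow> real) \<Rightarrow> 'a \<Rightarrow> complex" where
  "trig_sum n x c w = (\<Sum>j<n. of_real (c j) * cis (inner w (x j)))"

abbreviation "trig_sq n x c w \<equiv> (cmod (trig_sum n x c w))\<^sup>2"

abbreviation "heat_form n x c t \<equiv> \<Sum>i<n. \<Sum>j<n. c i * c j * exp (- (norm (x i - x j))\<^sup>2 / (4 * t))"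

abbreviation "riesz s b w \<equiv> (b\<^sup>2 + (norm w)\<^sup>2) powr (- s)"

lemma trig_sum_measurable [measurable]:
  "trig_sum n x c \<in> borel_measurable (borel :: 'a::euclidean_space measure)"
  unfolding trig_sum_def cis_conv_exp by measurable

lemma norm_trig_sum_power2:
  "complex_of_real (trig_sq n x c w) = (\<Sum>i<n. \<Sum>j<n. of_real (c i * c j) * cis (inner w (x i - x j)))"
  unfolding complex_norm_square trig_sum_def
  by (simp add: cnj_sum sum_product cis_cnj cis_mult inner_diff_right ac_simps del: of_real_mult)
     (simp add: algebra_simps cis_mult flip: cis_mult)

lemma
  fixes x :: "nat \<Rightarrow> 'a::euclidean_space"
  assumes "0 < t"
  shows integrable_trig_sum_gauss: "integrable lborel (\<lambda>w. trig_sq n x c w * exp (- t * (norm w)\<^sup>2))"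
    and integral_trig_sum_gauss: "(LINT w|lborel. trig_sq n x c w * exp (- t * (norm w)\<^sup>2)) =
      sqrt (pi / t) ^ DIM('a) * heat_form n x c t"
proof -
  let ?h = "\<lambda>i j w. of_real (c i * c j) * (cis (inner w (x i - x j)) * of_real (exp (- t * (norm w)\<^sup>2)))"
  let ?g = "\<lambda>w. trig_sq n x c w * exp (- t * (norm w)\<^sup>2)"
  have e: "complex_of_real (?g w) = (\<Sum>i<n. \<Sum>j<n. ?h i j w)" for w
    by (simp add: norm_trig_sum_power2 sum_distrib_right mult.assoc del: of_real_power)
  have hi: "integrable lborel (?h i j)" for i j
    by (intro integrable_mult_right integrable_cis_inner_gauss assms)
  have i: "integrable lborel (\<lambda>w. complex_of_real (?g w))"
    unfolding e by (intro Bochner_Integration.integrable_sum hi)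
  have i2: "integrable lborel ?g"
    using integrable_Re[OF i] by simp
  then show "integrable lborel ?g" .
  have "complex_of_real (LINT w|lborel. ?g w) = (LINT w|lborel. complex_of_real (?g w))"
    using integral_complex_of_real[of lborel ?g] by simp
  also have "\<dots> = (\<Sum>i<n. \<Sum>j<n. of_real (c i * c j) * of_real (sqrt (pi / t) ^ DIM('a) * exp (- (norm (x i - x j))\<^sup>2 / (4 * t))))"
    unfolding e using hi
    by (simp only: Bochner_Integration.integral_sum Bochner_Integration.integrable_sum integral_mult_right_zero
       integral_cis_inner_gauss[OF assms])
  also have "\<dots> = complex_of_real (sqrt (pi / t) ^ DIM('a) * heat_form n x c t)"
    by (simp add: sum_distrib_left ac_simps)
  finally show "(LINT w|lborel. ?g w) = sqrt (pi / t) ^ DIM('a) * heat_form n x c t"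
    unfolding of_real_eq_iff .
qed

definition matern_form :: "real \<Rightarrow> real \<Rightarrow> nat \<Rightarrow> (nat \<Rightarrow> 'a::real_normed_vector) \<Rightarrow> (nat \<Rightarrow> real) \<Rightarrow> real" where
  "matern_form nu al n x c = (\<Sum>i<n. \<Sum>j<n. c i * c j * matern nu al (x i - x j))"

text \<open>Up to a positive factor, the integral of a squared modulus against a Gaussian.\<close>

lemma heat_form_nonneg:
  fixes x :: "nat \<Rightarrow> 'a::euclidean_space"
  assumes "0 < t"
  shows "0 \<le> heat_form n x c t"
proof -
  have "0 \<le> sqrt (pi / t) ^ DIM('a) * heat_form n x c t"
    unfolding integral_trig_sum_gauss[OF assms, symmetric] by (intro Bochner_Integration.integral_nonneg) auto
  moreover have "0 < sqrt (pi / t) ^ DIM('a)" using assms by simp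
  ultimately show ?thesis using mult_pos_neg by (rule_tac ccontr) (fastforce simp only: not_le)
qed

lemma matern_form_eq_mixture:
  fixes x :: "nat \<Rightarrow> 'a::euclidean_space"
  assumes "0 < nu" "0 < al"
  shows "integrable lborel (\<lambda>t. indicat_real {0<..} t * (t powr (nu - 1) * exp (- al\<^sup>2 * t)) *
      heat_form n x c t)" (is "integrable _ ?F")
    and "matern_form nu al n x c = al powr (2 * nu) / Gamma nu *
    (LINT t|lborel. indicat_real {0<..} t * (t powr (nu - 1) * exp (- al\<^sup>2 * t)) *
      heat_form n x c t)"
proof -
  let ?h = "\<lambda>r t. indicat_real {0<..} t *\<^sub>R (t powr (nu - 1) * exp (- al\<^sup>2 * t - r / (4 * t)))"
  have hi: "integrable lborel (?h r)" if "0 \<le> r" for r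
    using set_integrable_Gamma_mixture[OF assms that] by (simp add: set_integrable_def)
  have e: "?F t = (\<Sum>i<n. \<Sum>j<n. c i * c j * ?h ((norm (x i - x j))\<^sup>2) t)" for t
    by (simp add: sum_distrib_left exp_diff exp_minus field_simps)
  show i: "integrable lborel ?F"
    unfolding e by (intro Bochner_Integration.integrable_sum integrable_mult_right hi) auto
  have "integral\<^sup>L lborel ?F = (\<Sum>i<n. \<Sum>j<n. c i * c j * integral\<^sup>L lborel (?h ((norm (x i - x j))\<^sup>2)))"
    unfolding e using hi
    by (simp only: Bochner_Integration.integral_sum Bochner_Integration.integrable_sum integral_mult_right_zero integrable_mult_right zero_le_power2)
  then show "matern_form nu al n x c = al powr (2 * nu) / Gamma nu * integral\<^sup>L lborel ?F"
    unfolding matern_form_def matern_eq_mixture[OF assms] set_lebesgue_integral_def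
    by (simp only: sum_distrib_left ac_simps)
qed

lemma ennreal_mult5: "ennreal (a * (p * e)) * ennreal (g * f) = ennreal a * (ennreal g * ennreal (p * (e * f)))"
  if "0 \<le> a" "0 \<le> p" "0 \<le> e" "0 \<le> g" "0 \<le> f"
  using that by (simp add: ennreal_mult ac_simps)

lemma ennreal_mult4: "ennreal a * (ennreal g * ennreal (b * p)) = ennreal (b * a) * ennreal (g * p)"
  if "0 \<le> a" "0 \<le> p" "0 \<le> b" "0 \<le> g"
  using that by (simp add: ennreal_mult ac_simps)

text \<open>Each Gaussian kernel of the mixture is a Fourier integral of \<open>trig_sq\<close>;
  after exchanging the integrals, the Gamma integral over \<open>t\<close> leaves
  \<open>Gamma s\<close> times the weight. With nonnegative integrals Tonelli's theorem applies
  without integrability questions.\<close>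

lemma matern_form_fourier:
  fixes x :: "nat \<Rightarrow> 'a::euclidean_space"
  assumes "0 < nu" "0 < al"
  defines "s \<equiv> nu + real DIM('a) / 2"
  shows "ennreal (al powr (- 2 * nu) * matern_form nu al n x c) = ennreal (Gamma s / (Gamma nu * sqrt pi ^ DIM('a))) *
     (\<integral>\<^sup>+w. ennreal (trig_sq n x c w * riesz s al w) \<partial>lborel)"
proof -
  let ?H = "\<lambda>t. heat_form n x c t"
  let ?e = "\<lambda>t. indicat_real {0<..} t * (t powr (nu - 1) * exp (- al\<^sup>2 * t))"
  let ?G = "\<lambda>w. trig_sq n x c w"
  let ?L = "\<lambda>t w. ennreal (1 / sqrt pi ^ DIM('a)) * (ennreal (?G w) * ennreal (indicat_real {0<..} t * (t powr (s - 1) * exp (- (al\<^sup>2 + (norm w)\<^sup>2) * t))))"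
  have G: "0 < Gamma nu" using assms by (simp add: Gamma_real_pos)
  have s: "0 < s" using assms by (simp add: s_def add_pos_nonneg)
  have "al powr (- 2 * nu) * al powr (2 * nu) = 1" using assms by (simp add: powr_add[symmetric])
  then have "al powr (- 2 * nu) * matern_form nu al n x c = 1 / Gamma nu * (LINT t|lborel. ?e t * ?H t)"
    unfolding matern_form_eq_mixture(2)[OF assms(1,2)]
    by (metis (no_types, lifting) mult.assoc times_divide_eq_left times_divide_eq_right)
  then have "ennreal (al powr (- 2 * nu) * matern_form nu al n x c) = ennreal (1 / Gamma nu) * ennreal (LINT t|lborel. ?e t * ?H t)"
    using G by (subst ennreal_mult'[symmetric]) (auto simp only: divide_nonneg_pos zero_le_one)
  also have "ennreal (LINT t|lborel. ?e t * ?H t) = (\<integral>\<^sup>+t. ennreal (?e t * ?H t) \<partial>lborel)"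
    using assms
    by (intro nn_integral_eq_integral[symmetric] matern_form_eq_mixture(1) assms)
      (auto simp: indicator_def intro!: AE_I2 mult_nonneg_nonneg heat_form_nonneg[simplified])
  also have "\<dots> = (\<integral>\<^sup>+t. \<integral>\<^sup>+w. ?L t w \<partial>lborel \<partial>lborel)"
  proof (intro nn_integral_cong)
    fix t :: real
    show "ennreal (?e t * ?H t) = (\<integral>\<^sup>+w. ?L t w \<partial>lborel)"
    proof (cases "0 < t")
      case True
      let ?k = "sqrt (t / pi) ^ DIM('a)"
      have k: "?k * sqrt (pi / t) ^ DIM('a) = 1"
        using True by (simp flip: power_mult_distrib real_sqrt_mult)
      have "ennreal (?H t) = ennreal (?k * (LINT w|lborel. ?G w * exp (- t * (norm w)\<^sup>2)))"
        unfolding integral_trig_sum_gauss[OF True] by (simp only: k mult.assoc[symmetric] mult_1_left)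
      also have "\<dots> = ennreal ?k * (\<integral>\<^sup>+w. ennreal (?G w * exp (- t * (norm w)\<^sup>2)) \<partial>lborel)"
        using True by (subst nn_integral_eq_integral[OF integrable_trig_sum_gauss]) (auto simp: ennreal_mult')
      finally have "ennreal (?e t * ?H t) = ennreal (?e t * ?k) * (\<integral>\<^sup>+w. ennreal (?G w * exp (- t * (norm w)\<^sup>2)) \<partial>lborel)"
        using True by (simp add: ennreal_mult' ennreal_mult mult.assoc)
      \<comment> \<open>The Gaussian normalisation contributes \<open>t\<close> to the power
        \<open>d / 2\<close>; this shift of the exponent from \<open>nu\<close> to \<open>s\<close>
        is the origin of the order \<open>nu + d / 2\<close>.\<close>
      also have "?e t * ?k = 1 / sqrt pi ^ DIM('a) * (t powr (s - 1) * exp (- al\<^sup>2 * t))"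
      proof -
        have "sqrt t ^ DIM('a) = t powr (real DIM('a) / 2)"
          using True by (simp add: powr_half_sqrt[symmetric] powr_powr flip: powr_realpow)
        moreover have "t powr (nu - 1) * t powr (real DIM('a) / 2) = t powr (s - 1)"
          by (simp add: s_def flip: powr_add) (simp add: algebra_simps)
        ultimately show ?thesis using True
          by (simp add: real_sqrt_divide power_divide)
      qed
      also have "ennreal (1 / sqrt pi ^ DIM('a) * (t powr (s - 1) * exp (- al\<^sup>2 * t))) *
           (\<integral>\<^sup>+w. ennreal (?G w * exp (- t * (norm w)\<^sup>2)) \<partial>lborel) =
          (\<integral>\<^sup>+w. ennreal (1 / sqrt pi ^ DIM('a) * (t powr (s - 1) * exp (- al\<^sup>2 * t))) * ennreal (?G w * exp (- t * (norm w)\<^sup>2)) \<partial>lborel)"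
        by (rule nn_integral_cmult[symmetric]) measurable
      also have "\<dots> = (\<integral>\<^sup>+w. ?L t w \<partial>lborel)"
      proof (intro nn_integral_cong)
        fix w :: 'a
        have "exp (- (al\<^sup>2 + (norm w)\<^sup>2) * t) = exp (- al\<^sup>2 * t) * exp (- t * (norm w)\<^sup>2)"
          by (simp add: exp_add[symmetric] algebra_simps)
        then show "ennreal (1 / sqrt pi ^ DIM('a) * (t powr (s - 1) * exp (- al\<^sup>2 * t))) * ennreal (?G w * exp (- t * (norm w)\<^sup>2)) =
          ?L t w"
          using True ennreal_mult5[of "1 / sqrt pi ^ DIM('a)" "t powr (s - 1)" "exp (- al\<^sup>2 * t)" "?G w" "exp (- t * (norm w)\<^sup>2)"]
          by simp
      qed
      finally show ?thesis .
    qed simp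
  qed
  also have "\<dots> = (\<integral>\<^sup>+w. \<integral>\<^sup>+t. ?L t w \<partial>lborel \<partial>lborel)"
    by (rule lborel_pair.Fubini') measurable
  also have "\<dots> = (\<integral>\<^sup>+w. ennreal (Gamma s / sqrt pi ^ DIM('a)) * ennreal (?G w * riesz s al w) \<partial>lborel)"
  proof (intro nn_integral_cong)
    fix w :: 'a
    have p: "0 < al\<^sup>2 + (norm w)\<^sup>2" using assms(2) by (simp add: add_pos_nonneg)
    have "(\<integral>\<^sup>+t. ?L t w \<partial>lborel)
      = ennreal (1 / sqrt pi ^ DIM('a)) * (ennreal (?G w) * ennreal (Gamma s * riesz s al w))"
    proof -
      have "(\<lambda>t. ennreal (indicat_real {0<..} t * (t powr (s - 1) * exp (- (al\<^sup>2 + (norm w)\<^sup>2) * t)))) \<in> borel_measurable lborel"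
        by measurable
      from nn_integral_cmult[OF this, of "ennreal (1 / sqrt pi ^ DIM('a)) * ennreal (?G w)"] show ?thesis
        unfolding nn_integral_Gamma_scaled[OF s p] by (simp only: mult.assoc)
    qed
    also have "\<dots> = ennreal (Gamma s / sqrt pi ^ DIM('a)) * ennreal (?G w * riesz s al w)"
      using s ennreal_mult4[of "1 / sqrt pi ^ DIM('a)" "riesz s al w" "Gamma s" "?G w"]
      by (simp add: Gamma_real_nonneg)
    finally show "(\<integral>\<^sup>+t. ?L t w \<partial>lborel)
      = ennreal (Gamma s / sqrt pi ^ DIM('a)) * ennreal (?G w * riesz s al w)" .
  qed
  also have "\<dots> = ennreal (Gamma s / sqrt pi ^ DIM('a)) * (\<integral>\<^sup>+w. ennreal (?G w * riesz s al w) \<partial>lborel)"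
    by (rule nn_integral_cmult) measurable
  finally have "ennreal (al powr (- 2 * nu) * matern_form nu al n x c) = ennreal (1 / Gamma nu) * ennreal (Gamma s / sqrt pi ^ DIM('a)) *
     (\<integral>\<^sup>+w. ennreal (?G w * riesz s al w) \<partial>lborel)"
    by (simp only: mult.assoc)
  also have "ennreal (1 / Gamma nu) * ennreal (Gamma s / sqrt pi ^ DIM('a)) = ennreal (Gamma s / (Gamma nu * sqrt pi ^ DIM('a)))"
    using G by (subst ennreal_mult'[symmetric]) auto
  finally show ?thesis .
qed

section \<open>A reproducing kernel for band-limited trigonometric sums\<close>

definition unif_pm1 :: "real measure" where
  "unif_pm1 = density lborel (\<lambda>x. ennreal (indicator {-1..1} x / 2))"

lemma prob_space_unif_pm1: "prob_space unif_pm1"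
proof
  have "emeasure unif_pm1 (space unif_pm1) = (\<integral>\<^sup>+x. ennreal (1 / 2) * indicator {-1..1::real} x \<partial>lborel)"
    unfolding unif_pm1_def by (simp add: emeasure_density) (intro nn_integral_cong, auto simp: indicator_def)
  also have "\<dots> = ennreal (1/2) * ennreal 2"
    by (simp add: nn_integral_cmult_indicator)
  also have "\<dots> = ennreal (1/2 * 2)" by (rule ennreal_mult[symmetric]) auto
  also have "\<dots> = 1" by simp
  finally show "emeasure unif_pm1 (space unif_pm1) = 1" .
qed

lemma sets_unif_pm1 [simp, measurable_cong]: "sets unif_pm1 = sets borel"
  and space_unif_pm1 [simp]: "space unif_pm1 = UNIV"
  by (simp_all add: unif_pm1_def)

lemma emeasure_unif_pm1: "emeasure unif_pm1 {-1..1} = 1"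
proof -
  have "emeasure unif_pm1 {-1..1} = emeasure unif_pm1 (space unif_pm1)"
    unfolding unif_pm1_def by (simp add: emeasure_density) (intro nn_integral_cong, auto simp: indicator_def)
  also have "\<dots> = 1" by (rule prob_space.emeasure_space_1[OF prob_space_unif_pm1])
  finally show ?thesis .
qed

lemma char_unif_pm1:
  assumes "t \<noteq> 0"
  shows "char unif_pm1 t = of_real (sin t / t)"
proof -
  let ?F = "\<lambda>x. - \<i> * cis (t * x) / of_real t"
  have d: "(?F has_vector_derivative iexp (t * x)) (at x within {-1..1})" for x
  proof -
    have "((\<lambda>z. - \<i> * exp (\<i> * (of_real t * z)) / of_real t) has_field_derivative exp (\<i> * (of_real t * of_real x))) (at (of_real x))"
      using assms by (auto intro!: derivative_eq_intros simp: field_simps)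
    from has_vector_derivative_at_within[OF has_vector_derivative_real_field[OF this]]
    have "((\<lambda>x. - \<i> * iexp (t * x) / of_real t) has_vector_derivative iexp (t * x)) (at x within {-1..1})"
      by (simp add: o_def)
    then show ?thesis by (simp add: cis_conv_exp)
  qed
  have "has_bochner_integral lborel (\<lambda>x. indicator {-1..1} x *\<^sub>R iexp (t * x)) (?F 1 - ?F (-1))"
    by (rule has_bochner_integral_FTC_Icc[OF _ d]) (auto intro!: continuous_intros)
  then have i: "(LINT x|lborel. indicator {-1..1} x *\<^sub>R iexp (t * x)) = ?F 1 - ?F (-1)"
    by (rule has_bochner_integral_integral_eq)
  have "char unif_pm1 t = (LINT x|lborel. (indicator {-1..1} x / 2) *\<^sub>R iexp (t * x))"
    unfolding char_def unif_pm1_def by (subst integral_density) auto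
  also have "\<dots> = (1/2) *\<^sub>R (LINT x|lborel. indicator {-1..1} x *\<^sub>R iexp (t * x))"
    by (subst integral_scaleR_right[symmetric]) simp
  also have "\<dots> = of_real (sin t / t)"
    unfolding i using assms
    by (simp add: complex_eq_iff field_simps Re_divide Im_divide power2_eq_square)
  finally show ?thesis .
qed

lemma integrable_inverse_1_plus_square_UNIV: "integrable lborel (\<lambda>t::real. 1 / (1 + t\<^sup>2))"
  using integrable_inverse_1_plus_square by (simp add: set_integrable_def inverse_eq_divide)

text \<open>Adds the bounds from \<open>\<bar>sin z\<bar> \<le> \<bar>z\<bar>\<close>, good near 0,
  and \<open>\<bar>sin z\<bar> \<le> 1\<close>, good far away. Each factor of the kernel thus decays
  like \<open>1 / t\<close>.\<close>

lemma sinc_bound: "(1 + t\<^sup>2) * (sin (L * t) / t)\<^sup>2 \<le> L\<^sup>2 + 1" for L t :: real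
proof (cases "t = 0")
  case False
  have 1: "\<bar>sin (L * t)\<bar> \<le> \<bar>L * t\<bar>" by (rule abs_sin_x_le_abs_x)
  have "(sin (L * t))\<^sup>2 \<le> (L * t)\<^sup>2" using 1 by (simp only: abs_le_square_iff[symmetric])
  moreover have "(sin (L * t))\<^sup>2 \<le> 1" by (simp add: abs_square_le_1)
  ultimately have "(1 + t\<^sup>2) * (sin (L * t))\<^sup>2 \<le> (L\<^sup>2 + 1) * t\<^sup>2"
    using mult_right_mono[of "(sin (L * t))\<^sup>2" 1 "t\<^sup>2"] by (simp add: algebra_simps power_mult_distrib)
  then show ?thesis using False by (simp add: power_divide divide_le_eq)
qed simp

text \<open>Up to normalisation, this is the Fourier transform of the convolution of the indicator of
  \<open>[-L, L]\<close> with the law of a sum of \<open>r\<close> independent uniform variables on \<open>[-1, 1]\<close>, a function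
  that equals 1 on \<open>[r - L, L - r]\<close>.\<close>

definition bump_ft :: "nat \<Rightarrow> real \<Rightarrow> real \<Rightarrow> real" where
  "bump_ft r L t = 1 / pi * (sin (L * t) / t) * (sin t / t) ^ r"

lemma bump_ft_measurable [measurable]: "bump_ft r L \<in> borel_measurable borel"
  unfolding bump_ft_def[abs_def] by measurable

lemma bump_ft_power2_le: "(bump_ft r L t)\<^sup>2 \<le> (L\<^sup>2 + 1) * 2 ^ r / (1 + t\<^sup>2) ^ (r + 1)"
proof -
  have pos: "0 < 1 + t\<^sup>2" by (simp add: add_pos_nonneg)
  have 1: "(sin (L * t) / t)\<^sup>2 \<le> (L\<^sup>2 + 1) / (1 + t\<^sup>2)"
    using sinc_bound[of t L] pos by (simp add: le_divide_eq mult.commute)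
  have 2: "(sin t / t)\<^sup>2 \<le> 2 / (1 + t\<^sup>2)"
    using sinc_bound[of t 1] pos by (simp add: le_divide_eq mult.commute)
  have 3: "((sin t / t)\<^sup>2) ^ r \<le> (2 / (1 + t\<^sup>2)) ^ r"
    using 2 by (intro power_mono) auto
  have 4: "(1 / pi)\<^sup>2 \<le> 1"
    using pi_ge_two by (intro power_le_one) auto
  have "(bump_ft r L t)\<^sup>2 = (1 / pi)\<^sup>2 * ((sin (L * t) / t)\<^sup>2 * ((sin t / t)\<^sup>2) ^ r)"
    unfolding bump_ft_def power_mult_distrib power_mult[symmetric] mult.commute[of 2 r] by (simp only: mult.assoc)
  also have "\<dots> \<le> 1 * ((L\<^sup>2 + 1) / (1 + t\<^sup>2) * (2 / (1 + t\<^sup>2)) ^ r)"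
    by (intro mult_mono 1 3 4) (use pos in auto)
  also have "\<dots> = (L\<^sup>2 + 1) * 2 ^ r / (1 + t\<^sup>2) ^ (r + 1)"
    by (simp add: power_divide)
  finally show ?thesis .
qed

lemma bump_ft_le:
  assumes "1 \<le> r"
  shows "\<bar>bump_ft r L t\<bar> \<le> sqrt ((L\<^sup>2 + 1) * 2 ^ r) * (1 / (1 + t\<^sup>2))"
proof -
  have pos: "1 \<le> 1 + t\<^sup>2" by simp
  have "(1 + t\<^sup>2) ^ 2 \<le> (1 + t\<^sup>2) ^ (r + 1)" using assms pos by (intro power_increasing) auto
  then have "(L\<^sup>2 + 1) * 2 ^ r / (1 + t\<^sup>2) ^ (r + 1) \<le> (L\<^sup>2 + 1) * 2 ^ r / (1 + t\<^sup>2) ^ 2"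
    by (intro divide_left_mono) (auto intro!: mult_pos_pos zero_less_power simp: add_pos_nonneg)
  then have "(bump_ft r L t)\<^sup>2 \<le> (L\<^sup>2 + 1) * 2 ^ r / (1 + t\<^sup>2)\<^sup>2"
    using bump_ft_power2_le[of r L t] by linarith
  then have "\<bar>bump_ft r L t\<bar> \<le> sqrt ((L\<^sup>2 + 1) * 2 ^ r / (1 + t\<^sup>2)\<^sup>2)"
    by (intro real_le_rsqrt) simp
  then show ?thesis
  proof -
    have "1 + t\<^sup>2 \<noteq> 0" using pos by linarith
    then show "\<bar>bump_ft r L t\<bar> \<le> sqrt ((L\<^sup>2 + 1) * 2 ^ r / (1 + t\<^sup>2)\<^sup>2) \<Longrightarrow> ?thesis"
      by (simp add: real_sqrt_divide)
  qed
qed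

lemma integrable_bump_ft:
  assumes "1 \<le> r"
  shows "integrable lborel (bump_ft r L)"
  by (rule Bochner_Integration.integrable_bound[OF integrable_mult_right[OF integrable_inverse_1_plus_square_UNIV, of "sqrt ((L\<^sup>2 + 1) * 2 ^ r)"]])
    (use bump_ft_le[OF assms, of L] in auto)

text \<open>The \<open>r\<close> uniform factors pay for the weight of order \<open>s\<close>, and
  the factor from the indicator of \<open>[-L, L]\<close> leaves the integrable
  \<open>1 / (1 + t^2)\<close>.\<close>

lemma integrable_bump_ft_weighted:
  assumes "s \<le> real r"
  shows "integrable lborel (\<lambda>t. (bump_ft r L t)\<^sup>2 * (1 + t\<^sup>2) powr s)"
proof (rule Bochner_Integration.integrable_bound[OF integrable_mult_right[OF integrable_inverse_1_plus_square_UNIV, of "(L\<^sup>2 + 1) * 2 ^ r"]])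
  have "(bump_ft r L t)\<^sup>2 * (1 + t\<^sup>2) powr s \<le> (L\<^sup>2 + 1) * 2 ^ r * (1 / (1 + t\<^sup>2))" for t
  proof -
    have pos: "0 < 1 + t\<^sup>2" by (simp add: add_pos_nonneg)
    have "(1 + t\<^sup>2) powr s \<le> (1 + t\<^sup>2) powr (real r)" using assms by (intro powr_mono) auto
    also have "\<dots> = (1 + t\<^sup>2) ^ r" using pos by (simp add: powr_realpow)
    finally have "(bump_ft r L t)\<^sup>2 * (1 + t\<^sup>2) powr s \<le> ((L\<^sup>2 + 1) * 2 ^ r / (1 + t\<^sup>2) ^ (r + 1)) * (1 + t\<^sup>2) ^ r"
      by (intro mult_mono bump_ft_power2_le) auto
    also have "\<dots> = (L\<^sup>2 + 1) * 2 ^ r * (1 / (1 + t\<^sup>2))"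
    proof -
      have "K / u ^ (r + 1) * u ^ r = K * (1 / u)" if "u \<noteq> 0" for K u :: real
        using that by simp
      then show ?thesis using pos by (metis less_irrefl)
    qed
    finally show ?thesis .
  qed
  then show "AE t in lborel. norm ((bump_ft r L t)\<^sup>2 * (1 + t\<^sup>2) powr s) \<le> norm ((L\<^sup>2 + 1) * 2 ^ r * (1 / (1 + t\<^sup>2)))"
    by (auto simp: abs_mult)
qed measurable

definition sum_unif :: "nat \<Rightarrow> real measure" where
  "sum_unif r = distr (Pi\<^sub>M {..<r} (\<lambda>_. unif_pm1)) borel (\<lambda>om. \<Sum>i<r. om i)"

lemma prob_space_PiM_unif: "prob_space (Pi\<^sub>M {..<r::nat} (\<lambda>_. unif_pm1))"
  by (intro prob_space_PiM prob_space_unif_pm1)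

lemma real_distribution_sum_unif: "real_distribution (sum_unif r)"
proof -
  interpret prob_space "Pi\<^sub>M {..<r} (\<lambda>_. unif_pm1)" by (rule prob_space_PiM_unif)
  show ?thesis unfolding sum_unif_def by (intro real_distribution_distr) measurable
qed

lemma char_sum_unif:
  assumes "t \<noteq> 0"
  shows "char (sum_unif r) t = of_real ((sin t / t) ^ r)"
proof -
  interpret prob_space unif_pm1 by (rule prob_space_unif_pm1)
  interpret P: product_sigma_finite "\<lambda>_::nat. unif_pm1" ..
  have "char (sum_unif r) t = (LINT om|Pi\<^sub>M {..<r} (\<lambda>_. unif_pm1). iexp (t * (\<Sum>i<r. om i)))"
    unfolding char_def sum_unif_def by (subst integral_distr) auto
  also have "\<dots> = (LINT om|Pi\<^sub>M {..<r} (\<lambda>_. unif_pm1). (\<Prod>i<r. iexp (t * om i)))"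
    by (simp add: sum_distrib_left exp_sum)
  also have "\<dots> = (\<Prod>i<r. (LINT x|unif_pm1. iexp (t * x)))"
    by (rule P.product_integral_prod) (auto intro!: integrable_iexp)
  also have "(LINT x|unif_pm1. iexp (t * x)) = of_real (sin t / t)"
    using char_unif_pm1[OF assms] by (simp add: char_def)
  finally show ?thesis by simp
qed

lemma measure_sum_unif:
  assumes "{- real r..real r} \<subseteq> B" "B \<in> sets borel"
  shows "measure (sum_unif r) B = 1"
proof -
  let ?M = "Pi\<^sub>M {..<r} (\<lambda>_. unif_pm1)"
  interpret P: product_sigma_finite "\<lambda>_::nat. unif_pm1"
    using prob_space_unif_pm1 by (simp add: product_sigma_finite_def prob_space_imp_sigma_finite)
  interpret real_distribution "sum_unif r" by (rule real_distribution_sum_unif)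
  have "1 = emeasure ?M (Pi\<^sub>E {..<r} (\<lambda>_. {-1..1}))"
    by (subst P.emeasure_PiM) (auto simp: emeasure_unif_pm1)
  also have "\<dots> \<le> emeasure ?M ((\<lambda>om. \<Sum>i<r. om i) -` B \<inter> space ?M)"
  proof (rule emeasure_mono)
    show "Pi\<^sub>E {..<r} (\<lambda>_. {-1..1}) \<subseteq> (\<lambda>om. \<Sum>i<r. om i) -` B \<inter> space ?M"
    proof
      fix om :: "nat \<Rightarrow> real" assume w: "om \<in> Pi\<^sub>E {..<r} (\<lambda>_. {-1..1})"
      have "\<bar>\<Sum>i<r. om i\<bar> \<le> (\<Sum>i<r. 1)"
        using w by (intro order_trans[OF sum_abs] sum_mono) (force simp: PiE_iff)
      then have "(\<Sum>i<r. om i) \<in> {- real r..real r}" by (simp, linarith)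
      then show "om \<in> (\<lambda>om. \<Sum>i<r. om i) -` B \<inter> space ?M"
        using w assms by (auto simp: space_PiM PiE_iff)
    qed
    show "(\<lambda>om. \<Sum>i<r. om i) -` B \<inter> space ?M \<in> sets ?M"
      using assms by (intro measurable_sets[of _ _ borel]) auto
  qed
  also have "\<dots> = emeasure (sum_unif r) B"
    unfolding sum_unif_def using assms by (subst emeasure_distr) auto
  finally have "1 \<le> measure (sum_unif r) B" by (simp add: emeasure_eq_measure)
  then show ?thesis using prob_le_1[of B] by linarith
qed

text \<open>Levy's inversion formula for \<open>sum_unif r\<close> on the interval from
  \<open>- x - L\<close> to \<open>- x + L\<close>, where \<open>L = T + r + 1\<close>. The interval
  contains the support \<open>[-r, r]\<close>, hence has probability 1; the added 1 keeps its
  endpoints off the support, so they carry no mass. The limit over growing intervals becomes an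
  ordinary integral because \<open>bump_ft\<close> is integrable.\<close>

lemma integral_bump_ft_cis:
  assumes r: "1 \<le> r" and x: "\<bar>x\<bar> \<le> T"
  shows "(LINT t|lborel. of_real (bump_ft r (T + real r + 1) t) * cis (t * x)) = 1"
proof -
  interpret real_distribution "sum_unif r" by (rule real_distribution_sum_unif)
  define L where "L = T + real r + 1"
  define a where "a = - x - L"
  define b where "b = - x + L"
  have L: "L > 0" using x by (simp add: L_def)
  have ab: "a < - real r" "real r < b" "a \<le> b" using x L by (auto simp: a_def b_def L_def)
  have full: "measure (sum_unif r) {- real r..real r} = 1"
    by (rule measure_sum_unif) auto
  have atom: "measure (sum_unif r) {c} = 0" if "c < - real r \<or> real r < c" for c
  proof -
    have "measure (sum_unif r) ({- real r..real r} \<union> {c}) = measure (sum_unif r) {- real r..real r} + measure (sum_unif r) {c}"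
      using that by (intro finite_measure_Union) auto
    then show ?thesis using full prob_le_1[of "{- real r..real r} \<union> {c}"] measure_nonneg[of "sum_unif r" "{c}"] by linarith
  qed
  have "measure (sum_unif r) {a<..b} = 1"
    using ab by (intro measure_sum_unif) auto
  with Levy_Inversion[of a b] atom[of a] atom[of b] ab
  have lim: "(\<lambda>n::nat. 1 / (2 * pi) * (CLBINT t=-real n..real n. (iexp (-(t * a)) - iexp (-(t * b))) / (\<i> * t) * char (sum_unif r) t)) \<longlonglongrightarrow> 1"
    by auto
  let ?h = "\<lambda>t. complex_of_real (bump_ft r L t) * cis (t * x)"
  let ?L = "\<lambda>t. (iexp (-(t * a)) - iexp (-(t * b))) / (\<i> * t) * char (sum_unif r) t"
  let ?k = "\<lambda>(n::nat) t. indicator {- real n<..<real n} t *\<^sub>R ?h t"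
  have e: "?L t = of_real (2 * pi) * ?h t" if "t \<noteq> 0" for t
  proof -
    have "iexp (-(t * a)) = cis (t * x) * cis (L * t)" "iexp (-(t * b)) = cis (t * x) * cis (- (L * t))"
      unfolding cis_conv_exp[symmetric] cis_mult a_def b_def by (simp_all add: algebra_simps)
    moreover have "cis (L * t) - cis (- (L * t)) = 2 * \<i> * of_real (sin (L * t))"
      by (simp add: complex_eq_iff)
    ultimately have "iexp (-(t * a)) - iexp (-(t * b)) = cis (t * x) * (2 * \<i> * of_real (sin (L * t)))"
      by (simp only: right_diff_distrib[symmetric])
    then show ?thesis
      using that by (simp add: char_sum_unif bump_ft_def)
  qed
  have hi: "integrable lborel ?h"
    by (rule Bochner_Integration.integrable_bound[OF integrable_bump_ft[OF r, of L]]) (auto simp: norm_mult cis_conv_exp)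
  have hm: "?h \<in> borel_measurable lborel" using hi by (rule borel_measurable_integrable)
  have c: "1 / (2 * pi) * (CLBINT t=-real n..real n. ?L t)
     = (LINT t|lborel. ?k n t)" for n :: nat
  proof -
    have "(CLBINT t=-real n..real n. ?L t) =
      (LINT t|lborel. indicator {- real n<..<real n} t *\<^sub>R ?L t)"
      by (simp add: interval_lebesgue_integral_def set_lebesgue_integral_def)
    also have "\<dots> = (LINT t|lborel. of_real (2 * pi) * (?k n t))"
    proof (rule integral_cong_AE)
      show "AE t in lborel. indicator {- real n<..<real n} t *\<^sub>R ?L t =
        of_real (2 * pi) * (?k n t)"
        using AE_lborel_singleton[of "0::real"] by eventually_elim (unfold mult_scaleR_right, subst e, auto)
    qed (use hm in auto)
    also have "\<dots> = of_real (2 * pi) * (LINT t|lborel. ?k n t)"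
      by (rule integral_mult_right_zero)
    finally show ?thesis by simp
  qed
  have "(\<lambda>n::nat. LINT t|lborel. ?k n t) \<longlonglongrightarrow> (LINT t|lborel. ?h t)"
  proof (rule integral_dominated_convergence[where w="\<lambda>t. norm (?h t)"])
    show "AE t in lborel. (\<lambda>n. ?k n t) \<longlonglongrightarrow> ?h t"
    proof (intro AE_I2 tendsto_eventually)
      fix t :: real
      obtain N :: nat where N: "\<bar>t\<bar> < real N" using reals_Archimedean2 by blast
      show "\<forall>\<^sub>F n in sequentially. ?k n t = ?h t"
        using eventually_ge_at_top[of N] by eventually_elim (use N in \<open>auto simp: indicator_def\<close>)
    qed
  qed (use hi hm in \<open>auto simp: indicator_def\<close>)
  with lim show ?thesis unfolding c L_def[symmetric] using LIMSEQ_unique by blast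
qed

text \<open>Peetre's inequality, from the parallelogram law.\<close>

lemma one_plus_norm2_add_le: "1 + (norm (w + v))\<^sup>2 \<le> 2 * (1 + (norm w)\<^sup>2) * (1 + (norm v)\<^sup>2)"
  for w v :: "'a::real_inner"
proof -
  have "(norm (w + v))\<^sup>2 + (norm (w - v))\<^sup>2 = 2 * ((norm w)\<^sup>2 + (norm v)\<^sup>2)"
    unfolding power2_norm_eq_inner by (simp add: inner_add inner_diff algebra_simps)
  then have "(norm (w + v))\<^sup>2 \<le> 2 * ((norm w)\<^sup>2 + (norm v)\<^sup>2)"
    using zero_le_power2[of "norm (w - v)"] by linarith
  moreover have "1 + N \<le> 2 * (1 + A) * (1 + B)" if "N \<le> 2 * (A + B)" "0 \<le> A" "0 \<le> B" for N A B :: real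
  proof -
    have "2 * (1 + A) * (1 + B) = 2 + 2 * (A + B) + 2 * (A * B)" by (simp add: algebra_simps)
    moreover have "0 \<le> A * B" using that by simp
    ultimately show ?thesis using that(1) by linarith
  qed
  ultimately show ?thesis by simp
qed

lemma one_plus_sum_le_prod:
  fixes f :: "'i \<Rightarrow> real"
  assumes "finite I" "\<And>i. i \<in> I \<Longrightarrow> 0 \<le> f i"
  shows "1 + (\<Sum>i\<in>I. f i) \<le> (\<Prod>i\<in>I. 1 + f i)"
  using assms
proof (induction I rule: finite_induct)
  case (insert i I)
  have "1 + (f i + (\<Sum>i\<in>I. f i)) \<le> (1 + f i) * (1 + (\<Sum>i\<in>I. f i))"
    using insert.prems by (simp add: algebra_simps mult_nonneg_nonneg sum_nonneg)
  also have "\<dots> \<le> (1 + f i) * (\<Prod>i\<in>I. 1 + f i)"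
    using insert by (intro mult_left_mono) (auto simp: add_nonneg_nonneg)
  finally show ?case using insert by simp
qed simp

lemma norm2_eq_sum: "(norm w)\<^sup>2 = (\<Sum>b\<in>Basis. (inner w b)\<^sup>2)"
  for w :: "'a::euclidean_space"
proof -
  have "(norm w)\<^sup>2 = (\<Sum>b\<in>Basis. inner w b * inner w b)"
    unfolding power2_norm_eq_inner by (rule euclidean_inner)
  then show ?thesis by (simp only: power2_eq_square)
qed

lemma one_plus_norm2_le_prod: "1 + (norm w)\<^sup>2 \<le> (\<Prod>b\<in>Basis. 1 + (inner w b)\<^sup>2)"
  for w :: "'a::euclidean_space"
  unfolding norm2_eq_sum by (rule one_plus_sum_le_prod) auto

lemma prod_powr_real:
  fixes f :: "'i \<Rightarrow> real"
  assumes "finite I" "\<And>i. i \<in> I \<Longrightarrow> 0 \<le> f i"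
  shows "(\<Prod>i\<in>I. f i) powr s = (\<Prod>i\<in>I. f i powr s)"
  using assms by (induction I rule: finite_induct) (auto simp: powr_mult prod_nonneg)

lemma nn_integral_lborel_translation:
  fixes f :: "'a::euclidean_space \<Rightarrow> ennreal"
  assumes [measurable]: "f \<in> borel_measurable borel"
  shows "(\<integral>\<^sup>+v. f (w + v) \<partial>lborel) = (\<integral>\<^sup>+v. f v \<partial>lborel)"
  by (subst (2) lborel_distr_plus[of w, symmetric]) (simp add: nn_integral_distr)

text \<open>The design points play the role of frequencies: as a function of \<open>w\<close>,
  \<open>trig_sum\<close> is band-limited to the cube of half-width \<open>T\<close>. For every
  single exponential the integral factorises over the coordinates into integrals equal to 1.\<close>

lemma trig_sum_reproducing:
  fixes x :: "nat \<Rightarrow> 'a::euclidean_space"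
  assumes r: "1 \<le> r" and x: "\<And>j b. j < n \<Longrightarrow> b \<in> Basis \<Longrightarrow> \<bar>inner (x j) b\<bar> \<le> T"
  defines "Psi \<equiv> \<lambda>v. \<Prod>b\<in>Basis. bump_ft r (T + real r + 1) (inner v b)"
  shows "integrable lborel (\<lambda>v. of_real (Psi v) * trig_sum n x c (w + v))"
    and "trig_sum n x c w = (LINT v|lborel. of_real (Psi v) * trig_sum n x c (w + v))"
proof -
  let ?L = "T + real r + 1"
  have P: "of_real (Psi v) * cis (inner v (x j)) = (\<Prod>b\<in>Basis. of_real (bump_ft r ?L (inner v b)) * cis (inner v b * inner (x j) b))" for v j
    unfolding Psi_def cis_inner_eq_prod by (simp add: prod.distrib)
  have i1: "integrable lborel (\<lambda>t. of_real (bump_ft r ?L t) * cis (t * y))" for y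
    by (rule Bochner_Integration.integrable_bound[OF integrable_bump_ft[OF r, of ?L]]) (auto simp: norm_mult cis_conv_exp)
  have i2: "integrable lborel (\<lambda>v. of_real (Psi v) * cis (inner v (x j)))" for j
    unfolding P by (rule lborel_integrable_prod[OF i1])
  have I2: "(LINT v|lborel. of_real (Psi v) * cis (inner v (x j))) = 1" if "j < n" for j
    unfolding P lborel_integral_prod[OF i1]
    by (rule prod.neutral) (use integral_bump_ft_cis[OF r x[OF that]] in blast)
  have e: "of_real (Psi v) * trig_sum n x c (w + v) = (\<Sum>j<n. (of_real (c j) * cis (inner w (x j))) * (of_real (Psi v) * cis (inner v (x j))))" for v
    unfolding trig_sum_def by (simp add: inner_add_left sum_distrib_left ac_simps flip: cis_mult)
  show "integrable lborel (\<lambda>v. of_real (Psi v) * trig_sum n x c (w + v))"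
    unfolding e by (intro Bochner_Integration.integrable_sum integrable_mult_right i2)
  have "(LINT v|lborel. of_real (Psi v) * trig_sum n x c (w + v)) = (\<Sum>j<n. (of_real (c j) * cis (inner w (x j))) * (LINT v|lborel. of_real (Psi v) * cis (inner v (x j))))"
    unfolding e using i2
    by (simp only: Bochner_Integration.integral_sum integrable_mult_right integral_mult_right_zero)
  also have "\<dots> = trig_sum n x c w"
    unfolding trig_sum_def by (intro sum.cong refl) (simp add: I2)
  finally show "trig_sum n x c w = (LINT v|lborel. of_real (Psi v) * trig_sum n x c (w + v))" ..
qed

text \<open>Cauchy-Schwarz in the reproducing formula, with opposite powers of
  \<open>1 + |w + v|^2\<close> put on the kernel and on the sum. Peetre's inequality moves the power
  on the kernel to \<open>w\<close>, up to a finite constant. \<open>C\<close> depends neither on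
  the number of points nor on their position in the cube, as a result for arbitrary designs
  requires.\<close>

lemma trig_sum_point_bound:
  fixes s T :: real
  assumes s: "0 \<le> s"
  obtains C where "0 < C"
    "\<And>n (x :: nat \<Rightarrow> 'a::euclidean_space) c w. (\<And>j b. j < n \<Longrightarrow> b \<in> Basis \<Longrightarrow> \<bar>inner (x j) b\<bar> \<le> T) \<Longrightarrow>
      ennreal (trig_sq n x c w) \<le> ennreal (C * (1 + (norm w)\<^sup>2) powr s) *
       (\<integral>\<^sup>+v. ennreal (trig_sq n x c v * (1 + (norm v)\<^sup>2) powr (- s)) \<partial>lborel)"
proof -
  \<comment> \<open>At least \<open>s\<close>, so that the weighted square of the kernel is
    integrable, and at least 1, so that the kernel itself is.\<close>
  define r where "r = nat \<lceil>s\<rceil> + 1"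
  define L where "L = T + real r + 1"
  have r: "1 \<le> r" "s \<le> real r" by (auto simp: r_def) linarith
  define q where "q = (\<lambda>t. (bump_ft r L t)\<^sup>2 * (1 + t\<^sup>2) powr s)"
  have qm: "q \<in> borel_measurable borel" unfolding q_def by measurable
  have q0: "0 \<le> q t" for t by (simp add: q_def)
  have qi: "integrable lborel q" unfolding q_def by (rule integrable_bump_ft_weighted[OF r(2)])
  define K where "K = (LINT t|lborel. q t) ^ DIM('a)"
  have K0: "0 \<le> K" unfolding K_def using q0 by (simp add: Bochner_Integration.integral_nonneg)
  define Psi where "Psi = (\<lambda>v::'a. \<Prod>b\<in>Basis. bump_ft r L (inner v b))"
  have Psi_eq: "(\<Prod>b\<in>Basis. bump_ft r L (inner v b)) = Psi v" for v
    by (simp add: Psi_def)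
  have Psim [measurable]: "Psi \<in> borel_measurable borel" unfolding Psi_def by measurable
  \<comment> \<open>The weight is dominated by a product over the coordinates, so that
    one-dimensional integrability is enough.\<close>
  have PsiK: "(\<integral>\<^sup>+v. ennreal ((Psi v)\<^sup>2 * (1 + (norm v)\<^sup>2) powr s) \<partial>lborel) \<le> ennreal K"
  proof -
    have "(Psi v)\<^sup>2 * (1 + (norm v)\<^sup>2) powr s \<le> (\<Prod>b\<in>Basis. q (inner v b))" for v :: 'a
    proof -
      have "(1 + (norm v)\<^sup>2) powr s \<le> (\<Prod>b\<in>Basis. 1 + (inner v b)\<^sup>2) powr s"
        by (intro powr_mono2 s one_plus_norm2_le_prod) (simp add: add_nonneg_nonneg)
      also have "\<dots> = (\<Prod>b\<in>Basis. (1 + (inner v b)\<^sup>2) powr s)"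
        by (rule prod_powr_real) (auto simp: add_nonneg_nonneg)
      finally have "(Psi v)\<^sup>2 * (1 + (norm v)\<^sup>2) powr s \<le> (Psi v)\<^sup>2 * (\<Prod>b\<in>Basis. (1 + (inner v b)\<^sup>2) powr s)"
        by (intro mult_left_mono) auto
      then show ?thesis by (simp add: Psi_def q_def prod.distrib prod_power_distrib)
    qed
    then have "(\<integral>\<^sup>+v. ennreal ((Psi v)\<^sup>2 * (1 + (norm v)\<^sup>2) powr s) \<partial>lborel) \<le> (\<integral>\<^sup>+v. (\<Prod>b\<in>Basis. ennreal (q (inner v b))) \<partial>(lborel :: 'a measure))"
      by (intro nn_integral_mono) (simp add: prod_ennreal q0 ennreal_leI)
    also have "\<dots> = (\<Prod>b\<in>(Basis::'a set). (\<integral>\<^sup>+t. ennreal (q t) \<partial>lborel))"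
      by (rule nn_integral_lborel_prod) (use qm in auto)
    also have "\<dots> = ennreal K"
      using q0 by (simp add: nn_integral_eq_integral[OF qi] K_def ennreal_power Bochner_Integration.integral_nonneg)
    finally show ?thesis .
  qed
  \<comment> \<open>The added 1 makes the constant positive; of \<open>K\<close> only nonnegativity
    is known.\<close>
  define C where "C = 2 powr s * K + 1"
  have C0: "0 < C" unfolding C_def using K0 by (simp add: add_nonneg_pos)
  have "ennreal (trig_sq n x c w) \<le> ennreal (C * (1 + (norm w)\<^sup>2) powr s) *
       (\<integral>\<^sup>+v. ennreal (trig_sq n x c v * (1 + (norm v)\<^sup>2) powr (- s)) \<partial>lborel)"
    if x: "\<And>j b. j < n \<Longrightarrow> b \<in> Basis \<Longrightarrow> \<bar>inner (x j) b\<bar> \<le> T" for n and x :: "nat \<Rightarrow> 'a" and c w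
  proof -
    let ?u = "\<lambda>v. 1 + (norm v)\<^sup>2"
    have u0: "0 < ?u v" for v :: 'a by (simp add: add_pos_nonneg)
    have sq: "(u powr a)\<^sup>2 = u powr (2 * a)" for u a :: real
      by (simp add: power2_eq_square powr_add[symmetric])
    have pm: "(2 * a * b) powr s = 2 powr s * a powr s * b powr s" if "0 < a" "0 < b" for a b :: real
      using that by (simp add: powr_mult)
    note rep = trig_sum_reproducing[where n=n and c=c and w=w and x=x and T=T, OF r(1) x, folded L_def, unfolded Psi_eq]
    let ?f = "\<lambda>v. ennreal (\<bar>Psi v\<bar> * ?u (w + v) powr (s / 2))"
    let ?g = "\<lambda>v. ennreal (cmod (trig_sum n x c (w + v)) * ?u (w + v) powr (- s / 2))"
    have "ennreal (cmod (trig_sum n x c w)) \<le> (\<integral>\<^sup>+v. ennreal (norm (of_real (Psi v) * trig_sum n x c (w + v))) \<partial>lborel)"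
      by (subst rep(2)) (auto intro!: integral_norm_bound_ennreal rep(1))
    also have "\<dots> = (\<integral>\<^sup>+v. ?f v * ?g v \<partial>lborel)"
    proof (intro nn_integral_cong)
      fix v
      have "?u (w + v) powr (s / 2) * ?u (w + v) powr (- s / 2) = 1"
        using u0[of "w + v"] by (simp add: powr_add[symmetric])
      then have "norm (of_real (Psi v) * trig_sum n x c (w + v)) = (\<bar>Psi v\<bar> * ?u (w + v) powr (s / 2)) * (cmod (trig_sum n x c (w + v)) * ?u (w + v) powr (- s / 2))"
        by (simp add: norm_mult algebra_simps)
      then show "ennreal (norm (of_real (Psi v) * trig_sum n x c (w + v))) = ?f v * ?g v"
        by (simp only:) (simp add: ennreal_mult)
    qed
    finally have "ennreal (cmod (trig_sum n x c w)) ^ 2 \<le> (\<integral>\<^sup>+v. ?f v * ?g v \<partial>lborel)\<^sup>2"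
      by (intro power_mono) auto
    also have "\<dots> \<le> (\<integral>\<^sup>+v. ?f v ^ 2 \<partial>lborel) * (\<integral>\<^sup>+v. ?g v ^ 2 \<partial>lborel)"
      by (rule Cauchy_Schwarz_nn_integral) measurable
    also have "(\<integral>\<^sup>+v. ?g v ^ 2 \<partial>lborel) = (\<integral>\<^sup>+v. ennreal (trig_sq n x c (w + v) * ?u (w + v) powr (- s)) \<partial>lborel)"
      by (intro nn_integral_cong) (simp add: ennreal_power power_mult_distrib sq)
    also have "\<dots> = (\<integral>\<^sup>+v. ennreal (trig_sq n x c v * ?u v powr (- s)) \<partial>lborel)"
      by (rule nn_integral_lborel_translation) measurable
    also have "(\<integral>\<^sup>+v. ?f v ^ 2 \<partial>lborel) \<le> (\<integral>\<^sup>+v. ennreal (2 powr s * ?u w powr s) * ennreal ((Psi v)\<^sup>2 * ?u v powr s) \<partial>lborel)"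
    proof (intro nn_integral_mono)
      fix v
      have "?u (w + v) powr s \<le> (2 * ?u w * ?u v) powr s"
        by (intro powr_mono2 s one_plus_norm2_add_le) (simp add: add_nonneg_nonneg)
      also have "\<dots> = 2 powr s * ?u w powr s * ?u v powr s"
        by (rule pm[OF u0 u0])
      finally have "(Psi v)\<^sup>2 * ?u (w + v) powr s \<le> (Psi v)\<^sup>2 * (2 powr s * ?u w powr s * ?u v powr s)"
        by (intro mult_left_mono) auto
      then have "ennreal ((Psi v)\<^sup>2 * ?u (w + v) powr s) \<le> ennreal ((2 powr s * ?u w powr s) * ((Psi v)\<^sup>2 * ?u v powr s))"
        by (intro ennreal_leI) (simp add: algebra_simps)
      also have "\<dots> = ennreal (2 powr s * ?u w powr s) * ennreal ((Psi v)\<^sup>2 * ?u v powr s)"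
        by (rule ennreal_mult) auto
      finally show "?f v ^ 2 \<le> ennreal (2 powr s * ?u w powr s) * ennreal ((Psi v)\<^sup>2 * ?u v powr s)"
        by (simp add: ennreal_power power_mult_distrib sq)
    qed
    also have "\<dots> = ennreal (2 powr s * ?u w powr s) * (\<integral>\<^sup>+v. ennreal ((Psi v)\<^sup>2 * ?u v powr s) \<partial>lborel)"
      by (rule nn_integral_cmult) measurable
    also have "\<dots> \<le> ennreal (2 powr s * ?u w powr s) * ennreal K"
      by (intro mult_left_mono PsiK) auto
    also have "\<dots> = ennreal (2 powr s * K * ?u w powr s)"
      using K0 by (subst ennreal_mult[symmetric]) (auto simp: mult_ac)
    also have "\<dots> \<le> ennreal (C * ?u w powr s)"
      by (intro ennreal_leI mult_right_mono) (auto simp: C_def)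
    finally show ?thesis by (simp add: mult_right_mono ennreal_power)
  qed
  with C0 show ?thesis using that by blast
qed

section \<open>Positivity and monotonicity of the Matern form\<close>

definition scaled_form :: "real \<Rightarrow> real \<Rightarrow> nat \<Rightarrow> (nat \<Rightarrow> 'a::real_normed_vector) \<Rightarrow> (nat \<Rightarrow> real) \<Rightarrow> real" where
  "scaled_form nu al n x c = al powr (- 2 * nu) * matern_form nu al n x c"

definition fourier_const :: "real \<Rightarrow> nat \<Rightarrow> real" where
  "fourier_const nu d = Gamma (nu + real d / 2) / (Gamma nu * sqrt pi ^ d)"

lemma fourier_const_pos: "0 < nu \<Longrightarrow> 0 < fourier_const nu d"
  by (auto simp: fourier_const_def add_pos_nonneg intro!: divide_pos_pos mult_pos_pos Gamma_real_pos)

lemma scaled_form_fourier: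
  fixes x :: "nat \<Rightarrow> 'a::euclidean_space"
  assumes "0 < nu" "0 < al"
  shows "ennreal (scaled_form nu al n x c) = ennreal (fourier_const nu DIM('a)) *
     (\<integral>\<^sup>+w. ennreal (trig_sq n x c w * riesz (nu + real DIM('a) / 2) al w) \<partial>lborel)"
  using matern_form_fourier[OF assms] by (simp add: scaled_form_def fourier_const_def)

lemma matern_form_nonneg:
  fixes x :: "nat \<Rightarrow> 'a::euclidean_space"
  assumes "0 < nu" "0 < al"
  shows "0 \<le> matern_form nu al n x c"
proof -
  have nn: "0 \<le> indicat_real {0<..} t * (t powr (nu - 1) * exp (- al\<^sup>2 * t)) *
      heat_form n x c t" for t
  proof (cases "0 < t")
    case True
    then show ?thesis by (intro mult_nonneg_nonneg heat_form_nonneg) auto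
  qed simp
  show ?thesis
    unfolding matern_form_eq_mixture(2)[OF assms] using Gamma_real_pos[OF assms(1)]
    by (intro mult_nonneg_nonneg[OF divide_nonneg_pos Bochner_Integration.integral_nonneg] nn) auto
qed

lemma scaled_form_nonneg:
  fixes x :: "nat \<Rightarrow> 'a::euclidean_space"
  assumes "0 < nu" "0 < al"
  shows "0 \<le> scaled_form nu al n x c"
  unfolding scaled_form_def by (intro mult_nonneg_nonneg matern_form_nonneg assms) auto

text \<open>Off the diagonal the Gaussian factor vanishes in the limit, because the points are
  distinct.\<close>

lemma heat_form_tendsto:
  fixes x :: "nat \<Rightarrow> 'a::euclidean_space"
  assumes "inj_on x {..<n}"
  shows "((\<lambda>t. heat_form n x c t) \<longlongrightarrow> (\<Sum>i<n. (c i)\<^sup>2)) (at_right 0)"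
proof -
  have "((\<lambda>t. exp (- (norm (x i - x j))\<^sup>2 / (4 * t))) \<longlongrightarrow> (if i = j then 1 else 0)) (at_right 0)" if "i < n" "j < n" for i j
  proof (cases "i = j")
    case False
    then have "0 < (norm (x i - x j))\<^sup>2 / 4" using assms that by (auto simp: inj_on_def)
    moreover have "filterlim (\<lambda>t::real. inverse t) at_top (at_right 0)"
      by (rule filterlim_inverse_at_top_right)
    ultimately have "filterlim (\<lambda>t. (norm (x i - x j))\<^sup>2 / 4 * inverse t) at_top (at_right 0)"
      by (intro filterlim_tendsto_pos_mult_at_top[OF tendsto_const])
    then have "((\<lambda>t. exp (- ((norm (x i - x j))\<^sup>2 / 4 * inverse t))) \<longlongrightarrow> 0) (at_right 0)"
      by (intro filterlim_compose[OF exp_at_bot]) (simp add: filterlim_uminus_at_bot)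
    then show ?thesis using False by (simp add: field_simps)
  qed simp
  then have "((\<lambda>t. heat_form n x c t) \<longlongrightarrow> (\<Sum>i<n. \<Sum>j<n. c i * c j * (if i = j then 1 else 0))) (at_right 0)"
    by (intro tendsto_sum tendsto_mult tendsto_const) auto
  then show ?thesis by (simp add: power2_eq_square if_distrib cong: if_cong)
qed

text \<open>A vanishing form forces \<open>trig_sum\<close> to vanish almost everywhere, and with it
  all heat forms. But their limit at time 0 is the sum of the squared coefficients.\<close>

lemma matern_form_pos:
  fixes x :: "nat \<Rightarrow> 'a::euclidean_space"
  assumes "0 < nu" "0 < al" "inj_on x {..<n}" "i < n" "c i \<noteq> 0"
  shows "0 < matern_form nu al n x c"
proof (rule ccontr)
  let ?G = "\<lambda>w. trig_sq n x c w"
  let ?s = "nu + real DIM('a) / 2"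
  assume "\<not> 0 < matern_form nu al n x c"
  then have "matern_form nu al n x c = 0" using matern_form_nonneg[OF assms(1,2), of n x c] by linarith
  then have "ennreal (fourier_const nu DIM('a)) * (\<integral>\<^sup>+w. ennreal (?G w * riesz ?s al w) \<partial>lborel) = 0"
    using scaled_form_fourier[OF assms(1,2), of n x c] by (simp add: scaled_form_def)
  then have "(\<integral>\<^sup>+w. ennreal (?G w * riesz ?s al w) \<partial>lborel) = 0"
    using fourier_const_pos[OF assms(1), of "DIM('a)"] by (simp add: ennreal_eq_0_iff)
  then have "AE w in lborel. ennreal (?G w * riesz ?s al w) = 0"
    by (subst (asm) nn_integral_0_iff_AE) auto
  then have ae: "AE w in lborel. ?G w = 0"
  proof eventually_elim
    case (elim w)
    have "0 < al\<^sup>2 + (norm w)\<^sup>2" using assms by (simp add: add_pos_nonneg)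
    then have "0 < riesz ?s al w" using assms(2) by simp
    then show ?case using elim by (auto simp: ennreal_eq_0_iff mult_le_0_iff)
  qed
  have "heat_form n x c t = 0" if "0 < t" for t
  proof -
    have "(LINT w|lborel. ?G w * exp (- t * (norm w)\<^sup>2)) = (LINT w|(lborel::'a measure). 0)"
      using ae by (intro integral_cong_AE) (auto elim: eventually_mono)
    then show ?thesis using integral_trig_sum_gauss[OF that, of n x c] that by simp
  qed
  then have "eventually (\<lambda>t. heat_form n x c t = 0) (at_right 0)"
    by (auto simp: eventually_at_right_field intro: exI[of _ 1])
  then have "((\<lambda>t. heat_form n x c t) \<longlongrightarrow> 0) (at_right 0)"
    by (rule tendsto_eventually)
  then have "(\<Sum>i<n. (c i)\<^sup>2) = 0"
    using heat_form_tendsto[OF assms(3), of c] by (intro tendsto_unique[OF trivial_limit_at_right_real])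
  then show False using assms(4,5) by (simp add: sum_nonneg_eq_0_iff)
qed

lemma scaled_form_antimono:
  fixes x :: "nat \<Rightarrow> 'a::euclidean_space"
  assumes "0 < nu" "0 < a" "a \<le> b"
  shows "scaled_form nu b n x c \<le> scaled_form nu a n x c"
proof -
  let ?s = "nu + real DIM('a) / 2"
  have b: "0 < b" using assms by simp
  have "riesz ?s b w \<le> riesz ?s a w" for w :: 'a
    using assms by (intro powr_mono2') (auto simp: add_pos_nonneg power_mono)
  then have "ennreal (scaled_form nu b n x c) \<le> ennreal (scaled_form nu a n x c)"
    unfolding scaled_form_fourier[OF assms(1) b] scaled_form_fourier[OF assms(1,2)]
    by (intro mult_left_mono nn_integral_mono ennreal_leI) auto
  then show ?thesis using scaled_form_nonneg[OF assms(1,2), of n x c] by simp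
qed

text \<open>The counterpart of \<open>scaled_form_antimono\<close>: multiplied by
  \<open>al powr (2 * s)\<close>, the spectral weight is
  \<open>(1 + |w|^2 / al^2) powr (- s)\<close>, which increases in \<open>al\<close>. The two
  together bound the change of the correlation matrix from both sides.\<close>

lemma matern_form_mono:
  fixes x :: "nat \<Rightarrow> 'a::euclidean_space"
  assumes "0 < nu" "0 < a" "a \<le> b"
  shows "a powr DIM('a) * matern_form nu a n x c \<le> b powr DIM('a) * matern_form nu b n x c"
proof -
  let ?s = "nu + real DIM('a) / 2"
  have b: "0 < b" using assms by simp
  have e: "e powr DIM('a) * matern_form nu e n x c = e powr (2 * ?s) * scaled_form nu e n x c" if "0 < e" for e
  proof -
    have "e powr (2 * ?s) * e powr (- 2 * nu) = e powr DIM('a)" by (simp add: powr_add[symmetric])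
    then show ?thesis unfolding scaled_form_def by (simp only: mult.assoc[symmetric])
  qed
  have w: "e powr (2 * ?s) * riesz ?s e w = (1 + (norm w)\<^sup>2 / e\<^sup>2) powr (- ?s)" if "0 < e" for e and w :: 'a
  proof -
    have "e\<^sup>2 + (norm w)\<^sup>2 = e\<^sup>2 * (1 + (norm w)\<^sup>2 / e\<^sup>2)" using that by (simp add: field_simps)
    then have "riesz ?s e w = (e\<^sup>2) powr (- ?s) * (1 + (norm w)\<^sup>2 / e\<^sup>2) powr (- ?s)"
      by (simp only: powr_mult)
    also have "(e\<^sup>2) powr (- ?s) = e powr (- 2 * ?s)" using power2_powr[OF that, of "- ?s"] by simp
    finally have "e powr (2 * ?s) * riesz ?s e w = (e powr (2 * ?s) * e powr (- 2 * ?s)) * (1 + (norm w)\<^sup>2 / e\<^sup>2) powr (- ?s)"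
      by (simp only: mult.assoc)
    also have "e powr (2 * ?s) * e powr (- 2 * ?s) = 1" using that by (simp add: powr_add[symmetric])
    finally show ?thesis by simp
  qed
  have f: "ennreal (e powr (2 * ?s) * scaled_form nu e n x c) = ennreal (fourier_const nu DIM('a)) *
     (\<integral>\<^sup>+w. ennreal (trig_sq n x c w * (1 + (norm w)\<^sup>2 / e\<^sup>2) powr (- ?s)) \<partial>lborel)" if e0: "0 < e" for e
  proof -
    have "ennreal (e powr (2 * ?s) * scaled_form nu e n x c) = ennreal (fourier_const nu DIM('a)) * (ennreal (e powr (2 * ?s)) *
      (\<integral>\<^sup>+w. ennreal (trig_sq n x c w * riesz ?s e w) \<partial>lborel))"
      by (simp add: ennreal_mult' scaled_form_fourier[OF assms(1) e0] mult.left_commute)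
    also have "ennreal (e powr (2 * ?s)) *
      (\<integral>\<^sup>+w. ennreal (trig_sq n x c w * riesz ?s e w) \<partial>lborel) =
      (\<integral>\<^sup>+w. ennreal (e powr (2 * ?s)) * ennreal (trig_sq n x c w * riesz ?s e w) \<partial>lborel)"
      by (rule nn_integral_cmult[symmetric]) measurable
    also have "\<dots> = (\<integral>\<^sup>+w. ennreal (trig_sq n x c w * (1 + (norm w)\<^sup>2 / e\<^sup>2) powr (- ?s)) \<partial>lborel)"
    proof (intro nn_integral_cong)
      fix v :: 'a
      have "e powr (2 * ?s) * (trig_sq n x c v * riesz ?s e v) = trig_sq n x c v * (1 + (norm v)\<^sup>2 / e\<^sup>2) powr (- ?s)"
        unfolding w[OF e0, symmetric] by (rule mult.left_commute)
      then show "ennreal (e powr (2 * ?s)) * ennreal (trig_sq n x c v * riesz ?s e v) =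
         ennreal (trig_sq n x c v * (1 + (norm v)\<^sup>2 / e\<^sup>2) powr (- ?s))"
        by (simp only: ennreal_mult'[OF powr_ge_zero, symmetric])
    qed
    finally show ?thesis .
  qed
  have "(1 + (norm w)\<^sup>2 / a\<^sup>2) powr (- ?s) \<le> (1 + (norm w)\<^sup>2 / b\<^sup>2) powr (- ?s)" for w :: 'a
    using assms b by (intro powr_mono2') (auto simp: add_pos_nonneg power_mono intro!: divide_left_mono)
  then have "ennreal (a powr (2 * ?s) * scaled_form nu a n x c) \<le> ennreal (b powr (2 * ?s) * scaled_form nu b n x c)"
    unfolding f[OF assms(2)] f[OF b]
    by (intro mult_left_mono nn_integral_mono ennreal_leI) auto
  then show ?thesis unfolding e[OF assms(2)] e[OF b]
    using scaled_form_nonneg[OF assms(1) b, of n x c] by (simp add: ennreal_le_iff)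
qed

section \<open>Trace comparison of two Matern forms\<close>

lemma powr_minus_diff_le:
  fixes s u v :: real
  assumes "0 < s" "0 < u" "u \<le> v"
  shows "u powr (- s) \<le> v powr (- s) + s * (v - u) * u powr (- s - 1)"
proof -
  have v: "0 < v" using assms by simp
  \<comment> \<open>The tangent at \<open>u\<close> of the convex function
    \<open>v powr (- s)\<close>, obtained from \<open>ln z \<le> z - 1\<close> and
    \<open>exp z \<ge> 1 + z\<close>.\<close>
  have "1 - s * (v / u - 1) \<le> 1 - s * ln (v / u)"
    using ln_le_minus_one[of "v / u"] assms v by (simp add: mult_left_mono)
  also have "\<dots> \<le> exp (- s * ln (v / u))"
    using exp_ge_add_one_self[of "- s * ln (v / u)"] by simp
  also have "\<dots> = (v / u) powr (- s)"
    using assms v by (simp add: powr_def)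
  finally have "u powr (- s) * (1 - s * (v / u - 1)) \<le> u powr (- s) * (v / u) powr (- s)"
    by (intro mult_left_mono) auto
  also have "\<dots> = v powr (- s)"
    using assms v by (simp add: powr_mult[symmetric])
  also have "u powr (- s) * (1 - s * (v / u - 1)) = u powr (- s) - s * (v - u) * (u powr (- s) / u)"
    using assms by (simp add: field_simps)
  also have "u powr (- s) / u = u powr (- s - 1)"
    using assms by (simp add: powr_diff)
  finally show ?thesis by simp
qed

text \<open>In dimension at most 3 the weight is bounded by the product of
  \<open>(1 + t^2) powr (- 1 / 3)\<close> over the coordinates \<open>t\<close> of \<open>w\<close>,
  so the integral splits into at most three factors of size \<open>6 * W powr (1 / 3)\<close>; with
  fewer coordinates \<open>1 \<le> W\<close> fills up. Growth that is only linear in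
  \<open>W\<close> is what the bound on the dimension buys.\<close>

lemma nn_integral_cube_weight_le:
  fixes W :: real
  assumes "1 \<le> W" "DIM('a::euclidean_space) \<le> 3"
  shows "(\<integral>\<^sup>+w. ennreal (indicat_real {w. \<forall>b\<in>Basis. \<bar>inner w b\<bar> \<le> W} w * (1 / (1 + (norm w)\<^sup>2))) \<partial>(lborel :: 'a measure)) \<le> ennreal (216 * W)"
proof -
  \<comment> \<open>A primitive in closed form: its derivative \<open>f\<close> is at least a third
    of \<open>(1 + t^2) powr (- 1 / 3)\<close>, the function to be integrated, and
    \<open>F W\<close> grows like \<open>W powr (1 / 3)\<close>.\<close>
  define F where "F = (\<lambda>t::real. t * (1 + t\<^sup>2) powr (- 1 / 3))"
  define f where "f = (\<lambda>t::real. (1 + t\<^sup>2) powr (- 4 / 3) * (1 + t\<^sup>2 / 3))"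
  have p: "0 < 1 + t\<^sup>2" for t :: real by (simp add: add_pos_nonneg)
  have split: "(1 + t\<^sup>2) powr (- 1 / 3) = (1 + t\<^sup>2) * (1 + t\<^sup>2) powr (- 4 / 3)" for t :: real
    using p[of t] powr_mult_base[of "1 + t\<^sup>2" "- 4 / 3"] by simp
  have dF: "(F has_real_derivative f t) (at t)" for t
  proof -
    have "(F has_real_derivative (1 + t\<^sup>2) powr (- 1 / 3) + t * ((- 1 / 3) * (1 + t\<^sup>2) powr (- 1 / 3 - 1) * (2 * t))) (at t)"
      unfolding F_def using p[of t] by (auto intro!: derivative_eq_intros)
    also have "(- 1 / 3 - 1) = (- 4 / 3 :: real)" by simp
    also have "(1 + t\<^sup>2) powr (- 1 / 3) + t * ((- 1 / 3) * (1 + t\<^sup>2) powr (- 4 / 3) * (2 * t)) = f t"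
      unfolding split f_def by (simp add: field_simps power2_eq_square)
    finally show ?thesis .
  qed
  have f0: "0 \<le> f t" for t unfolding f_def using p[of t] by (auto intro!: mult_nonneg_nonneg add_nonneg_nonneg)
  have fm: "f \<in> borel_measurable borel" unfolding f_def by measurable
  let ?q = "\<lambda>t. indicat_real {-W..W} t * (1 + t\<^sup>2) powr (- 1 / 3)"
  have qf: "?q t \<le> 3 * (f t * indicat_real {-W..W} t)" for t
  proof -
    have "(1 + t\<^sup>2) powr (- 1 / 3) \<le> 3 * f t"
      unfolding split f_def using p[of t] by (simp add: algebra_simps)
    then show ?thesis by (auto simp: indicator_def)
  qed
  have FW: "F W - F (- W) \<le> 2 * W powr (1 / 3)"
  proof -
    have W: "0 < W" using assms by simp
    have "(1 + W\<^sup>2) powr (- 1 / 3) \<le> (W\<^sup>2) powr (- 1 / 3)"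
      by (rule powr_mono2') (use W in simp_all)
    also have "\<dots> = W powr (- 2 / 3)"
      using power2_powr[OF W, of "- 1 / 3"] by simp
    finally have "W * (1 + W\<^sup>2) powr (- 1 / 3) \<le> W * W powr (- 2 / 3)"
      using assms by (intro mult_left_mono) auto
    also have "\<dots> = W powr (1 / 3)" using assms by (simp add: powr_mult_base)
    finally show ?thesis by (simp add: F_def)
  qed
  have J: "(\<integral>\<^sup>+t. ennreal (?q t) \<partial>lborel) \<le> ennreal (6 * W powr (1 / 3))"
  proof -
    have "(\<integral>\<^sup>+t. ennreal (?q t) \<partial>lborel) \<le> (\<integral>\<^sup>+t. ennreal 3 * (ennreal (f t) * indicator {-W..W} t) \<partial>lborel)"
    proof (intro nn_integral_mono)
      fix t
      have "ennreal (?q t) \<le> ennreal (3 * (f t * indicat_real {-W..W} t))" by (intro ennreal_leI qf)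
      also have "\<dots> = ennreal 3 * (ennreal (f t) * indicator {-W..W} t)"
        using f0[of t] by (auto simp: indicator_def ennreal_mult)
      finally show "ennreal (?q t) \<le> ennreal 3 * (ennreal (f t) * indicator {-W..W} t)" .
    qed
    also have "\<dots> = ennreal 3 * (\<integral>\<^sup>+t. ennreal (f t) * indicator {-W..W} t \<partial>lborel)"
      using fm by (intro nn_integral_cmult) auto
    also have "(\<integral>\<^sup>+t. ennreal (f t) * indicator {-W..W} t \<partial>lborel) = ennreal (F W - F (- W))"
      using assms by (intro nn_integral_FTC_Icc fm)
        (auto intro: f0 dF[THEN has_field_derivative_at_within])
    also have "ennreal 3 * ennreal (F W - F (- W)) \<le> ennreal 3 * ennreal (2 * W powr (1 / 3))"
      by (intro mult_left_mono ennreal_leI FW) auto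
    also have "\<dots> = ennreal (6 * W powr (1 / 3))" by (subst ennreal_mult[symmetric]) auto
    finally show ?thesis .
  qed
  have "ennreal (indicat_real {w. \<forall>b\<in>Basis. \<bar>inner w b\<bar> \<le> W} w * (1 / (1 + (norm w)\<^sup>2))) \<le> (\<Prod>b\<in>Basis. ennreal (?q (inner w b)))" for w :: 'a
  proof (cases "\<forall>b\<in>Basis. \<bar>inner w b\<bar> \<le> W")
    case True
    let ?u = "1 + (norm w)\<^sup>2"
    have u: "1 \<le> ?u" by simp
    have "?u powr (- 1) \<le> ?u powr (- (real DIM('a) / 3))"
      using u assms by (intro powr_mono) auto
    also have "\<dots> = (?u powr (- 1 / 3)) powr real DIM('a)"
      by (simp add: powr_powr)
    also have "\<dots> = (?u powr (- 1 / 3)) ^ DIM('a)"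
    proof (intro powr_realpow)
      have "?u \<noteq> 0" using u by linarith
      then show "0 < ?u powr (- 1 / 3)" by simp
    qed
    also have "\<dots> = (\<Prod>b\<in>(Basis::'a set). ?u powr (- 1 / 3))" by simp
    also have "\<dots> \<le> (\<Prod>b\<in>(Basis::'a set). (1 + (inner w b)\<^sup>2) powr (- 1 / 3))"
    proof (intro prod_mono conjI powr_mono2')
      fix b :: 'a assume b: "b \<in> Basis"
      show "1 + (inner w b)\<^sup>2 \<le> 1 + (norm w)\<^sup>2"
        using power_mono[OF Basis_le_norm[OF b, of w], of 2] by simp
    qed (auto simp: p)
    also have "\<dots> = (\<Prod>b\<in>(Basis::'a set). ?q (inner w b))"
      using True by (intro prod.cong refl) (auto simp: indicator_def abs_le_iff)
    finally have le: "?u powr (- 1) \<le> (\<Prod>b\<in>(Basis::'a set). ?q (inner w b))" .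
    have "1 / ?u = ?u powr (- 1)" using u by (simp only: powr_minus_divide powr_one)
    then have "ennreal (indicat_real {w. \<forall>b\<in>Basis. \<bar>inner w b\<bar> \<le> W} w * (1 / ?u)) \<le> ennreal (\<Prod>b\<in>(Basis::'a set). ?q (inner w b))"
      using True le by (intro ennreal_leI) (simp only: indicator_simps mem_Collect_eq mult_1_left)
    also have "\<dots> = (\<Prod>b\<in>Basis. ennreal (?q (inner w b)))"
      by (rule prod_ennreal[symmetric]) simp
    finally show ?thesis .
  qed simp
  then have "(\<integral>\<^sup>+w. ennreal (indicat_real {w. \<forall>b\<in>Basis. \<bar>inner w b\<bar> \<le> W} w * (1 / (1 + (norm w)\<^sup>2))) \<partial>(lborel :: 'a measure))
     \<le> (\<integral>\<^sup>+w. (\<Prod>b\<in>Basis. ennreal (?q (inner w b))) \<partial>(lborel :: 'a measure))"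
    by (intro nn_integral_mono) blast
  also have "\<dots> = (\<Prod>b\<in>(Basis::'a set). (\<integral>\<^sup>+t. ennreal (?q t) \<partial>lborel))"
    by (rule nn_integral_lborel_prod) auto
  also have "\<dots> = (\<integral>\<^sup>+t. ennreal (?q t) \<partial>lborel) ^ DIM('a)" by simp
  also have "\<dots> \<le> ennreal (6 * W powr (1 / 3)) ^ DIM('a)"
    using J by (intro power_mono) auto
  also have "\<dots> = ennreal ((6 * W powr (1 / 3)) ^ DIM('a))" by (simp add: ennreal_power)
  also have "\<dots> \<le> ennreal (216 * W)"
  proof (intro ennreal_leI)
    have "1 \<le> W powr (1 / 3)" using assms by (intro ge_one_powr_ge_zero) auto
    then have "(6 * W powr (1 / 3)) ^ DIM('a) \<le> (6 * W powr (1 / 3)) ^ 3"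
      using assms by (intro power_increasing) auto
    also have "\<dots> = 216 * W"
    proof -
      have "(W powr (1 / 3)) ^ 3 = (W powr (1 / 3)) powr real 3"
        using assms by (intro powr_realpow[symmetric]) simp
      also have "\<dots> = W" using assms by (simp add: powr_powr)
      finally show ?thesis by (simp add: power_mult_distrib)
    qed
    finally show "(6 * W powr (1 / 3)) ^ DIM('a) \<le> 216 * W" .
  qed
  finally show ?thesis .
qed

lemma trig_sum_linear:
  "trig_sum n x (\<lambda>i. \<Sum>k<m. l k * u k i) w = (\<Sum>k<m. of_real (l k) * trig_sum n x (u k) w)"
proof -
  have "trig_sum n x (\<lambda>i. \<Sum>k<m. l k * u k i) w = (\<Sum>j<n. \<Sum>k<m. of_real (l k) * (of_real (u k j) * cis (inner w (x j))))"
    by (simp add: trig_sum_def sum_distrib_right mult.assoc)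
  also have "\<dots> = (\<Sum>k<m. \<Sum>j<n. of_real (l k) * (of_real (u k j) * cis (inner w (x j))))"
    by (rule sum.swap)
  finally show ?thesis by (simp add: trig_sum_def sum_distrib_left)
qed

lemma sum_squares_le_of_bound:
  fixes r :: "nat \<Rightarrow> real"
  assumes "(\<Sum>k<m. (r k)\<^sup>2)\<^sup>2 \<le> B * (\<Sum>k<m. (r k)\<^sup>2)" "0 \<le> B"
  shows "(\<Sum>k<m. (r k)\<^sup>2) \<le> B"
proof (cases "(\<Sum>k<m. (r k)\<^sup>2) = 0")
  case False
  then have "0 < (\<Sum>k<m. (r k)\<^sup>2)" by (simp add: sum_nonneg less_le)
  with assms(1) show ?thesis by (simp add: power2_eq_square)
qed (use assms in simp)

text \<open>The sum is the diagonal of a reproducing kernel. The bound for a single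
  \<open>c\<close>, applied to the combination whose coefficients are the real parts of the values
  \<open>?t k\<close>, controls the sum of the squared real parts; the imaginary parts are treated
  likewise. Coefficients are real, hence the two rounds and the factor 2.\<close>

lemma orthonormal_trig_sum_bound:
  fixes x :: "nat \<Rightarrow> 'a::euclidean_space" and q :: "(nat \<Rightarrow> real) \<Rightarrow> real" and u :: "nat \<Rightarrow> nat \<Rightarrow> real"
  assumes bound: "\<And>c. trig_sq n x c w \<le> B * q c" and B: "0 \<le> B"
    and orth: "\<And>l. q (\<lambda>i. \<Sum>k<m. l k * u k i) = (\<Sum>k<m. (l k)\<^sup>2)"
  shows "(\<Sum>k<m. trig_sq n x (u k) w) \<le> 2 * B"
proof -
  let ?t = "\<lambda>k. trig_sum n x (u k) w"
  have gen: "(\<Sum>k<m. (g k)\<^sup>2) \<le> B" if g: "(\<Sum>k<m. (g k)\<^sup>2)\<^sup>2 \<le> (cmod (\<Sum>k<m. of_real (g k) * ?t k))\<^sup>2" for g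
  proof (rule sum_squares_le_of_bound[OF _ B])
    have "(cmod (\<Sum>k<m. of_real (g k) * ?t k))\<^sup>2 \<le> B * (\<Sum>k<m. (g k)\<^sup>2)"
      unfolding trig_sum_linear[symmetric] using bound[of "\<lambda>i. \<Sum>k<m. g k * u k i"] by (simp add: orth)
    with g show "(\<Sum>k<m. (g k)\<^sup>2)\<^sup>2 \<le> B * (\<Sum>k<m. (g k)\<^sup>2)" by simp
  qed
  have c: "x = Re z \<or> x = Im z \<Longrightarrow> x\<^sup>2 \<le> (cmod z)\<^sup>2" for x z by (auto simp: cmod_power2)
  have "(\<Sum>k<m. (Re (?t k))\<^sup>2) \<le> B" "(\<Sum>k<m. (Im (?t k))\<^sup>2) \<le> B"
    by (intro gen c disjI1, simp add: power2_eq_square) (intro gen c disjI2, simp add: power2_eq_square)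
  then show ?thesis by (simp add: cmod_power2 sum.distrib)
qed

lemma scaled_weight_le:
  fixes s b r :: real
  assumes "0 \<le> s" "1 \<le> b" "0 \<le> r"
  shows "(1 + r) powr (- s) \<le> b powr (2 * s) * (b\<^sup>2 + r) powr (- s)"
proof -
  have b: "0 < b" "1 \<le> b\<^sup>2" using assms by (auto simp: one_le_power)
  have "b\<^sup>2 + r \<le> b\<^sup>2 * (1 + r)"
    using mult_right_mono[OF b(2), of r] assms by (simp add: algebra_simps)
  then have "(b\<^sup>2 * (1 + r)) powr (- s) \<le> (b\<^sup>2 + r) powr (- s)"
    using assms b by (intro powr_mono2') (auto intro: add_pos_nonneg)
  then have "b powr (2 * s) * (b\<^sup>2 * (1 + r)) powr (- s) \<le> b powr (2 * s) * (b\<^sup>2 + r) powr (- s)"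
    by (intro mult_left_mono) auto
  also have "b powr (2 * s) * (b\<^sup>2 * (1 + r)) powr (- s) = (b powr (2 * s) * b powr (- (2 * s))) * (1 + r) powr (- s)"
    using power2_powr[OF b(1), of "- s"] by (simp add: powr_mult)
  also have "b powr (2 * s) * b powr (- (2 * s)) = 1"
    using b by (simp add: powr_add[symmetric])
  finally show ?thesis by simp
qed

text \<open>The tangent bound gains one power of \<open>1 / (1 + r)\<close>: in this sense the two
  weights agree at high frequency. The price is \<open>b^2\<close> and a negative power of
  \<open>a\<close>.\<close>

lemma low_weight_le:
  fixes s a b r :: real
  assumes "0 < s" "0 < a" "a \<le> 1" "1 \<le> b" "0 \<le> r"
  shows "(a\<^sup>2 + r) powr (- s) \<le> (b\<^sup>2 + r) powr (- s) + s * (b\<^sup>2 * a powr (- (2 * s + 2))) * (1 + r) powr (- s - 1)"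
proof -
  have p: "0 < a\<^sup>2 + r" using assms by (simp add: add_pos_nonneg)
  have ab: "a\<^sup>2 \<le> b\<^sup>2" using assms by (intro power_mono) auto
  have a1: "a\<^sup>2 \<le> 1" using assms by (simp add: power_le_one)
  have "(a\<^sup>2 + r) powr (- s) \<le> (b\<^sup>2 + r) powr (- s) + s * ((b\<^sup>2 + r) - (a\<^sup>2 + r)) * (a\<^sup>2 + r) powr (- s - 1)"
    using assms p ab by (intro powr_minus_diff_le) auto
  also have "s * ((b\<^sup>2 + r) - (a\<^sup>2 + r)) * (a\<^sup>2 + r) powr (- s - 1) \<le> s * b\<^sup>2 * (a\<^sup>2 * (1 + r)) powr (- s - 1)"
  proof (intro mult_mono powr_mono2' mult_left_mono)
    show "a\<^sup>2 * (1 + r) \<le> a\<^sup>2 + r" using mult_right_mono[OF a1, of r] assms by (simp add: algebra_simps)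
    show "0 < a\<^sup>2 * (1 + r)" using assms by (simp add: add_pos_nonneg)
  qed (use assms in auto)
  also have "(a\<^sup>2 * (1 + r)) powr (- s - 1) = a powr (- (2 * s + 2)) * (1 + r) powr (- s - 1)"
    using power2_powr[OF assms(2), of "- s - 1"] by (simp add: powr_mult)
  finally show ?thesis by (simp only: mult.assoc add_left_mono)
qed

text \<open>The excess weight is cut at the cube of half-width \<open>W\<close>. Outside,
  \<open>1 / (1 + |w|^2)\<close> is at most \<open>1 / W^2\<close>, a relative error of the weight
  for \<open>b\<close>, which costs \<open>n * E / W^2\<close> when summed over the orthonormal
  basis. Inside, the summed squares are at most \<open>2 * B w\<close>, whose growth cancels the
  decay of order \<open>s\<close>; the remaining integral over the cube is of order
  \<open>W\<close>.\<close>

lemma scaled_form_sum_le: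
  fixes nu T :: real
  assumes nu: "0 < nu" and dim: "DIM('a::euclidean_space) \<le> 3"
  defines "s \<equiv> nu + real DIM('a) / 2"
  obtains C where "0 < C"
    "\<And>n (x :: nat \<Rightarrow> 'a) a b u. 1 \<le> n \<Longrightarrow> (\<And>j e. j < n \<Longrightarrow> e \<in> Basis \<Longrightarrow> \<bar>inner (x j) e\<bar> \<le> T) \<Longrightarrow>
       0 < a \<Longrightarrow> a \<le> 1 \<Longrightarrow> 1 \<le> b \<Longrightarrow>
       (\<And>l. scaled_form nu b n x (\<lambda>i. \<Sum>k<n. l k * u k i) = (\<Sum>k<n. (l k)\<^sup>2)) \<Longrightarrow>
       (\<Sum>k<n. scaled_form nu a n x (u k)) \<le> real n + C * (b / a) powr (2 * s + 2) * real n powr (1 / 3)"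
proof -
  have s: "0 < s" using nu by (simp add: s_def add_pos_nonneg)
  define K where "K = fourier_const nu DIM('a)"
  have K: "0 < K" unfolding K_def by (rule fourier_const_pos[OF nu])
  obtain C5 where C5: "0 < C5" and pb: "\<And>n (x :: nat \<Rightarrow> 'a) c w. (\<And>j b. j < n \<Longrightarrow> b \<in> Basis \<Longrightarrow> \<bar>inner (x j) b\<bar> \<le> T) \<Longrightarrow>
      ennreal (trig_sq n x c w) \<le> ennreal (C5 * (1 + (norm w)\<^sup>2) powr s) *
       (\<integral>\<^sup>+v. ennreal (trig_sq n x c v * (1 + (norm v)\<^sup>2) powr (- s)) \<partial>lborel)"
  proof (rule trig_sum_point_bound[where s=s and T=T and 'a='a, OF less_imp_le[OF s]], goal_cases)
    case (1 C)
    show ?case by (rule 1(1)[OF 1(2)], rule 1(3), blast)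
  qed
  \<comment> \<open>\<open>s\<close> comes from \<open>E\<close>, the 1 from the frequencies outside
    the cube, and \<open>432 = 2 * 216\<close> from those inside.\<close>
  define C where "C = s * (1 + 432 * C5)"
  have "(\<Sum>k<n. scaled_form nu a n x (u k)) \<le> real n + C * (b / a) powr (2 * s + 2) * real n powr (1 / 3)"
    if n: "1 \<le> n" and x: "\<And>j e. j < n \<Longrightarrow> e \<in> Basis \<Longrightarrow> \<bar>inner (x j) e\<bar> \<le> T"
      and a: "0 < a" "a \<le> 1" and b: "1 \<le> b"
      and orth: "\<And>l. scaled_form nu b n x (\<lambda>i. \<Sum>k<n. l k * u k i) = (\<Sum>k<n. (l k)\<^sup>2)"
    for n and x :: "nat \<Rightarrow> 'a" and a b u
  proof -
    have b0: "0 < b" using b by simp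
    let ?I = "\<lambda>e c. \<integral>\<^sup>+v. ennreal (trig_sq n x c v * riesz s e v) \<partial>lborel"
    have I: "?I e c = ennreal (scaled_form nu e n x c / K)" if "0 < e" for e c
    proof -
      have "ennreal (1 / K) * ennreal (scaled_form nu e n x c) = ennreal (1 / K) * (ennreal K * ?I e c)"
        unfolding scaled_form_fourier[OF nu that] K_def s_def ..
      also have "\<dots> = ennreal (1 / K * K) * ?I e c"
        using K by (simp only: mult.assoc[symmetric] ennreal_mult' divide_nonneg_pos zero_le_one)
      also have "\<dots> = ?I e c" using K by simp
      finally show ?thesis using K by (simp add: ennreal_mult'[symmetric])
    qed
    \<comment> \<open>The pointwise bound after converting its weight from inverse length scale 1 to
      \<open>b\<close>.\<close>
    define B where "B = (\<lambda>w::'a. C5 / K * b powr (2 * s) * (1 + (norm w)\<^sup>2) powr s)"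
    have B0: "0 \<le> B w" for w unfolding B_def using C5 K by simp
    have point: "trig_sq n x c w \<le> B w * scaled_form nu b n x c" for c w
    proof -
      have "ennreal (trig_sq n x c w) \<le> ennreal (C5 * (1 + (norm w)\<^sup>2) powr s) *
         (\<integral>\<^sup>+v. ennreal (trig_sq n x c v * (1 + (norm v)\<^sup>2) powr (- s)) \<partial>lborel)"
        by (rule pb[OF x])
      also have "(\<integral>\<^sup>+v. ennreal (trig_sq n x c v * (1 + (norm v)\<^sup>2) powr (- s)) \<partial>lborel)
         \<le> (\<integral>\<^sup>+v. ennreal (b powr (2 * s)) * ennreal (trig_sq n x c v * riesz s b v) \<partial>lborel)"
      proof (intro nn_integral_mono)
        fix v :: 'a
        have "trig_sq n x c v * (1 + (norm v)\<^sup>2) powr (- s) \<le> trig_sq n x c v * (b powr (2 * s) * riesz s b v)"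
          using s b by (intro mult_left_mono scaled_weight_le) auto
        also have "\<dots> = b powr (2 * s) * (trig_sq n x c v * riesz s b v)"
          by (rule mult.left_commute)
        finally show "ennreal (trig_sq n x c v * (1 + (norm v)\<^sup>2) powr (- s)) \<le> ennreal (b powr (2 * s)) * ennreal (trig_sq n x c v * riesz s b v)"
          by (simp only: ennreal_mult'[OF powr_ge_zero, symmetric] ennreal_leI)
      qed
      also have "\<dots> = ennreal (b powr (2 * s)) * ?I b c"
        by (rule nn_integral_cmult) measurable
      also have "\<dots> = ennreal (b powr (2 * s)) * ennreal (scaled_form nu b n x c / K)"
        unfolding I[OF b0] ..
      finally have "ennreal (trig_sq n x c w) \<le> ennreal (C5 * (1 + (norm w)\<^sup>2) powr s) * (ennreal (b powr (2 * s)) * ennreal (scaled_form nu b n x c / K))"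
        by (simp add: mult_left_mono)
      also have "\<dots> = ennreal (B w * scaled_form nu b n x c)"
        using C5 K by (subst ennreal_mult'[symmetric], simp, subst ennreal_mult'[symmetric]) (auto simp: B_def field_simps)
      finally show ?thesis
        using B0[of w] scaled_form_nonneg[OF nu b0, of n x c] by (simp add: ennreal_le_iff)
    qed
    have sum2B: "(\<Sum>k<n. trig_sq n x (u k) w) \<le> 2 * B w" for w
      by (rule orthonormal_trig_sum_bound[OF point B0 orth])
    \<comment> \<open>Balances \<open>n / W^2\<close> against \<open>W\<close>.\<close>
    define W where "W = real n powr (1 / 3)"
    have W: "1 \<le> W" using n by (auto simp: W_def intro!: ge_one_powr_ge_zero)
    define E where "E = s * (b / a) powr (2 * s + 2)"
    have E0: "0 \<le> E" using s by (simp add: E_def)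
    let ?A = "s * (b\<^sup>2 * a powr (- (2 * s + 2)))"
    have Eab: "?A * b powr (2 * s) = E"
    proof -
      have "b\<^sup>2 * b powr (2 * s) = b powr (2 * s + 2)" using b0 by (simp add: powr_add)
      moreover have "(b / a) powr (2 * s + 2) = b powr (2 * s + 2) * a powr (- (2 * s + 2))"
      proof -
        have "(b / a) powr (2 * s + 2) = b powr (2 * s + 2) / a powr (2 * s + 2)"
          using b0 a by (simp add: powr_divide)
        then show ?thesis by (simp only: powr_minus divide_inverse)
      qed
      ultimately show ?thesis by (simp add: E_def mult.assoc mult.left_commute mult.commute)
    qed
    define Q where "Q = {w::'a. \<forall>e\<in>Basis. \<bar>inner w e\<bar> \<le> W}"
    have Qm [measurable]: "Q \<in> sets borel"
    proof -
      have "Q = {w \<in> space borel. \<forall>e\<in>Basis. \<bar>inner w e\<bar> \<le> W}" by (simp add: Q_def)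
      also have "\<dots> \<in> sets borel" by measurable
      finally show ?thesis .
    qed
    define D where "D = (\<lambda>w::'a. ?A * (1 + (norm w)\<^sup>2) powr (- s - 1))"
    have D0: "0 \<le> D w" for w unfolding D_def using s by simp
    have u1: "(1 + (norm w)\<^sup>2) powr (- s - 1) = (1 + (norm w)\<^sup>2) powr (- s) * (1 / (1 + (norm w)\<^sup>2))" for w :: 'a
      by (simp add: powr_diff)
    let ?H = "\<lambda>w. indicat_real Q w * D w"
    \<comment> \<open>Inside the cube the excess is kept as \<open>?H\<close>; outside it is
      absorbed into a multiple of the weight for \<open>b\<close>.\<close>
    have weight: "riesz s a w \<le> (1 + E / W\<^sup>2) * riesz s b w + ?H w" for w
    proof (cases "w \<in> Q")
      case True
      have "0 \<le> E / W\<^sup>2 * riesz s b w" using E0 by simp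
      then show ?thesis using low_weight_le[OF s a b, of "(norm w)\<^sup>2"] True by (simp add: D_def algebra_simps)
    next
      case False
      then obtain e where e: "e \<in> Basis" "W < \<bar>inner w e\<bar>" by (auto simp: Q_def not_le)
      have "W \<le> norm w" using Basis_le_norm[OF e(1), of w] e(2) by simp
      then have "W\<^sup>2 \<le> (norm w)\<^sup>2" using W by (intro power_mono) auto
      then have "W\<^sup>2 \<le> 1 + (norm w)\<^sup>2" by linarith
      then have "1 / (1 + (norm w)\<^sup>2) \<le> 1 / W\<^sup>2" using W by (intro divide_left_mono) (auto intro!: mult_pos_pos add_pos_nonneg)
      then have "(1 + (norm w)\<^sup>2) powr (- s - 1) \<le> (b powr (2 * s) * riesz s b w) * (1 / W\<^sup>2)"
        unfolding u1 using s b by (intro mult_mono scaled_weight_le) auto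
      then have "D w \<le> ?A * ((b powr (2 * s) * riesz s b w) * (1 / W\<^sup>2))"
        unfolding D_def using s by (intro mult_left_mono) auto
      also have "\<dots> = (?A * b powr (2 * s)) / W\<^sup>2 * riesz s b w"
        by (simp only: divide_inverse mult.assoc mult_1_left mult.commute mult.left_commute)
      also have "\<dots> = E / W\<^sup>2 * riesz s b w" unfolding Eab ..
      finally show ?thesis using low_weight_le[OF s a b, of "(norm w)\<^sup>2"] False by (simp add: D_def algebra_simps)
    qed
    let ?F = "\<lambda>k. scaled_form nu a n x (u k)"
    let ?g = "\<lambda>k. trig_sq n x (u k)"
    let ?J = "\<lambda>k. \<integral>\<^sup>+w. ennreal (?H w * ?g k w) \<partial>lborel"
    have Sk: "ennreal (?F k / K) \<le> ennreal ((1 + E / W\<^sup>2) / K) + ?J k" if k: "k < n" for k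
    proof -
      \<comment> \<open>Orthonormality tested with a single coefficient equal to 1.\<close>
      have one: "scaled_form nu b n x (u k) = 1"
      proof -
        have "(\<lambda>i. \<Sum>j<n. (if j = k then 1 else 0) * u j i) = u k"
          using k by (auto simp: if_distrib[of "\<lambda>z. z * _"] cong: if_cong)
        moreover have "(\<Sum>j<n. (if j = k then 1 else 0 :: real)\<^sup>2) = 1"
          using k by (simp add: if_distrib[of "\<lambda>z. z\<^sup>2"] cong: if_cong)
        ultimately show ?thesis using orth[of "\<lambda>j. if j = k then 1 else 0"] by simp
      qed
      have "ennreal (?F k / K) = ?I a (u k)" using I[OF a(1)] by simp
      also have "\<dots> \<le> (\<integral>\<^sup>+w. ennreal (1 + E / W\<^sup>2) * ennreal (?g k w * riesz s b w) + ennreal (?H w * ?g k w) \<partial>lborel)"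
      proof (intro nn_integral_mono)
        fix w
        have "?g k w * riesz s a w \<le> ?g k w * ((1 + E / W\<^sup>2) * riesz s b w + ?H w)"
          by (intro mult_left_mono weight) auto
        also have "\<dots> = (1 + E / W\<^sup>2) * (?g k w * riesz s b w) + ?H w * ?g k w"
          by (simp add: algebra_simps)
        finally have "ennreal (?g k w * riesz s a w) \<le> ennreal (\<dots>)" by (rule ennreal_leI)
        also have "\<dots> = ennreal ((1 + E / W\<^sup>2) * (?g k w * riesz s b w)) + ennreal (?H w * ?g k w)"
          using E0 D0[of w] by (intro ennreal_plus) (auto intro!: mult_nonneg_nonneg add_nonneg_nonneg)
        also have "ennreal ((1 + E / W\<^sup>2) * (?g k w * riesz s b w)) = ennreal (1 + E / W\<^sup>2) * ennreal (?g k w * riesz s b w)"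
          using E0 by (intro ennreal_mult') (auto intro!: add_nonneg_nonneg)
        finally show "ennreal (?g k w * riesz s a w) \<le> ennreal (1 + E / W\<^sup>2) * ennreal (?g k w * riesz s b w) + ennreal (?H w * ?g k w)" .
      qed
      also have "\<dots> = (\<integral>\<^sup>+w. ennreal (1 + E / W\<^sup>2) * ennreal (?g k w * riesz s b w) \<partial>lborel) + ?J k"
        unfolding D_def by (rule nn_integral_add) measurable
      also have "(\<integral>\<^sup>+w. ennreal (1 + E / W\<^sup>2) * ennreal (?g k w * riesz s b w) \<partial>lborel) = ennreal (1 + E / W\<^sup>2) * ?I b (u k)"
        by (rule nn_integral_cmult) measurable
      also have "\<dots> = ennreal (1 + E / W\<^sup>2) * ennreal (1 / K)" unfolding I[OF b0] one ..
      also have "\<dots> = ennreal ((1 + E / W\<^sup>2) / K)"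
        using E0 by (subst ennreal_mult'[symmetric]) (auto intro!: add_nonneg_nonneg)
      finally show ?thesis .
    qed
    have JJ: "(\<Sum>k<n. ?J k) \<le> ennreal (2 * C5 / K * E * (216 * W))"
    proof -
      have "(\<Sum>k<n. ?J k) = (\<integral>\<^sup>+w. (\<Sum>k<n. ennreal (?H w * ?g k w)) \<partial>lborel)"
        unfolding D_def by (subst nn_integral_sum) auto
      also have "\<dots> \<le> (\<integral>\<^sup>+w. ennreal (2 * C5 / K * E) * ennreal (indicat_real Q w * (1 / (1 + (norm w)\<^sup>2))) \<partial>lborel)"
      proof (intro nn_integral_mono)
        fix w
        have "(\<Sum>k<n. ennreal (?H w * ?g k w)) = ennreal (?H w * (\<Sum>k<n. ?g k w))"
          unfolding sum_distrib_left by (rule sum_ennreal) (use D0[of w] in auto)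
        also have "\<dots> \<le> ennreal (?H w * (2 * B w))"
          by (intro ennreal_leI mult_left_mono sum2B) (use D0[of w] in auto)
        finally have le: "(\<Sum>k<n. ennreal (?H w * ?g k w)) \<le> ennreal (?H w * (2 * B w))" .
        \<comment> \<open>The powers of order \<open>s\<close> of \<open>1 + |w|^2\<close> in
          \<open>D\<close> and \<open>B\<close> cancel, and \<open>Eab\<close> collects the powers
          of \<open>a\<close> and \<open>b\<close>.\<close>
        have DB: "D w * (2 * B w) = 2 * C5 / K * E * (1 / (1 + (norm w)\<^sup>2))"
        proof -
          have "(1 + (norm w)\<^sup>2) powr (- s) * (1 + (norm w)\<^sup>2) powr s = 1"
            using add_pos_nonneg[of 1 "(norm w)\<^sup>2"] by (simp add: powr_add[symmetric])
          moreover have "d * (p * q) * (2 * (c * bb * pp)) = 2 * c * (d * bb) * q" if "p * pp = 1" for d p q c bb pp :: real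
          proof -
            have "d * (p * q) * (2 * (c * bb * pp)) = 2 * c * (d * bb) * q * (p * pp)" by (simp only: mult.assoc mult.commute mult.left_commute)
            then show ?thesis by (simp only: that mult_1_right)
          qed
          ultimately have "D w * (2 * B w) = 2 * (C5 / K) * (?A * b powr (2 * s)) * (1 / (1 + (norm w)\<^sup>2))"
            unfolding D_def B_def u1 by blast
          then show ?thesis unfolding Eab by simp
        qed
        have "?H w * (2 * B w) = 2 * C5 / K * E * (indicat_real Q w * (1 / (1 + (norm w)\<^sup>2)))"
          unfolding mult.assoc[of "indicat_real Q w"] DB by (rule mult.left_commute)
        then have "ennreal (?H w * (2 * B w)) = ennreal (2 * C5 / K * E) * ennreal (indicat_real Q w * (1 / (1 + (norm w)\<^sup>2)))"
          using C5 K E0 by (simp only:) (intro ennreal_mult', simp)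
        with le show "(\<Sum>k<n. ennreal (?H w * ?g k w)) \<le> ennreal (2 * C5 / K * E) * ennreal (indicat_real Q w * (1 / (1 + (norm w)\<^sup>2)))" by simp
      qed
      also have "\<dots> = ennreal (2 * C5 / K * E) * (\<integral>\<^sup>+w. ennreal (indicat_real Q w * (1 / (1 + (norm w)\<^sup>2))) \<partial>lborel)"
        by (rule nn_integral_cmult) measurable
      also have "\<dots> \<le> ennreal (2 * C5 / K * E) * ennreal (216 * W)"
        unfolding Q_def by (intro mult_left_mono nn_integral_cube_weight_le W dim) auto
      also have "\<dots> = ennreal (2 * C5 / K * E * (216 * W))"
        using C5 K E0 by (intro ennreal_mult'[symmetric]) simp
      finally show ?thesis .
    qed
    have "ennreal (\<Sum>k<n. ?F k / K) = (\<Sum>k<n. ennreal (?F k / K))"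
      by (rule sum_ennreal[symmetric]) (intro divide_nonneg_pos scaled_form_nonneg nu a K)
    also have "\<dots> \<le> (\<Sum>k<n. ennreal ((1 + E / W\<^sup>2) / K) + ?J k)"
      by (intro sum_mono Sk) auto
    also have "\<dots> = ennreal (real n * ((1 + E / W\<^sup>2) / K)) + (\<Sum>k<n. ?J k)"
    proof -
      have "(\<Sum>k<n. ennreal ((1 + E / W\<^sup>2) / K)) = ennreal (\<Sum>k<n. (1 + E / W\<^sup>2) / K)"
        using E0 K by (intro sum_ennreal) auto
      then show ?thesis unfolding sum.distrib by simp
    qed
    also have "\<dots> \<le> ennreal (real n * ((1 + E / W\<^sup>2) / K)) + ennreal (2 * C5 / K * E * (216 * W))"
      by (intro add_left_mono JJ)
    also have "\<dots> = ennreal (real n * ((1 + E / W\<^sup>2) / K) + 2 * C5 / K * E * (216 * W))"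
      using E0 K C5 W by (intro ennreal_plus[symmetric]) auto
    finally have "(\<Sum>k<n. ?F k / K) \<le> real n * ((1 + E / W\<^sup>2) / K) + 2 * C5 / K * E * (216 * W)"
      using E0 K C5 W by (subst (asm) ennreal_le_iff) auto
    then have "(\<Sum>k<n. ?F k) / K \<le> (real n * (1 + E / W\<^sup>2) + 432 * C5 * E * W) / K"
      by (simp add: sum_divide_distrib[symmetric] add_divide_distrib algebra_simps)
    then have "(\<Sum>k<n. ?F k) \<le> real n * (1 + E / W\<^sup>2) + 432 * C5 * E * W"
      using K by (simp add: divide_le_cancel)
    also have "real n * (1 + E / W\<^sup>2) = real n + E * (real n / W\<^sup>2)" by (simp add: algebra_simps)
    also have "real n / W\<^sup>2 = W"
    proof -
      have "W ^ 3 = (real n powr (1 / 3)) powr real 3"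
        unfolding W_def using n by (intro powr_realpow[symmetric]) simp
      also have "\<dots> = real n" using n by (simp add: powr_powr)
      finally have "real n = W * W\<^sup>2" by (simp add: power3_eq_cube power2_eq_square)
      then show ?thesis using W by simp
    qed
    finally have "(\<Sum>k<n. ?F k) \<le> real n + (1 + 432 * C5) * E * W" by (simp add: algebra_simps)
    also have "(1 + 432 * C5) * E * W = C * (b / a) powr (2 * s + 2) * real n powr (1 / 3)"
      unfolding C_def E_def W_def by (simp add: algebra_simps)
    finally show ?thesis .
  qed
  moreover have "0 < C" unfolding C_def using s C5 by simp
  ultimately show ?thesis using that by blast
qed

section \<open>Positive definite matrices and generalised least squares\<close>

abbreviation "mdet \<equiv> Determinant.det"
abbreviation "qf A x \<equiv> x \<bullet> (A *\<^sub>v x)"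

definition pd_mat :: "nat \<Rightarrow> real mat \<Rightarrow> bool" where
  "pd_mat n A \<longleftrightarrow> A \<in> carrier_mat n n \<and> A\<^sup>T = A \<and>
     (\<forall>v\<in>carrier_vec n. v \<noteq> 0\<^sub>v n \<longrightarrow> 0 < qf A v)"

lemma pd_matD:
  assumes "pd_mat n A"
  shows "A \<in> carrier_mat n n" "A\<^sup>T = A" "v \<in> carrier_vec n \<Longrightarrow> v \<noteq> 0\<^sub>v n \<Longrightarrow> 0 < qf A v"
  using assms by (auto simp: pd_mat_def)

lemma psd_matD:
  assumes "psd_mat n A"
  shows "A \<in> carrier_mat n n" "A\<^sup>T = A" "v \<in> carrier_vec n \<Longrightarrow> 0 \<le> qf A v"
  using assms by (auto simp: psd_mat_def)

lemma pd_mat_imp_psd: "pd_mat n A \<Longrightarrow> psd_mat n A"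
  unfolding pd_mat_def psd_mat_def
  by (metis (no_types, lifting) less_imp_le mult_mat_vec_carrier order_refl scalar_prod_left_zero)

lemma sym_mat_scalar_prod:
  fixes A :: "real mat"
  assumes "A \<in> carrier_mat n n" "A\<^sup>T = A" "u \<in> carrier_vec n" "v \<in> carrier_vec n"
  shows "u \<bullet> (A *\<^sub>v v) = v \<bullet> (A *\<^sub>v u)"
proof -
  have "u \<bullet> (A *\<^sub>v v) = (A *\<^sub>v u) \<bullet> v"
    using transpose_vec_mult_scalar[OF assms(1) assms(4,3)] assms(2) by simp
  also have "\<dots> = v \<bullet> (A *\<^sub>v u)" by (rule comm_scalar_prod[of _ n]) (use assms in auto)
  finally show ?thesis .
qed

lemma quad_add_smult:
  fixes A :: "real mat"
  assumes A: "A \<in> carrier_mat n n" "A\<^sup>T = A" and uv: "u \<in> carrier_vec n" "v \<in> carrier_vec n"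
  shows "qf A (u + t \<cdot>\<^sub>v v) = qf A u + 2 * t * (v \<bullet> (A *\<^sub>v u)) + t\<^sup>2 * (qf A v)"
proof -
  have Au: "A *\<^sub>v u \<in> carrier_vec n" "A *\<^sub>v v \<in> carrier_vec n" "t \<cdot>\<^sub>v v \<in> carrier_vec n" "t \<cdot>\<^sub>v (A *\<^sub>v v) \<in> carrier_vec n"
    using assms by auto
  have "qf A (u + t \<cdot>\<^sub>v v) = (u + t \<cdot>\<^sub>v v) \<bullet> (A *\<^sub>v u + t \<cdot>\<^sub>v (A *\<^sub>v v))"
    using A uv Au by (simp add: mult_add_distrib_mat_vec[of _ n n] mult_mat_vec[of _ n n])
  also have "\<dots> = qf A u + t * (u \<bullet> (A *\<^sub>v v)) + (t * (v \<bullet> (A *\<^sub>v u)) + t * (t * (qf A v)))"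
    using uv Au by (simp add: add_scalar_prod_distrib[of _ n] scalar_prod_add_distrib[of _ n])
  finally show ?thesis using sym_mat_scalar_prod[OF A uv] by (simp add: power2_eq_square algebra_simps)
qed

lemma quad_minus:
  fixes A :: "real mat"
  assumes A: "A \<in> carrier_mat n n" "A\<^sup>T = A" and uv: "u \<in> carrier_vec n" "v \<in> carrier_vec n"
  shows "qf A (u - v) = qf A u - 2 * (v \<bullet> (A *\<^sub>v u)) + qf A v"
proof -
  have "u - v = u + (- 1) \<cdot>\<^sub>v v" using uv by (intro eq_vecI) auto
  then show ?thesis using quad_add_smult[OF assms, of "- 1"] by simp
qed

lemma mat_inv:
  assumes A: "A \<in> carrier_mat n n" and det: "mdet A \<noteq> 0"
  shows mat_inv_carrier: "mat_inv A \<in> carrier_mat n n"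
    and mat_inv_right: "A * mat_inv A = 1\<^sub>m n"
    and mat_inv_left: "mat_inv A * A = 1\<^sub>m n"
proof -
  have "A \<in> Units (ring_mat TYPE(real) n ())"
    using det_non_zero_imp_unit[OF A det] .
  then obtain B where "mat_inverse A = Some B"
    using mat_inverse(1)[OF A, of "()"] by (cases "mat_inverse A") auto
  from mat_inverse(2)[OF A this] this
  show "mat_inv A \<in> carrier_mat n n" "A * mat_inv A = 1\<^sub>m n" "mat_inv A * A = 1\<^sub>m n"
    by (auto simp: mat_inv_def)
qed

lemma mat_inv_eqI:
  assumes A: "A \<in> carrier_mat n n" and B: "B \<in> carrier_mat n n" and AB: "A * B = 1\<^sub>m n"
  shows "mat_inv A = B"
proof -
  have "mdet A * mdet B = 1" using det_mult[OF A B] AB by simp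
  then have det: "mdet A \<noteq> 0" by auto
  note Ai = mat_inv[OF A det]
  have "mat_inv A = mat_inv A * (A * B)" unfolding AB using Ai(1) by simp
  also have "\<dots> = (mat_inv A * A) * B" using Ai(1) A B by (simp add: assoc_mult_mat[of _ n n _ n _ n])
  also have "\<dots> = B" unfolding Ai(3) using B by simp
  finally show ?thesis .
qed

lemma pd_mat_det_nonzero:
  assumes "pd_mat n A" shows "mdet A \<noteq> 0"
proof
  note A = pd_matD[OF assms]
  assume "mdet A = 0"
  then obtain v where "v \<in> carrier_vec n" "v \<noteq> 0\<^sub>v n" "A *\<^sub>v v = 0\<^sub>v n"
    using det_0_iff_vec_prod_zero_field[OF A(1)] by auto
  then show False using A(3)[of v] by auto
qed

lemma pd_mat_inv:
  assumes "pd_mat n A"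
  shows "pd_mat n (mat_inv A)"
proof -
  note A = pd_matD[OF assms]
  note Ai = mat_inv[OF A(1) pd_mat_det_nonzero[OF assms]]
  have sym: "(mat_inv A)\<^sup>T = mat_inv A"
  proof (rule mat_inv_eqI[symmetric, OF A(1)])
    have "(mat_inv A * A)\<^sup>T = A\<^sup>T * (mat_inv A)\<^sup>T"
      by (rule transpose_mult[OF Ai(1) A(1)])
    then show "A * (mat_inv A)\<^sup>T = 1\<^sub>m n" unfolding Ai(3) A(2) by simp
  qed (use Ai in auto)
  have "0 < qf (mat_inv A) v" if v: "v \<in> carrier_vec n" "v \<noteq> 0\<^sub>v n" for v
  proof -
    define w where "w = mat_inv A *\<^sub>v v"
    have w: "w \<in> carrier_vec n" using Ai v by (simp add: w_def)
    have Aw: "A *\<^sub>v w = v"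
      unfolding w_def using A Ai v by (simp add: assoc_mult_mat_vec[symmetric, of _ n n _ n])
    have "w \<noteq> 0\<^sub>v n" using Aw v A by auto
    then have "0 < qf A w" using A(3) w by blast
    also have "qf A w = v \<bullet> w" unfolding Aw using w v by (intro comm_scalar_prod[of _ n])
    finally show ?thesis by (simp add: w_def)
  qed
  then show ?thesis using Ai sym by (simp add: pd_mat_def)
qed

lemma pd_mat_mult_inv:
  assumes "pd_mat n A" "y \<in> carrier_vec n"
  shows "A *\<^sub>v (mat_inv A *\<^sub>v y) = y"
proof -
  note A = pd_matD[OF assms(1)]
  note Ai = mat_inv[OF A(1) pd_mat_det_nonzero[OF assms(1)]]
  show ?thesis using A Ai assms(2) by (simp add: assoc_mult_mat_vec[symmetric, of _ n n _ n])
qed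

text \<open>Legendre duality, by completing the square; equality holds at
  \<open>v = mat_inv A *\<^sub>v y\<close>. Inverses are compared through this inequality, without
  square roots or eigenvalues.\<close>

lemma inv_quad_ge:
  assumes A: "pd_mat n A" and yv: "y \<in> carrier_vec n" "v \<in> carrier_vec n"
  shows "2 * (v \<bullet> y) - qf A v \<le> qf (mat_inv A) y"
proof -
  note AD = pd_matD[OF A]
  define w where "w = mat_inv A *\<^sub>v y"
  have w: "w \<in> carrier_vec n" using pd_matD(1)[OF pd_mat_inv[OF A]] yv by (simp add: w_def)
  have Aw: "A *\<^sub>v w = y" unfolding w_def by (rule pd_mat_mult_inv[OF A yv(1)])
  have "0 \<le> qf A (w - v)"
    using psd_matD(3)[OF pd_mat_imp_psd[OF A], of "w - v"] w yv by simp
  also have "\<dots> = w \<bullet> y - 2 * (v \<bullet> y) + qf A v"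
    unfolding quad_minus[OF AD(1,2) w yv(2)] Aw ..
  also have "w \<bullet> y = y \<bullet> w" using w yv by (intro comm_scalar_prod[of _ n])
  finally show ?thesis by (simp add: w_def)
qed

text \<open>The dual inequality for \<open>A\<close>, evaluated at the point that is optimal for
  \<open>B\<close>.\<close>

lemma inv_quad_antimono:
  assumes A: "pd_mat n A" and B: "pd_mat n B" and le: "\<And>v. v \<in> carrier_vec n \<Longrightarrow> qf A v \<le> qf B v"
    and y: "y \<in> carrier_vec n"
  shows "qf (mat_inv B) y \<le> qf (mat_inv A) y"
proof -
  define w where "w = mat_inv B *\<^sub>v y"
  have w: "w \<in> carrier_vec n" using pd_matD(1)[OF pd_mat_inv[OF B]] y by (simp add: w_def)
  have Bw: "B *\<^sub>v w = y" unfolding w_def by (rule pd_mat_mult_inv[OF B y])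
  have "w \<bullet> y = y \<bullet> w" using w y by (intro comm_scalar_prod[of _ n])
  moreover have "2 * (w \<bullet> y) - qf A w \<le> qf (mat_inv A) y" by (rule inv_quad_ge[OF A y w])
  moreover have "qf A w \<le> w \<bullet> y" using le[OF w] unfolding Bw .
  ultimately show ?thesis by (simp add: w_def)
qed

lemma psd_mat_diff:
  assumes "A \<in> carrier_mat n n" "A\<^sup>T = A" "B \<in> carrier_mat n n" "B\<^sup>T = B"
    and "\<And>v. v \<in> carrier_vec n \<Longrightarrow> qf A v \<le> qf B v"
  shows "psd_mat n (B - A)"
proof -
  have "0 \<le> qf (B - A) v" if v: "v \<in> carrier_vec n" for v
  proof -
    have "qf (B - A) v = qf B v - qf A v"
      using assms(1-4) v by (simp add: minus_mult_distrib_mat_vec[of _ n n] scalar_prod_minus_distrib[of _ n])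
    then show ?thesis using assms(5)[OF v] by simp
  qed
  then show ?thesis using assms(1-4) by (auto simp: psd_mat_def transpose_minus[of _ n n])
qed

text \<open>Cholesky factorisation by induction: the last index is eliminated and the Schur
  complement \<open>B'\<close> remains. A zero pivot forces its whole column to vanish, so nothing
  has to be divided by it.\<close>

lemma psd_form_factor:
  fixes B :: "nat \<Rightarrow> nat \<Rightarrow> real"
  assumes "\<And>i j. i < n \<Longrightarrow> j < n \<Longrightarrow> B i j = B j i"
    and "\<And>v. 0 \<le> (\<Sum>i<n. \<Sum>j<n. v i * v j * B i j)"
  shows "\<exists>c. \<forall>i<n. \<forall>j<n. B i j = (\<Sum>k<n. c k i * c k j)"
  using assms
proof (induction n arbitrary: B)
  case (Suc n)
  note sym = Suc.prems(1) and psd = Suc.prems(2)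
  let ?q = "\<lambda>v. \<Sum>i<n. \<Sum>j<n. v i * v j * B i j"
  have expand: "(\<Sum>i<Suc n. \<Sum>j<Suc n. v i * v j * B i j) = ?q v + 2 * v n * (\<Sum>i<n. v i * B i n) + (v n)\<^sup>2 * B n n" for v
  proof -
    have "(\<Sum>i<Suc n. \<Sum>j<Suc n. v i * v j * B i j) = ?q v + (\<Sum>i<n. v i * v n * B i n) + ((\<Sum>j<n. v n * v j * B n j) + v n * v n * B n n)"
      by (simp add: sum.distrib)
    also have "(\<Sum>j<n. v n * v j * B n j) = (\<Sum>i<n. v i * v n * B i n)"
      by (intro sum.cong refl) (use sym in auto)
    finally show ?thesis by (simp add: sum_distrib_left power2_eq_square algebra_simps)
  qed
  define b where "b = B n n"
  define r where "r = (\<lambda>i. if b = 0 then 0 else B i n / b)"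
  have b0: "0 \<le> b"
    using psd[of "\<lambda>i. if i = n then 1 else 0"] unfolding expand by (simp add: b_def)
  have rb: "B i n = r i * b" if "i < n" for i
  proof (cases "b = 0")
    case True
    let ?v = "\<lambda>t j. if j = n then t else if j = i then 1 else (0::real)"
    have "?q (?v t) = B i i" for t
      using that by (simp add: if_distrib[of "\<lambda>z. z * _"] if_distrib[of "\<lambda>z. _ * z"] cong: if_cong sum.cong_simp)
    moreover have "(\<Sum>j<n. ?v t j * B j n) = B i n" for t
      using that by (simp add: if_distrib[of "\<lambda>z. z * _"] cong: if_cong sum.cong_simp)
    ultimately have q: "0 \<le> B i i + 2 * t * B i n" for t
      using psd[of "?v t"] True unfolding expand by (simp add: b_def)
    have "B i n = 0"
    proof (rule ccontr)
      assume "B i n \<noteq> 0"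
      \<comment> \<open>The expression is affine in \<open>t\<close>; at this \<open>t\<close> it
        equals -1.\<close>
      then show False using q[of "- (B i i + 1) / (2 * B i n)"] by (simp add: field_simps)
    qed
    then show ?thesis using True by simp
  qed (simp add: r_def)
  define B' where "B' = (\<lambda>i j. B i j - r i * r j * b)"
  have "0 \<le> (\<Sum>i<n. \<Sum>j<n. v i * v j * B' i j)" for v
  proof -
    define S where "S = (\<Sum>i<n. v i * r i)"
    \<comment> \<open>The last coordinate minimises the full form in that variable; the minimum is
      the form of \<open>B'\<close>.\<close>
    let ?w = "\<lambda>j. if j = n then - S else v j"
    have SB: "(\<Sum>i<n. v i * B i n) = S * b"
      unfolding S_def sum_distrib_right by (intro sum.cong refl) (use rb in auto)
    have "(\<Sum>i<n. \<Sum>j<n. v i * v j * B' i j) = ?q v - (\<Sum>i<n. \<Sum>j<n. (v i * r i) * ((v j * r j) * b))"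
      unfolding sum_subtractf[symmetric] by (intro sum.cong refl) (simp add: B'_def algebra_simps)
    also have "(\<Sum>i<n. \<Sum>j<n. (v i * r i) * ((v j * r j) * b)) = S * (S * b)"
      unfolding S_def sum_distrib_right[symmetric] sum_distrib_left[symmetric] ..
    also have "?q v - S * (S * b) = ?q ?w + 2 * ?w n * (\<Sum>i<n. ?w i * B i n) + (?w n)\<^sup>2 * B n n"
      using SB by (simp add: b_def[symmetric] power2_eq_square algebra_simps cong: sum.cong_simp)
    finally show ?thesis using psd[of ?w] unfolding expand by simp
  qed
  moreover have "B' i j = B' j i" if "i < n" "j < n" for i j
    using sym that by (simp add: B'_def)
  ultimately obtain c' where c': "\<forall>i<n. \<forall>j<n. B' i j = (\<Sum>k<n. c' k i * c' k j)"
    using Suc.IH[of B'] by blast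
  define c where "c = (\<lambda>k i. if k = n then (if i = n then 1 else r i) * sqrt b else if i = n then 0 else c' k i)"
  have "B i j = (\<Sum>k<Suc n. c k i * c k j)" if ij: "i < Suc n" "j < Suc n" for i j
  proof -
    have s: "(\<Sum>k<Suc n. c k i * c k j) = (\<Sum>k<n. (if i = n then 0 else c' k i) * (if j = n then 0 else c' k j)) + (if i = n then 1 else r i) * (if j = n then 1 else r j) * b"
      using b0 by (simp add: c_def)
    consider "i < n" "j < n" | "i = n" "j < n" | "i < n" "j = n" | "i = n" "j = n" using ij by linarith
    then show ?thesis
    proof cases
      case 1
      then have "B' i j = (\<Sum>k<n. c' k i * c' k j)" using c' by blast
      then show ?thesis unfolding s using 1 by (simp add: B'_def)
    next
      case 2 then show ?thesis unfolding s using rb[of j] sym[of n j] by simp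
    next
      case 3 then show ?thesis unfolding s using rb[of i] by simp
    next
      case 4 then show ?thesis unfolding s by (simp add: b_def)
    qed
  qed
  then show ?case by blast
qed simp

lemma quad_eq_sum:
  fixes A :: "real mat"
  assumes "A \<in> carrier_mat n n" "v \<in> carrier_vec n"
  shows "qf A v = (\<Sum>i<n. \<Sum>j<n. v $ i * v $ j * A $$ (i, j))"
proof -
  have "qf A v = (\<Sum>i<n. v $ i * (\<Sum>j<n. A $$ (i, j) * v $ j))"
    using assms by (simp add: scalar_prod_def lessThan_atLeast0)
  then show ?thesis by (simp add: sum_distrib_left ac_simps)
qed

lemma psd_mat_factor:
  assumes "psd_mat n A"
  obtains C where "C \<in> carrier_mat n n" "A = C * C\<^sup>T"
proof -
  note A = psd_matD[OF assms]
  have sym: "A $$ (i, j) = A $$ (j, i)" if "i < n" "j < n" for i j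
  proof -
    have "A\<^sup>T $$ (i, j) = A $$ (j, i)" using A(1) that by simp
    then show ?thesis unfolding A(2) .
  qed
  have "0 \<le> (\<Sum>i<n. \<Sum>j<n. v i * v j * A $$ (i, j))" for v
    using A(3)[of "Matrix.vec n v"] quad_eq_sum[OF A(1), of "Matrix.vec n v"] by simp
  with sym obtain c where c: "\<forall>i<n. \<forall>j<n. A $$ (i, j) = (\<Sum>k<n. c k i * c k j)"
    using psd_form_factor[of n "\<lambda>i j. A $$ (i, j)"] by blast
  define C where "C = Matrix.mat n n (\<lambda>(i, k). c k i)"
  have "A = C * C\<^sup>T"
    using A(1) c by (intro eq_matI) (auto simp: C_def scalar_prod_def lessThan_atLeast0)
  then show ?thesis using that[of C] by (simp add: C_def)
qed

section \<open>Traces and determinants\<close>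

definition mtrace :: "real mat \<Rightarrow> real" where
  "mtrace A = (\<Sum>i<dim_row A. A $$ (i, i))"

lemma mtrace_mult_comm:
  assumes "A \<in> carrier_mat n m" "B \<in> carrier_mat m n"
  shows "mtrace (A * B) = mtrace (B * A)"
proof -
  have "mtrace (A * B) = (\<Sum>i<n. \<Sum>j<m. A $$ (i, j) * B $$ (j, i))"
    using assms by (simp add: mtrace_def scalar_prod_def lessThan_atLeast0)
  also have "\<dots> = (\<Sum>j<m. \<Sum>i<n. A $$ (i, j) * B $$ (j, i))" by (rule sum.swap)
  also have "\<dots> = mtrace (B * A)"
    using assms by (simp add: mtrace_def scalar_prod_def lessThan_atLeast0 mult.commute)
  finally show ?thesis .
qed

lemma mtrace_minus:
  assumes "A \<in> carrier_mat n n" "B \<in> carrier_mat n n"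
  shows "mtrace (A - B) = mtrace A - mtrace B"
  using assms by (simp add: mtrace_def sum_subtractf)

lemma mtrace_one: "mtrace (1\<^sub>m n) = real n"
  by (simp add: mtrace_def)

lemma mtrace_factor:
  assumes C: "C \<in> carrier_mat n m" and G: "G \<in> carrier_mat n n"
  shows "mtrace (C * C\<^sup>T * G) = (\<Sum>k<m. qf G (Matrix.col C k))"
proof -
  have "mtrace (C * C\<^sup>T * G) = mtrace (C * (C\<^sup>T * G))"
    using C G by (simp add: assoc_mult_mat[of _ n m _ n _ n])
  also have "\<dots> = mtrace (C\<^sup>T * G * C)"
    using C G by (intro mtrace_mult_comm[of _ n m]) auto
  also have "\<dots> = mtrace (C\<^sup>T * (G * C))"
    using C G by (simp add: assoc_mult_mat[of _ m n _ n _ m])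
  also have "\<dots> = (\<Sum>k<m. qf G (Matrix.col C k))"
    unfolding mtrace_def using C G by (intro sum.cong) (auto simp: mult_mat_vec_def)
  finally show ?thesis .
qed

lemma quad_factor:
  fixes C :: "real mat"
  assumes C: "C \<in> carrier_mat n m" and v: "v \<in> carrier_vec n"
  shows "v \<bullet> (C * C\<^sup>T *\<^sub>v v) = (\<Sum>k<m. (Matrix.col C k \<bullet> v)\<^sup>2)"
proof -
  have Ct: "C\<^sup>T *\<^sub>v v \<in> carrier_vec m" using C v by auto
  have "v \<bullet> (C * C\<^sup>T *\<^sub>v v) = v \<bullet> (C *\<^sub>v (C\<^sup>T *\<^sub>v v))"
    using C v by (simp add: assoc_mult_mat_vec[of _ n m _ n])
  also have "\<dots> = (C\<^sup>T *\<^sub>v v) \<bullet> (C\<^sup>T *\<^sub>v v)"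
    using transpose_vec_mult_scalar[OF C Ct v] by simp
  also have "\<dots> = (\<Sum>k<m. (Matrix.col C k \<bullet> v)\<^sup>2)"
    using C v by (simp add: scalar_prod_def[of "C\<^sup>T *\<^sub>v v"] lessThan_atLeast0 power2_eq_square)
  finally show ?thesis .
qed

lemma mtrace_psd_mono:
  assumes B: "psd_mat n B" and G: "G \<in> carrier_mat n n" "H \<in> carrier_mat n n"
    and le: "\<And>v. v \<in> carrier_vec n \<Longrightarrow> qf G v \<le> qf H v"
  shows "mtrace (B * G) \<le> mtrace (B * H)"
proof -
  obtain C where C: "C \<in> carrier_mat n n" "B = C * C\<^sup>T"
    using psd_mat_factor[OF B] by blast
  show ?thesis unfolding C(2) mtrace_factor[OF C(1) G(1)] mtrace_factor[OF C(1) G(2)]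
    using C(1) by (intro sum_mono le) auto
qed

text \<open>Sylvester's identity. \<open>?L * ?X\<close> and \<open>?X * ?L\<close> have the same
  determinant, and each is block triangular with one identity block.\<close>

lemma det_one_plus_mult_comm:
  fixes U V :: "real mat"
  assumes U: "U \<in> carrier_mat n m" and V: "V \<in> carrier_mat m n"
  shows "mdet (1\<^sub>m n + U * V) = mdet (1\<^sub>m m + V * U)"
proof -
  let ?X = "four_block_mat (1\<^sub>m n) U (- V) (1\<^sub>m m)"
  let ?L = "four_block_mat (1\<^sub>m n) (0\<^sub>m n m) V (1\<^sub>m m)"
  have X: "?X \<in> carrier_mat (n + m) (n + m)" and L: "?L \<in> carrier_mat (n + m) (n + m)"
    using U V by auto
  have UV: "U * V \<in> carrier_mat n n" and VU: "V * U \<in> carrier_mat m m" using U V by auto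
  have "?L * ?X = four_block_mat (1\<^sub>m n * 1\<^sub>m n + 0\<^sub>m n m * (- V)) (1\<^sub>m n * U + 0\<^sub>m n m * 1\<^sub>m m) (V * 1\<^sub>m n + 1\<^sub>m m * (- V)) (V * U + 1\<^sub>m m * 1\<^sub>m m)"
    by (rule mult_four_block_mat) (use U V in auto)
  also have "\<dots> = four_block_mat (1\<^sub>m n) U (0\<^sub>m m n) (1\<^sub>m m + V * U)"
    using U V VU by (intro arg_cong2[of _ _ _ _ "\<lambda>a b. four_block_mat _ a b _"] arg_cong2[of _ _ _ _ "\<lambda>a b. four_block_mat a _ _ b"] cong_four_block_mat)
      (auto simp: comm_add_mat[OF VU])
  finally have "mdet (?L * ?X) = mdet (four_block_mat (1\<^sub>m n) U (0\<^sub>m m n) (1\<^sub>m m + V * U))" by simp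
  also have "\<dots> = mdet (1\<^sub>m m + V * U)"
    using U V VU by (subst det_four_block_mat_lower_left_zero[of _ n _ m]) auto
  finally have 1: "mdet (?L * ?X) = mdet (1\<^sub>m m + V * U)" .
  have "?X * ?L = four_block_mat (1\<^sub>m n * 1\<^sub>m n + U * V) (1\<^sub>m n * 0\<^sub>m n m + U * 1\<^sub>m m) ((- V) * 1\<^sub>m n + 1\<^sub>m m * V) ((- V) * 0\<^sub>m n m + 1\<^sub>m m * 1\<^sub>m m)"
    by (rule mult_four_block_mat) (use U V in auto)
  also have "\<dots> = four_block_mat (1\<^sub>m n + U * V) U (0\<^sub>m m n) (1\<^sub>m m)"
    using U V UV by (intro cong_four_block_mat) auto
  finally have "mdet (?X * ?L) = mdet (four_block_mat (1\<^sub>m n + U * V) U (0\<^sub>m m n) (1\<^sub>m m))" by simp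
  also have "\<dots> = mdet (1\<^sub>m n + U * V)"
    using U V UV by (subst det_four_block_mat_lower_left_zero[of _ n _ m]) auto
  finally have 2: "mdet (?X * ?L) = mdet (1\<^sub>m n + U * V)" .
  show ?thesis using 1 2 det_mult[OF X L] det_mult[OF L X] by (simp add: mult.commute)
qed

definition outer :: "real vec \<Rightarrow> real vec \<Rightarrow> real mat" where
  "outer u v = Matrix.mat (dim_vec u) (dim_vec v) (\<lambda>(i, j). u $ i * v $ j)"

lemma outer_carrier [simp]: "u \<in> carrier_vec n \<Longrightarrow> v \<in> carrier_vec m \<Longrightarrow> outer u v \<in> carrier_mat n m"
  by (auto simp: outer_def)

lemma transpose_outer: "(outer u v)\<^sup>T = outer v u"
  by (intro eq_matI) (auto simp: outer_def)

lemma outer_mult_vec: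
  assumes "v \<in> carrier_vec n" "w \<in> carrier_vec n"
  shows "outer u v *\<^sub>v w = (v \<bullet> w) \<cdot>\<^sub>v u"
  using assms by (intro eq_vecI) (auto simp: outer_def scalar_prod_def sum_distrib_left ac_simps)

lemma mult_outer:
  assumes "A \<in> carrier_mat m n" "u \<in> carrier_vec n"
  shows "A * outer u v = outer (A *\<^sub>v u) v"
  using assms by (intro eq_matI) (auto simp: outer_def scalar_prod_def sum_distrib_right sum_distrib_left ac_simps)

lemma outer_mult:
  assumes "A \<in> carrier_mat n m" "v \<in> carrier_vec n"
  shows "outer u v * A = outer u (A\<^sup>T *\<^sub>v v)"
  using assms by (intro eq_matI) (auto simp: outer_def scalar_prod_def sum_distrib_left ac_simps)

lemma outer_mult_outer:
  assumes "v \<in> carrier_vec n" "w \<in> carrier_vec n"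
  shows "outer u v * outer w z = (v \<bullet> w) \<cdot>\<^sub>m outer u z"
  using assms by (intro eq_matI) (auto simp: outer_def scalar_prod_def sum_distrib_left sum_distrib_right ac_simps)

lemma quad_outer:
  assumes "v \<in> carrier_vec n" "b \<in> carrier_vec n"
  shows "qf (outer b b) v = (b \<bullet> v)\<^sup>2"
  using assms comm_scalar_prod[of v n b] by (simp add: outer_mult_vec power2_eq_square)

lemma det_one_plus_outer:
  assumes u: "u \<in> carrier_vec n" and v: "v \<in> carrier_vec n"
  shows "mdet (1\<^sub>m n + outer u v) = 1 + v \<bullet> u"
proof -
  define U where "U = Matrix.mat n 1 (\<lambda>(i, j). u $ i)"
  define V where "V = Matrix.mat 1 n (\<lambda>(i, j). v $ j)"
  have UV: "U \<in> carrier_mat n 1" "V \<in> carrier_mat 1 n" by (auto simp: U_def V_def)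
  have "outer u v = U * V"
    using u v by (intro eq_matI) (auto simp: outer_def U_def V_def scalar_prod_def)
  then have "mdet (1\<^sub>m n + outer u v) = mdet (1\<^sub>m 1 + V * U)"
    using det_one_plus_mult_comm[OF UV] by simp
  also have "\<dots> = (1\<^sub>m 1 + V * U) $$ (0, 0)"
    using UV by (intro det_single) auto
  also have "\<dots> = 1 + v \<bullet> u"
    using u v by (simp add: U_def V_def scalar_prod_def)
  finally show ?thesis .
qed

text \<open>The matrix determinant lemma: \<open>A\<close> is factored out, which leaves
  \<open>det_one_plus_outer\<close>.\<close>

lemma det_add_outer:
  fixes A :: "real mat"
  assumes A: "A \<in> carrier_mat n n" "mdet A \<noteq> 0" and u: "u \<in> carrier_vec n" and v: "v \<in> carrier_vec n"
  shows "mdet (A + outer u v) = mdet A * (1 + v \<bullet> (mat_inv A *\<^sub>v u))"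
proof -
  note Ai = mat_inv[OF A]
  have w: "mat_inv A *\<^sub>v u \<in> carrier_vec n" using Ai u by auto
  have "A * (1\<^sub>m n + outer (mat_inv A *\<^sub>v u) v) = A + A * outer (mat_inv A *\<^sub>v u) v"
    using A(1) by (simp add: mult_add_distrib_mat[OF A(1) one_carrier_mat outer_carrier[OF w v]])
  also have "A * outer (mat_inv A *\<^sub>v u) v = outer u v"
    using A Ai u v by (simp add: mult_outer[of _ n n] assoc_mult_mat_vec[symmetric, of _ n n _ n])
  finally have "mdet (A + outer u v) = mdet (A * (1\<^sub>m n + outer (mat_inv A *\<^sub>v u) v))" by simp
  also have "\<dots> = mdet A * mdet (1\<^sub>m n + outer (mat_inv A *\<^sub>v u) v)"
    using A w v by (intro det_mult) auto
  finally show ?thesis unfolding det_one_plus_outer[OF w v] .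
qed

text \<open>By factorisation the determinant is a square, and it is not 0.\<close>

lemma pd_mat_det_pos:
  assumes "pd_mat n A"
  shows "0 < mdet A"
proof -
  obtain C where C: "C \<in> carrier_mat n n" "A = C * C\<^sup>T"
    using psd_mat_factor[OF pd_mat_imp_psd[OF assms]] by blast
  have "mdet A = (mdet C)\<^sup>2"
    unfolding C(2) using C(1) by (simp add: det_mult[of _ n] det_transpose[of _ n] power2_eq_square)
  then show ?thesis using pd_mat_det_nonzero[OF assms] by (metis less_le zero_le_power2)
qed

lemma pd_mat_add_psd:
  assumes "pd_mat n A" "psd_mat n B"
  shows "pd_mat n (A + B)"
proof -
  note A = pd_matD[OF assms(1)] and B = psd_matD[OF assms(2)]
  have "0 < qf (A + B) v" if v: "v \<in> carrier_vec n" "v \<noteq> 0\<^sub>v n" for v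
  proof -
    have "qf (A + B) v = qf A v + qf B v"
      using A B v by (simp add: add_mult_distrib_mat_vec[of _ n n] scalar_prod_add_distrib[of _ n])
    then show ?thesis using A(3)[OF v] B(3)[OF v(1)] by simp
  qed
  then show ?thesis using A B by (auto simp: pd_mat_def transpose_add[of _ n n])
qed

lemma psd_mat_outer: "b \<in> carrier_vec n \<Longrightarrow> psd_mat n (outer b b)"
  by (simp add: psd_mat_def transpose_outer quad_outer)

text \<open>The passage from \<open>A\<close> to \<open>A + C * C\<^sup>T\<close> one column at a
  time, so that monotonicity reduces to rank-one updates.\<close>

fun add_cols :: "real mat \<Rightarrow> real mat \<Rightarrow> nat \<Rightarrow> real mat" where
  "add_cols A C 0 = A"
| "add_cols A C (Suc k) = add_cols A C k + outer (Matrix.col C k) (Matrix.col C k)"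

lemma add_cols_carrier:
  assumes "A \<in> carrier_mat n n" "C \<in> carrier_mat n m"
  shows "add_cols A C k \<in> carrier_mat n n"
  using assms by (induction k) auto

lemma add_cols_index:
  assumes "A \<in> carrier_mat n n" "C \<in> carrier_mat n m" "k \<le> m" "i < n" "j < n"
  shows "add_cols A C k $$ (i, j) = A $$ (i, j) + (\<Sum>l<k. C $$ (i, l) * C $$ (j, l))"
  using assms(3)
proof (induction k)
  case (Suc k)
  have o: "outer (Matrix.col C k) (Matrix.col C k) \<in> carrier_mat n n" using assms by auto
  show ?case using Suc assms add_cols_carrier[OF assms(1,2), of k] o by (simp add: outer_def)
qed simp

lemma add_cols_all:
  assumes "A \<in> carrier_mat n n" "C \<in> carrier_mat n m"
  shows "add_cols A C m = A + C * C\<^sup>T"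
  using assms add_cols_carrier[OF assms, of m]
  by (intro eq_matI) (auto simp: add_cols_index scalar_prod_def lessThan_atLeast0)

lemma pd_mat_add_cols:
  assumes "pd_mat n A" "C \<in> carrier_mat n m"
  shows "pd_mat n (add_cols A C k)"
  using assms by (induction k) (auto intro!: pd_mat_add_psd psd_mat_outer)

lemma quad_add_cols_ge:
  assumes "A \<in> carrier_mat n n" "C \<in> carrier_mat n m" "v \<in> carrier_vec n"
  shows "qf A v \<le> qf (add_cols A C k) v"
proof (induction k)
  case (Suc k)
  have c: "Matrix.col C k \<in> carrier_vec n" using assms by auto
  have "qf (add_cols A C (Suc k)) v = qf (add_cols A C k) v + (Matrix.col C k \<bullet> v)\<^sup>2"
    using c outer_carrier[OF c c] mult_mat_vec_carrier[OF outer_carrier[OF c c] assms(3)] assms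
      add_cols_carrier[OF assms(1,2), of k] mult_mat_vec_carrier[OF add_cols_carrier[OF assms(1,2), of k] assms(3)]
    by (simp add: add_mult_distrib_mat_vec[of _ n n] scalar_prod_add_distrib[of _ n] quad_outer[of _ n])
  then show ?case using Suc zero_le_power2[of "Matrix.col C k \<bullet> v"] by linarith
qed simp

lemma psd_diff_factor:
  assumes A: "pd_mat n A" and B: "pd_mat n B" and le: "\<And>v. v \<in> carrier_vec n \<Longrightarrow> qf A v \<le> qf B v"
  obtains C where "C \<in> carrier_mat n n" "B - A = C * C\<^sup>T" "add_cols A C n = B"
proof -
  note AD = pd_matD[OF A] and BD = pd_matD[OF B]
  obtain C where C: "C \<in> carrier_mat n n" "B - A = C * C\<^sup>T"
    using psd_mat_factor[OF psd_mat_diff[OF AD(1,2) BD(1,2) le]] by blast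
  have "add_cols A C n = A + (B - A)" unfolding add_cols_all[OF AD(1) C(1)] C(2) ..
  also have "\<dots> = B" using AD(1) BD(1) by (intro eq_matI) auto
  finally show ?thesis using that C by blast
qed

text \<open>Each rank-one step multiplies the determinant by 1 plus the current inverse form at the
  added column. This factor is at least 1. It is at most the exponential of the inverse form of the
  initial \<open>A\<close>, since inverses decrease along the way, and these exponents add up to the
  trace of \<open>mat_inv A * (B - A)\<close>.\<close>

lemma det_mono:
  assumes A: "pd_mat n A" and B: "pd_mat n B" and le: "\<And>v. v \<in> carrier_vec n \<Longrightarrow> qf A v \<le> qf B v"
  shows "mdet A \<le> mdet B"
    and "mdet B \<le> mdet A * exp (mtrace (mat_inv A * B) - real n)"
proof -
  note AD = pd_matD[OF A] and BD = pd_matD[OF B]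
  obtain C where C: "C \<in> carrier_mat n n" "B - A = C * C\<^sup>T" "add_cols A C n = B"
    using psd_diff_factor[OF A B le] by blast
  let ?c = "\<lambda>k. Matrix.col C k" and ?A = "add_cols A C"
  have c: "?c k \<in> carrier_vec n" for k using C(1) by auto
  have pA: "pd_mat n (?A k)" for k by (rule pd_mat_add_cols[OF A C(1)])
  have step: "mdet (?A (Suc k)) = mdet (?A k) * (1 + ?c k \<bullet> (mat_inv (?A k) *\<^sub>v ?c k))" for k
    unfolding add_cols.simps by (rule det_add_outer[OF pd_matD(1)[OF pA] pd_mat_det_nonzero[OF pA] c c])
  have nn: "0 \<le> ?c k \<bullet> (mat_inv (?A k) *\<^sub>v ?c k)" for k
    using psd_matD(3)[OF pd_mat_imp_psd[OF pd_mat_inv[OF pA]] c] .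
  have up: "?c k \<bullet> (mat_inv (?A k) *\<^sub>v ?c k) \<le> ?c k \<bullet> (mat_inv A *\<^sub>v ?c k)" for k
    by (rule inv_quad_antimono[OF A pA quad_add_cols_ge[OF AD(1) C(1)] c])
  have "mdet A \<le> mdet (?A k) \<and>
     mdet (?A k) \<le> mdet A * exp (\<Sum>l<k. ?c l \<bullet> (mat_inv A *\<^sub>v ?c l))" for k
  proof (induction k)
    case (Suc k)
    let ?t = "?c k \<bullet> (mat_inv (?A k) *\<^sub>v ?c k)"
    have d: "0 < mdet (?A k)" by (rule pd_mat_det_pos[OF pA])
    have "mdet (?A k) \<le> mdet (?A (Suc k))"
      unfolding step using nn[of k] d by (simp add: algebra_simps)
    moreover have "mdet (?A (Suc k)) \<le> mdet (?A k) * exp (?c k \<bullet> (mat_inv A *\<^sub>v ?c k))"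
      unfolding step using d up[of k] by (intro mult_left_mono order_trans[OF _ exp_ge_add_one_self]) auto
    moreover have "\<dots> \<le> (mdet A * exp (\<Sum>l<k. ?c l \<bullet> (mat_inv A *\<^sub>v ?c l))) * exp (?c k \<bullet> (mat_inv A *\<^sub>v ?c k))"
      using Suc by (intro mult_right_mono) auto
    moreover have "(mdet A * exp (\<Sum>l<k. ?c l \<bullet> (mat_inv A *\<^sub>v ?c l))) * exp (?c k \<bullet> (mat_inv A *\<^sub>v ?c k)) =
        mdet A * exp (\<Sum>l<Suc k. ?c l \<bullet> (mat_inv A *\<^sub>v ?c l))"
      by (simp add: exp_add)
    ultimately show ?case using Suc by linarith
  qed simp
  from this[of n] have 1: "mdet A \<le> mdet B"
    and 2: "mdet B \<le> mdet A * exp (\<Sum>l<n. ?c l \<bullet> (mat_inv A *\<^sub>v ?c l))" unfolding C(3) by auto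
  show "mdet A \<le> mdet B" by (rule 1)
  note Ai = mat_inv[OF AD(1) pd_mat_det_nonzero[OF A]]
  have "(\<Sum>l<n. ?c l \<bullet> (mat_inv A *\<^sub>v ?c l)) = mtrace ((B - A) * mat_inv A)"
    unfolding C(2) by (rule mtrace_factor[symmetric, OF C(1) Ai(1)])
  also have "\<dots> = mtrace (mat_inv A * (B - A))"
    using AD BD Ai by (intro mtrace_mult_comm[of _ n n]) auto
  also have "mat_inv A * (B - A) = mat_inv A * B - 1\<^sub>m n"
    using AD BD Ai by (simp add: mult_minus_distrib_mat[of _ n n])
  also have "mtrace \<dots> = mtrace (mat_inv A * B) - real n"
    using AD BD Ai by (subst mtrace_minus[of _ n]) (auto simp: mtrace_one)
  finally show "mdet B \<le> mdet A * exp (mtrace (mat_inv A * B) - real n)" using 2 by simp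
qed

section \<open>Generalised least squares with a Gaussian prior on the coefficients\<close>

definition gls_of :: "real mat \<Rightarrow> real mat \<Rightarrow> real mat \<Rightarrow> real mat" where
  "gls_of M Om R = M\<^sup>T * mat_inv R * M + Om"

definition Q_of :: "real mat \<Rightarrow> real mat \<Rightarrow> real mat \<Rightarrow> real mat" where
  "Q_of M Om R = mat_inv R - mat_inv R * M * mat_inv (gls_of M Om R) * M\<^sup>T * mat_inv R"

text \<open>The two determinants of the likelihood move in opposite directions when \<open>R\<close>
  grows; they are kept together because their product is monotone.\<close>

definition detprod :: "real mat \<Rightarrow> real mat \<Rightarrow> real mat \<Rightarrow> real" where
  "detprod M Om R = mdet R * mdet (gls_of M Om R)"

lemma pd_mat_smult:
  assumes "pd_mat n A" "0 < t"
  shows "pd_mat n (t \<cdot>\<^sub>m A)"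
proof -
  note A = pd_matD[OF assms(1)]
  have "v \<bullet> (t \<cdot>\<^sub>m A *\<^sub>v v) = t * (qf A v)" if "v \<in> carrier_vec n" for v
  proof -
    have "t \<cdot>\<^sub>m A *\<^sub>v v = t \<cdot>\<^sub>v (A *\<^sub>v v)" using A(1) that by (intro eq_vecI) auto
    then show ?thesis using A that by simp
  qed
  moreover have "(t \<cdot>\<^sub>m A)\<^sup>T = t \<cdot>\<^sub>m A"
  proof -
    have "(t \<cdot>\<^sub>m A)\<^sup>T = t \<cdot>\<^sub>m A\<^sup>T" by (intro eq_matI) auto
    then show ?thesis by (simp add: A(2))
  qed
  ultimately show ?thesis using A assms(2) by (simp add: pd_mat_def)
qed

lemma smult_mat_mult_vec: "t \<cdot>\<^sub>m A *\<^sub>v v = t \<cdot>\<^sub>v (A *\<^sub>v v)" if "A \<in> carrier_mat n m" "v \<in> carrier_vec m" for A :: "real mat"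
  using that by (intro eq_vecI) auto

lemma quad_smult_mat: "v \<bullet> (t \<cdot>\<^sub>m A *\<^sub>v v) = t * (qf A v)" if "A \<in> carrier_mat n n" "v \<in> carrier_vec n" for A :: "real mat"
  using that by (simp add: smult_mat_mult_vec[of _ n n])

lemma mat_inv_smult:
  assumes "pd_mat n A" "t \<noteq> 0"
  shows "mat_inv (t \<cdot>\<^sub>m A) = (1 / t) \<cdot>\<^sub>m mat_inv A"
proof (rule mat_inv_eqI[of _ n])
  note A = pd_matD[OF assms(1)]
  note Ai = mat_inv[OF A(1) pd_mat_det_nonzero[OF assms(1)]]
  show "t \<cdot>\<^sub>m A * ((1 / t) \<cdot>\<^sub>m mat_inv A) = 1\<^sub>m n"
    using A(1) Ai assms(2)
    by (simp add: mult_smult_assoc_mat[of _ n n _ n] mult_smult_distrib[of _ n n _ n]) (intro eq_matI, auto)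
qed (use pd_matD[OF assms(1)] mat_inv_carrier[OF pd_matD(1)[OF assms(1)] pd_mat_det_nonzero[OF assms(1)]] in auto)

lemma zero_mat_mult_vec: "0\<^sub>m n m *\<^sub>v v = 0\<^sub>v n" if "v \<in> carrier_vec m" for v :: "real vec"
  using that by (intro eq_vecI) auto

lemma vec_minus_eq_0:
  fixes u v :: "real vec"
  assumes "u - v = 0\<^sub>v n" "u \<in> carrier_vec n" "v \<in> carrier_vec n"
  shows "u = v"
proof (intro eq_vecI)
  fix i assume "i < dim_vec v"
  then have "i < n" using assms by simp
  have "(u - v) $ i = u $ i - v $ i" using \<open>i < dim_vec v\<close> by (rule index_minus_vec(1))
  moreover have "(u - v) $ i = 0" unfolding assms(1) using \<open>i < n\<close> by simp
  ultimately show "u $ i = v $ i" by simp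
qed (use assms in simp)

text \<open>\<open>R\<close> is an argument of the lemmas and not a parameter: the same design is
  used with \<open>R al\<close>, \<open>S al\<close> and multiples of them. The locale is also
  instantiated with the zero matrix in place of \<open>Om\<close>, the flat prior.\<close>

locale gls =
  fixes n p :: nat and M Om :: "real mat"
  assumes M: "M \<in> carrier_mat n p"
    and inj: "\<And>b. b \<in> carrier_vec p \<Longrightarrow> M *\<^sub>v b = 0\<^sub>v n \<Longrightarrow> b = 0\<^sub>v p"
    and Om: "psd_mat p Om"
begin

abbreviation "G \<equiv> gls_of M Om"
abbreviation "Q \<equiv> Q_of M Om"

text \<open>The penalised least squares criterion. The form of \<open>Q R\<close> is its minimum
  over \<open>b\<close>; comparisons between different \<open>R\<close>, penalties or shifts of
  \<open>y\<close> insert the minimiser of one problem into another.\<close>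

definition crit :: "real mat \<Rightarrow> real vec \<Rightarrow> real vec \<Rightarrow> real" where
  "crit R y b = qf (mat_inv R) (y - M *\<^sub>v b) + qf Om b"

lemma inv_carrier:
  assumes "pd_mat n R"
  shows "mat_inv R \<in> carrier_mat n n" "(mat_inv R)\<^sup>T = mat_inv R"
  using pd_matD[OF pd_mat_inv[OF assms]] by auto

lemma MtRM_carrier:
  assumes "pd_mat n R"
  shows "M\<^sup>T * mat_inv R * M \<in> carrier_mat p p"
  using M inv_carrier[OF assms] by auto

lemma quad_MtRM:
  assumes R: "pd_mat n R" and b: "b \<in> carrier_vec p"
  shows "b \<bullet> (M\<^sup>T * mat_inv R * M *\<^sub>v b) = qf (mat_inv R) (M *\<^sub>v b)"
proof -
  note Ri = inv_carrier[OF R]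
  have Mb: "M *\<^sub>v b \<in> carrier_vec n" using M b by auto
  have e: "M\<^sup>T * mat_inv R * M *\<^sub>v b = M\<^sup>T *\<^sub>v (mat_inv R *\<^sub>v (M *\<^sub>v b))"
    using M Ri b by (simp add: assoc_mult_mat_vec[of _ p n _ p] assoc_mult_mat_vec[of _ p n _ n])
  have "b \<bullet> (M\<^sup>T *\<^sub>v (mat_inv R *\<^sub>v (M *\<^sub>v b))) = (M\<^sup>T *\<^sub>v (mat_inv R *\<^sub>v (M *\<^sub>v b))) \<bullet> b"
    using M Ri b Mb by (intro comm_scalar_prod[of _ p]) auto
  also have "\<dots> = (mat_inv R *\<^sub>v (M *\<^sub>v b)) \<bullet> (M *\<^sub>v b)"
    by (rule transpose_vec_mult_scalar[OF M b]) (use Ri Mb in auto)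
  also have "\<dots> = qf (mat_inv R) (M *\<^sub>v b)"
    using Ri Mb by (intro comm_scalar_prod[of _ n]) auto
  finally show ?thesis unfolding e .
qed

lemma quad_gls:
  assumes R: "pd_mat n R" and b: "b \<in> carrier_vec p"
  shows "qf (G R) b = qf (mat_inv R) (M *\<^sub>v b) + qf Om b"
  unfolding gls_of_def quad_MtRM[OF R b, symmetric]
  using MtRM_carrier[OF R] psd_matD(1)[OF Om] b
  by (simp add: add_mult_distrib_mat_vec[of _ p p] scalar_prod_add_distrib[of _ p])

lemma gls_pd:
  assumes R: "pd_mat n R"
  shows "pd_mat p (G R)"
proof -
  note Ri = inv_carrier[OF R] and O = psd_matD[OF Om]
  have sym: "(G R)\<^sup>T = G R"
  proof -
    have "(M\<^sup>T * mat_inv R * M)\<^sup>T = M\<^sup>T * ((M\<^sup>T * mat_inv R)\<^sup>T)"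
      using M Ri by (intro transpose_mult[of _ p n]) auto
    also have "(M\<^sup>T * mat_inv R)\<^sup>T = mat_inv R * M"
      using M Ri by (subst transpose_mult[of _ p n]) auto
    also have "M\<^sup>T * (mat_inv R * M) = M\<^sup>T * mat_inv R * M"
      using M Ri by (intro assoc_mult_mat[of _ p n _ n, symmetric]) auto
    finally show ?thesis unfolding gls_of_def using MtRM_carrier[OF R] O by (simp add: transpose_add[of _ p p])
  qed
  have "0 < qf (G R) b" if b: "b \<in> carrier_vec p" "b \<noteq> 0\<^sub>v p" for b
  proof -
    have "M *\<^sub>v b \<noteq> 0\<^sub>v n" using inj b by blast
    then have "0 < qf (mat_inv R) (M *\<^sub>v b)"
      using M b by (intro pd_matD(3)[OF pd_mat_inv[OF R]]) auto
    then show ?thesis unfolding quad_gls[OF R b(1)] using O(3)[OF b(1)] by simp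
  qed
  then show ?thesis using sym MtRM_carrier[OF R] O by (auto simp: pd_mat_def gls_of_def)
qed

lemma Q_carrier:
  assumes R: "pd_mat n R"
  shows "Q R \<in> carrier_mat n n"
  using M inv_carrier[OF R] by (auto simp: Q_of_def)

lemma Q_sym:
  assumes R: "pd_mat n R"
  shows "(Q R)\<^sup>T = Q R"
proof -
  let ?B = "mat_inv R * M * mat_inv (G R)"
  note Ri = inv_carrier[OF R] and Gi = pd_matD[OF pd_mat_inv[OF gls_pd[OF R]]]
  have 1: "mat_inv R * M \<in> carrier_mat n p" using M Ri by auto
  have 2: "?B \<in> carrier_mat n p" using 1 Gi by auto
  have t1: "(mat_inv R * M)\<^sup>T = M\<^sup>T * mat_inv R"
    using transpose_mult[OF Ri(1) M] by (simp add: Ri(2))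
  have e: "?B * M\<^sup>T * mat_inv R = ?B * (mat_inv R * M)\<^sup>T"
    unfolding t1 using 2 M Ri by (intro assoc_mult_mat[of _ n p _ n _ n]) auto
  have "(?B * (mat_inv R * M)\<^sup>T)\<^sup>T = mat_inv R * M * ?B\<^sup>T"
    using 1 2 by (subst transpose_mult[of _ n p _ n]) auto
  also have "?B\<^sup>T = mat_inv (G R) * (mat_inv R * M)\<^sup>T"
    using transpose_mult[OF 1 Gi(1)] by (simp add: Gi(2))
  also have "mat_inv R * M * (mat_inv (G R) * (mat_inv R * M)\<^sup>T) = ?B * (mat_inv R * M)\<^sup>T"
    using 1 Gi by (intro assoc_mult_mat[of _ n p _ p _ n, symmetric]) auto
  finally show ?thesis unfolding Q_of_def e using Ri 1 2 by (subst transpose_minus[of _ n n]) auto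
qed

lemma crit_expand:
  assumes R: "pd_mat n R" and y: "y \<in> carrier_vec n" and b: "b \<in> carrier_vec p"
  shows "crit R y b = qf (mat_inv R) y - 2 * (b \<bullet> (M\<^sup>T *\<^sub>v (mat_inv R *\<^sub>v y))) + qf (G R) b"
proof -
  note Ri = inv_carrier[OF R]
  have Mb: "M *\<^sub>v b \<in> carrier_vec n" using M b by auto
  have Ry: "mat_inv R *\<^sub>v y \<in> carrier_vec n" using Ri y by auto
  have "(M *\<^sub>v b) \<bullet> (mat_inv R *\<^sub>v y) = (mat_inv R *\<^sub>v y) \<bullet> (M *\<^sub>v b)"
    using Mb Ry by (intro comm_scalar_prod[of _ n])
  also have "\<dots> = (M\<^sup>T *\<^sub>v (mat_inv R *\<^sub>v y)) \<bullet> b"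
    using transpose_vec_mult_scalar[OF M b Ry] by simp
  also have "\<dots> = b \<bullet> (M\<^sup>T *\<^sub>v (mat_inv R *\<^sub>v y))"
    using M b Ry by (intro comm_scalar_prod[of _ p]) auto
  finally show ?thesis unfolding crit_def quad_minus[OF Ri y Mb] quad_gls[OF R b] by simp
qed

lemma quad_Q:
  assumes R: "pd_mat n R" and y: "y \<in> carrier_vec n"
  defines "g \<equiv> M\<^sup>T *\<^sub>v (mat_inv R *\<^sub>v y)"
  shows "qf (Q R) y = qf (mat_inv R) y - qf (mat_inv (G R)) g"
proof -
  let ?B = "mat_inv R * M * mat_inv (G R)" and ?v = "M *\<^sub>v (mat_inv (G R) *\<^sub>v g)"
  note Ri = inv_carrier[OF R] and Gi = pd_matD[OF pd_mat_inv[OF gls_pd[OF R]]]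
  have Ry: "mat_inv R *\<^sub>v y \<in> carrier_vec n" using Ri y by auto
  have g: "g \<in> carrier_vec p" unfolding g_def using M Ry by auto
  have h: "mat_inv (G R) *\<^sub>v g \<in> carrier_vec p" using Gi g by auto
  have Mh: "?v \<in> carrier_vec n" using M h by auto
  have "?B * M\<^sup>T * mat_inv R *\<^sub>v y = mat_inv R *\<^sub>v ?v"
  proof -
    have 1: "mat_inv R * M \<in> carrier_mat n p" using M Ri by auto
    have 2: "?B \<in> carrier_mat n p" using 1 Gi by auto
    have 3: "?B * M\<^sup>T \<in> carrier_mat n n" using 2 M by auto
    have "?B * M\<^sup>T * mat_inv R *\<^sub>v y = ?B * M\<^sup>T *\<^sub>v (mat_inv R *\<^sub>v y)"
      by (rule assoc_mult_mat_vec[OF 3 Ri(1) y])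
    also have "\<dots> = ?B *\<^sub>v g"
      unfolding g_def using 2 M Ry by (intro assoc_mult_mat_vec[of _ n p _ n]) auto
    also have "\<dots> = mat_inv R * M *\<^sub>v (mat_inv (G R) *\<^sub>v g)" by (rule assoc_mult_mat_vec[OF 1 Gi(1) g])
    also have "\<dots> = mat_inv R *\<^sub>v ?v" by (rule assoc_mult_mat_vec[OF Ri(1) M h])
    finally show ?thesis .
  qed
  then have "Q R *\<^sub>v y = mat_inv R *\<^sub>v y - mat_inv R *\<^sub>v ?v"
    unfolding Q_of_def using M Ri Gi y by (subst minus_mult_distrib_mat_vec[of _ n n]) auto
  then have "qf (Q R) y = qf (mat_inv R) y - y \<bullet> (mat_inv R *\<^sub>v ?v)"
    using y Ry Ri Mh by (simp add: scalar_prod_minus_distrib[of _ n])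
  also have "y \<bullet> (mat_inv R *\<^sub>v ?v) = ?v \<bullet> (mat_inv R *\<^sub>v y)"
    by (rule sym_mat_scalar_prod[OF Ri y Mh])
  also have "\<dots> = (mat_inv R *\<^sub>v y) \<bullet> ?v"
    using Mh Ry by (intro comm_scalar_prod[of _ n])
  also have "\<dots> = qf (mat_inv (G R)) g"
    unfolding g_def using transpose_vec_mult_scalar[OF M h[unfolded g_def] Ry] by simp
  finally show ?thesis .
qed

lemma quad_Q_le_crit:
  assumes R: "pd_mat n R" and y: "y \<in> carrier_vec n" and b: "b \<in> carrier_vec p"
  shows "qf (Q R) y \<le> crit R y b"
proof -
  let ?g = "M\<^sup>T *\<^sub>v (mat_inv R *\<^sub>v y)"
  have g: "?g \<in> carrier_vec p" using M inv_carrier[OF R] y by auto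
  show ?thesis
    unfolding quad_Q[OF R y] crit_expand[OF R y b] using inv_quad_ge[OF gls_pd[OF R] g b] by simp
qed

lemma quad_Q_attained:
  assumes R: "pd_mat n R" and y: "y \<in> carrier_vec n"
  obtains b where "b \<in> carrier_vec p" "qf (Q R) y = crit R y b"
proof -
  let ?g = "M\<^sup>T *\<^sub>v (mat_inv R *\<^sub>v y)"
  let ?b = "mat_inv (G R) *\<^sub>v ?g"
  have g: "?g \<in> carrier_vec p" using M inv_carrier[OF R] y by auto
  have b: "?b \<in> carrier_vec p" using pd_matD(1)[OF pd_mat_inv[OF gls_pd[OF R]]] g by auto
  have "?b \<bullet> ?g = ?g \<bullet> ?b" using b g by (intro comm_scalar_prod[of _ p])
  then have "qf (Q R) y = crit R y ?b"
    unfolding quad_Q[OF R y] crit_expand[OF R y b] pd_mat_mult_inv[OF gls_pd[OF R] g] by simp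
  with b show ?thesis using that by blast
qed

lemma psd_Q:
  assumes R: "pd_mat n R"
  shows "psd_mat n (Q R)"
proof -
  have "0 \<le> qf (Q R) y" if y: "y \<in> carrier_vec n" for y
  proof -
    obtain b where b: "b \<in> carrier_vec p" "qf (Q R) y = crit R y b" by (rule quad_Q_attained[OF R y])
    have "y - M *\<^sub>v b \<in> carrier_vec n" using y M b by auto
    then show ?thesis unfolding b(2) crit_def
      using psd_matD(3)[OF pd_mat_imp_psd[OF pd_mat_inv[OF R]]] psd_matD(3)[OF Om b(1)] by simp
  qed
  then show ?thesis using Q_carrier[OF R] Q_sym[OF R] by (simp add: psd_mat_def)
qed

lemma quad_Q_pos:
  assumes R: "pd_mat n R" and y: "y \<in> carrier_vec n" and ne: "\<And>b. b \<in> carrier_vec p \<Longrightarrow> y \<noteq> M *\<^sub>v b"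
  shows "0 < qf (Q R) y"
proof -
  obtain b where b: "b \<in> carrier_vec p" "qf (Q R) y = crit R y b" by (rule quad_Q_attained[OF R y])
  have Mb: "M *\<^sub>v b \<in> carrier_vec n" using M b by auto
  have "y - M *\<^sub>v b \<noteq> 0\<^sub>v n"
  proof
    assume "y - M *\<^sub>v b = 0\<^sub>v n"
    then have "y = M *\<^sub>v b" using y Mb by (rule vec_minus_eq_0)
    then show False using ne[OF b(1)] by simp
  qed
  then have "0 < qf (mat_inv R) (y - M *\<^sub>v b)"
    using y Mb by (intro pd_matD(3)[OF pd_mat_inv[OF R]]) auto
  then show ?thesis unfolding b(2) crit_def using psd_matD(3)[OF Om b(1)] by simp
qed

lemma quad_Q_le_inv:
  assumes R: "pd_mat n R" and y: "y \<in> carrier_vec n"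
  shows "qf (Q R) y \<le> qf (mat_inv R) y"
proof -
  have O: "M *\<^sub>v 0\<^sub>v p = 0\<^sub>v n" using M by auto
  have "qf (Q R) y \<le> crit R y (0\<^sub>v p)" by (rule quad_Q_le_crit[OF R y]) simp
  also have "\<dots> = qf (mat_inv R) y"
    unfolding crit_def O using y psd_matD(1)[OF Om] by simp
  finally show ?thesis .
qed

text \<open>The minimiser for \<open>R'\<close> is inserted into the criterion for \<open>R\<close>.
  The penalty does not scale with \<open>R\<close>, hence the alternative in the hypothesis: it must
  not exceed \<open>t\<close> times itself.\<close>

lemma quad_Q_compare:
  assumes R: "pd_mat n R" and R': "pd_mat n R'" and t: "0 < t" "1 \<le> t \<or> Om = 0\<^sub>m p p"
    and le: "\<And>v. v \<in> carrier_vec n \<Longrightarrow> qf R' v \<le> t * (qf R v)"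
    and y: "y \<in> carrier_vec n"
  shows "qf (Q R) y \<le> t * (qf (Q R') y)"
proof -
  obtain b where b: "b \<in> carrier_vec p" "qf (Q R') y = crit R' y b" by (rule quad_Q_attained[OF R' y])
  let ?z = "y - M *\<^sub>v b"
  have z: "?z \<in> carrier_vec n" using y M b by auto
  have tR: "pd_mat n (t \<cdot>\<^sub>m R)" using R t by (intro pd_mat_smult) auto
  have "?z \<bullet> (mat_inv (t \<cdot>\<^sub>m R) *\<^sub>v ?z) \<le> ?z \<bullet> (mat_inv R' *\<^sub>v ?z)"
    by (rule inv_quad_antimono[OF R' tR _ z]) (use le pd_matD(1)[OF R] in \<open>simp add: quad_smult_mat[of _ n]\<close>)
  also have "mat_inv (t \<cdot>\<^sub>m R) = (1 / t) \<cdot>\<^sub>m mat_inv R" using R t by (intro mat_inv_smult) auto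
  finally have "?z \<bullet> (mat_inv R *\<^sub>v ?z) \<le> t * (?z \<bullet> (mat_inv R' *\<^sub>v ?z))"
    using inv_carrier(1)[OF R] z t by (simp add: quad_smult_mat[of _ n] field_simps)
  moreover have "qf Om b \<le> t * (qf Om b)"
  proof (cases "1 \<le> t")
    case True
    then show ?thesis using psd_matD(3)[OF Om b(1)] mult_right_mono[of 1 t "qf Om b"] by simp
  next
    case False
    then show ?thesis using t(2) b(1) by (simp add: zero_mat_mult_vec)
  qed
  moreover have "qf (Q R) y \<le> crit R y b" by (rule quad_Q_le_crit[OF R y b(1)])
  ultimately show ?thesis unfolding b(2) crit_def by (simp add: distrib_left)
qed

end

lemma add_minus_cancel_vec: "u + x - u = x"
  if "u \<in> carrier_vec n" "x \<in> carrier_vec n" for u x :: "real vec"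
  using that by (intro eq_vecI) auto

lemma minus_minus_vec: "x - (d - u) = u + x - d"
  if "u \<in> carrier_vec n" "x \<in> carrier_vec n" "d \<in> carrier_vec n" for u x d :: "real vec"
  using that by (intro eq_vecI) auto

text \<open>The Sherman-Morrison formula.\<close>

lemma inv_add_outer:
  assumes R: "pd_mat n R" and b: "b \<in> carrier_vec n"
  defines "w \<equiv> mat_inv R *\<^sub>v b"
  defines "c \<equiv> 1 / (1 + b \<bullet> w)"
  shows "mat_inv (R + outer b b) = mat_inv R - outer (c \<cdot>\<^sub>v w) w"
proof (rule mat_inv_eqI[of _ n])
  note RD = pd_matD[OF R] and Ri = pd_matD[OF pd_mat_inv[OF R]]
  have w: "w \<in> carrier_vec n" "c \<cdot>\<^sub>v w \<in> carrier_vec n" using Ri b by (auto simp: w_def)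
  have obb: "outer b b \<in> carrier_mat n n" and oww: "outer (c \<cdot>\<^sub>v w) w \<in> carrier_mat n n" using b w by auto
  show "R + outer b b \<in> carrier_mat n n" "mat_inv R - outer (c \<cdot>\<^sub>v w) w \<in> carrier_mat n n"
    using RD obb oww Ri by auto
  have "0 \<le> b \<bullet> w" unfolding w_def using psd_matD(3)[OF pd_mat_imp_psd[OF pd_mat_inv[OF R]] b] .
  then have c: "c + c * (b \<bullet> w) = 1" by (simp add: c_def field_simps)
  have Rw: "R *\<^sub>v w = b" unfolding w_def by (rule pd_mat_mult_inv[OF R b])
  have "(R + outer b b) * (mat_inv R - outer (c \<cdot>\<^sub>v w) w) = (R + outer b b) * mat_inv R - (R + outer b b) * outer (c \<cdot>\<^sub>v w) w"
    by (rule mult_minus_distrib_mat[OF _ Ri(1) oww]) (use RD obb in auto)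
  also have "(R + outer b b) * mat_inv R = 1\<^sub>m n + outer b w"
    unfolding add_mult_distrib_mat[OF RD(1) obb Ri(1)] mat_inv_right[OF RD(1) pd_mat_det_nonzero[OF R]] outer_mult[OF Ri(1) b] Ri(2) w_def ..
  also have "(R + outer b b) * outer (c \<cdot>\<^sub>v w) w = outer (c \<cdot>\<^sub>v b) w + (c * (b \<bullet> w)) \<cdot>\<^sub>m outer b w"
    unfolding add_mult_distrib_mat[OF RD(1) obb oww] mult_outer[OF RD(1) w(2)] outer_mult_outer[OF b w(2)] mult_mat_vec[OF RD(1) w(1)] Rw
    using b w by simp
  also have "1\<^sub>m n + outer b w - (outer (c \<cdot>\<^sub>v b) w + (c * (b \<bullet> w)) \<cdot>\<^sub>m outer b w) = 1\<^sub>m n"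
  proof (intro eq_matI)
    fix i j assume ij: "i < dim_row (1\<^sub>m n)" "j < dim_col (1\<^sub>m n)"
    have "b $ i * w $ j - (c * (b $ i * w $ j) + c * (b \<bullet> w) * (b $ i * w $ j)) = b $ i * w $ j * (1 - (c + c * (b \<bullet> w)))"
      by (simp add: algebra_simps)
    also have "\<dots> = 0" unfolding c by simp
    finally show "(1\<^sub>m n + outer b w - (outer (c \<cdot>\<^sub>v b) w + (c * (b \<bullet> w)) \<cdot>\<^sub>m outer b w)) $$ (i, j) = 1\<^sub>m n $$ (i, j)"
      using ij b w by (simp add: outer_def mult.assoc)
  qed (use b w in \<open>auto simp: outer_def\<close>)
  finally show "(R + outer b b) * (mat_inv R - outer (c \<cdot>\<^sub>v w) w) = 1\<^sub>m n" .
qed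

context gls
begin

lemma detprod_pos: "pd_mat n R \<Longrightarrow> 0 < detprod M Om R"
  unfolding detprod_def by (intro mult_pos_pos pd_mat_det_pos[of n] pd_mat_det_pos[of p] gls_pd)

lemma quad_gls_antimono:
  assumes R: "pd_mat n R" and R': "pd_mat n R'"
    and le: "\<And>v. v \<in> carrier_vec n \<Longrightarrow> qf R v \<le> qf R' v" and b: "b \<in> carrier_vec p"
  shows "qf (G R') b \<le> qf (G R) b"
  unfolding quad_gls[OF R b] quad_gls[OF R' b]
  using inv_quad_antimono[OF R R' le, of "M *\<^sub>v b"] M b by auto

text \<open>\<open>mdet R\<close> grows by the factor \<open>1 + be\<close>, and by Sherman-Morrison
  \<open>G\<close> changes by a negative rank-one term, whose factor is \<open>1 - c * ga\<close>.
  The product of the two is \<open>1 + be - ga\<close>, and \<open>be - ga\<close> is the form of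
  \<open>Q R\<close> by \<open>quad_Q\<close>. Its nonnegativity is what makes the product of
  determinants monotone.\<close>

lemma detprod_add_outer:
  assumes R: "pd_mat n R" and b: "b \<in> carrier_vec n"
  shows "detprod M Om (R + outer b b) = detprod M Om R * (1 + qf (Q R) b)"
proof -
  note RD = pd_matD[OF R] and Ri = pd_matD[OF pd_mat_inv[OF R]] and GD = pd_matD[OF gls_pd[OF R]]
  define w where "w = mat_inv R *\<^sub>v b"
  define be where "be = b \<bullet> w"
  define c where "c = 1 / (1 + be)"
  define g where "g = M\<^sup>T *\<^sub>v w"
  define ga where "ga = qf (mat_inv (G R)) g"
  have w: "w \<in> carrier_vec n" using Ri b by (auto simp: w_def)
  have g: "g \<in> carrier_vec p" using M w by (auto simp: g_def)
  have b0: "0 \<le> be" unfolding be_def w_def using psd_matD(3)[OF pd_mat_imp_psd[OF pd_mat_inv[OF R]] b] .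
  have Mt: "M\<^sup>T \<in> carrier_mat p n" using M by auto
  have oww: "outer (c \<cdot>\<^sub>v w) w \<in> carrier_mat n n" using w by auto
  have MtR: "M\<^sup>T * mat_inv R \<in> carrier_mat p n" using M Ri by auto
  have "M\<^sup>T * mat_inv (R + outer b b) = M\<^sup>T * mat_inv R - outer (c \<cdot>\<^sub>v g) w"
    unfolding inv_add_outer[OF R b] w_def[symmetric] be_def[symmetric] c_def[symmetric] mult_minus_distrib_mat[OF Mt Ri(1) oww]
    unfolding mult_outer[OF Mt smult_carrier_vec[THEN iffD2, OF w]] mult_mat_vec[OF Mt w] g_def ..
  then have "M\<^sup>T * mat_inv (R + outer b b) * M = M\<^sup>T * mat_inv R * M - outer (c \<cdot>\<^sub>v g) g"
    using minus_mult_distrib_mat[OF MtR _ M, of "outer (c \<cdot>\<^sub>v g) w"] w g by (simp add: outer_mult[OF M] g_def)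
  then have "G (R + outer b b) = G R + outer ((- c) \<cdot>\<^sub>v g) g"
    unfolding gls_of_def using MtRM_carrier[OF R] psd_matD(1)[OF Om] g
    by (intro eq_matI) (auto simp: outer_def)
  then have "mdet (G (R + outer b b)) = mdet (G R) * (1 + g \<bullet> (mat_inv (G R) *\<^sub>v ((- c) \<cdot>\<^sub>v g)))"
    using det_add_outer[OF GD(1) pd_mat_det_nonzero[OF gls_pd[OF R]], of "(- c) \<cdot>\<^sub>v g" g] g by simp
  also have "g \<bullet> (mat_inv (G R) *\<^sub>v ((- c) \<cdot>\<^sub>v g)) = - c * ga"
    unfolding ga_def using pd_matD(1)[OF pd_mat_inv[OF gls_pd[OF R]]] g by (simp add: mult_mat_vec[of _ p p])
  finally have 1: "mdet (G (R + outer b b)) = mdet (G R) * (1 - c * ga)" by simp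
  have 2: "mdet (R + outer b b) = mdet R * (1 + be)"
    unfolding be_def w_def by (rule det_add_outer[OF RD(1) pd_mat_det_nonzero[OF R] b b])
  have "qf (Q R) b = be - ga"
    unfolding quad_Q[OF R b] be_def ga_def g_def w_def ..
  moreover have "(1 + be) * (1 - c * ga) = 1 + be - ga" using b0 by (simp add: c_def field_simps)
  ultimately have "(1 + be) * (1 - c * ga) = 1 + qf (Q R) b" by simp
  then show ?thesis unfolding detprod_def 1 2
    by (metis (no_types, opaque_lifting) mult.assoc mult.left_commute)
qed

lemma detprod_mono:
  assumes R: "pd_mat n R" and R': "pd_mat n R'"
    and le: "\<And>v. v \<in> carrier_vec n \<Longrightarrow> qf R v \<le> qf R' v"
  shows "detprod M Om R \<le> detprod M Om R'"
proof -
  obtain C where C: "C \<in> carrier_mat n n" "add_cols R C n = R'"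
    using psd_diff_factor[OF R R' le] by blast
  have "detprod M Om R \<le> detprod M Om (add_cols R C k)" for k
  proof (induction k)
    case (Suc k)
    have pd: "pd_mat n (add_cols R C k)" by (rule pd_mat_add_cols[OF R C(1)])
    have c: "Matrix.col C k \<in> carrier_vec n" using C(1) by auto
    have "detprod M Om (add_cols R C k) \<le> detprod M Om (add_cols R C (Suc k))"
      using detprod_add_outer[OF pd c] detprod_pos[OF pd] psd_matD(3)[OF psd_Q[OF pd] c]
      by (simp add: algebra_simps)
    with Suc show ?case by linarith
  qed simp
  from this[of n] show ?thesis unfolding C(2) .
qed

lemma gls_smult_inv:
  assumes R: "pd_mat n R" and t: "0 < t"
  shows "b \<in> carrier_vec p \<Longrightarrow> qf (G (t \<cdot>\<^sub>m R)) b = (1 / t) * (qf (mat_inv R) (M *\<^sub>v b)) + qf Om b"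
  using t inv_carrier(1)[OF R] M quad_smult_mat[of "mat_inv R" n "M *\<^sub>v b" "1 / t"]
  by (subst quad_gls[OF pd_mat_smult[OF R t]]) (auto simp: mat_inv_smult[OF R])

lemma detprod_smult_le1:
  assumes R: "pd_mat n R" and t: "0 < t" "t \<le> 1"
  shows "t ^ n * detprod M Om R \<le> detprod M Om (t \<cdot>\<^sub>m R)"
proof -
  have tR: "pd_mat n (t \<cdot>\<^sub>m R)" by (rule pd_mat_smult[OF R t(1)])
  have "mdet (G R) \<le> mdet (G (t \<cdot>\<^sub>m R))"
  proof (rule det_mono(1)[OF gls_pd[OF R] gls_pd[OF tR]])
    fix v :: "real vec" assume v: "v \<in> carrier_vec p"
    have "0 \<le> qf (mat_inv R) (M *\<^sub>v v)"
      using M v by (intro psd_matD(3)[OF pd_mat_imp_psd[OF pd_mat_inv[OF R]]]) auto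
    then have "qf (mat_inv R) (M *\<^sub>v v) \<le> (1 / t) * (qf (mat_inv R) (M *\<^sub>v v))"
      using t mult_right_mono[of 1 "1 / t" "qf (mat_inv R) (M *\<^sub>v v)"] by simp
    then show "qf (G R) v \<le> qf (G (t \<cdot>\<^sub>m R)) v"
      unfolding gls_smult_inv[OF R t(1) v] quad_gls[OF R v] by simp
  qed
  then have "t ^ n * mdet R * mdet (G R) \<le> t ^ n * mdet R * mdet (G (t \<cdot>\<^sub>m R))"
    using t pd_mat_det_pos[OF R] by (intro mult_left_mono) auto
  then show ?thesis unfolding detprod_def using pd_matD(1)[OF R] by (simp add: mult.assoc)
qed

text \<open>Enlarging \<open>R\<close> shrinks \<open>G\<close>, but at most by \<open>1 / t\<close>
  in each of its \<open>p\<close> dimensions: the data part scales exactly and the penalty stays.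
  The net power \<open>n - p\<close> of \<open>t\<close> is the one that accompanies the quadratic
  form in the likelihood.\<close>

lemma detprod_smult_ge1:
  assumes R: "pd_mat n R" and t: "1 \<le> t"
  shows "t ^ n * (1 / t) ^ p * detprod M Om R \<le> detprod M Om (t \<cdot>\<^sub>m R)"
proof -
  have t0: "0 < t" using t by simp
  have tR: "pd_mat n (t \<cdot>\<^sub>m R)" by (rule pd_mat_smult[OF R t0])
  note GD = pd_matD[OF gls_pd[OF R]]
  have "mdet ((1 / t) \<cdot>\<^sub>m G R) \<le> mdet (G (t \<cdot>\<^sub>m R))"
  proof (rule det_mono(1)[OF _ gls_pd[OF tR]])
    show "pd_mat p ((1 / t) \<cdot>\<^sub>m G R)" using t0 by (intro pd_mat_smult gls_pd R) auto
    fix v :: "real vec" assume v: "v \<in> carrier_vec p"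
    have "0 \<le> qf Om v" by (rule psd_matD(3)[OF Om v])
    then have "(1 / t) * (qf Om v) \<le> qf Om v"
      using t by (simp add: divide_le_eq mult_right_mono[of 1 t, simplified] mult.commute)
    then show "v \<bullet> ((1 / t) \<cdot>\<^sub>m G R *\<^sub>v v) \<le> qf (G (t \<cdot>\<^sub>m R)) v"
      unfolding gls_smult_inv[OF R t0 v] quad_smult_mat[OF GD(1) v] quad_gls[OF R v] distrib_left by simp
  qed
  then have "(1 / t) ^ p * mdet (G R) \<le> mdet (G (t \<cdot>\<^sub>m R))"
    using GD by simp
  then have "t ^ n * mdet R * ((1 / t) ^ p * mdet (G R)) \<le> t ^ n * mdet R * mdet (G (t \<cdot>\<^sub>m R))"
    using t0 pd_mat_det_pos[OF R] by (intro mult_left_mono) auto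
  then show ?thesis unfolding detprod_def using pd_matD(1)[OF R] by (simp add: mult_ac)
qed

text \<open>\<open>G\<close> decreases, so only \<open>mdet R\<close> can grow.\<close>

lemma detprod_ratio:
  assumes R: "pd_mat n R" and R': "pd_mat n R'"
    and le: "\<And>v. v \<in> carrier_vec n \<Longrightarrow> qf R v \<le> qf R' v"
  shows "detprod M Om R' \<le> detprod M Om R * exp (mtrace (mat_inv R * R') - real n)"
proof -
  have "mdet (G R') \<le> mdet (G R)"
    by (rule det_mono(1)[OF gls_pd[OF R'] gls_pd[OF R] quad_gls_antimono[OF R R' le]])
  then have "detprod M Om R' \<le> (mdet R * exp (mtrace (mat_inv R * R') - real n)) * mdet (G R)"
    unfolding detprod_def using det_mono(2)[OF R R' le] pd_mat_det_pos[OF R] pd_mat_det_pos[OF gls_pd[OF R']]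
    by (intro mult_mono) auto
  then show ?thesis unfolding detprod_def by (simp add: mult_ac)
qed

text \<open>With the true coefficient as trial value the residual is the noise \<open>x\<close>, and
  besides it only the penalty remains.\<close>

lemma quad_Q_shift_le:
  assumes R: "pd_mat n R" and x: "x \<in> carrier_vec n" and b: "b \<in> carrier_vec p"
  shows "qf (Q R) (M *\<^sub>v b + x) \<le> qf (mat_inv R) x + qf Om b"
proof -
  have Mb: "M *\<^sub>v b \<in> carrier_vec n" using M b by auto
  have "M *\<^sub>v b + x - M *\<^sub>v b = x" by (rule add_minus_cancel_vec[OF Mb x])
  then show ?thesis using quad_Q_le_crit[OF R _ b, of "M *\<^sub>v b + x"] Mb x by (simp add: crit_def)
qed

lemma gls_flat: "gls n p M (0\<^sub>m p p)"
proof
  show "psd_mat p (0\<^sub>m p p)" by (auto simp: psd_mat_def zero_mat_mult_vec)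
qed (use M inj in auto)

text \<open>Under the flat prior a shift by a combination of the columns of \<open>M\<close> costs
  nothing; the minimiser \<open>d\<close> becomes the trial value \<open>d - b\<close>. Together
  with \<open>quad_Q_shift_le\<close> this removes the unknown mean from both bounds.\<close>

lemma quad_Q_flat_le:
  assumes R: "pd_mat n R" and x: "x \<in> carrier_vec n" and b: "b \<in> carrier_vec p"
  shows "qf (Q_of M (0\<^sub>m p p) R) x \<le> qf (Q R) (M *\<^sub>v b + x)"
proof -
  interpret flat: gls n p M "0\<^sub>m p p" by (rule gls_flat)
  have Mb: "M *\<^sub>v b \<in> carrier_vec n" using M b by auto
  obtain d where d: "d \<in> carrier_vec p" "qf (Q R) (M *\<^sub>v b + x) = crit R (M *\<^sub>v b + x) d"
    using quad_Q_attained[OF R, of "M *\<^sub>v b + x"] Mb x by auto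
  have db: "d - b \<in> carrier_vec p" using d b by auto
  have Md: "M *\<^sub>v d \<in> carrier_vec n" using M d by auto
  have "x - M *\<^sub>v (d - b) = M *\<^sub>v b + x - M *\<^sub>v d"
    unfolding mult_minus_distrib_mat_vec[OF M d(1) b] by (rule minus_minus_vec[OF Mb x Md])
  then have "flat.crit R x (d - b) \<le> crit R (M *\<^sub>v b + x) d"
    unfolding flat.crit_def crit_def using psd_matD(3)[OF Om d(1)] db by (simp add: zero_mat_mult_vec)
  then show ?thesis using flat.quad_Q_le_crit[OF R x db] d(2) by simp
qed

text \<open>\<open>Q R * R\<close> is the identity minus a projection of rank \<open>p\<close>;
  cyclicity reduces the trace of the projection to that of the identity of size
  \<open>p\<close>.\<close>

lemma mtrace_Q_flat:
  assumes R: "pd_mat n R"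
  shows "mtrace (Q_of M (0\<^sub>m p p) R * R) = real n - real p"
proof -
  interpret flat: gls n p M "0\<^sub>m p p" by (rule gls_flat)
  note RD = pd_matD[OF R] and Ri = pd_matD[OF pd_mat_inv[OF R]]
  note Gpd = flat.gls_pd[OF R]
  note Gi = pd_matD[OF pd_mat_inv[OF Gpd]]
  have RR: "mat_inv R * R = 1\<^sub>m n" by (rule mat_inv_left[OF RD(1) pd_mat_det_nonzero[OF R]])
  let ?B = "mat_inv R * M * mat_inv (flat.G R)"
  have 1: "mat_inv R * M \<in> carrier_mat n p" using M Ri by auto
  have 2: "?B \<in> carrier_mat n p" using 1 Gi by auto
  have Mt: "M\<^sup>T \<in> carrier_mat p n" using M by auto
  have 3: "?B * M\<^sup>T \<in> carrier_mat n n" using 2 Mt by auto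
  have G0: "flat.G R = M\<^sup>T * mat_inv R * M"
    unfolding gls_of_def using MtRM_carrier[OF R] by simp
  have "Q_of M (0\<^sub>m p p) R * R = mat_inv R * R - ?B * M\<^sup>T * mat_inv R * R"
    unfolding Q_of_def using 3 Ri RD by (intro minus_mult_distrib_mat[of _ n n]) auto
  also have "?B * M\<^sup>T * mat_inv R * R = ?B * M\<^sup>T"
    using assoc_mult_mat[OF 3 Ri(1) RD(1)] unfolding RR right_mult_one_mat[OF 3] .
  finally have "mtrace (Q_of M (0\<^sub>m p p) R * R) = mtrace (1\<^sub>m n) - mtrace (?B * M\<^sup>T)"
    using 3 by (simp add: RR mtrace_minus[of _ n])
  also have "mtrace (?B * M\<^sup>T) = mtrace (M\<^sup>T * ?B)"
    using 2 Mt by (intro mtrace_mult_comm[of _ n p])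
  also have "M\<^sup>T * ?B = M\<^sup>T * (mat_inv R * M) * mat_inv (flat.G R)"
    by (rule assoc_mult_mat[OF Mt 1 Gi(1), symmetric])
  also have "M\<^sup>T * (mat_inv R * M) = flat.G R"
    unfolding G0 by (rule assoc_mult_mat[OF Mt Ri(1) M, symmetric])
  also have "flat.G R * mat_inv (flat.G R) = 1\<^sub>m p"
    by (rule mat_inv_right[OF pd_matD(1)[OF Gpd] pd_mat_det_nonzero[OF Gpd]])
  finally show ?thesis by (simp add: mtrace_one)
qed

end

lemma mtrace_psd_mono_left:
  assumes D: "psd_mat n D" and G: "G \<in> carrier_mat n n" "H \<in> carrier_mat n n"
    and le: "\<And>v. v \<in> carrier_vec n \<Longrightarrow> qf G v \<le> qf H v"
  shows "mtrace (G * D) \<le> mtrace (H * D)"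
  using mtrace_psd_mono[OF D G le] mtrace_mult_comm[OF G(1) psd_matD(1)[OF D]] mtrace_mult_comm[OF G(2) psd_matD(1)[OF D]]
  by simp

lemma mtrace_mult_minus:
  assumes "A \<in> carrier_mat n n" "B \<in> carrier_mat n n" "C \<in> carrier_mat n n"
  shows "mtrace (A * (B - C)) = mtrace (A * B) - mtrace (A * C)"
    and "mtrace ((B - C) * A) = mtrace (B * A) - mtrace (C * A)"
  using assms by (simp_all add: mult_minus_distrib_mat[of _ n n] minus_mult_distrib_mat[of _ n n] mtrace_minus[of _ n])

section \<open>Correlation matrices of the Matern family\<close>

definition scaled_mat :: "real \<Rightarrow> nat \<Rightarrow> (nat \<Rightarrow> 'a::real_normed_vector) \<Rightarrow> real \<Rightarrow> real mat" where
  "scaled_mat nu n x al = al powr (- 2 * nu) \<cdot>\<^sub>m corr_mat nu n x al"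

lemma matern_minus_commute: "matern nu al (x - y) = matern nu al (y - x)"
  by (simp add: matern_def norm_minus_commute)

lemma quad_corr_mat:
  assumes "v \<in> carrier_vec n"
  shows "qf (corr_mat nu n x al) v = matern_form nu al n x (\<lambda>i. v $ i)"
  using assms by (subst quad_eq_sum[of _ n]) (auto simp: corr_mat_def matern_form_def)

lemma corr_mat_carrier: "corr_mat nu n x al \<in> carrier_mat n n"
  by (simp add: corr_mat_def)

locale matern_points =
  fixes nu :: real and n :: nat and x :: "nat \<Rightarrow> 'a::euclidean_space"
  assumes nu: "0 < nu" and inj_pts: "inj_on x {..<n}"
begin

abbreviation "R \<equiv> corr_mat nu n x"
abbreviation "S \<equiv> scaled_mat nu n x"

lemma pd_R:
  assumes "0 < al"
  shows "pd_mat n (R al)"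
proof -
  have "(R al)\<^sup>T = R al"
    by (intro eq_matI) (auto simp: corr_mat_def matern_minus_commute[of nu al])
  moreover have "0 < qf (R al) v" if v: "v \<in> carrier_vec n" "v \<noteq> 0\<^sub>v n" for v
  proof -
    obtain i where "i < n" "v $ i \<noteq> 0" using v by (metis carrier_vecD eq_vecI index_zero_vec)
    then show ?thesis unfolding quad_corr_mat[OF v(1)]
      by (intro matern_form_pos[OF nu assms inj_pts])
  qed
  ultimately show ?thesis by (simp add: pd_mat_def corr_mat_carrier)
qed

lemma pd_S: "0 < al \<Longrightarrow> pd_mat n (S al)"
  unfolding scaled_mat_def by (intro pd_mat_smult pd_R) auto

lemma quad_S: "v \<in> carrier_vec n \<Longrightarrow> qf (S al) v = scaled_form nu al n x (\<lambda>i. v $ i)"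
  unfolding scaled_mat_def by (simp add: quad_smult_mat[of _ n] corr_mat_carrier quad_corr_mat scaled_form_def)

lemma quad_S_R: "v \<in> carrier_vec n \<Longrightarrow> qf (S al) v = al powr (- 2 * nu) * (qf (R al) v)"
  unfolding scaled_mat_def by (simp add: quad_smult_mat[of _ n] corr_mat_carrier)

lemma quad_S_antimono:
  assumes "0 < a" "a \<le> b" "v \<in> carrier_vec n"
  shows "qf (S b) v \<le> qf (S a) v"
  unfolding quad_S[OF assms(3)] by (rule scaled_form_antimono[OF nu assms(1,2)])

lemma quad_R_le_smaller:
  assumes "0 < a" "a \<le> b" "v \<in> carrier_vec n"
  shows "qf (R a) v \<le> (b / a) powr DIM('a) * (qf (R b) v)"
proof -
  have "a powr DIM('a) * (qf (R a) v) \<le> b powr DIM('a) * (qf (R b) v)"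
    unfolding quad_corr_mat[OF assms(3)] by (rule matern_form_mono[OF nu assms(1,2)])
  then show ?thesis using assms by (simp add: powr_divide field_simps)
qed

lemma quad_R_le_larger:
  assumes "0 < a" "a \<le> b" "v \<in> carrier_vec n"
  shows "qf (R b) v \<le> (b / a) powr (2 * nu) * (qf (R a) v)"
proof -
  have "b powr (- 2 * nu) * (qf (R b) v) \<le> a powr (- 2 * nu) * (qf (R a) v)"
    using quad_S_antimono[OF assms] unfolding quad_S_R[OF assms(3)] .
  then show ?thesis using assms by (simp add: powr_divide powr_minus field_simps)
qed

lemma inv_S: "0 < al \<Longrightarrow> mat_inv (S al) = al powr (2 * nu) \<cdot>\<^sub>m mat_inv (R al)"
  unfolding scaled_mat_def by (subst mat_inv_smult[OF pd_R]) (auto simp: powr_minus divide_inverse)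

end

text \<open>The columns of \<open>C\<close> form a basis orthonormal for \<open>S\<close>: for
  square matrices the one-sided inverse in \<open>C * (C\<^sup>T * S) = 1\<^sub>m n\<close> is
  two-sided.\<close>

lemma orthonormal_factor:
  assumes S: "pd_mat n S"
  obtains C where "C \<in> carrier_mat n n" "mat_inv S = C * C\<^sup>T" "C\<^sup>T * S * C = 1\<^sub>m n"
proof -
  note SD = pd_matD[OF S]
  obtain C where C: "C \<in> carrier_mat n n" "mat_inv S = C * C\<^sup>T"
    using psd_mat_factor[OF pd_mat_imp_psd[OF pd_mat_inv[OF S]]] by blast
  have Ct: "C\<^sup>T \<in> carrier_mat n n" using C by auto
  have CS: "C\<^sup>T * S \<in> carrier_mat n n" using Ct SD by auto
  have "C * (C\<^sup>T * S) = mat_inv S * S"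
    unfolding C(2) by (rule assoc_mult_mat[OF C(1) Ct SD(1), symmetric])
  also have "\<dots> = 1\<^sub>m n" by (rule mat_inv_left[OF SD(1) pd_mat_det_nonzero[OF S]])
  finally have "C\<^sup>T * S * C = 1\<^sub>m n"
    by (rule mat_mult_left_right_inverse[OF C(1) CS])
  with C show ?thesis using that by blast
qed

text \<open>With the factor from \<open>orthonormal_factor\<close> the trace is the sum of the form
  of \<open>S a\<close> over a basis orthonormal for \<open>S b\<close>, the situation of
  \<open>scaled_form_sum_le\<close>.\<close>

lemma mtrace_inv_scaled_mat_le:
  fixes nu T :: real
  assumes nu: "0 < nu" and dim: "DIM('a::euclidean_space) \<le> 3"
  defines "e \<equiv> 2 * nu + real DIM('a) + 2"
  obtains C where "0 < C"
    "\<And>n (x :: nat \<Rightarrow> 'a) a b. 1 \<le> n \<Longrightarrow> inj_on x {..<n} \<Longrightarrow> (\<And>j e. j < n \<Longrightarrow> e \<in> Basis \<Longrightarrow> \<bar>inner (x j) e\<bar> \<le> T) \<Longrightarrow>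
       0 < a \<Longrightarrow> a \<le> 1 \<Longrightarrow> 1 \<le> b \<Longrightarrow>
       mtrace (mat_inv (scaled_mat nu n x b) * scaled_mat nu n x a) \<le> real n + C * (b / a) powr e * real n powr (1 / 3)"
proof (rule scaled_form_sum_le[OF nu dim, of T], goal_cases)
  case (1 C)
  have e: "2 * (nu + real DIM('a) / 2) + 2 = e" by (simp add: e_def)
  show ?case
  proof (rule 1(1)[OF 1(2)])
    fix n and x :: "nat \<Rightarrow> 'a" and a b :: real
    assume n: "1 \<le> n" and inj: "inj_on x {..<n}" and x: "\<And>j e. j < n \<Longrightarrow> e \<in> Basis \<Longrightarrow> \<bar>inner (x j) e\<bar> \<le> T"
      and a: "0 < a" "a \<le> 1" and b: "1 \<le> b"
    have b0: "0 < b" using b by simp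
    interpret matern_points nu n x by standard (rule nu, rule inj)
    note Sb = pd_matD[OF pd_S[OF b0]]
    obtain Cm where Cm: "Cm \<in> carrier_mat n n" "mat_inv (S b) = Cm * Cm\<^sup>T" "Cm\<^sup>T * S b * Cm = 1\<^sub>m n"
      by (rule orthonormal_factor[OF pd_S[OF b0]])
    define u where "u = (\<lambda>k i. Cm $$ (i, k))"
    have "scaled_form nu b n x (\<lambda>i. \<Sum>k<n. l k * u k i) = (\<Sum>k<n. (l k)\<^sup>2)" for l
    proof -
      define L where "L = Matrix.vec n l"
      have L: "L \<in> carrier_vec n" by (simp add: L_def)
      have CL: "Cm *\<^sub>v L \<in> carrier_vec n" using Cm L by auto
      have CS: "Cm\<^sup>T * S b \<in> carrier_mat n n" using Cm Sb by auto
      have "scaled_form nu b n x (\<lambda>i. \<Sum>k<n. l k * u k i) = scaled_form nu b n x (\<lambda>i. (Cm *\<^sub>v L) $ i)"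
        using Cm L by (auto simp: scaled_form_def matern_form_def scalar_prod_def lessThan_atLeast0 u_def L_def mult.commute)
      also have "\<dots> = qf (S b) (Cm *\<^sub>v L)" by (rule quad_S[OF CL, symmetric])
      also have "\<dots> = (S b *\<^sub>v (Cm *\<^sub>v L)) \<bullet> (Cm *\<^sub>v L)" using CL Sb by (intro comm_scalar_prod[of _ n]) auto
      also have "\<dots> = (Cm\<^sup>T *\<^sub>v (S b *\<^sub>v (Cm *\<^sub>v L))) \<bullet> L"
        using CL Sb by (intro transpose_vec_mult_scalar[OF Cm(1) L, symmetric]) auto
      also have "Cm\<^sup>T *\<^sub>v (S b *\<^sub>v (Cm *\<^sub>v L)) = Cm\<^sup>T * S b * Cm *\<^sub>v L"
        unfolding assoc_mult_mat_vec[OF CS Cm(1) L] using Cm Sb CL by (intro assoc_mult_mat_vec[of _ n n _ n, symmetric]) auto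
      also have "\<dots> = L" unfolding Cm(3) using L by simp
      also have "L \<bullet> L = (\<Sum>k<n. (l k)\<^sup>2)"
        by (simp add: L_def scalar_prod_def lessThan_atLeast0 power2_eq_square)
      finally show ?thesis .
    qed
    then have "(\<Sum>k<n. scaled_form nu a n x (u k)) \<le> real n + C * (b / a) powr e * real n powr (1 / 3)"
      using 1(3)[where u=u and x=x, OF n x a b] unfolding e by blast
    moreover have "mtrace (mat_inv (S b) * S a) = (\<Sum>k<n. scaled_form nu a n x (u k))"
      unfolding Cm(2) mtrace_factor[OF Cm(1) pd_matD(1)[OF pd_S[OF a(1)]]]
    proof (intro sum.cong refl)
      fix k assume "k \<in> {..<n}"
      then show "qf (S a) (Matrix.col Cm k) = scaled_form nu a n x (u k)"
        using Cm(1) by (subst quad_S) (auto simp: scaled_form_def matern_form_def u_def)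
    qed
    ultimately show "mtrace (mat_inv (S b) * S a) \<le> real n + C * (b / a) powr e * real n powr (1 / 3)" by simp
  qed
qed

section \<open>The regression quantities as functions of the inverse length scale\<close>

locale matern_gls = gls n p M Om + matern_points nu n x
  for n p M Om nu and x :: "nat \<Rightarrow> 'a::euclidean_space"
begin

definition q :: "real \<Rightarrow> real vec \<Rightarrow> real" where
  "q al y = qf (Q (R al)) y"

definition D :: "real \<Rightarrow> real" where
  "D al = detprod M Om (R al)"

lemma q_compare_smaller:
  assumes "0 < a" "a \<le> b" "y \<in> carrier_vec n"
  shows "q b y \<le> (b / a) powr DIM('a) * q a y"
  unfolding q_def using assms
  by (intro quad_Q_compare pd_R quad_R_le_smaller) (auto intro!: disjI1 ge_one_powr_ge_zero)

lemma q_compare_larger: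
  assumes "0 < a" "a \<le> b" "y \<in> carrier_vec n"
  shows "q a y \<le> (b / a) powr (2 * nu) * q b y"
  unfolding q_def using assms nu
  by (intro quad_Q_compare pd_R quad_R_le_larger) (auto intro!: disjI1 ge_one_powr_ge_zero)

lemma D_pos: "0 < al \<Longrightarrow> 0 < D al"
  unfolding D_def by (intro detprod_pos pd_R)

lemma D_compare:
  assumes R1: "pd_mat n R1" and R2: "pd_mat n R2" and t: "1 \<le> t"
    and le: "\<And>v. v \<in> carrier_vec n \<Longrightarrow> qf R2 v \<le> t * (qf R1 v)"
  shows "detprod M Om R2 \<le> t ^ n * detprod M Om R1"
proof -
  have t': "0 < 1 / t" "1 / t \<le> 1" using t by auto
  have "(1 / t) ^ n * detprod M Om R2 \<le> detprod M Om ((1 / t) \<cdot>\<^sub>m R2)"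
    by (rule detprod_smult_le1[OF R2 t'])
  also have "\<dots> \<le> detprod M Om R1"
  proof (rule detprod_mono[OF pd_mat_smult[OF R2 t'(1)] R1])
    fix v :: "real vec" assume v: "v \<in> carrier_vec n"
    show "v \<bullet> ((1 / t) \<cdot>\<^sub>m R2 *\<^sub>v v) \<le> qf R1 v"
      unfolding quad_smult_mat[OF pd_matD(1)[OF R2] v] using le[OF v] t by (simp add: divide_le_eq mult.commute)
  qed
  finally show ?thesis using t by (simp add: power_divide divide_le_eq mult.commute)
qed

lemma D_compare_smaller:
  assumes "0 < a" "a \<le> b"
  shows "D b \<le> ((b / a) powr (2 * nu)) ^ n * D a"
  unfolding D_def using assms nu
  by (intro D_compare pd_R quad_R_le_larger) (auto intro!: ge_one_powr_ge_zero)

lemma D_compare_larger: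
  assumes "0 < a" "a \<le> b"
  shows "D a \<le> ((b / a) powr DIM('a)) ^ n * D b"
  unfolding D_def using assms
  by (intro D_compare pd_R quad_R_le_smaller) (auto intro!: ge_one_powr_ge_zero)

text \<open>For the scaled matrices the comparison is nearly exact: \<open>S b\<close> lies below
  \<open>S a\<close>, and the loss in the logarithm is only the excess of the trace over
  \<open>n\<close>. The powers of \<open>t\<close>, \<open>n - p\<close> in total, come from
  rescaling to \<open>R b\<close>.\<close>

lemma D_compare_trace:
  assumes "0 < a" "a \<le> b"
  shows "((b / a) powr (2 * nu)) ^ n * (1 / (b / a) powr (2 * nu)) ^ p * D a \<le> D b * exp (mtrace (mat_inv (S b) * S a) - real n)"
proof -
  have b: "0 < b" using assms by simp
  define t where "t = (b / a) powr (2 * nu)"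
  have t: "1 \<le> t" unfolding t_def using assms nu by (intro ge_one_powr_ge_zero) auto
  define r where "r = a powr (2 * nu)"
  have r: "0 < r" using assms by (simp add: r_def)
  have RS: "R al = al powr (2 * nu) \<cdot>\<^sub>m S al" if "0 < al" for al
    unfolding scaled_mat_def using that by (intro eq_matI) (auto simp: powr_minus)
  have Ra: "R a = r \<cdot>\<^sub>m S a" unfolding r_def by (rule RS[OF assms(1)])
  have Rb: "R b = t \<cdot>\<^sub>m (r \<cdot>\<^sub>m S b)"
  proof -
    have "t * r = b powr (2 * nu)" unfolding t_def r_def using assms by (simp add: powr_divide)
    then show ?thesis unfolding RS[OF b] by (intro eq_matI) (auto simp: mult.assoc[symmetric])
  qed
  have rS: "pd_mat n (r \<cdot>\<^sub>m S b)" by (intro pd_mat_smult pd_S b r)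
  have le: "v \<bullet> (r \<cdot>\<^sub>m S b *\<^sub>v v) \<le> qf (R a) v" if v: "v \<in> carrier_vec n" for v
    unfolding Ra quad_smult_mat[OF pd_matD(1)[OF pd_S[OF b]] v] quad_smult_mat[OF pd_matD(1)[OF pd_S[OF assms(1)]] v]
    using quad_S_antimono[OF assms v] r by simp
  have "mat_inv (r \<cdot>\<^sub>m S b) * R a = mat_inv (S b) * S a"
    unfolding Ra using r pd_matD(1)[OF pd_S[OF assms(1)]] pd_matD(1)[OF pd_mat_inv[OF pd_S[OF b]]]
    by (subst mat_inv_smult[OF pd_S[OF b]]) (auto simp: mult_smult_assoc_mat[of _ n n _ n] mult_smult_distrib[of _ n n _ n] intro!: eq_matI)
  then have "D a \<le> detprod M Om (r \<cdot>\<^sub>m S b) * exp (mtrace (mat_inv (S b) * S a) - real n)"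
    unfolding D_def using detprod_ratio[OF rS pd_R[OF assms(1)] le] by simp
  then have "t ^ n * (1 / t) ^ p * D a \<le> (t ^ n * (1 / t) ^ p * detprod M Om (r \<cdot>\<^sub>m S b)) * exp (mtrace (mat_inv (S b) * S a) - real n)"
    using t by (simp add: mult.assoc mult_left_mono)
  also have "\<dots> \<le> detprod M Om (R b) * exp (mtrace (mat_inv (S b) * S a) - real n)"
    unfolding Rb by (intro mult_right_mono detprod_smult_ge1[OF rS t]) auto
  finally show ?thesis unfolding t_def D_def .
qed

abbreviation "Q0 \<equiv> Q_of M (0\<^sub>m p p)"

lemma quad_inv_S:
  assumes "0 < al" "z \<in> carrier_vec n"
  shows "qf (mat_inv (S al)) z = al powr (2 * nu) * (qf (mat_inv (R al)) z)"
  unfolding inv_S[OF assms(1)] by (rule quad_smult_mat[OF pd_matD(1)[OF pd_mat_inv[OF pd_R[OF assms(1)]]] assms(2)])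

lemma quad_inv_S_mono:
  assumes "0 < a" "a \<le> b" "z \<in> carrier_vec n"
  shows "qf (mat_inv (S a)) z \<le> qf (mat_inv (S b)) z"
  using assms by (intro inv_quad_antimono[OF pd_S pd_S] quad_S_antimono) auto

lemma quad_Q0_le_inv:
  assumes "0 < a" "z \<in> carrier_vec n"
  shows "qf (Q0 (S a)) z \<le> qf (mat_inv (S a)) z"
proof -
  interpret flat: gls n p M "0\<^sub>m p p" by (rule gls_flat)
  show ?thesis by (rule flat.quad_Q_le_inv[OF pd_S[OF assms(1)] assms(2)])
qed

text \<open>This bound and \<open>q_upper\<close> have sides that are free of \<open>al\<close> and
  contain the mean only through a penalty. The flat prior is taken here because the factor
  \<open>al powr (2 * nu)\<close> may be less than 1, which \<open>quad_Q_compare\<close> admits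
  only without penalty.\<close>

lemma q_lower:
  assumes "0 < a" "a \<le> al" and z: "z \<in> carrier_vec n" and b: "b \<in> carrier_vec p"
  shows "qf (Q0 (S a)) z \<le> al powr (2 * nu) * q al (M *\<^sub>v b + z)"
proof -
  have al: "0 < al" using assms by simp
  interpret flat: gls n p M "0\<^sub>m p p" by (rule gls_flat)
  have "qf (Q0 (S a)) z \<le> al powr (2 * nu) * (qf (Q0 (R al)) z)"
  proof (rule flat.quad_Q_compare[OF pd_S[OF assms(1)] pd_R[OF al] _ _ _ z])
    fix v :: "real vec" assume v: "v \<in> carrier_vec n"
    have "al powr (2 * nu) * (qf (S al) v) = qf (R al) v"
      unfolding quad_S_R[OF v] using al by (simp add: mult.assoc[symmetric] powr_add[symmetric])
    moreover have "al powr (2 * nu) * (qf (S al) v) \<le> al powr (2 * nu) * (qf (S a) v)"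
      by (intro mult_left_mono quad_S_antimono[OF assms(1,2) v]) auto
    ultimately show "qf (R al) v \<le> al powr (2 * nu) * (qf (S a) v)" by simp
  qed (use al in auto)
  also have "\<dots> \<le> al powr (2 * nu) * q al (M *\<^sub>v b + z)"
    unfolding q_def by (intro mult_left_mono quad_Q_flat_le[OF pd_R[OF al] z b]) auto
  finally show ?thesis .
qed

lemma q_upper:
  assumes "0 < al" "al \<le> c" and z: "z \<in> carrier_vec n" and b: "b \<in> carrier_vec p"
  shows "al powr (2 * nu) * q al (M *\<^sub>v b + z) \<le> qf (mat_inv (S c)) z + c powr (2 * nu) * (qf Om b)"
proof -
  have "al powr (2 * nu) * q al (M *\<^sub>v b + z) \<le> al powr (2 * nu) * (qf (mat_inv (R al)) z + qf Om b)"
    unfolding q_def by (intro mult_left_mono quad_Q_shift_le[OF pd_R[OF assms(1)] z b]) auto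
  also have "\<dots> = qf (mat_inv (S al)) z + al powr (2 * nu) * (qf Om b)"
    unfolding quad_inv_S[OF assms(1) z] by (simp add: distrib_left)
  also have "\<dots> \<le> qf (mat_inv (S c)) z + c powr (2 * nu) * (qf Om b)"
    using assms nu psd_matD(3)[OF Om b] by (intro add_mono quad_inv_S_mono mult_right_mono powr_mono2) auto
  finally show ?thesis .
qed

text \<open>The random fluctuation of the profiled quadratic form over \<open>[a, c]\<close> is bounded by the form of this matrix.\<close>

definition spread :: "real \<Rightarrow> real \<Rightarrow> real mat" where
  "spread a c = mat_inv (S c) - Q0 (S a)"

lemma spread_carrier:
  assumes "0 < a" "0 < c"
  shows "mat_inv (S c) \<in> carrier_mat n n" "Q0 (S a) \<in> carrier_mat n n"
proof -
  interpret flat: gls n p M "0\<^sub>m p p" by (rule gls_flat)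
  show "mat_inv (S c) \<in> carrier_mat n n" by (rule pd_matD(1)[OF pd_mat_inv[OF pd_S[OF assms(2)]]])
  show "Q0 (S a) \<in> carrier_mat n n" by (rule flat.Q_carrier[OF pd_S[OF assms(1)]])
qed

lemma quad_spread:
  assumes "0 < a" "0 < c" "z \<in> carrier_vec n"
  shows "qf (spread a c) z = qf (mat_inv (S c)) z - qf (Q0 (S a)) z"
  unfolding spread_def using spread_carrier[OF assms(1,2)] assms(3)
  by (simp add: minus_mult_distrib_mat_vec[of _ n n] scalar_prod_minus_distrib[of _ n])

lemma psd_spread:
  assumes "0 < a" "a \<le> c"
  shows "psd_mat n (spread a c)"
proof -
  interpret flat: gls n p M "0\<^sub>m p p" by (rule gls_flat)
  have c: "0 < c" using assms by simp
  note Sc = pd_matD[OF pd_mat_inv[OF pd_S[OF c]]]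
  show ?thesis unfolding spread_def
  proof (rule psd_mat_diff[OF flat.Q_carrier[OF pd_S[OF assms(1)]] flat.Q_sym[OF pd_S[OF assms(1)]] Sc(1,2)])
    fix v :: "real vec" assume v: "v \<in> carrier_vec n"
    show "qf (Q0 (S a)) v \<le> qf (mat_inv (S c)) v"
      using quad_Q0_le_inv[OF assms(1) v] quad_inv_S_mono[OF assms v] by simp
  qed
qed

text \<open>Three contributions: the excess over \<open>n\<close> of the trace at the upper
  endpoint, the \<open>p\<close> lost by \<open>Q0 (S a)\<close>, and the error of pairing
  \<open>Q0 (S a)\<close> with \<open>S al0\<close> instead of \<open>S a\<close>. For the last one,
  \<open>Q0 (S a)\<close> is replaced by the larger \<open>mat_inv (S b')\<close> against the
  positive difference \<open>S a - S al0\<close>. The points \<open>a'\<close> and \<open>b'\<close>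
  stand in for \<open>al0\<close> because the trace estimate compares a point below 1 with one
  above.\<close>

lemma mtrace_spread_le:
  assumes a: "0 < a" "a \<le> al0" and c: "al0 \<le> c" and a': "0 < a'" "a' \<le> al0" and b': "al0 \<le> b'"
  shows "mtrace (spread a c * S al0) \<le> real p + (mtrace (mat_inv (S c) * S a') - real n) + (mtrace (mat_inv (S b') * S a) - real n)"
proof -
  interpret flat: gls n p M "0\<^sub>m p p" by (rule gls_flat)
  have pos: "0 < al0" "0 < c" "0 < b'" using assms by auto
  note S = pd_matD(1)[OF pd_S] and Si = pd_matD(1)[OF pd_mat_inv[OF pd_S]]
  have le: "mtrace (mat_inv (S e) * S b) \<le> mtrace (mat_inv (S e) * S b2)" if "0 < e" "0 < b2" "b2 \<le> b" for e b b2
    by (rule mtrace_psd_mono[OF pd_mat_imp_psd[OF pd_mat_inv[OF pd_S[OF that(1)]]]])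
      (use that S quad_S_antimono in auto)
  have one: "mtrace (mat_inv (S e) * S e) = real n" if "0 < e" for e
    using mat_inv_left[OF S[OF that] pd_mat_det_nonzero[OF pd_S[OF that]]] by (simp add: mtrace_one)
  have psd: "psd_mat n (S a - S al0)"
    by (rule psd_mat_diff[OF pd_matD(1,2)[OF pd_S[OF pos(1)]] pd_matD(1,2)[OF pd_S[OF a(1)]] quad_S_antimono[OF a]])
  have Qc: "Q0 (S a) \<in> carrier_mat n n" by (rule flat.Q_carrier[OF pd_S[OF a(1)]])
  have "mtrace (Q0 (S a) * S a) - mtrace (Q0 (S a) * S al0) = mtrace (Q0 (S a) * (S a - S al0))"
    by (rule mtrace_mult_minus(1)[symmetric, OF Qc S[OF a(1)] S[OF pos(1)]])
  also have "\<dots> \<le> mtrace (mat_inv (S b') * (S a - S al0))"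
  proof (rule mtrace_psd_mono_left[OF psd Qc Si[OF pos(3)]])
    fix v :: "real vec" assume v: "v \<in> carrier_vec n"
    show "qf (Q0 (S a)) v \<le> qf (mat_inv (S b')) v"
      using quad_Q0_le_inv[OF a(1) v] quad_inv_S_mono[OF a(1) _ v, of b'] a b' by simp
  qed
  also have "\<dots> = mtrace (mat_inv (S b') * S a) - mtrace (mat_inv (S b') * S al0)"
    by (rule mtrace_mult_minus(1)[OF Si[OF pos(3)] S[OF a(1)] S[OF pos(1)]])
  also have "\<dots> \<le> mtrace (mat_inv (S b') * S a) - real n"
    using le[OF pos(3,1) b'] one[OF pos(3)] by simp
  finally have 1: "mtrace (Q0 (S a) * S a) - mtrace (Q0 (S a) * S al0) \<le> mtrace (mat_inv (S b') * S a) - real n" .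
  have "mtrace (Q0 (S a) * S a) = real n - real p" by (rule mtrace_Q_flat[OF pd_S[OF a(1)]])
  moreover have "mtrace (spread a c * S al0) = mtrace (mat_inv (S c) * S al0) - mtrace (Q0 (S a) * S al0)"
    unfolding spread_def by (rule mtrace_mult_minus(2)[OF S[OF pos(1)] Si[OF pos(2)] Qc])
  moreover have "mtrace (mat_inv (S c) * S al0) \<le> mtrace (mat_inv (S c) * S a')" by (rule le[OF pos(2) a'])
  ultimately show ?thesis using 1 by linarith
qed

end

section \<open>Gaussian vectors and tail bounds\<close>

lemma sets_normal_law [simp, measurable_cong]: "sets (normal_law mu v) = sets borel"
  and space_normal_law [simp]: "space (normal_law mu v) = UNIV"
  by (auto simp: normal_law_def)

lemma prob_space_normal_law: "prob_space (normal_law mu v)"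
  unfolding normal_law_def by (auto intro!: prob_space_normal_density prob_space_return)

lemma nn_integral_normal_law:
  assumes [measurable]: "f \<in> borel_measurable borel"
  shows "(\<integral>\<^sup>+x. f x \<partial>normal_law mu v) = (if 0 < v then (\<integral>\<^sup>+x. ennreal (normal_density mu (sqrt v) x) * f x \<partial>lborel) else f mu)"
  unfolding normal_law_def by (auto simp: nn_integral_density nn_integral_return)

lemma integral_normal_law:
  fixes f :: "real \<Rightarrow> 'b::{banach,second_countable_topology}"
  assumes [measurable]: "f \<in> borel_measurable borel"
  shows "(LINT x|normal_law mu v. f x) = (if 0 < v then (LINT x|lborel. normal_density mu (sqrt v) x *\<^sub>R f x) else f mu)"
  unfolding normal_law_def by (auto simp: integral_density integral_return)

lemma integrable_normal_law:
  fixes f :: "real \<Rightarrow> 'b::{banach,second_countable_topology}"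
  assumes [measurable]: "f \<in> borel_measurable borel"
  shows "integrable (normal_law mu v) f \<longleftrightarrow> (0 < v \<longrightarrow> integrable lborel (\<lambda>x. normal_density mu (sqrt v) x *\<^sub>R f x))"
proof (cases "0 < v")
  case False
  interpret prob_space "normal_law mu v" by (rule prob_space_normal_law)
  have "integrable (return borel mu) f \<longleftrightarrow> integrable (return borel mu) (\<lambda>_. f mu)"
    by (rule integrable_cong_AE) (auto simp: AE_return)
  then show ?thesis using False integrable_const[of "f mu"] by (simp add: normal_law_def)
qed (simp add: normal_law_def integrable_density)

lemma normal_law_moments:
  assumes "0 \<le> v"
  shows "integrable (normal_law mu v) (\<lambda>x. x)" "integrable (normal_law mu v) (\<lambda>x. x\<^sup>2)"
    and "(LINT x|normal_law mu v. x) = mu" "(LINT x|normal_law mu v. x\<^sup>2) = v + mu\<^sup>2"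
proof -
  have i1: "integrable lborel (\<lambda>x. normal_density mu (sqrt v) x * x)" and I1: "(LINT x|lborel. normal_density mu (sqrt v) x * x) = mu" if "0 < v"
    using normal_moment_nz_1[of "sqrt v" mu] that by (auto simp: has_bochner_integral_iff)
  have e: "normal_density mu (sqrt v) x * x\<^sup>2 = normal_density mu (sqrt v) x * (x - mu)\<^sup>2 + 2 * mu * (normal_density mu (sqrt v) x * x) - mu\<^sup>2 * normal_density mu (sqrt v) x" for x
    by (simp add: power2_eq_square algebra_simps)
  have i2: "integrable lborel (\<lambda>x. normal_density mu (sqrt v) x * (x - mu)\<^sup>2)" and I2: "(LINT x|lborel. normal_density mu (sqrt v) x * (x - mu)\<^sup>2) = v" if "0 < v"
    using normal_moment_even[of "sqrt v" mu 1] that by (auto simp: has_bochner_integral_iff)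
  have i3: "integrable lborel (\<lambda>x. normal_density mu (sqrt v) x * x\<^sup>2)" if "0 < v"
    unfolding e using i1[OF that] i2[OF that] that by auto
  have I3: "(LINT x|lborel. normal_density mu (sqrt v) x * x\<^sup>2) = v + mu\<^sup>2" if v: "0 < v"
  proof -
    have "(LINT x|lborel. normal_density mu (sqrt v) x * x\<^sup>2) = v + 2 * mu * mu - mu\<^sup>2 * 1"
      unfolding e using i1[OF v] i2[OF v] v integrable_normal_density[of "sqrt v" mu]
      by (simp only: Bochner_Integration.integral_add Bochner_Integration.integral_diff integral_mult_right_zero I1[OF v] I2[OF v]
           integral_normal_density[of "sqrt v" mu] integrable_mult_right Bochner_Integration.integrable_add real_sqrt_gt_0_iff)
    then show ?thesis by (simp add: power2_eq_square)
  qed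
  show "integrable (normal_law mu v) (\<lambda>x. x)" using i1 by (subst integrable_normal_law) auto
  show "integrable (normal_law mu v) (\<lambda>x. x\<^sup>2)" using i3 by (subst integrable_normal_law) auto
  show "(LINT x|normal_law mu v. x) = mu" using I1 by (subst integral_normal_law) auto
  show "(LINT x|normal_law mu v. x\<^sup>2) = v + mu\<^sup>2" using I3 assms by (subst integral_normal_law) auto
qed

text \<open>Gaussianity supplies some mean and variance for the combination, and the first two
  moments identify them. Combinations are indexed by points in the definition of the process and by
  numbers here, hence \<open>inv_into\<close> and the injectivity.\<close>

lemma gaussian_process_linear:
  fixes x :: "nat \<Rightarrow> 'a"
  assumes P: "prob_space P" and GP: "centered_gaussian_process P S C X"
    and x: "x ` {..<n} \<subseteq> S" "inj_on x {..<n}"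
  shows "distr P borel (\<lambda>om. \<Sum>i<n. c i * X (x i) om) = normal_law 0 (\<Sum>i<n. \<Sum>j<n. c i * c j * C (x i) (x j))"
    and "0 \<le> (\<Sum>i<n. \<Sum>j<n. c i * c j * C (x i) (x j))" (is "_ \<le> ?V")
proof -
  interpret prob_space P by (rule P)
  have Xm: "X s \<in> borel_measurable P" if "s \<in> S" for s
    using GP that by (simp add: centered_gaussian_process_def gaussian_process_def)
  have lin: "\<exists>mu v. 0 \<le> v \<and> distr P borel (\<lambda>om. \<Sum>s\<in>I. c s * X s om) = normal_law mu v" if "finite I" "I \<subseteq> S" for I c
    using GP that by (auto simp: centered_gaussian_process_def gaussian_process_def)
  have one: "integrable P (X s)" "integrable P (\<lambda>om. (X s om)\<^sup>2)" if s: "s \<in> S" for s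
  proof -
    obtain mu v where v: "0 \<le> v" "distr P borel (\<lambda>om. \<Sum>s\<in>{s}. 1 * X s om) = normal_law mu v"
      using lin[of "{s}" "\<lambda>_. 1"] s by auto
    then have d: "distr P borel (X s) = normal_law mu v" by simp
    have "integrable (distr P borel (X s)) (\<lambda>x. x)" "integrable (distr P borel (X s)) (\<lambda>x. x\<^sup>2)"
      unfolding d using normal_law_moments[OF v(1)] by auto
    then show "integrable P (X s)" "integrable P (\<lambda>om. (X s om)\<^sup>2)"
      using Xm[OF s] by (auto simp: integrable_distr_eq)
  qed
  have two: "integrable P (\<lambda>om. X s om * X t om)" if "s \<in> S" "t \<in> S" for s t
  proof (rule Bochner_Integration.integrable_bound[of P "\<lambda>om. (X s om)\<^sup>2 + (X t om)\<^sup>2"])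
    show "AE om in P. norm (X s om * X t om) \<le> norm ((X s om)\<^sup>2 + (X t om)\<^sup>2)"
    proof (intro AE_I2)
      fix om
      have "2 * (\<bar>X s om\<bar> * \<bar>X t om\<bar>) \<le> (X s om)\<^sup>2 + (X t om)\<^sup>2"
        using sum_squares_bound[of "\<bar>X s om\<bar>" "\<bar>X t om\<bar>"] by (simp add: mult.assoc)
      moreover have "0 \<le> \<bar>X s om\<bar> * \<bar>X t om\<bar>" by simp
      ultimately have "\<bar>X s om\<bar> * \<bar>X t om\<bar> \<le> (X s om)\<^sup>2 + (X t om)\<^sup>2" by linarith
      then show "norm (X s om * X t om) \<le> norm ((X s om)\<^sup>2 + (X t om)\<^sup>2)" by (simp add: abs_mult)
    qed
  qed (use one Xm that in auto)
  let ?L = "\<lambda>om. \<Sum>i<n. c i * X (x i) om"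
  have xS: "x i \<in> S" if "i < n" for i using x that by auto
  have Lm: "?L \<in> borel_measurable P" using Xm xS by auto
  obtain mu v where v: "0 \<le> v" "distr P borel (\<lambda>om. \<Sum>s\<in>x ` {..<n}. c (inv_into {..<n} x s) * X s om) = normal_law mu v"
    using lin[OF finite_imageI[OF finite_lessThan] x(1), of "\<lambda>s. c (inv_into {..<n} x s)"] by blast
  have "(\<Sum>s\<in>x ` {..<n}. c (inv_into {..<n} x s) * X s om) = ?L om" for om
    using x(2) by (subst sum.reindex) (auto intro!: sum.cong simp: inv_into_f_f)
  with v have d: "distr P borel ?L = normal_law mu v" by simp
  have "mu = (LINT z|distr P borel ?L. z)" unfolding d using normal_law_moments[OF v(1)] by simp
  also have "\<dots> = (LINT om|P. ?L om)" using Lm by (subst integral_distr) auto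
  also have "\<dots> = (\<Sum>i<n. c i * (LINT om|P. X (x i) om))"
    using one xS by (subst Bochner_Integration.integral_sum) auto
  also have "\<dots> = 0" using GP xS by (auto simp: centered_gaussian_process_def intro!: sum.neutral)
  finally have mu: "mu = 0" .
  have "v = (LINT z|distr P borel ?L. z\<^sup>2)" unfolding d using normal_law_moments[OF v(1)] mu by simp
  also have "\<dots> = (LINT om|P. (?L om)\<^sup>2)" using Lm by (subst integral_distr) auto
  also have "\<dots> = (LINT om|P. (\<Sum>i<n. \<Sum>j<n. (c i * c j) * (X (x i) om * X (x j) om)))"
    by (intro Bochner_Integration.integral_cong refl) (simp add: power2_eq_square sum_product ac_simps)
  also have "\<dots> = (\<Sum>i<n. \<Sum>j<n. (c i * c j) * (LINT om|P. X (x i) om * X (x j) om))"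
  proof -
    have "integrable P (\<lambda>om. (c i * c j) * (X (x i) om * X (x j) om))" if "i < n" "j < n" for i j
      using two[OF xS xS] that by auto
    then show ?thesis
      by (subst Bochner_Integration.integral_sum) (auto intro!: sum.cong Bochner_Integration.integral_sum[THEN trans])
  qed
  also have "\<dots> = ?V"
    using GP xS by (intro sum.cong refl) (simp add: centered_gaussian_process_def)
  finally have vv: "v = ?V" .
  show "distr P borel ?L = normal_law 0 ?V"
    using d unfolding mu vv .
  show "0 \<le> ?V" using v(1) unfolding vv .
qed

section \<open>Exponential moments and tails of sums of Gaussian squares\<close>

lemma normal_density_exp_square:
  assumes v: "0 < v" and l: "2 * l * v < 1"
  shows "normal_density 0 (sqrt v) z * exp (l * z\<^sup>2) = 1 / sqrt (1 - 2 * l * v) * normal_density 0 (sqrt (v / (1 - 2 * l * v))) z"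
proof -
  let ?k = "1 - 2 * l * v"
  have k: "0 < ?k" using l by simp
  have "- (z\<^sup>2 / (2 * v)) + l * z\<^sup>2 = - (z\<^sup>2 / (2 * (v / ?k)))"
    using v k by (simp add: field_simps)
  then have "exp (- (z\<^sup>2 / (2 * v))) * exp (l * z\<^sup>2) = exp (- (z\<^sup>2 / (2 * (v / ?k))))"
    by (simp add: exp_add[symmetric])
  moreover have "1 / sqrt (2 * pi * v) = 1 / sqrt ?k * (1 / sqrt (2 * pi * (v / ?k)))"
    using v k by (simp add: real_sqrt_mult real_sqrt_divide)
  ultimately show ?thesis using v k
    by (simp add: normal_density_def power2_eq_square[of "sqrt _"])
qed

lemma nn_integral_normal_exp_square:
  assumes v: "0 \<le> v" and l: "2 * l * v < 1"
  shows "(\<integral>\<^sup>+z. ennreal (exp (l * z\<^sup>2)) \<partial>normal_law 0 v) = ennreal (1 / sqrt (1 - 2 * l * v))"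
proof (cases "v = 0")
  case False
  with v have v: "0 < v" by simp
  let ?k = "1 - 2 * l * v"
  have k: "0 < ?k" using l by simp
  have "(\<integral>\<^sup>+z. ennreal (exp (l * z\<^sup>2)) \<partial>normal_law 0 v) = (\<integral>\<^sup>+z. ennreal (1 / sqrt ?k) * ennreal (normal_density 0 (sqrt (v / ?k)) z) \<partial>lborel)"
    using v k by (subst nn_integral_normal_law)
      (auto intro!: nn_integral_cong simp: ennreal_mult'[symmetric] normal_density_exp_square[OF v l])
  also have "\<dots> = ennreal (1 / sqrt ?k) * (\<integral>\<^sup>+z. ennreal (normal_density 0 (sqrt (v / ?k)) z) \<partial>lborel)"
    by (rule nn_integral_cmult) measurable
  also have "(\<integral>\<^sup>+z. ennreal (normal_density 0 (sqrt (v / ?k)) z) \<partial>lborel) = 1"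
    using v k by (subst nn_integral_eq_integral) (auto intro!: integrable_normal_density)
  finally show ?thesis by simp
qed (simp add: nn_integral_normal_law)

text \<open>A union bound replaces independence here: only the laws of the single \<open>Z k\<close> enter.\<close>

lemma normal_square_tail:
  assumes v: "0 \<le> v"
  shows "measure (normal_law 0 v) {z. 4 * t * v < z\<^sup>2} \<le> sqrt 2 * exp (- t)"
proof (cases "v = 0")
  case True
  have "measure (return borel 0) {z::real. 0 < z\<^sup>2} = indicator {z. 0 < z\<^sup>2} (0::real)" by (rule measure_return) measurable
  then show ?thesis using True by (simp add: normal_law_def)
next
  case False
  then have v: "0 < v" using v by simp
  interpret N: prob_space "normal_law 0 v" by (rule prob_space_normal_law)
  \<comment> \<open>The exponent \<open>1 / (4 * v)\<close> is half of the critical one; the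
    exponential moment is then \<open>sqrt 2\<close>.\<close>
  have h: "2 * (1 / (4 * v)) * v = 1 / 2" using v by simp
  have "{z. 4 * t * v < z\<^sup>2} \<subseteq> {z \<in> space (normal_law 0 v). 1 \<le> ennreal (exp (- t)) * ennreal (exp (1 / (4 * v) * z\<^sup>2))}"
  proof
    fix z assume "z \<in> {z. 4 * t * v < z\<^sup>2}"
    then have "t \<le> 1 / (4 * v) * z\<^sup>2" using v by (simp add: field_simps)
    then have "1 \<le> exp (- t + 1 / (4 * v) * z\<^sup>2)" by simp
    then have "1 \<le> ennreal (exp (- t) * exp (1 / (4 * v) * z\<^sup>2))" unfolding exp_add by simp
    then show "z \<in> {z \<in> space (normal_law 0 v). 1 \<le> ennreal (exp (- t)) * ennreal (exp (1 / (4 * v) * z\<^sup>2))}"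
      by (simp only: ennreal_mult'[OF exp_ge_zero]) simp
  qed
  then have "emeasure (normal_law 0 v) {z. 4 * t * v < z\<^sup>2}
      \<le> emeasure (normal_law 0 v) {z \<in> space (normal_law 0 v). 1 \<le> ennreal (exp (- t)) * ennreal (exp (1 / (4 * v) * z\<^sup>2))}"
    by (intro emeasure_mono) measurable
  also have "\<dots> \<le> ennreal (exp (- t)) * (\<integral>\<^sup>+z. ennreal (exp (1 / (4 * v) * z\<^sup>2)) * indicator (space (normal_law 0 v)) z \<partial>normal_law 0 v)"
    by (rule nn_integral_Markov_inequality) measurable
  also have "\<dots> = ennreal (exp (- t)) * ennreal (1 / sqrt (1 - 2 * (1 / (4 * v)) * v))"
    using v h by (subst nn_integral_normal_exp_square[symmetric]) auto
  also have "\<dots> = ennreal (sqrt 2 * exp (- t))"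
    unfolding h by (simp add: real_sqrt_divide ennreal_mult'[symmetric] mult.commute)
  finally show ?thesis by (simp add: N.emeasure_eq_measure)
qed

text \<open>If no square exceeds its own share \<open>4 * t * v k\<close>, the sum stays below
  \<open>4 * t * V\<close>. The factor \<open>n\<close> in the bound is absorbed by a logarithmic
  \<open>t\<close>.\<close>

lemma gaussian_squares_tail:
  fixes Z :: "nat \<Rightarrow> 'w \<Rightarrow> real"
  assumes P: "prob_space P" and Zm: "\<And>k. k < n \<Longrightarrow> Z k \<in> borel_measurable P"
    and law: "\<And>k. k < n \<Longrightarrow> distr P borel (Z k) = normal_law 0 (v k)" and v: "\<And>k. k < n \<Longrightarrow> 0 \<le> v k"
    and V: "(\<Sum>k<n. v k) \<le> V" and t: "0 \<le> t"
  shows "measure P {om\<in>space P. 4 * t * V < (\<Sum>k<n. (Z k om)\<^sup>2)} \<le> real n * (sqrt 2 * exp (- t))"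
proof -
  interpret prob_space P by (rule P)
  let ?A = "\<lambda>k. {om\<in>space P. 4 * t * v k < (Z k om)\<^sup>2}"
  have A: "?A k \<in> events" "prob (?A k) \<le> sqrt 2 * exp (- t)" if k: "k < n" for k
  proof -
    show "?A k \<in> events" using Zm[OF k] by measurable
    have "prob (?A k) = measure (distr P borel (Z k)) {z. 4 * t * v k < z\<^sup>2}"
      using Zm[OF k] by (subst measure_distr) (auto intro!: arg_cong[of _ _ prob])
    then show "prob (?A k) \<le> sqrt 2 * exp (- t)" unfolding law[OF k] using normal_square_tail[OF v[OF k]] by simp
  qed
  have "{om\<in>space P. 4 * t * V < (\<Sum>k<n. (Z k om)\<^sup>2)} \<subseteq> (\<Union>k<n. ?A k)"
  proof (rule subsetI, rule ccontr)
    fix om assume om: "om \<in> {om\<in>space P. 4 * t * V < (\<Sum>k<n. (Z k om)\<^sup>2)}" "om \<notin> (\<Union>k<n. ?A k)"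
    then have "(\<Sum>k<n. (Z k om)\<^sup>2) \<le> (\<Sum>k<n. 4 * t * v k)" by (intro sum_mono) (auto simp: not_less)
    also have "\<dots> \<le> 4 * t * V" unfolding sum_distrib_left[symmetric] using V t by (intro mult_left_mono) auto
    finally show False using om by simp
  qed
  then have "prob {om\<in>space P. 4 * t * V < (\<Sum>k<n. (Z k om)\<^sup>2)} \<le> prob (\<Union>k<n. ?A k)"
    using A(1) by (intro finite_measure_mono) auto
  also have "\<dots> \<le> (\<Sum>k<n. prob (?A k))" using A(1) by (intro finite_measure_subadditive_finite) auto
  also have "\<dots> \<le> (\<Sum>k<n. sqrt 2 * exp (- t))" by (intro sum_mono A(2)) auto
  finally show ?thesis by simp
qed

lemma std_normal_exp_linear:
  "(\<integral>\<^sup>+g. ennreal (exp (a * g)) \<partial>normal_law 0 v) = ennreal (exp (a\<^sup>2 * v / 2))" if "0 \<le> v"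
proof (cases "v = 0")
  case False
  with that have v: "0 < v" by simp
  have e: "normal_density 0 (sqrt v) g * exp (a * g) = exp (a\<^sup>2 * v / 2) * normal_density (a * v) (sqrt v) g" for g
  proof -
    have "- (g\<^sup>2 / (2 * v)) + a * g = a\<^sup>2 * v / 2 - (g - a * v)\<^sup>2 / (2 * v)"
      using v by (simp add: field_simps power2_eq_square)
    then have "exp (- (g\<^sup>2 / (2 * v))) * exp (a * g) = exp (a\<^sup>2 * v / 2) * exp (- ((g - a * v)\<^sup>2 / (2 * v)))"
      by (simp add: exp_add[symmetric])
    then show ?thesis using v by (simp add: normal_density_def)
  qed
  have "(\<integral>\<^sup>+g. ennreal (exp (a * g)) \<partial>normal_law 0 v) = (\<integral>\<^sup>+g. ennreal (exp (a\<^sup>2 * v / 2)) * ennreal (normal_density (a * v) (sqrt v) g) \<partial>lborel)"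
    using v by (subst nn_integral_normal_law) (auto intro!: nn_integral_cong simp: ennreal_mult'[symmetric] e)
  also have "\<dots> = ennreal (exp (a\<^sup>2 * v / 2)) * (\<integral>\<^sup>+g. ennreal (normal_density (a * v) (sqrt v) g) \<partial>lborel)"
    by (rule nn_integral_cmult) measurable
  also have "(\<integral>\<^sup>+g. ennreal (normal_density (a * v) (sqrt v) g) \<partial>lborel) = 1"
    using v by (subst nn_integral_eq_integral) (auto intro!: integrable_normal_density)
  finally show ?thesis by simp
qed (simp add: nn_integral_normal_law)

lemma std_normal_cis_linear:
  "(LINT g|normal_law 0 v. cis (a * g)) = of_real (exp (- (a\<^sup>2 * v / 2)))" if "0 \<le> v"
proof (cases "v = 0")
  case False
  with that have v: "0 < v" by simp
  have nd: "normal_density 0 (sqrt v) g = 1 / sqrt (2 * pi * v) * exp (- (1 / (2 * v)) * g\<^sup>2)" for g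
    using v by (simp add: normal_density_def)
  have "(LINT g|normal_law 0 v. cis (a * g)) = (LINT g|lborel. of_real (1 / sqrt (2 * pi * v)) * (cis (g * a) * of_real (exp (- (1 / (2 * v)) * g\<^sup>2))))"
    using v by (subst integral_normal_law) (auto simp: cis_conv_exp nd scaleR_conv_of_real mult_ac intro!: Bochner_Integration.integral_cong)
  also have "\<dots> = of_real (1 / sqrt (2 * pi * v)) * of_real (sqrt (pi / (1 / (2 * v))) * exp (- a\<^sup>2 / (4 * (1 / (2 * v)))))"
    using v by (subst integral_mult_right_zero, subst integral_cis_gauss) auto
  also have "\<dots> = of_real ((1 / sqrt (2 * pi * v) * sqrt (2 * pi * v)) * exp (- (a\<^sup>2 * v / 2)))"
    using v by (simp add: mult_ac)
  also have "\<dots> = of_real (exp (- (a\<^sup>2 * v / 2)))" using v by simp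
  finally show ?thesis .
next
  case True
  then show ?thesis by (subst integral_normal_law) (auto simp: cis_conv_exp)
qed

text \<open>With the Chernoff parameter \<open>l = 1 / sqrt n\<close> the quadratic remainder
  \<open>n * l^2\<close> stays bounded; \<open>16 \<le> n\<close> ensures
  \<open>2 * l \<le> 1 / 2\<close>, the range of the logarithm bounds.\<close>

lemma chernoff_scale:
  assumes "16 \<le> n"
  shows "0 < 1 / sqrt (real n)" "1 / sqrt (real n) \<le> 1 / 4" "real n * (1 / sqrt (real n))\<^sup>2 = 1"
    "1 / sqrt (real n) * (t * sqrt n) = t"
proof -
  have "sqrt (4\<^sup>2) \<le> sqrt (real n)" using assms by (intro real_sqrt_le_mono) simp
  then show "1 / sqrt (real n) \<le> 1 / 4" by (simp add: divide_le_eq)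
qed (use assms in \<open>auto simp: power_divide\<close>)

lemma inverse_sqrt_eq_exp: "0 < u \<Longrightarrow> 1 / sqrt u = exp (- (ln u / 2))"
  unfolding exp_minus using ln_sqrt[of u] by (metis exp_ln inverse_eq_divide less_imp_le real_sqrt_gt_zero)

text \<open>Joint standard normality in Cramer-Wold form, through the laws of all linear
  combinations. A Gaussian process provides it in this form, and independence never has to be
  extracted from it.\<close>

locale standard_gaussians = prob_space P for P :: "'w measure" +
  fixes n :: nat and Z :: "nat \<Rightarrow> 'w \<Rightarrow> real"
  assumes Zm [measurable]: "\<And>k. k < n \<Longrightarrow> Z k \<in> borel_measurable P"
    and law: "\<And>l. distr P borel (\<lambda>om. \<Sum>k<n. l k * Z k om) = normal_law 0 (\<Sum>k<n. (l k)\<^sup>2)"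
begin

abbreviation "sq om \<equiv> \<Sum>k<n. (Z k om)\<^sup>2"
abbreviation "lin l om \<equiv> \<Sum>k<n. l k * Z k om"
abbreviation "N \<equiv> Pi\<^sub>M {..<n} (\<lambda>_. normal_law 0 1)"

sublocale N: product_prob_space "\<lambda>_::nat. normal_law 0 1" "{..<n}"
  by (simp add: product_prob_space_def product_prob_space_axioms_def product_sigma_finite_def
     prob_space_normal_law prob_space_imp_sigma_finite)

lemma lin_measurable [measurable]: "(\<lambda>om. \<Sum>k<n. l k * Z k om) \<in> borel_measurable P"
  by auto

lemma pair_measurable [measurable]: "(\<lambda>(om, g). \<Sum>k<n. g k * Z k om) \<in> borel_measurable (P \<Otimes>\<^sub>M N)"
proof -
  have "(\<lambda>x. snd x k * Z k (fst x)) \<in> borel_measurable (P \<Otimes>\<^sub>M N)" if "k < n" for k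
    using that by (intro borel_measurable_times measurable_compose[OF measurable_fst Zm] measurable_compose[OF measurable_snd]) auto
  then show ?thesis by (auto simp: split_beta)
qed

text \<open>Linearisation: \<open>exp (l z\<^sup>2)\<close> is an average of exponentials of multiples of \<open>z\<close> with an auxiliary
  Gaussian multiplier, so that only the laws of linear combinations of the \<open>Z k\<close> are needed.\<close>

lemma nn_integral_exp_sum_squares:
  assumes l: "0 \<le> l" "2 * l < 1"
  shows "(\<integral>\<^sup>+om. ennreal (exp (l * sq om)) \<partial>P) = ennreal ((1 / sqrt (1 - 2 * l)) ^ n)"
proof -
  \<comment> \<open>The auxiliary multiplier has variance 1, so \<open>a^2 / 2 = l\<close>
    reproduces the exponent.\<close>
  define a where "a = sqrt (2 * l)"
  have a2: "a\<^sup>2 = 2 * l" using l by (simp add: a_def)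
  interpret PN: pair_sigma_finite P N ..
  have "(\<integral>\<^sup>+om. ennreal (exp (l * sq om)) \<partial>P) = (\<integral>\<^sup>+om. \<integral>\<^sup>+g. ennreal (exp (a * lin g om)) \<partial>N \<partial>P)"
  proof (intro nn_integral_cong)
    fix om
    have "(\<integral>\<^sup>+g. ennreal (exp (a * lin g om)) \<partial>N) = (\<integral>\<^sup>+g. (\<Prod>k<n. ennreal (exp ((a * Z k om) * g k))) \<partial>N)"
      by (intro nn_integral_cong) (simp add: prod_ennreal exp_sum[symmetric] sum_distrib_left ac_simps)
    also have "\<dots> = (\<Prod>k<n. (\<integral>\<^sup>+g. ennreal (exp ((a * Z k om) * g)) \<partial>normal_law 0 1))"
      by (rule N.product_nn_integral_prod) auto
    also have "\<dots> = (\<Prod>k<n. ennreal (exp (l * (Z k om)\<^sup>2)))"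
      by (simp add: std_normal_exp_linear power_mult_distrib a2)
    also have "\<dots> = ennreal (exp (l * sq om))"
      by (simp add: prod_ennreal exp_sum[symmetric] sum_distrib_left)
    finally show "ennreal (exp (l * sq om)) = (\<integral>\<^sup>+g. ennreal (exp (a * lin g om)) \<partial>N)" ..
  qed
  also have "\<dots> = (\<integral>\<^sup>+g. \<integral>\<^sup>+om. ennreal (exp (a * lin g om)) \<partial>P \<partial>N)"
    by (rule PN.Fubini'[symmetric]) (use pair_measurable in \<open>simp add: split_beta\<close>)
  also have "\<dots> = (\<integral>\<^sup>+g. (\<Prod>k<n. ennreal (exp (l * (g k)\<^sup>2))) \<partial>N)"
  proof (intro nn_integral_cong)
    fix g :: "nat \<Rightarrow> real"
    have "(\<integral>\<^sup>+om. ennreal (exp (a * lin g om)) \<partial>P) = (\<integral>\<^sup>+y. ennreal (exp (a * y)) \<partial>normal_law 0 (\<Sum>k<n. (g k)\<^sup>2))"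
      unfolding law[symmetric] by (subst nn_integral_distr) auto
    also have "\<dots> = ennreal (exp (l * (\<Sum>k<n. (g k)\<^sup>2)))"
      by (subst std_normal_exp_linear) (auto simp: a2 sum_nonneg)
    also have "\<dots> = (\<Prod>k<n. ennreal (exp (l * (g k)\<^sup>2)))"
      by (simp add: prod_ennreal exp_sum[symmetric] sum_distrib_left)
    finally show "(\<integral>\<^sup>+om. ennreal (exp (a * lin g om)) \<partial>P) = (\<Prod>k<n. ennreal (exp (l * (g k)\<^sup>2)))" .
  qed
  also have "\<dots> = (\<Prod>k<n. (\<integral>\<^sup>+g. ennreal (exp (l * g\<^sup>2)) \<partial>normal_law 0 1))"
    by (rule N.product_nn_integral_prod) auto
  also have "\<dots> = ennreal ((1 / sqrt (1 - 2 * l)) ^ n)"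
    using l by (simp add: nn_integral_normal_exp_square ennreal_power)
  finally show ?thesis .
qed

text \<open>For a negative exponent the linearisation needs imaginary multiples: \<open>cis\<close>
  takes the place of the exponential, and boundedness justifies the exchange of integrals.\<close>

lemma integral_exp_neg_sum_squares:
  assumes l: "0 \<le> l"
  shows "(LINT om|P. exp (- l * sq om)) = (1 / sqrt (1 + 2 * l)) ^ n"
proof -
  define a where "a = sqrt (2 * l)"
  have a2: "a\<^sup>2 = 2 * l" using l by (simp add: a_def)
  interpret PN: pair_prob_space P N ..
  have "complex_of_real (LINT om|P. exp (- l * sq om)) = (LINT om|P. complex_of_real (exp (- l * sq om)))"
    by (rule integral_complex_of_real[symmetric])
  also have "\<dots> = (LINT om|P. LINT g|N. cis (a * lin g om))"
  proof (intro Bochner_Integration.integral_cong refl)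
    fix om
    have "(LINT g|N. cis (a * lin g om)) = (LINT g|N. (\<Prod>k<n. cis ((a * Z k om) * g k)))"
      by (intro Bochner_Integration.integral_cong refl) (simp add: cis_conv_exp exp_sum[symmetric] sum_distrib_left ac_simps)
    also have "\<dots> = (\<Prod>k<n. (LINT g|normal_law 0 1. cis ((a * Z k om) * g)))"
    proof (rule N.product_integral_prod)
      fix k
      show "integrable (normal_law 0 1) (\<lambda>g. cis (a * Z k om * g))"
        by (rule finite_measure.integrable_const_bound[OF prob_space.finite_measure[OF prob_space_normal_law], where B=1]) (auto simp: cis_conv_exp)
    qed simp
    also have "\<dots> = (\<Prod>k<n. of_real (exp (- l * (Z k om)\<^sup>2)))"
      by (simp add: std_normal_cis_linear power_mult_distrib a2)
    also have "\<dots> = of_real (exp (- l * sq om))"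
      by (simp add: exp_sum[symmetric] sum_distrib_left sum_negf[symmetric] flip: of_real_prod)
    finally show "of_real (exp (- l * sq om)) = (LINT g|N. cis (a * lin g om))" ..
  qed
  also have "\<dots> = (LINT g|N. LINT om|P. cis (a * lin g om))"
  proof (rule PN.Fubini_integral[symmetric])
    have "integrable (P \<Otimes>\<^sub>M N) (\<lambda>x. cis (a * (\<Sum>k<n. snd x k * Z k (fst x))))"
      by (rule PN.integrable_const_bound[where B=1]) (use pair_measurable in \<open>auto simp: cis_conv_exp split_beta\<close>)
    then show "integrable (P \<Otimes>\<^sub>M N) (\<lambda>(om, g). cis (a * lin g om))" by (simp add: case_prod_unfold)
  qed
  also have "\<dots> = (LINT g|N. complex_of_real (\<Prod>k<n. exp (- l * (g k)\<^sup>2)))"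
  proof (intro Bochner_Integration.integral_cong refl)
    fix g :: "nat \<Rightarrow> real"
    have "(LINT om|P. cis (a * lin g om)) = (LINT y|normal_law 0 (\<Sum>k<n. (g k)\<^sup>2). cis (a * y))"
      unfolding law[symmetric] by (subst integral_distr) (auto simp: cis_conv_exp)
    also have "\<dots> = of_real (exp (- l * (\<Sum>k<n. (g k)\<^sup>2)))"
      by (subst std_normal_cis_linear) (auto simp: a2 sum_nonneg)
    also have "\<dots> = complex_of_real (\<Prod>k<n. exp (- l * (g k)\<^sup>2))"
      by (simp add: exp_sum[symmetric] sum_distrib_left sum_negf[symmetric])
    finally show "(LINT om|P. cis (a * lin g om)) = complex_of_real (\<Prod>k<n. exp (- l * (g k)\<^sup>2))" .
  qed
  also have "\<dots> = complex_of_real (LINT g|N. (\<Prod>k<n. exp (- l * (g k)\<^sup>2)))"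
    by (rule integral_complex_of_real)
  also have "(LINT g|N. (\<Prod>k<n. exp (- l * (g k)\<^sup>2))) = (\<Prod>k<n. (LINT g|normal_law 0 1. exp (- l * g\<^sup>2)))"
  proof (rule N.product_integral_prod)
    fix k
    show "integrable (normal_law 0 1) (\<lambda>g. exp (- l * g\<^sup>2))"
      by (rule finite_measure.integrable_const_bound[OF prob_space.finite_measure[OF prob_space_normal_law], where B=1]) (use l in auto)
  qed simp
  also have "(LINT g|normal_law 0 1. exp (- l * g\<^sup>2)) = 1 / sqrt (1 + 2 * l)"
    using nn_integral_normal_exp_square[of 1 "- l"] l
    by (subst integral_eq_nn_integral) (auto)
  finally show ?thesis unfolding of_real_eq_iff by simp
qed

lemma sum_squares_measurable [measurable]: "(\<lambda>om. \<Sum>k<n. (Z k om)\<^sup>2) \<in> borel_measurable P"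
  by auto

text \<open>Chernoff's bound with \<open>l = 1 / sqrt n\<close>: the linear term
  \<open>n * l\<close> cancels the mean, and the quadratic remainder \<open>4 * n * l^2\<close> is
  the constant 4.\<close>

lemma sum_squares_upper_tail:
  assumes n: "16 \<le> n"
  shows "prob {om\<in>space P. real n + t * sqrt n < sq om} \<le> exp 4 * exp (- t)"
proof -
  define l where "l = 1 / sqrt (real n)"
  note l = chernoff_scale[OF n, folded l_def]
  let ?c = "exp (- (l * (real n + t * sqrt n)))"
  have "1 / sqrt (1 - 2 * l) \<le> exp (l + 4 * l\<^sup>2)"
  proof -
    have u: "0 < 1 - 2 * l" using l(2) by simp
    have "- (2 * l) - 2 * (2 * l)\<^sup>2 \<le> ln (1 - 2 * l)"
      using l(1,2) by (intro ln_one_minus_pos_lower_bound) auto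
    then have "- (ln (1 - 2 * l) / 2) \<le> l + 4 * l\<^sup>2" by (simp add: power2_eq_square)
    then have "exp (- (ln (1 - 2 * l) / 2)) \<le> exp (l + 4 * l\<^sup>2)" by simp
    then show ?thesis unfolding inverse_sqrt_eq_exp[OF u] .
  qed
  then have "(1 / sqrt (1 - 2 * l)) ^ n \<le> exp (l + 4 * l\<^sup>2) ^ n"
    using l(2) by (intro power_mono) auto
  also have "\<dots> = exp (real n * (l + 4 * l\<^sup>2))" by (rule exp_of_nat_mult[symmetric])
  also have "real n * (l + 4 * l\<^sup>2) = real n * l + 4"
  proof -
    have "real n * (l + 4 * l\<^sup>2) = real n * (l) + 4 * (real n * l\<^sup>2)" by (simp add: algebra_simps)
    then show ?thesis using l(3) by simp
  qed
  finally have le: "(1 / sqrt (1 - 2 * l)) ^ n \<le> exp (real n * l + 4)" .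
  have "{om\<in>space P. real n + t * sqrt n < sq om} \<subseteq> {om\<in>space P. 1 \<le> ennreal ?c * ennreal (exp (l * sq om))}"
  proof safe
    fix om assume "real n + t * sqrt n < sq om"
    then have "l * (real n + t * sqrt n) \<le> l * sq om" using l(1) by (intro mult_left_mono) auto
    then have "1 \<le> ?c * exp (l * sq om)" by (simp add: exp_add[symmetric])
    then have "1 \<le> ennreal (?c * exp (l * sq om))" by simp
    then show "1 \<le> ennreal ?c * ennreal (exp (l * sq om))" by (simp only: ennreal_mult'[OF exp_ge_zero])
  qed
  then have "emeasure P {om\<in>space P. real n + t * sqrt n < sq om} \<le> emeasure P {om\<in>space P. 1 \<le> ennreal ?c * ennreal (exp (l * sq om))}"
    by (intro emeasure_mono) measurable
  also have "\<dots> \<le> ennreal ?c * (\<integral>\<^sup>+om. ennreal (exp (l * sq om)) * indicator (space P) om \<partial>P)"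
    by (rule nn_integral_Markov_inequality) measurable
  also have "(\<integral>\<^sup>+om. ennreal (exp (l * sq om)) * indicator (space P) om \<partial>P) = ennreal ((1 / sqrt (1 - 2 * l)) ^ n)"
    using l(1,2) by (subst nn_integral_exp_sum_squares[symmetric]) (auto intro!: nn_integral_cong)
  also have "ennreal ?c * \<dots> \<le> ennreal ?c * ennreal (exp (real n * l + 4))"
    by (intro mult_left_mono ennreal_leI le) auto
  also have "\<dots> = ennreal (?c * exp (real n * l + 4))" by (simp only: ennreal_mult'[OF exp_ge_zero])
  also have "?c * exp (real n * l + 4) = exp 4 * exp (- t)"
  proof -
    have "- (l * (real n + t * sqrt n)) + (real n * l + 4) = 4 + - t" using l(4) by (simp add: distrib_left)
    then show ?thesis by (metis exp_add)
  qed
  finally show ?thesis by (simp add: emeasure_eq_measure)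
qed

text \<open>Markov's inequality for \<open>exp (- l * sq om)\<close>. The constant
  \<open>exp 2\<close> that results is relaxed to match the upper tail.\<close>

lemma sum_squares_lower_tail:
  assumes n: "16 \<le> n"
  shows "prob {om\<in>space P. sq om < real n - t * sqrt n} \<le> exp 4 * exp (- t)"
proof -
  define l where "l = 1 / sqrt (real n)"
  note l = chernoff_scale[OF n, folded l_def]
  let ?c = "exp (l * (real n - t * sqrt n))"
  have "1 / sqrt (1 + 2 * l) \<le> exp (- l + 2 * l\<^sup>2)"
  proof -
    have u: "0 < 1 + 2 * l" using l(1) by simp
    have "2 * l - (2 * l)\<^sup>2 \<le> ln (1 + 2 * l)"
      using l(1,2) by (intro ln_one_plus_pos_lower_bound) auto
    then have "- (ln (1 + 2 * l) / 2) \<le> - l + 2 * l\<^sup>2" by (simp add: power2_eq_square)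
    then have "exp (- (ln (1 + 2 * l) / 2)) \<le> exp (- l + 2 * l\<^sup>2)" by simp
    then show ?thesis unfolding inverse_sqrt_eq_exp[OF u] .
  qed
  then have "(1 / sqrt (1 + 2 * l)) ^ n \<le> exp (- l + 2 * l\<^sup>2) ^ n"
    using l(1) by (intro power_mono) auto
  also have "\<dots> = exp (real n * (- l + 2 * l\<^sup>2))" by (rule exp_of_nat_mult[symmetric])
  also have "real n * (- l + 2 * l\<^sup>2) = - (real n * l) + 2"
  proof -
    have "real n * (- l + 2 * l\<^sup>2) = real n * (- l) + 2 * (real n * l\<^sup>2)" by (simp add: algebra_simps)
    then show ?thesis using l(3) by simp
  qed
  finally have le: "(1 / sqrt (1 + 2 * l)) ^ n \<le> exp (- (real n * l) + 2)" .
  have S0: "0 \<le> sq om" for om by (simp add: sum_nonneg)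
  have int: "integrable P (\<lambda>om. ?c * exp (- l * sq om))"
    by (intro integrable_mult_right integrable_const_bound[where B=1]) (use l(1) S0 in auto)
  have "prob {om\<in>space P. sq om < real n - t * sqrt n} \<le> prob {om\<in>space P. 1 \<le> ?c * exp (- l * sq om)}"
  proof (intro finite_measure_mono subsetI)
    fix om assume w: "om \<in> {om\<in>space P. sq om < real n - t * sqrt n}"
    then have "l * sq om \<le> l * (real n - t * sqrt n)" using l(1) by (intro mult_left_mono) auto
    then have "1 \<le> ?c * exp (- l * sq om)" by (simp add: exp_add[symmetric])
    with w show "om \<in> {om\<in>space P. 1 \<le> ?c * exp (- l * sq om)}" by simp
  qed measurable
  also have "\<dots> \<le> (LINT om|P. ?c * exp (- l * sq om)) / 1"
    by (rule integral_Markov_inequality_measure[OF int, of "space P"]) auto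
  also have "\<dots> = ?c * (1 / sqrt (1 + 2 * l)) ^ n"
    using integral_exp_neg_sum_squares[OF less_imp_le[OF l(1)]] by simp
  also have "\<dots> \<le> ?c * exp (- (real n * l) + 2)" by (intro mult_left_mono le) auto
  also have "\<dots> = exp 2 * exp (- t)"
  proof -
    have "l * (real n - t * sqrt n) + (- (real n * l) + 2) = 2 + - t" using l(4) by (simp add: right_diff_distrib)
    then show ?thesis by (metis exp_add)
  qed
  also have "\<dots> \<le> exp 4 * exp (- t)" by (intro mult_right_mono) auto
  finally show ?thesis .
qed

end

section \<open>Quadratic forms of a Gaussian vector\<close>

locale gaussian_vector = prob_space P for P :: "'w measure" +
  fixes n :: nat and S :: "real mat" and th :: real and x :: "'w \<Rightarrow> real vec"
  assumes S: "pd_mat n S" and th: "0 < th"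
    and x: "\<And>om. x om \<in> carrier_vec n"
    and xm [measurable]: "\<And>i. i < n \<Longrightarrow> (\<lambda>om. x om $ i) \<in> borel_measurable P"
    and x_law: "\<And>c. c \<in> carrier_vec n \<Longrightarrow> distr P borel (\<lambda>om. c \<bullet> x om) = normal_law 0 (th * (qf S c))"
begin

lemma lin_measurable [measurable]: "(\<lambda>om. c \<bullet> x om) \<in> borel_measurable P"
proof -
  have "c \<bullet> x om = (\<Sum>i<n. c $ i * x om $ i)" for om
    using x[of om] by (simp add: scalar_prod_def lessThan_atLeast0)
  then show ?thesis by auto
qed

text \<open>A factor of \<open>B\<close> turns the form into a sum of squared linear forms of the
  vector, whose variances add up to \<open>th\<close> times the trace.\<close>

lemma quad_tail:
  assumes B: "psd_mat n B" and V: "mtrace (B * S) \<le> V" and t: "0 \<le> t"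
  shows "prob {om\<in>space P. 4 * t * (th * V) < qf B (x om)} \<le> real n * (sqrt 2 * exp (- t))"
proof -
  obtain C where C: "C \<in> carrier_mat n n" "B = C * C\<^sup>T" by (rule psd_mat_factor[OF B])
  have quad: "qf B (x om) = (\<Sum>k<n. (Matrix.col C k \<bullet> x om)\<^sup>2)" for om
    unfolding C(2) by (rule quad_factor[OF C(1) x])
  have col: "Matrix.col C k \<in> carrier_vec n" if "k < n" for k using C(1) that by auto
  have tr: "(\<Sum>k<n. th * (qf S (Matrix.col C k))) \<le> th * V"
    using V th unfolding C(2) mtrace_factor[OF C(1) pd_matD(1)[OF S]] sum_distrib_left[symmetric] by simp
  show ?thesis unfolding quad
  proof (rule gaussian_squares_tail[OF prob_space_axioms _ _ _ tr])
    fix k assume "k < n"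
    then show "distr P borel (\<lambda>om. Matrix.col C k \<bullet> x om) = normal_law 0 (th * (qf S (Matrix.col C k)))"
      by (intro x_law col)
    show "0 \<le> th * (qf S (Matrix.col C k))"
      using th psd_matD(3)[OF pd_mat_imp_psd[OF S] col[OF \<open>k < n\<close>]] by simp
  qed (use V th t in auto)
qed

text \<open>Whitening by \<open>orthonormal_factor\<close>: the form divided by \<open>th\<close> is
  a sum of \<open>n\<close> squares of standard normal variables.\<close>

lemma inv_quad_concentration:
  assumes n: "16 \<le> n"
  shows "prob {om\<in>space P. t * sqrt n < \<bar>qf (mat_inv S) (x om) / th - real n\<bar>} \<le> 2 * exp 4 * exp (- t)"
proof -
  obtain C where C: "C \<in> carrier_mat n n" "mat_inv S = C * C\<^sup>T" "C\<^sup>T * S * C = 1\<^sub>m n"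
    by (rule orthonormal_factor[OF S])
  define Z where "Z = (\<lambda>k om. (Matrix.col C k \<bullet> x om) / sqrt th)"
  have st: "(sqrt th)\<^sup>2 = th" "0 < sqrt th" using th by auto
  have quad: "qf (mat_inv S) (x om) / th = (\<Sum>k<n. (Z k om)\<^sup>2)" for om
    unfolding C(2) quad_factor[OF C(1) x] Z_def using st by (simp add: power_divide sum_divide_distrib)
  note SD = pd_matD[OF S]
  have Ct: "C\<^sup>T \<in> carrier_mat n n" using C by auto
  interpret G: standard_gaussians P n Z
  proof
    show "Z k \<in> borel_measurable P" for k unfolding Z_def by measurable
    fix l :: "nat \<Rightarrow> real"
    \<comment> \<open>Pulls the coefficients back to a linear form of \<open>x\<close>;
      \<open>th\<close> times its \<open>S\<close>-form is the plain sum of squares, because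
      \<open>C\<^sup>T * S * C\<close> is the identity.\<close>
    define c where "c = C *\<^sub>v Matrix.vec n (\<lambda>k. l k / sqrt th)"
    let ?l = "Matrix.vec n (\<lambda>k. l k / sqrt th)"
    have l: "?l \<in> carrier_vec n" by simp
    have c: "c \<in> carrier_vec n" using C by (simp add: c_def)
    have "(\<Sum>k<n. l k * Z k om) = c \<bullet> x om" for om
    proof -
      have "c \<bullet> x om = ?l \<bullet> (C\<^sup>T *\<^sub>v x om)"
        unfolding c_def using transpose_vec_mult_scalar[OF C(1) l x, of om]
          comm_scalar_prod[of "C *\<^sub>v ?l" n "x om"] comm_scalar_prod[of ?l n "C\<^sup>T *\<^sub>v x om"] C(1) Ct x by auto
      also have "\<dots> = (\<Sum>k<n. l k * Z k om)"
        using C x by (simp add: scalar_prod_def[of ?l] lessThan_atLeast0 Z_def)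
      finally show ?thesis ..
    qed
    moreover have "qf S c = ?l \<bullet> ?l"
    proof -
      have Cl: "C *\<^sub>v ?l \<in> carrier_vec n" using C l by auto
      have SCl: "S *\<^sub>v (C *\<^sub>v ?l) \<in> carrier_vec n" using SD Cl by auto
      have "qf S c = (S *\<^sub>v (C *\<^sub>v ?l)) \<bullet> (C *\<^sub>v ?l)" unfolding c_def by (rule comm_scalar_prod[OF Cl SCl])
      also have "\<dots> = (C\<^sup>T *\<^sub>v (S *\<^sub>v (C *\<^sub>v ?l))) \<bullet> ?l"
        using transpose_vec_mult_scalar[OF C(1) l SCl] by simp
      also have "C\<^sup>T *\<^sub>v (S *\<^sub>v (C *\<^sub>v ?l)) = (C\<^sup>T * S * C) *\<^sub>v ?l"
        using C(1) Ct SD(1) l by (simp add: assoc_mult_mat_vec[of _ n n _ n])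
      finally show ?thesis unfolding C(3) using l by simp
    qed
    moreover have "th * (?l \<bullet> ?l) = (\<Sum>k<n. (l k)\<^sup>2)"
      unfolding scalar_prod_def using st th
      by (simp add: lessThan_atLeast0 sum_distrib_left power2_eq_square[symmetric] power_divide)
    ultimately show "distr P borel (\<lambda>om. \<Sum>k<n. l k * Z k om) = normal_law 0 (\<Sum>k<n. (l k)\<^sup>2)"
      using x_law[OF c] by simp
  qed
  have "prob {om\<in>space P. t * sqrt n < \<bar>(\<Sum>k<n. (Z k om)\<^sup>2) - real n\<bar>}
     \<le> prob ({om\<in>space P. real n + t * sqrt n < (\<Sum>k<n. (Z k om)\<^sup>2)} \<union> {om\<in>space P. (\<Sum>k<n. (Z k om)\<^sup>2) < real n - t * sqrt n})"
    by (intro finite_measure_mono) auto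
  also have "\<dots> \<le> prob {om\<in>space P. real n + t * sqrt n < (\<Sum>k<n. (Z k om)\<^sup>2)} + prob {om\<in>space P. (\<Sum>k<n. (Z k om)\<^sup>2) < real n - t * sqrt n}"
    by (rule measure_Un_le) auto
  also have "\<dots> \<le> exp 4 * exp (- t) + exp 4 * exp (- t)"
    by (intro add_mono G.sum_squares_upper_tail G.sum_squares_lower_tail n)
  finally show ?thesis unfolding quad by (simp add: mult.commute)
qed

lemma AE_lin_nonzero:
  assumes "c \<in> carrier_vec n" "c \<noteq> 0\<^sub>v n"
  shows "AE om in P. c \<bullet> x om \<noteq> 0"
proof -
  have v: "0 < th * (qf S c)" using pd_matD(3)[OF S assms] th by simp
  have "AE z in normal_law 0 (th * (qf S c)). z \<noteq> 0"
  proof -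
    have "AE z in lborel. 0 < ennreal (normal_density 0 (sqrt (th * (qf S c))) z) \<longrightarrow> z \<noteq> (0::real)"
      using AE_lborel_singleton[of "0::real"] by eventually_elim simp
    then show ?thesis using v unfolding normal_law_def by (simp only: if_True AE_density measurable_lborel1) (subst AE_density, auto)
  qed
  then show ?thesis unfolding x_law[OF assms(1), symmetric] by (subst (asm) AE_distr_iff) auto
qed

text \<open>Fewer columns than observations leave a nonzero \<open>v\<close> orthogonal to the range
  of \<open>M\<close>. If the observation lay in that range, \<open>v \<bullet> x om\<close> would
  vanish, an event of probability 0.\<close>

lemma AE_not_in_range:
  assumes M: "M \<in> carrier_mat n p" and pn: "p < n" and b0: "b0 \<in> carrier_vec p"
  shows "AE om in P. \<forall>b\<in>carrier_vec p. M *\<^sub>v b0 + x om \<noteq> M *\<^sub>v b"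
proof -
  \<comment> \<open>The transpose of \<open>M\<close>, padded with zero rows to a square matrix. Row
    \<open>p\<close> exists and is zero, so the determinant vanishes and there is a kernel
    vector.\<close>
  define A where "A = Matrix.mat n n (\<lambda>(i, j). if i < p then M $$ (j, i) else 0)"
  have A: "A \<in> carrier_mat n n" "A\<^sup>T \<in> carrier_mat n n" by (auto simp: A_def)
  have "A\<^sup>T *\<^sub>v unit_vec n p = 0\<^sub>v n"
    using pn by (intro eq_vecI) (auto simp: A_def)
  moreover have "unit_vec n p \<noteq> (0\<^sub>v n :: real vec)" using pn by (metis index_unit_vec(2) index_zero_vec(1) zero_neq_one)
  ultimately have "mdet (A\<^sup>T) = 0"
    using det_0_iff_vec_prod_zero_field[OF A(2)] by (metis unit_vec_carrier)
  then have "mdet A = 0" using det_transpose[OF A(1)] by simp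
  then obtain v where v: "v \<in> carrier_vec n" "v \<noteq> 0\<^sub>v n" "A *\<^sub>v v = 0\<^sub>v n"
    using det_0_iff_vec_prod_zero_field[OF A(1)] by auto
  have Mv: "M\<^sup>T *\<^sub>v v = 0\<^sub>v p"
  proof (intro eq_vecI)
    fix i assume i: "i < dim_vec (0\<^sub>v p :: real vec)"
    then have ip: "i < p" by simp
    have "(A *\<^sub>v v) $ i = 0" unfolding v(3) using ip pn by simp
    moreover have "(A *\<^sub>v v) $ i = (M\<^sup>T *\<^sub>v v) $ i"
      using ip pn M v(1) by (simp add: A_def scalar_prod_def)
    ultimately show "(M\<^sup>T *\<^sub>v v) $ i = 0\<^sub>v p $ i" using ip by simp
  qed (use M in simp)
  have orth: "v \<bullet> (M *\<^sub>v b) = 0" if b: "b \<in> carrier_vec p" for b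
    using transpose_vec_mult_scalar[OF M b v(1)] b unfolding Mv by simp
  show ?thesis using AE_lin_nonzero[OF v(1,2)]
  proof eventually_elim
    case (elim om)
    show ?case
    proof
      fix b :: "real vec" assume b: "b \<in> carrier_vec p"
      show "M *\<^sub>v b0 + x om \<noteq> M *\<^sub>v b"
      proof
        assume "M *\<^sub>v b0 + x om = M *\<^sub>v b"
        then have "v \<bullet> (M *\<^sub>v b0 + x om) = 0" using orth[OF b] by simp
        then have "v \<bullet> x om = 0"
          using orth[OF b0] v(1) x[of om] M b0 by (simp add: scalar_prod_add_distrib[of _ n])
        with elim show False by simp
      qed
    qed
  qed
qed

end

lemma AE_eventually_of_tail:
  fixes Q :: "nat \<Rightarrow> 'w \<Rightarrow> bool"
  assumes P: "prob_space P"
    and ev: "\<forall>\<^sub>F n in sequentially. {om\<in>space P. Q n om} \<in> sets P \<and> measure P {om\<in>space P. Q n om} \<le> C / (real n)\<^sup>2"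
  shows "AE om in P. \<forall>\<^sub>F n in sequentially. \<not> Q n om"
proof -
  interpret prob_space P by (rule P)
  obtain n0 where n0: "\<And>n. n0 \<le> n \<Longrightarrow> {om\<in>space P. Q n om} \<in> sets P \<and> prob {om\<in>space P. Q n om} \<le> C / (real n)\<^sup>2"
    using ev unfolding eventually_sequentially by blast
  \<comment> \<open>Measurability is known only for large \<open>n\<close>; the earlier events are
    replaced by the empty set.\<close>
  define A where "A = (\<lambda>n. if n0 \<le> n then {om\<in>space P. Q n om} else {})"
  have "summable (\<lambda>n. C * (1 / (real n) ^ 2))"
    by (intro summable_mult inverse_power_summable[of 2, where 'a=real, unfolded inverse_eq_divide]) auto
  then have "summable (\<lambda>n. prob (A n))"
  proof (rule summable_comparison_test_ev[rotated])
    show "\<forall>\<^sub>F n in sequentially. norm (prob (A n)) \<le> C * (1 / (real n) ^ 2)"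
      using eventually_ge_at_top[of n0] by eventually_elim (use n0 in \<open>simp add: A_def\<close>)
  qed
  then have "AE om in P. \<forall>\<^sub>F n in sequentially. om \<in> space P - A n"
    using n0 by (intro borel_cantelli_AE1) (auto simp: emeasure_eq_measure A_def)
  then show ?thesis
  proof eventually_elim
    case (elim om)
    then show ?case using eventually_ge_at_top[of n0] by eventually_elim (auto simp: A_def)
  qed
qed

section \<open>Regularity of the likelihood along a path\<close>

context matern_gls
begin

abbreviation "df \<equiv> real n - real p"

definition ell :: "real vec \<Rightarrow> real \<Rightarrow> real" where
  "ell y al = - df / 2 * ln (q al y / df) - 1 / 2 * ln (D al) - df / 2"

text \<open>\<open>n - p\<close> times the REML; undivided, it is directly comparable with quadratic
  forms of the data.\<close>

definition tau :: "real vec \<Rightarrow> real \<Rightarrow> real" where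
  "tau y al = al powr (2 * nu) * q al y"

lemma ln_q_le:
  assumes "0 < a" "0 < b" "y \<in> carrier_vec n" and q: "0 < q a y" "0 < q b y"
  shows "ln (q a y) \<le> ln (q b y) + max (real DIM('a) * ln (a / b)) (2 * nu * ln (b / a))"
proof (cases "a \<le> b")
  case True
  have "ln (q a y) \<le> ln ((b / a) powr (2 * nu) * q b y)"
    using q_compare_larger[OF assms(1) True assms(3)] q assms by (subst ln_le_cancel_iff) auto
  also have "\<dots> = 2 * nu * ln (b / a) + ln (q b y)" using q assms by (subst ln_mult) (auto simp: ln_powr)
  finally show ?thesis by simp
next
  case False
  then have ba: "b \<le> a" by simp
  have "ln (q a y) \<le> ln ((a / b) powr DIM('a) * q b y)"
    using q_compare_smaller[OF assms(2) ba assms(3)] q assms by (subst ln_le_cancel_iff) auto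
  also have "\<dots> = DIM('a) * ln (a / b) + ln (q b y)" using q assms by (subst ln_mult) (auto simp: ln_powr)
  finally show ?thesis by simp
qed

lemma ln_D_le_smaller:
  assumes "0 < a" "a \<le> b"
  shows "ln (D b) \<le> ln (D a) + real n * (2 * nu) * ln (b / a)"
proof -
  have "ln (D b) \<le> ln (((b / a) powr (2 * nu)) ^ n * D a)"
    using D_compare_smaller[OF assms] D_pos[of a] D_pos[of b] assms by (subst ln_le_cancel_iff) auto
  also have "\<dots> = n * (2 * nu * ln (b / a)) + ln (D a)"
    using D_pos[of a] assms by (subst ln_mult) (auto simp: ln_powr ln_realpow)
  finally show ?thesis by simp
qed

lemma ln_D_le_larger:
  assumes "0 < a" "a \<le> b"
  shows "ln (D a) \<le> ln (D b) + real n * DIM('a) * ln (b / a)"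
proof -
  have "ln (D a) \<le> ln (((b / a) powr DIM('a)) ^ n * D b)"
    using D_compare_larger[OF assms] D_pos[of a] D_pos[of b] assms by (subst ln_le_cancel_iff) auto
  also have "\<dots> = n * (DIM('a) * ln (b / a)) + ln (D b)"
    using D_pos[of b] assms by (subst ln_mult) (auto simp: ln_powr ln_realpow)
  finally show ?thesis by simp
qed

lemma ell_diff:
  assumes y: "y \<in> carrier_vec n" and pn: "p \<le> n" and q: "p < n \<Longrightarrow> 0 < q a y" "p < n \<Longrightarrow> 0 < q b y"
  shows "ell y a - ell y b = df / 2 * (ln (q b y) - ln (q a y)) + 1 / 2 * (ln (D b) - ln (D a))"
proof (cases "p < n")
  case True
  then have "ln (q c y / df) = ln (q c y) - ln df" if "0 < q c y" for c
    using that by (subst ln_div) auto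
  from this[OF q(1)[OF True]] this[OF q(2)[OF True]] show ?thesis
    unfolding ell_def by (simp only:) (simp add: field_simps)
next
  case False
  then have "real n - real p = 0" using pn by simp
  then show ?thesis unfolding ell_def by (simp only:) (simp add: field_simps)
qed

text \<open>In either direction one of quadratic form and determinants changes at the rate
  \<open>d\<close> and the other at the rate \<open>2 * nu\<close>, each weighted by at most
  \<open>n / 2\<close>; so the constant is the same both ways. It matches the power of
  \<open>al\<close> in the tail conditions on the prior.\<close>

lemma ell_le_smaller:
  assumes y: "y \<in> carrier_vec n" and pn: "p \<le> n" and ab: "0 < a" "a \<le> b"
    and q: "\<And>al. p < n \<Longrightarrow> 0 < al \<Longrightarrow> 0 < q al y"
  shows "\<bar>ell y a - ell y b\<bar> \<le> real n * (nu + real DIM('a) / 2) * ln (b / a)"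
proof -
  have b: "0 < b" using ab by simp
  define l where "l = ln (b / a)"
  have l: "0 \<le> l" using ab unfolding l_def by simp
  have l': "ln (a / b) = - l" using ab by (simp add: l_def ln_div)
  let ?N = "df / 2"
  have N: "0 \<le> ?N" "?N \<le> real n / 2" using pn by auto
  have 1: "?N * (ln (q b y) - ln (q a y)) \<le> ?N * (DIM('a) * l)"
  proof (cases "p < n")
    case True
    have "max (real DIM('a) * ln (b / a)) (2 * nu * ln (a / b)) = DIM('a) * l"
      unfolding l' l_def[symmetric] using l nu by (simp add: max_def) (smt (verit) mult_nonneg_nonneg of_nat_0_le_iff)
    then have "ln (q b y) \<le> ln (q a y) + DIM('a) * l"
      using ln_q_le[OF b ab(1) y q[OF True b] q[OF True ab(1)]] by simp
    then show ?thesis using N by (intro mult_left_mono) auto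
  qed (use pn in simp)
  have 2: "?N * (ln (q a y) - ln (q b y)) \<le> ?N * (2 * nu * l)"
  proof (cases "p < n")
    case True
    have "max (real DIM('a) * ln (a / b)) (2 * nu * ln (b / a)) = 2 * nu * l"
      unfolding l' l_def[symmetric] using l nu by (simp add: max_def) (smt (verit) mult_nonneg_nonneg of_nat_0_le_iff)
    then have "ln (q a y) \<le> ln (q b y) + 2 * nu * l"
      using ln_q_le[OF ab(1) b y q[OF True ab(1)] q[OF True b]] by simp
    then show ?thesis using N by (intro mult_left_mono) auto
  qed (use pn in simp)
  have 3: "?N * (DIM('a) * l) \<le> real n / 2 * (DIM('a) * l)" "?N * (2 * nu * l) \<le> real n / 2 * (2 * nu * l)"
    using N l nu by (auto intro!: mult_right_mono)
  have 4: "ell y a - ell y b = ?N * (ln (q b y) - ln (q a y)) + 1 / 2 * (ln (D b) - ln (D a))"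
    by (rule ell_diff[OF y pn q q]) (use ab b in auto)
  have 5: "?N * (ln (q a y) - ln (q b y)) = - (?N * (ln (q b y) - ln (q a y)))" by (simp add: algebra_simps)
  note DD = ln_D_le_smaller[OF ab, folded l_def] ln_D_le_larger[OF ab, folded l_def]
  have 6: "real n * (nu + real DIM('a) / 2) * l = real n / 2 * (DIM('a) * l) + real n / 2 * (2 * nu * l)"
    by (simp add: algebra_simps)
  have 7: "real n * (2 * nu) * l = 2 * (real n / 2 * (2 * nu * l))" "real n * DIM('a) * l = 2 * (real n / 2 * (DIM('a) * l))"
    by simp_all
  define X Y A where "X = real n / 2 * (DIM('a) * l)" and "Y = real n / 2 * (2 * nu * l)" and "A = ?N * (ln (q b y) - ln (q a y))"
  have "\<bar>A + 1 / 2 * (ln (D b) - ln (D a))\<bar> \<le> X + Y"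
    using order_trans[OF 1 3(1)] order_trans[OF 2 3(2)] DD
    unfolding 5 7 X_def[symmetric] Y_def[symmetric] A_def[symmetric] abs_le_iff by (auto simp: field_simps)
  then show ?thesis unfolding l_def[symmetric] 4 6 X_def Y_def A_def .
qed

lemma ell_lipschitz:
  assumes y: "y \<in> carrier_vec n" and pn: "p \<le> n" and ab: "0 < a" "0 < b"
    and q: "\<And>al. p < n \<Longrightarrow> 0 < al \<Longrightarrow> 0 < q al y"
  shows "\<bar>ell y a - ell y b\<bar> \<le> real n * (nu + real DIM('a) / 2) * \<bar>ln (a / b)\<bar>"
proof (cases "a \<le> b")
  case True
  have "\<bar>ln (a / b)\<bar> = ln (b / a)" using True ab by (simp add: ln_div)
  then show ?thesis using ell_le_smaller[OF y pn ab(1) True q] by simp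
next
  case False
  then have "\<bar>ln (a / b)\<bar> = ln (a / b)" using ab by (simp add: ln_div)
  then show ?thesis using ell_le_smaller[OF y pn ab(2) _ q, of a] False by (simp add: abs_minus_commute)
qed

lemma ln_tau: "0 < al \<Longrightarrow> 0 < q al y \<Longrightarrow> ln (tau y al) = 2 * nu * ln al + ln (q al y)"
  unfolding tau_def by (subst ln_mult) (auto simp: ln_powr)

text \<open>Written with \<open>tau\<close>, the powers of \<open>b / a\<close> in the quadratic
  form and in the determinants cancel except for \<open>p\<close> of them. Since \<open>tau\<close>
  hardly varies over the range, this is far sharper than the Lipschitz bound and controls the
  likelihood at the lower endpoint.\<close>

lemma ell_le_below:
  assumes y: "y \<in> carrier_vec n" and pn: "p < n" and ab: "0 < a" "a \<le> b" and q: "0 < q a y" "0 < q b y"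
  shows "ell y a - ell y b \<le> df / 2 * (ln (tau y b) - ln (tau y a)) + nu * p * ln (b / a)"
proof -
  have b: "0 < b" using ab by simp
  have l: "ln (b / a) = ln b - ln a" using ab b by (simp add: ln_div)
  have "ell y a - ell y b = df / 2 * (ln (q b y) - ln (q a y)) + 1 / 2 * (ln (D b) - ln (D a))"
    by (rule ell_diff[OF y _ q]) (use pn in auto)
  also have "\<dots> \<le> df / 2 * (ln (q b y) - ln (q a y)) + real n * nu * ln (b / a)"
    using ln_D_le_smaller[OF ab] by simp
  also have "\<dots> = df / 2 * (ln (tau y b) - ln (tau y a)) + nu * p * ln (b / a)"
    unfolding ln_tau[OF ab(1) q(1)] ln_tau[OF b q(2)] l by (simp add: field_simps)
  finally show ?thesis .
qed

text \<open>In this direction the crude comparison of determinants would lose a term of order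
  \<open>n * ln (b / a)\<close>; the trace version loses only half the excess of the trace over
  \<open>n\<close>.\<close>

lemma ell_le_above:
  assumes y: "y \<in> carrier_vec n" and pn: "p < n" and ab: "0 < a" "a \<le> b" and q: "0 < q a y" "0 < q b y"
  shows "ell y b - ell y a \<le> df / 2 * (ln (tau y a) - ln (tau y b)) + (mtrace (mat_inv (S b) * S a) - real n) / 2"
proof -
  have b: "0 < b" using ab by simp
  have l: "ln (b / a) = ln b - ln a" using ab b by (simp add: ln_div)
  define t where "t = (b / a) powr (2 * nu)"
  have t: "0 < t" using ab b by (simp add: t_def)
  have lt: "ln t = 2 * nu * (ln b - ln a)" unfolding t_def l[symmetric] using ab b by (simp add: ln_powr)
  let ?m = "mtrace (mat_inv (S b) * S a) - real n"
  have "ln (t ^ n * (1 / t) ^ p * D a) \<le> ln (D b * exp ?m)"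
    using D_compare_trace[OF ab] D_pos[OF ab(1)] D_pos[OF b] t unfolding t_def[symmetric] by (subst ln_le_cancel_iff) auto
  moreover have "ln (t ^ n * (1 / t) ^ p * D a) = n * ln t - p * ln t + ln (D a)"
    using t D_pos[OF ab(1)] by (simp add: ln_mult ln_realpow ln_div)
  moreover have "ln (D b * exp ?m) = ln (D b) + ?m" using D_pos[OF b] by (simp add: ln_mult)
  ultimately have D: "ln (D a) - ln (D b) \<le> ?m - df * (2 * nu * (ln b - ln a))"
    by (simp add: lt algebra_simps)
  have "ell y b - ell y a = df / 2 * (ln (q a y) - ln (q b y)) + 1 / 2 * (ln (D a) - ln (D b))"
    by (rule ell_diff[OF y _ q(2,1)]) (use pn in auto)
  also have "\<dots> \<le> df / 2 * (ln (q a y) - ln (q b y)) + 1 / 2 * (?m - df * (2 * nu * (ln b - ln a)))"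
    using D by simp
  also have "\<dots> = df / 2 * (ln (tau y a) - ln (tau y b)) + ?m / 2"
    unfolding ln_tau[OF ab(1) q(1)] ln_tau[OF b q(2)] by (simp add: field_simps)
  finally show ?thesis .
qed

end

text \<open>1/8 is small enough for 1/3 + 1/8 to stay below 1/2. Up to \<open>nu = 10\<close> the
  cap 0.005 suffices, as \<open>0.005 * 25 = 1 / 8\<close>; beyond that the bound
  \<open>1 / (24 * nu)\<close> does.\<close>

lemma exponent_bound:
  fixes nu d k :: real
  assumes "0 < nu" "d \<le> 3" "0 < k" "k \<le> 0.005" "k \<le> 1 / (24 * nu)"
  shows "k * (2 * nu + d + 2) \<le> 1 / 8"
proof (cases "nu \<le> 10")
  case True
  then have "k * (2 * nu + d + 2) \<le> k * 25" using assms by (intro mult_left_mono) auto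
  also have "\<dots> \<le> 1 / 8" using assms by simp
  finally show ?thesis .
next
  case False
  have "k * (2 * nu + d + 2) \<le> k * (2 * nu + 5)" using assms by (intro mult_left_mono) auto
  also have "\<dots> \<le> 1 / (24 * nu) * (2 * nu + 5)" using assms by (intro mult_right_mono) auto
  also have "\<dots> \<le> 1 / 8" using False by (simp add: field_simps)
  finally show ?thesis .
qed

lemma kappa_lower_bounds:
  assumes "0 < nu" "1 \<le> d" "d \<le> 3"
  shows "0 < kappa_lower d nu" "kappa_lower d nu * (2 * nu + real d + 2) \<le> 1 / 8"
proof -
  have d: "1 \<le> real d" "real d \<le> 3" using assms by auto
  show pos: "0 < kappa_lower d nu" unfolding kappa_lower_def using assms d
    by (auto intro!: divide_pos_pos mult_pos_pos)
  have "kappa_lower d nu \<le> 1 / 2 * (1 / (4 * (3 * nu + real d)))" unfolding kappa_lower_def by (intro mult_left_mono Min_le) auto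
  also have "\<dots> \<le> 1 / (24 * nu)" using assms d by (simp add: field_simps)
  finally show "kappa_lower d nu * (2 * nu + real d + 2) \<le> 1 / 8"
    by (intro exponent_bound assms d pos) (simp_all add: kappa_lower_def)
qed

lemma kappa_upper_bounds:
  assumes "0 < nu" "1 \<le> d" "d \<le> 3"
  shows "0 < kappa_upper d nu" "kappa_upper d nu * (2 * nu + real d + 2) \<le> 1 / 8"
proof -
  have d: "1 \<le> real d" "real d \<le> 3" using assms by auto
  show pos: "0 < kappa_upper d nu" unfolding kappa_upper_def using assms d
    by (auto intro!: divide_pos_pos mult_pos_pos)
  \<comment> \<open>The first entry of the minimum is chosen because the second one, for large
    \<open>nu\<close>, decays only like \<open>1 / (8 * nu)\<close> after halving.\<close>
  have "kappa_upper d nu \<le> 1 / 2 * (0.9 / ((2 * real d + 0.94) * (8 * nu + 5 * real d + 0.9)))"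
    unfolding kappa_upper_def by simp
  also have "\<dots> = 0.45 / ((2 * real d + 0.94) * (8 * nu + 5 * real d + 0.9))" by simp
  also have "\<dots> \<le> 0.45 / (2.94 * (8 * nu))"
    using assms d by (intro divide_left_mono mult_mono mult_pos_pos) auto
  also have "\<dots> \<le> 1 / (24 * nu)" using assms by (simp add: field_simps)
  finally show "kappa_upper d nu * (2 * nu + real d + 2) \<le> 1 / 8"
    by (intro exponent_bound assms d pos) (simp_all add: kappa_upper_def)
qed

text \<open>23/48 lies halfway between 11/24 and 1/2: it absorbs the logarithm and still leaves a
  power of \<open>n\<close> below the scale \<open>sqrt n\<close> of the Gaussian
  fluctuation.\<close>

lemma spread_asymp:
  fixes th K B :: real
  shows "\<forall>\<^sub>F n in sequentially. 4 * (3 * ln (real n)) * (th * (real p + K * real n powr (11 / 24))) + B * real n powr (1 / 8) \<le> 1 / 2 * real n powr (23 / 48)" (is "\<forall>\<^sub>F n in _. ?S n \<le> _")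
proof -
  have "(\<lambda>n. ?S n / real n powr (23 / 48)) \<longlonglongrightarrow> 0"
    by real_asymp
  then have "\<forall>\<^sub>F n in sequentially. ?S n / real n powr (23 / 48) < 1 / 2"
    by (rule order_tendstoD) simp
  then show ?thesis using eventually_gt_at_top[of 0]
    by eventually_elim (simp add: field_simps)
qed

section \<open>Almost sure behaviour of the REML and of the profile likelihood\<close>

context matern_gls
begin

text \<open>Both quantities lie between the lower form at \<open>a1\<close> and the upper bound at
  \<open>a2\<close>, so their distance is at most the gap.\<close>

lemma tau_sandwich:
  assumes a: "0 < a1" "a1 \<le> a" "a \<le> a2" and a0: "a1 \<le> a0" "a0 \<le> a2"
    and z: "z \<in> carrier_vec n" and b: "b \<in> carrier_vec p"
  shows "\<bar>tau (M *\<^sub>v b + z) a - qf (mat_inv (S a0)) z\<bar>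
    \<le> qf (spread a1 a2) z + a2 powr (2 * nu) * (qf Om b)"
proof -
  have pos: "0 < a" "0 < a0" "0 < a2" using a a0 by auto
  have B: "0 \<le> a2 powr (2 * nu) * (qf Om b)" using psd_matD(3)[OF Om b] by simp
  have "qf (Q0 (S a1)) z \<le> qf (mat_inv (S a0)) z"
    using quad_Q0_le_inv[OF a(1) z] quad_inv_S_mono[OF a(1) a0(1) z] by simp
  moreover have "qf (mat_inv (S a0)) z \<le> qf (mat_inv (S a2)) z"
    by (rule quad_inv_S_mono[OF pos(2) a0(2) z])
  moreover note q_lower[OF a(1,2) z b, folded tau_def] q_upper[OF pos(1) a(3) z b, folded tau_def]
  ultimately show ?thesis unfolding quad_spread[OF a(1) pos(3) z] using B by linarith
qed

lemma mtrace_inv_S_antimono: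
  assumes "0 < c" "0 < a" "a \<le> b"
  shows "mtrace (mat_inv (S c) * S b) \<le> mtrace (mat_inv (S c) * S a)"
proof (rule mtrace_psd_mono[of n])
  show "psd_mat n (mat_inv (S c))" by (rule pd_mat_imp_psd[OF pd_mat_inv[OF pd_S[OF assms(1)]]])
  show "S b \<in> carrier_mat n n" "S a \<in> carrier_mat n n" using assms by (auto intro!: pd_matD(1)[OF pd_S])
qed (rule quad_S_antimono[OF assms(2,3)])

end

locale matern_regression = prob_space P for P :: "'w measure" +
  fixes nu al0 th0 T kl ku :: real and p :: nat and M :: "nat \<Rightarrow> real mat" and Om :: "real mat"
    and s :: "nat \<Rightarrow> nat \<Rightarrow> 'a::euclidean_space" and x :: "nat \<Rightarrow> 'w \<Rightarrow> real vec" and b0 :: "real vec"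
  assumes pos: "0 < al0" "0 < th0" and dim: "DIM('a) \<le> 3"
    and gls: "\<And>n. p \<le> n \<Longrightarrow> matern_gls n p (M n) Om nu (s n)"
    and coord: "\<And>n j e. j < n \<Longrightarrow> e \<in> Basis \<Longrightarrow> \<bar>inner (s n j) e\<bar> \<le> T"
    and gauss: "\<And>n. p \<le> n \<Longrightarrow> gaussian_vector P n (scaled_mat nu n (s n) al0) th0 (x n)"
    and b0: "b0 \<in> carrier_vec p"
    and kl: "0 < kl" "kl * (2 * nu + real DIM('a) + 2) \<le> 1 / 8"
    and ku: "0 < ku" "ku * (2 * nu + real DIM('a) + 2) \<le> 1 / 8"
begin

abbreviation "Sn n \<equiv> scaled_mat nu n (s n)"
abbreviation "lo n \<equiv> real n powr - kl"
abbreviation "hi n \<equiv> real n powr ku"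
abbreviation "trace_hi n \<equiv> mtrace (mat_inv (Sn n (hi n)) * Sn n (min 1 al0))"
abbreviation "trace_lo n \<equiv> mtrace (mat_inv (Sn n (max 1 al0)) * Sn n (lo n))"

abbreviation "Y n om \<equiv> M n *\<^sub>v b0 + x n om"
abbreviation "qn n om al \<equiv> matern_gls.q n (M n) Om nu (s n) al (Y n om)"
abbreviation "taun n om \<equiv> matern_gls.tau n (M n) Om nu (s n) (Y n om)"
abbreviation "elln n om \<equiv> matern_gls.ell n p (M n) Om nu (s n) (Y n om)"

lemma nu: "0 < nu" using matern_points.nu[OF matern_gls.axioms(2)[OF gls[of p]]] by simp

lemma Y_carrier: "p \<le> n \<Longrightarrow> Y n om \<in> carrier_vec n"
  using gaussian_vector.x[OF gauss, of n om] gls.M[OF matern_gls.axioms(1)[OF gls, of n]] b0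
  by (metis add_carrier_vec mult_mat_vec_carrier)

lemma AE_qn_pos:
  assumes "p < n"
  shows "AE om in P. \<forall>al>0. 0 < qn n om al"
proof -
  interpret V: gaussian_vector P n "Sn n al0" th0 "x n" by (rule gauss) (use assms in simp)
  interpret G: matern_gls n p "M n" Om nu "s n" by (rule gls) (use assms in simp)
  show ?thesis using V.AE_not_in_range[OF G.M assms b0]
  proof eventually_elim
    case (elim om)
    show ?case unfolding G.q_def using elim Y_carrier[of n] assms by (auto intro!: G.quad_Q_pos G.pd_R)
  qed
qed

lemma a12:
  "\<forall>\<^sub>F n in sequentially. 0 < lo n \<and> lo n \<le> min 1 al0 \<and> max 1 al0 \<le> hi n"
proof -
  note k = kl(1) ku(1)
  have "(\<lambda>n. lo n) \<longlonglongrightarrow> 0" using k by real_asymp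
  then have "\<forall>\<^sub>F n in sequentially. lo n < min 1 al0" by (rule order_tendstoD) (use pos in simp)
  moreover have "filterlim (\<lambda>n. hi n) at_top sequentially" using k by real_asymp
  then have "\<forall>\<^sub>F n in sequentially. max 1 al0 \<le> hi n" unfolding filterlim_at_top by blast
  ultimately show ?thesis using eventually_gt_at_top[of 0] by eventually_elim auto
qed

definition "trace_const C \<longleftrightarrow> 0 < C \<and> (\<forall>\<^sub>F n in sequentially.
    trace_hi n \<le> real n + C * real n powr (11 / 24) \<and>
    trace_lo n \<le> real n + C * real n powr (11 / 24))"

text \<open>In each trace one point is fixed and the other is an endpoint of the range, so the ratio
  is a constant times \<open>n powr kl\<close> or \<open>n powr ku\<close>. Its power
  \<open>e\<close> costs at most a multiple of \<open>n powr (1 / 8)\<close>, and 1/8 + 1/3 =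
  11/24.\<close>

lemma trace_const: obtains C where "trace_const C"
proof (rule mtrace_inv_scaled_mat_le[OF nu dim, of T], goal_cases)
  case (1 C)
  define e where "e = 2 * nu + real DIM('a) + 2"
  have e: "0 < e" using nu by (simp add: e_def)
  define A where "A = (1 / min 1 al0) powr e + (max 1 al0) powr e"
  have A: "0 < A" using pos by (simp add: A_def add_pos_pos)
  have "\<forall>\<^sub>F n in sequentially.
    trace_hi n \<le> real n + C * A * real n powr (11 / 24) \<and>
    trace_lo n \<le> real n + C * A * real n powr (11 / 24)"
    using a12 eventually_ge_at_top[of "max 1 p"]
  proof eventually_elim
    case (elim n)
    then have n: "1 \<le> n" "p \<le> n" by simp_all
    then have n1: "1 \<le> real n" by simp
    interpret G: matern_gls n p "M n" Om nu "s n" by (rule gls) (use n in simp)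
    note tr = 1(3)[OF n(1) G.inj_pts coord]
    have pw: "C * (r * real n powr k) powr e * real n powr (1 / 3) \<le> C * A * real n powr (11 / 24)"
      if r: "0 < r" "r powr e \<le> A" and k: "0 < k" "k * e \<le> 1 / 8" for r k
    proof -
      have "(r * real n powr k) powr e * real n powr (1 / 3) = r powr e * real n powr (k * e + 1 / 3)"
        using r n1 by (simp add: powr_mult powr_powr powr_add)
      also have "\<dots> \<le> A * real n powr (11 / 24)"
        using r k n1 A by (intro mult_mono powr_mono) (auto simp: mult.commute)
      finally show ?thesis using 1(2) by (simp add: mult.assoc)
    qed
    have "trace_hi n
      \<le> real n + C * (hi n / min 1 al0) powr e * real n powr (1 / 3)"
      unfolding e_def using elim pos by (intro tr) auto
    also have "hi n / min 1 al0 = 1 / min 1 al0 * real n powr ku" by simp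
    finally have X: "trace_hi n
      \<le> real n + C * (1 / min 1 al0 * real n powr ku) powr e * real n powr (1 / 3)" .
    have "trace_lo n
      \<le> real n + C * (max 1 al0 / lo n) powr e * real n powr (1 / 3)"
      unfolding e_def using elim pos by (intro tr) auto
    also have "max 1 al0 / lo n = max 1 al0 * real n powr kl" by (simp add: powr_minus divide_inverse)
    finally have Z: "trace_lo n
      \<le> real n + C * (max 1 al0 * real n powr kl) powr e * real n powr (1 / 3)" .
    have "(1 / min 1 al0) powr e \<le> A" "max 1 al0 powr e \<le> A" "0 < 1 / min 1 al0" "0 < max 1 al0"
      using pos by (auto simp: A_def)
    note r = this
    have "C * (1 / min 1 al0 * real n powr ku) powr e * real n powr (1 / 3) \<le> C * A * real n powr (11 / 24)"
      using ku unfolding e_def[symmetric] by (intro pw r)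
    moreover have "C * (max 1 al0 * real n powr kl) powr e * real n powr (1 / 3) \<le> C * A * real n powr (11 / 24)"
      using kl unfolding e_def[symmetric] by (intro pw r)
    ultimately show ?case using X Z by (meson add_left_mono order_trans)
  qed
  then show ?case using 1(1)[of "C * A"] 1(2) A by (simp add: trace_const_def)
qed

end

context matern_regression
begin

abbreviation "wn n om \<equiv> qf (mat_inv (Sn n al0)) (x n om)"
abbreviation "spreadn n \<equiv> matern_gls.spread n p (M n) nu (s n) (lo n) (hi n)"

lemma exp_ln_powers:
  assumes "0 < real n"
  shows "exp (- (2 * ln (real n))) = 1 / (real n)\<^sup>2" "real n * (sqrt 2 * exp (- (3 * ln (real n)))) = sqrt 2 / (real n)\<^sup>2"
  using assms exp_of_nat_mult[of 2 "ln (real n)"] exp_of_nat_mult[of 3 "ln (real n)"]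
  by (simp_all add: exp_minus field_simps power2_eq_square power3_eq_cube)

text \<open>The level \<open>2 * ln n\<close> makes the tail probability a multiple of
  \<open>1 / n^2\<close>, which is summable.\<close>

lemma AE_wn: "AE om in P. \<forall>\<^sub>F n in sequentially. \<not> 2 * ln n * sqrt n < \<bar>wn n om / th0 - real n\<bar>"
proof (rule AE_eventually_of_tail[OF prob_space_axioms, where C="2 * exp 4"])
  show "\<forall>\<^sub>F n in sequentially. {om\<in>space P. 2 * ln n * sqrt n < \<bar>wn n om / th0 - real n\<bar>} \<in> events \<and>
      prob {om\<in>space P. 2 * ln n * sqrt n < \<bar>wn n om / th0 - real n\<bar>} \<le> 2 * exp 4 / (real n)\<^sup>2"
    using eventually_ge_at_top[of "16 + p"]
  proof eventually_elim
    case (elim n)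
    then have n: "p \<le> n" "16 \<le> n" "0 < real n" by simp_all
    interpret V: gaussian_vector P n "Sn n al0" th0 "x n" by (rule gauss[OF n(1)])
    have "wn n om = (\<Sum>i<n. \<Sum>j<n. x n om $ i * x n om $ j * mat_inv (Sn n al0) $$ (i, j))" for om
      using V.x pd_matD(1)[OF pd_mat_inv[OF V.S]] by (intro quad_eq_sum)
    then show ?case
      using V.inv_quad_concentration[OF n(2), of "2 * ln n"] exp_ln_powers(1)[OF n(3)] by simp
  qed
qed

lemma spreadn_trace:
  assumes "trace_const C"
  shows "\<forall>\<^sub>F n in sequentially. psd_mat n (spreadn n) \<and>
    mtrace (spreadn n * Sn n al0) \<le> real p + 2 * C * real n powr (11 / 24)"
proof -
  have "\<forall>\<^sub>F n in sequentially.
    trace_hi n \<le> real n + C * real n powr (11 / 24) \<and>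
    trace_lo n \<le> real n + C * real n powr (11 / 24)"
    using assms by (simp add: trace_const_def)
  then show ?thesis using a12 eventually_ge_at_top[of p]
  proof eventually_elim
    case (elim n)
    interpret G: matern_gls n p "M n" Om nu "s n" by (rule gls) (rule elim(3))
    have "psd_mat n (spreadn n)" using elim(2) by (intro G.psd_spread) auto
    moreover have "mtrace (spreadn n * Sn n al0) \<le> real p
       + (trace_hi n - real n)
       + (trace_lo n - real n)"
      using elim(2) pos by (intro G.mtrace_spread_le) auto
    ultimately show ?case using elim(1) by simp
  qed
qed

text \<open>\<open>3 * ln n\<close> in the place of \<open>2 * ln n\<close> compensates the factor
  \<open>n\<close> of the union bound in \<open>quad_tail\<close>.\<close>

lemma AE_spreadn:
  assumes C: "trace_const C"
  shows "AE om in P. \<forall>\<^sub>F n in sequentially.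
    \<not> 4 * (3 * ln n) * (th0 * (real p + 2 * C * real n powr (11 / 24))) < qf (spreadn n) (x n om)"
proof (rule AE_eventually_of_tail[OF prob_space_axioms, where C="sqrt 2"])
  define V where "V = (\<lambda>n. real p + 2 * C * real n powr (11 / 24))"
  show "\<forall>\<^sub>F n in sequentially.
      {om\<in>space P. 4 * (3 * ln n) * (th0 * (real p + 2 * C * real n powr (11 / 24))) < qf (spreadn n) (x n om)} \<in> events \<and>
      prob {om\<in>space P. 4 * (3 * ln n) * (th0 * (real p + 2 * C * real n powr (11 / 24))) < qf (spreadn n) (x n om)} \<le> sqrt 2 / (real n)\<^sup>2"
    using spreadn_trace[OF C] eventually_ge_at_top[of "1 + p"] unfolding V_def[symmetric, THEN fun_cong]
  proof eventually_elim
    case (elim n)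
    then have n: "p \<le> n" "0 < real n" "0 \<le> 3 * ln n" by simp_all
    interpret V: gaussian_vector P n "Sn n al0" th0 "x n" by (rule gauss[OF n(1)])
    have "qf (spreadn n) (x n om) = (\<Sum>i<n. \<Sum>j<n. x n om $ i * x n om $ j * spreadn n $$ (i, j))" for om
      using V.x psd_matD(1)[OF conjunct1[OF elim(1)]] by (intro quad_eq_sum)
    then have "(\<lambda>om. x n om \<bullet> (spreadn n *\<^sub>v x n om)) \<in> borel_measurable P" by simp
    then show ?case
      using V.quad_tail[OF conjunct1[OF elim(1)] conjunct2[OF elim(1)] n(3)] unfolding exp_ln_powers(2)[OF n(2)] by simp
  qed
qed

text \<open>All that the deterministic part needs from a sample path. The last clause can be crude:
  a bound of order \<open>n\<close> at the endpoints is beaten by the \<open>n * ln n\<close> gained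
  from the tail conditions on the prior.\<close>

definition "regular_path om \<longleftrightarrow> (\<forall>n>p. \<forall>al>0. 0 < qn n om al) \<and>
  (\<forall>\<^sub>F n in sequentially. \<forall>al\<in>{lo n..hi n}. \<bar>taun n om al - taun n om al0\<bar> \<le> real n powr (23 / 48)) \<and>
  (\<forall>\<^sub>F n in sequentially. \<bar>taun n om al0 - th0 * n\<bar> \<le> 3 * th0 * ln n * sqrt n) \<and>
  (\<forall>\<^sub>F n in sequentially. elln n om (lo n) - elln n om al0 \<le> 2 * real n \<and> elln n om (hi n) - elln n om al0 \<le> 2 * real n)"

lemma AE_regular_path: "AE om in P. regular_path om"
proof -
  obtain C where C: "trace_const C" by (rule trace_const)
  have "AE om in P. \<forall>n>p. \<forall>al>0. 0 < qn n om al"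
    using AE_qn_pos by (simp add: AE_all_countable)
  then show ?thesis using AE_wn[unfolded not_less] AE_spreadn[OF C, unfolded not_less]
  proof eventually_elim
    case (elim om)
    define B where "B = qf Om b0"
    \<comment> \<open>One centre \<open>wn\<close> for all \<open>al\<close> in the range; closeness
      of the values to each other and to \<open>th0 * n\<close> then follows by the triangle
      inequality.\<close>
    have tauw: "\<forall>\<^sub>F n in sequentially. \<forall>al\<in>{lo n..hi n}. \<bar>taun n om al - wn n om\<bar> \<le> 1 / 2 * real n powr (23 / 48)"
      using elim(3) a12 eventually_ge_at_top[of "max 1 p"] spread_asymp[of th0 p "2 * C" B]
    proof eventually_elim
      case (elim n)
      then have n: "p \<le> n" "1 \<le> n" by simp_all
      interpret G: matern_gls n p "M n" Om nu "s n" by (rule gls[OF n(1)])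
      have B: "0 \<le> B" unfolding B_def by (rule psd_matD(3)[OF G.Om b0])
      have "hi n powr (2 * nu) = real n powr (ku * (2 * nu))"
        by (simp add: powr_powr)
      also have "\<dots> \<le> real n powr (1 / 8)"
      proof (intro powr_mono)
        have "ku * (2 * nu) \<le> ku * (2 * nu + real DIM('a) + 2)"
          using ku by (intro mult_left_mono) auto
        then show "ku * (2 * nu) \<le> 1 / 8" using ku(2) by linarith
      qed (use n in simp)
      finally have "hi n powr (2 * nu) * B \<le> real n powr (1 / 8) * B" using B by (rule mult_right_mono)
      then have up: "hi n powr (2 * nu) * B \<le> B * real n powr (1 / 8)" by (simp only: mult.commute[of B])
      show ?case
      proof
        fix al assume a: "al \<in> {lo n..hi n}"
        have "\<bar>taun n om al - wn n om\<bar> \<le> qf (spreadn n) (x n om) + hi n powr (2 * nu) * B"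
          unfolding B_def using a elim(2) gaussian_vector.x[OF gauss[OF n(1)]] by (intro G.tau_sandwich b0) auto
        then show "\<bar>taun n om al - wn n om\<bar> \<le> 1 / 2 * real n powr (23 / 48)" using elim(1,4) up by linarith
      qed
    qed
    have c1: "\<forall>\<^sub>F n in sequentially. \<forall>al\<in>{lo n..hi n}. \<bar>taun n om al - taun n om al0\<bar> \<le> real n powr (23 / 48)"
      using tauw a12
    proof eventually_elim
      case (elim n)
      then have "\<bar>taun n om al0 - wn n om\<bar> \<le> 1 / 2 * real n powr (23 / 48)" by simp
      show ?case
      proof
        fix al assume "al \<in> {lo n..hi n}"
        then have "\<bar>taun n om al - wn n om\<bar> \<le> 1 / 2 * real n powr (23 / 48)" using elim(1) by blast
        with \<open>\<bar>taun n om al0 - wn n om\<bar> \<le> _\<close> show "\<bar>taun n om al - taun n om al0\<bar> \<le> real n powr (23 / 48)" by linarith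
      qed
    qed
    have c2: "\<forall>\<^sub>F n in sequentially. \<bar>taun n om al0 - th0 * n\<bar> \<le> 3 * th0 * ln n * sqrt n"
    proof -
      have "(\<lambda>n. real n powr (23 / 48) / (ln n * sqrt n)) \<longlonglongrightarrow> 0" by real_asymp
      then have "\<forall>\<^sub>F n in sequentially. real n powr (23 / 48) / (ln n * sqrt n) < th0"
        by (rule order_tendstoD) (rule pos)
      then show ?thesis using tauw a12 elim(2) eventually_gt_at_top[of 1]
      proof eventually_elim
        case (elim n)
        have l: "0 < ln n * sqrt n" using elim(5) by simp
        have 1: "real n powr (23 / 48) \<le> th0 * (ln n * sqrt n)" using elim(1) l by (simp add: divide_less_eq)
        have 2: "\<bar>taun n om al0 - wn n om\<bar> \<le> 1 / 2 * real n powr (23 / 48)" using elim(2,3) by simp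
        have "\<bar>wn n om - th0 * n\<bar> = th0 * \<bar>wn n om / th0 - real n\<bar>"
          using pos by (simp add: abs_mult_pos' right_diff_distrib)
        also have "\<dots> \<le> th0 * (2 * ln n * sqrt n)" using elim(4) pos by (intro mult_left_mono) auto
        finally have "\<bar>wn n om - th0 * n\<bar> \<le> 2 * (th0 * (ln n * sqrt n))" by (simp add: mult_ac)
        moreover have "3 * th0 * ln n * sqrt n = 3 * (th0 * (ln n * sqrt n))" by simp
        ultimately show ?case using 1 2 by linarith
      qed
    qed
    have c3: "\<forall>\<^sub>F n in sequentially. elln n om (lo n) - elln n om al0 \<le> 2 * real n \<and> elln n om (hi n) - elln n om al0 \<le> 2 * real n"
    proof -
      have e1: "\<forall>\<^sub>F n in sequentially. 3 * th0 * ln (real n) * sqrt (real n) + real n powr (23 / 48) < 1 / 2 * (th0 * real n)"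
      proof -
        have "(\<lambda>n. (3 * th0 * ln (real n) * sqrt (real n) + real n powr (23 / 48)) / real n) \<longlonglongrightarrow> 0" by real_asymp
        then have "\<forall>\<^sub>F n in sequentially. (3 * th0 * ln (real n) * sqrt (real n) + real n powr (23 / 48)) / real n < 1 / 2 * th0"
          by (rule order_tendstoD) (use pos in simp)
        then show ?thesis using eventually_gt_at_top[of 0] by eventually_elim (simp add: divide_less_eq)
      qed
      have e2: "\<forall>\<^sub>F n in sequentially. nu * p * ln (al0 / lo n) < real n"
      proof -
        have "(\<lambda>n. (nu * p * (ln al0 + kl * ln n)) / real n) \<longlonglongrightarrow> 0" by real_asymp
        then have "\<forall>\<^sub>F n in sequentially. (nu * p * (ln al0 + kl * ln n)) / real n < 1"
          by (rule order_tendstoD) simp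
        then show ?thesis using eventually_gt_at_top[of 0]
        proof eventually_elim
          case (elim n)
          have "ln (al0 / lo n) = ln al0 + kl * ln n"
            using pos elim by (simp add: ln_div ln_powr)
          then show ?case using elim by (simp add: divide_less_eq)
        qed
      qed
      have e3: "\<forall>\<^sub>F n in sequentially. C * real n powr (11 / 24) < real n"
      proof -
        have "(\<lambda>n. C * real n powr (11 / 24) / real n) \<longlonglongrightarrow> 0" by real_asymp
        then have "\<forall>\<^sub>F n in sequentially. C * real n powr (11 / 24) / real n < 1" by (rule order_tendstoD) simp
        then show ?thesis using eventually_gt_at_top[of 0] by eventually_elim (simp add: divide_less_eq)
      qed
      have e4: "\<forall>\<^sub>F n in sequentially.
        trace_hi n \<le> real n + C * real n powr (11 / 24)"
        using C unfolding trace_const_def by (auto elim: eventually_mono)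
      show ?thesis using e1 e2 e3 e4 c1 c2 a12 eventually_gt_at_top[of p]
      proof eventually_elim
        case (elim n)
        interpret G: matern_gls n p "M n" Om nu "s n" by (rule gls) (use elim(8) in simp)
        let ?l = "lo n" and ?u = "hi n"
        have ord: "0 < ?l" "?l \<le> al0" "al0 \<le> ?u" "0 < ?u" using elim(7) pos by auto
        \<comment> \<open>All values over the range are within a factor 3 of each other.\<close>
        have tb: "1 / 2 * (th0 * real n) \<le> taun n om al" "taun n om al \<le> 3 / 2 * (th0 * real n)"
          if "al \<in> {?l..?u}" for al
        proof -
          have "\<bar>taun n om al - taun n om al0\<bar> \<le> real n powr (23 / 48)" using elim(5) that by blast
          with elim(1,6) show "1 / 2 * (th0 * real n) \<le> taun n om al" "taun n om al \<le> 3 / 2 * (th0 * real n)" by linarith+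
        qed
        have n0: "0 < th0 * real n" using pos elim(8) by simp
        \<comment> \<open>A ratio of at most 3 has logarithm at most \<open>3 - 1\<close>.\<close>
        have lt: "ln (taun n om al0) - ln (taun n om al) \<le> 2" if a: "al \<in> {?l..?u}" for al
        proof -
          have "0 < taun n om al" using tb(1)[OF a] n0 by linarith
          moreover have "0 < taun n om al0" using tb(1)[of al0] n0 ord by (simp add: less_le_trans)
          moreover have "taun n om al0 \<le> 3 * taun n om al" using tb(1)[OF a] tb(2)[of al0] ord by simp
          ultimately have r: "0 < taun n om al0 / taun n om al" "taun n om al0 / taun n om al \<le> 3"
             and l: "ln (taun n om al0 / taun n om al) = ln (taun n om al0) - ln (taun n om al)"
            by (simp_all add: divide_le_eq ln_div)
          show ?thesis using ln_le_minus_one[OF r(1)] r(2) unfolding l by linarith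
        qed
        have N: "(real n - real p) / 2 * t \<le> real n" if "t \<le> 2" for t
        proof -
          have "(real n - real p) / 2 * t \<le> (real n - real p) / 2 * 2" using that elim(8) by (intro mult_left_mono) auto
          then show ?thesis by simp
        qed
        have q: "0 < qn n om al" if "0 < al" for al using \<open>\<forall>n>p. \<forall>al>0. 0 < qn n om al\<close> elim(8) that by blast
        have "elln n om ?l - elln n om al0 \<le> (real n - real p) / 2 * (ln (taun n om al0) - ln (taun n om ?l)) + nu * p * ln (al0 / ?l)"
          using elim(8) ord by (intro G.ell_le_below Y_carrier q) (auto simp: pos)
        moreover have "(real n - real p) / 2 * (ln (taun n om al0) - ln (taun n om ?l)) \<le> real n"
          using ord by (intro N lt) auto
        ultimately have 1: "elln n om ?l - elln n om al0 \<le> 2 * real n" using elim(2) by simp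
        \<comment> \<open>Collects the summands: the part \<open>A\<close> from the quadratic forms,
          and half the trace excess, which is itself below \<open>k\<close>.\<close>
        have gen: "e \<le> 2 * k" if "e \<le> A + (m - k) / 2" "A \<le> k" "m \<le> m'" "c < k" "m' \<le> k + c" "0 \<le> k" for e A m m' k c :: real
          using that by (simp add: field_simps)
        have "elln n om ?u - elln n om al0 \<le> (real n - real p) / 2 * (ln (taun n om al0) - ln (taun n om ?u))
            + (mtrace (mat_inv (Sn n ?u) * Sn n al0) - real n) / 2"
          using elim(8) ord by (intro G.ell_le_above Y_carrier q) (auto simp: pos)
        moreover have "(real n - real p) / 2 * (ln (taun n om al0) - ln (taun n om ?u)) \<le> real n"
          using ord by (intro N lt) auto
        moreover have "mtrace (mat_inv (Sn n ?u) * Sn n al0)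
          \<le> mtrace (mat_inv (Sn n ?u) * Sn n (min 1 al0))"
          using ord pos by (intro G.mtrace_inv_S_antimono) auto
        ultimately have 2: "elln n om ?u - elln n om al0 \<le> 2 * real n" using elim(3,4) of_nat_0_le_iff by (rule gen)
        from 1 2 show ?case ..
      qed
    qed
    show ?case unfolding regular_path_def using elim(1) c1 c2 c3 by blast
  qed
qed

end

section \<open>Laplace approximation of the posterior\<close>

abbreviation lborel2 :: "(real \<times> real) measure" where
  "lborel2 \<equiv> lborel \<Otimes>\<^sub>M lborel"

section \<open>Total variation distance and joint measurability\<close>

lemma tv_dist_leI:
  assumes "\<And>A. A \<in> sets M \<Longrightarrow> \<bar>measure M A - measure N A\<bar> \<le> e"
  shows "tv_dist M N \<le> e"
  unfolding tv_dist_def by (rule cSUP_least) (use assms sets.empty_sets in auto)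

lemma tv_dist_upper:
  assumes "\<And>A. A \<in> sets M \<Longrightarrow> measure M A \<le> 1 \<and> measure N A \<le> 1" "A \<in> sets M"
  shows "\<bar>measure M A - measure N A\<bar> \<le> tv_dist M N"
  unfolding tv_dist_def
proof (rule cSUP_upper[OF assms(2)], rule bdd_aboveI2)
  fix A assume "A \<in> sets M"
  then have "measure M A \<le> 1" "measure N A \<le> 1" using assms(1) by auto
  then show "\<bar>measure M A - measure N A\<bar> \<le> 1" using measure_nonneg[of M A] measure_nonneg[of N A] by linarith
qed

lemma measure_density_real:
  assumes f: "integrable M f" "\<And>x. x \<in> space M \<Longrightarrow> 0 \<le> f x" and A: "A \<in> sets M"
  shows "measure (density M (\<lambda>x. ennreal (f x))) A = (LINT x:A|M. f x)"
proof -
  have "emeasure (density M (\<lambda>x. ennreal (f x))) A = (\<integral>\<^sup>+x. ennreal (f x) * indicator A x \<partial>M)"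
    using f A by (intro emeasure_density) auto
  also have "\<dots> = (\<integral>\<^sup>+x. ennreal (indicator A x * f x) \<partial>M)"
    by (intro nn_integral_cong) (auto simp: indicator_def)
  also have "\<dots> = ennreal (LINT x|M. indicator A x * f x)"
    using f(2) integrable_mult_indicator[OF A f(1)]
    by (intro nn_integral_eq_integral AE_I2) (auto split: split_indicator)
  finally have "emeasure (density M (\<lambda>x. ennreal (f x))) A = ennreal (LINT x:A|M. f x)"
    by (simp add: set_lebesgue_integral_def)
  moreover have "0 \<le> (LINT x:A|M. f x)" unfolding set_lebesgue_integral_def
    using f(2) by (intro integral_nonneg_AE AE_I2) (auto split: split_indicator)
  ultimately show ?thesis by (simp add: measure_def)
qed

text \<open>The factor \<open>c\<close> is free, since it disappears in the normalisation. The mass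
  of \<open>c * f\<close> differs from 1 by at most \<open>e\<close>, so normalising costs a second
  \<open>e\<close>. The hypothesis concerns a nonnegative integral, so that integrability of
  \<open>f\<close>, which is propriety of the posterior, comes out as a conclusion.\<close>

lemma tv_dist_normalized:
  fixes f g :: "'b \<Rightarrow> real"
  assumes f: "f \<in> borel_measurable M" "\<And>x. x \<in> space M \<Longrightarrow> 0 \<le> f x"
    and g: "integrable M g" "\<And>x. x \<in> space M \<Longrightarrow> 0 \<le> g x" "(LINT x|M. g x) = 1"
    and c: "0 < c" and e: "(\<integral>\<^sup>+x. ennreal \<bar>c * f x - g x\<bar> \<partial>M) \<le> ennreal e" "0 \<le> e" "e < 1"
  shows "tv_dist (normalized_measure M f) (density M (\<lambda>x. ennreal (g x))) \<le> 2 * e"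
    and "integrable M f" and "0 < (LINT x|M. f x)"
proof -
  have gm: "g \<in> borel_measurable M" using g by auto
  have d: "integrable M (\<lambda>x. c * f x - g x)"
    unfolding integrable_iff_bounded using f gm e by (auto intro: le_less_trans)
  have "integrable M (\<lambda>x. (c * f x - g x) + g x)" by (intro Bochner_Integration.integrable_add d g)
  then have cf: "integrable M (\<lambda>x. c * f x)" by simp
  then show fi: "integrable M f" using c by simp
  have abs: "(LINT x|M. \<bar>c * f x - g x\<bar>) \<le> e"
    using e d by (subst (asm) nn_integral_eq_integral) (auto simp: ennreal_le_iff)
  have A: "\<bar>(LINT x:A|M. c * f x) - (LINT x:A|M. g x)\<bar> \<le> e" if "A \<in> sets M" for A
  proof -
    have i: "set_integrable M A (\<lambda>x. c * f x)" "set_integrable M A g" "set_integrable M A (\<lambda>x. c * f x - g x)"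
      using integrable_mult_indicator[OF that cf] integrable_mult_indicator[OF that g(1)] integrable_mult_indicator[OF that d]
      unfolding set_integrable_def by blast+
    have "(LINT x:A|M. c * f x) - (LINT x:A|M. g x) = (LINT x:A|M. c * f x - g x)"
      by (rule set_integral_diff(2)[OF i(1,2), symmetric])
    also have "\<bar>\<dots>\<bar> \<le> (LINT x|M. \<bar>indicator A x *\<^sub>R (c * f x - g x)\<bar>)"
      unfolding set_lebesgue_integral_def by (rule integral_abs_bound)
    also have "\<dots> \<le> (LINT x|M. \<bar>c * f x - g x\<bar>)"
      using i(3) d unfolding set_integrable_def by (intro integral_mono) (auto simp: indicator_def)
    finally show ?thesis using abs by linarith
  qed
  define I where "I = (LINT x|M. c * f x)"
  have Ic: "I = c * (LINT x|M. f x)" unfolding I_def by simp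
  have I1: "\<bar>I - 1\<bar> \<le> e"
    using A[OF sets.top] unfolding set_integral_space[OF cf] set_integral_space[OF g(1)] g(3) I_def .
  then have I0: "0 < I" using e by linarith
  then show "0 < (LINT x|M. f x)" unfolding Ic using c by (simp add: zero_less_mult_iff)
  show "tv_dist (normalized_measure M f) (density M (\<lambda>x. ennreal (g x))) \<le> 2 * e"
  proof (rule tv_dist_leI)
    fix A assume "A \<in> sets (normalized_measure M f)"
    then have AM: "A \<in> sets M" by (simp add: normalized_measure_def)
    have "measure (normalized_measure M f) A = (LINT x:A|M. f x / (LINT x|M. f x))"
      unfolding normalized_measure_def using fi f(2) \<open>0 < (LINT x|M. f x)\<close> AM by (intro measure_density_real) auto
    also have "\<dots> = (LINT x:A|M. (c * f x) / I)" unfolding Ic using c by simp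
    also have "\<dots> = (LINT x:A|M. c * f x) / I" by (rule set_integral_divide_zero)
    finally have m: "measure (normalized_measure M f) A = (LINT x:A|M. c * f x) / I" .
    have m': "measure (density M (\<lambda>x. ennreal (g x))) A = (LINT x:A|M. g x)"
      by (rule measure_density_real[OF g(1,2) AM])
    have le: "0 \<le> (LINT x:A|M. c * f x)" "(LINT x:A|M. c * f x) \<le> I"
    proof -
      show "0 \<le> (LINT x:A|M. c * f x)" unfolding set_lebesgue_integral_def
        using f(2) c by (intro integral_nonneg_AE AE_I2) (auto simp: indicator_def)
      show "(LINT x:A|M. c * f x) \<le> I" unfolding set_lebesgue_integral_def I_def
        using cf f(2) c AM by (intro integral_mono integrable_mult_indicator) (auto simp: indicator_def)
    qed
    have "\<bar>(LINT x:A|M. c * f x) / I - (LINT x:A|M. c * f x)\<bar> = (LINT x:A|M. c * f x) / I * \<bar>1 - I\<bar>"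
    proof -
      have "(LINT x:A|M. c * f x) / I - (LINT x:A|M. c * f x) = (LINT x:A|M. c * f x) / I * (1 - I)"
        using I0 by (simp add: field_simps)
      moreover have "0 \<le> (LINT x:A|M. c * f x) / I" using le I0 by simp
      ultimately show ?thesis by (simp only: abs_mult abs_of_nonneg)
    qed
    also have "\<dots> \<le> 1 * e" using le I0 I1 by (intro mult_mono) auto
    finally show "\<bar>measure (normalized_measure M f) A - measure (density M (\<lambda>x. ennreal (g x))) A\<bar> \<le> 2 * e"
      unfolding m m' using A[OF AM] by linarith
  qed
qed

lemma tv_dist_distr_le:
  assumes f: "f \<in> measurable M K" "f \<in> measurable N K" and s: "sets M = sets N"
    and le: "\<And>A. A \<in> sets M \<Longrightarrow> measure M A \<le> 1 \<and> measure N A \<le> 1"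
  shows "tv_dist (distr M K f) (distr N K f) \<le> tv_dist M N"
proof (rule tv_dist_leI)
  fix A assume "A \<in> sets (distr M K f)"
  then have A: "A \<in> sets K" by simp
  have sp: "space M = space N" by (rule sets_eq_imp_space_eq[OF s])
  show "\<bar>measure (distr M K f) A - measure (distr N K f) A\<bar> \<le> tv_dist M N"
    unfolding measure_distr[OF f(1) A] measure_distr[OF f(2) A] sp[symmetric]
    using le by (intro tv_dist_upper measurable_sets[OF f(1) A]) auto
qed

text \<open>The prior is continuous in each variable separately, not jointly. Replacing
  \<open>al\<close> by the next grid point above it leaves countably many measurable sections;
  refining the grid recovers \<open>c\<close> by continuity in \<open>al\<close>.\<close>

lemma sup_measurable_Caratheodory:
  fixes c :: "real \<Rightarrow> real \<Rightarrow> real"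
  assumes c1: "\<And>al. 0 < al \<Longrightarrow> continuous_on {0<..} (\<lambda>th. c th al)"
    and c2: "\<And>th. 0 < th \<Longrightarrow> continuous_on {0<..} (\<lambda>al. c th al)"
  shows "(\<lambda>(th, al). indicat_real ({0<..} \<times> {0<..}) (th, al) * c th al) \<in> borel_measurable lborel2"
proof -
  \<comment> \<open>Rounding up keeps the grid point positive.\<close>
  define u where "u = (\<lambda>(k::nat) (x::real \<times> real). indicat_real {0<..} (fst x) * indicat_real {0<..} (snd x)
      * c (fst x) (real (nat \<lceil>snd x * Suc k\<rceil>) / Suc k))"
  have "u k \<in> borel_measurable lborel2" for k
  proof -
    have 1: "(\<lambda>th. indicat_real {0<..} th * c th (real j / Suc k)) \<in> borel_measurable lborel" if "0 < j" for j :: nat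
      using borel_measurable_continuous_on_indicator[OF _ c1[of "real j / Suc k"]] that by simp
    have 2: "(\<lambda>x::real \<times> real. (if 0 < j then indicat_real {0<..} (fst x) * c (fst x) (real j / Suc k) else 0) * indicat_real {0<..} (snd x))
        \<in> borel_measurable lborel2" for j :: nat
    proof (cases "0 < j")
      case True
      have "(\<lambda>x::real \<times> real. indicat_real {0<..} (fst x) * c (fst x) (real j / Suc k)) \<in> borel_measurable lborel2"
        using 1[OF True] by (rule measurable_compose[OF measurable_fst])
      then show ?thesis using True by simp
    qed simp
    have 3: "(\<lambda>x::real \<times> real. nat \<lceil>snd x * Suc k\<rceil>) \<in> measurable lborel2 (count_space UNIV)"
      by measurable
    have "u k = (\<lambda>x::real \<times> real. (if 0 < nat \<lceil>snd x * Suc k\<rceil> then indicat_real {0<..} (fst x) * c (fst x) (real (nat \<lceil>snd x * Suc k\<rceil>) / Suc k) else 0) * indicat_real {0<..} (snd x))"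
      by (auto simp: u_def fun_eq_iff split: split_indicator)
    then show ?thesis using measurable_compose_countable[OF 2 3] by (simp only:)
  qed
  moreover have "(\<lambda>k. u k x) \<longlonglongrightarrow> (case x of (th, al) \<Rightarrow> indicat_real ({0<..} \<times> {0<..}) (th, al) * c th al)" for x
  proof (cases "0 < fst x \<and> 0 < snd x")
    case True
    define al where "al = snd x"
    have a: "0 < al" using True by (simp add: al_def)
    have lim: "(\<lambda>k. real (nat \<lceil>al * Suc k\<rceil>) / Suc k) \<longlonglongrightarrow> al"
    proof (rule tendsto_sandwich[of "\<lambda>_. al" _ _ "\<lambda>k. al + 1 / Suc k"])
      have lu: "al * Suc k \<le> real (nat \<lceil>al * Suc k\<rceil>)" "real (nat \<lceil>al * Suc k\<rceil>) \<le> al * Suc k + 1" for k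
        using a by (auto simp: of_nat_nat intro!: real_nat_ceiling_ge)
      have "al * Suc k / Suc k \<le> real (nat \<lceil>al * Suc k\<rceil>) / Suc k"
        "real (nat \<lceil>al * Suc k\<rceil>) / Suc k \<le> (al * Suc k + 1) / Suc k" for k
        by (rule divide_right_mono[OF lu(1)], simp, rule divide_right_mono[OF lu(2)], simp)
      then show "\<forall>\<^sub>F k in sequentially. al \<le> real (nat \<lceil>al * Suc k\<rceil>) / Suc k"
        "\<forall>\<^sub>F k in sequentially. real (nat \<lceil>al * Suc k\<rceil>) / Suc k \<le> al + 1 / Suc k"
        by (auto simp: add_divide_distrib intro!: always_eventually simp del: of_nat_Suc)
      show "(\<lambda>k. al + 1 / Suc k) \<longlonglongrightarrow> al" by real_asymp
    qed simp
    have "(\<lambda>k. c (fst x) (real (nat \<lceil>al * Suc k\<rceil>) / Suc k)) \<longlonglongrightarrow> c (fst x) al"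
      by (rule continuous_on_tendsto_compose[OF c2 lim]) (use a True in \<open>auto intro!: always_eventually\<close>)
    then show ?thesis using True by (simp add: u_def al_def split_beta indicator_def)
  next
    case False
    then show ?thesis by (auto simp: u_def split_beta indicator_def)
  qed
  ultimately show ?thesis by (rule borel_measurable_LIMSEQ_metric)
qed

section \<open>Laplace expansion in \<open>th\<close>\<close>

definition divh :: "real \<Rightarrow> real" where
  "divh x = x - 1 - ln x"

text \<open>The difference vanishes at 0 and has derivative \<open>- (x^2 / (1 + x))\<close>, at
  most \<open>2 * u^2\<close> in modulus on the segment.\<close>

lemma divh_cubic:
  assumes "\<bar>u\<bar> \<le> 1 / 2"
  shows "\<bar>divh (1 + u) - u\<^sup>2 / 2\<bar> \<le> 2 * \<bar>u\<bar> ^ 3"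
proof -
  define G where "G = (\<lambda>u. divh (1 + u) - u\<^sup>2 / 2 :: real)"
  have der: "(G has_real_derivative - (x\<^sup>2 / (1 + x))) (at x)" if "\<bar>x\<bar> \<le> 1 / 2" for x
  proof -
    have "1 + x > 0" using that by linarith
    then have "(G has_real_derivative 1 - 1 / (1 + x) - x) (at x)"
      unfolding G_def divh_def by (auto intro!: derivative_eq_intros simp: field_simps)
    moreover have "1 - 1 / (1 + x) - x = - (x\<^sup>2 / (1 + x))"
      using \<open>1 + x > 0\<close> by (simp add: field_simps power2_eq_square)
    ultimately show ?thesis by simp
  qed
  have bd: "norm (G u - G 0) \<le> 2 * u\<^sup>2 * norm (u - 0)"
  proof (rule field_differentiable_bound[of "{- \<bar>u\<bar>..\<bar>u\<bar>}"])
    fix z assume z: "z \<in> {- \<bar>u\<bar>..\<bar>u\<bar>}"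
    then have z2: "\<bar>z\<bar> \<le> 1 / 2" "\<bar>z\<bar> \<le> \<bar>u\<bar>" using assms by auto
    from der[OF z2(1)] show "(G has_field_derivative - (z\<^sup>2 / (1 + z))) (at z within {- \<bar>u\<bar>..\<bar>u\<bar>})"
      by (rule has_field_derivative_at_within)
    have "z\<^sup>2 \<le> u\<^sup>2" using power_mono[OF z2(2), of 2] by simp
    have z1: "1 / 2 \<le> 1 + z" using z2(1) by linarith
    have "z\<^sup>2 / (1 + z) \<le> u\<^sup>2 / (1 / 2)"
      by (rule frac_le) (use z1 \<open>z\<^sup>2 \<le> u\<^sup>2\<close> in simp_all)
    moreover have "0 \<le> z\<^sup>2 / (1 + z)" by (rule divide_nonneg_nonneg) (use z1 in simp_all)
    ultimately have "\<bar>z\<^sup>2 / (1 + z)\<bar> \<le> 2 * u\<^sup>2" unfolding abs_le_iff by simp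
    then show "norm (- (z\<^sup>2 / (1 + z))) \<le> 2 * u\<^sup>2" by (simp only: norm_minus_cancel real_norm_def)
  qed auto
  moreover have "G 0 = 0" by (simp add: G_def divh_def)
  moreover have "2 * u\<^sup>2 * \<bar>u\<bar> = 2 * \<bar>u\<bar> ^ 3" by (simp add: power2_eq_square power3_eq_cube)
  ultimately show ?thesis by (simp add: G_def)
qed

text \<open>The difference of the sides has derivative \<open>(z - 1) * (1 / z - 1 / 4)\<close>,
  which up to 4 has the sign of \<open>z - 1\<close>; so it is minimal at 1, where it
  vanishes.\<close>

lemma divh_lower:
  assumes "0 < x" "x \<le> 4"
  shows "(x - 1)\<^sup>2 / 8 \<le> divh x"
proof -
  define G where "G = (\<lambda>x. divh x - (x - 1)\<^sup>2 / 8 :: real)"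
  have der: "(G has_real_derivative (z - 1) * (1 / z - 1 / 4)) (at z)" if "0 < z" for z
    unfolding G_def divh_def using that by (auto intro!: derivative_eq_intros simp: field_simps)
  have "G 1 \<le> G x"
  proof (cases "1 \<le> x")
    case True
    show ?thesis
    proof (rule DERIV_nonneg_imp_nondecreasing[OF True])
      fix z assume z: "1 \<le> z" "z \<le> x"
      then have "0 \<le> 1 / z - 1 / 4" using assms by (simp add: field_simps)
      then show "\<exists>y. (G has_real_derivative y) (at z) \<and> 0 \<le> y"
        using z by (intro exI[of _ "(z - 1) * (1 / z - 1 / 4)"] conjI der mult_nonneg_nonneg) auto
    qed
  next
    case False
    then have le: "x \<le> 1" by simp
    show ?thesis
    proof (rule DERIV_nonpos_imp_nonincreasing[OF le])
      fix z assume z: "x \<le> z" "z \<le> 1"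
      then have "0 \<le> 1 / z - 1 / 4" using assms by (simp add: field_simps)
      then show "\<exists>y. (G has_real_derivative y) (at z) \<and> y \<le> 0"
        using z assms by (intro exI[of _ "(z - 1) * (1 / z - 1 / 4)"] conjI der mult_nonpos_nonneg) auto
    qed
  qed
  then show ?thesis by (simp add: G_def divh_def)
qed

lemma divh_nonneg: "0 < x \<Longrightarrow> 0 \<le> divh x"
  using ln_le_minus_one[of x] by (simp add: divh_def)

text \<open>The thresholds are the extreme values of \<open>ta / th\<close> when \<open>ta\<close>
  is within a quarter of \<open>th0\<close> and \<open>th\<close> lies outside
  \<open>{th0 / 2<..<2 * th0}\<close>: \<open>(5 / 4) / 2\<close> and
  \<open>(3 / 4) / (1 / 2)\<close>.\<close>

lemma divh_far:
  assumes "0 < x" "x \<le> 5 / 8 \<or> 3 / 2 \<le> x"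
  shows "1 / 64 \<le> divh x"
proof (cases "x \<le> 4")
  case True
  have "(3 / 8)\<^sup>2 \<le> (x - 1)\<^sup>2"
  proof -
    have "3 / 8 \<le> \<bar>x - 1\<bar>" using assms(2) by auto
    from power_mono[OF this, of 2] show ?thesis by simp
  qed
  then have "9 / 64 \<le> (x - 1)\<^sup>2" by (simp add: power2_eq_square)
  then show ?thesis using divh_lower[OF assms(1) True] by linarith
next
  case False
  have "ln (x / 2) \<le> x / 2 - 1" using assms by (intro ln_le_minus_one) auto
  moreover have "ln (2::real) \<le> 2 - 1" by (rule ln_le_minus_one) simp
  ultimately show ?thesis using False assms by (simp add: divh_def ln_div)
qed

lemma nn_integral_gauss:
  assumes "0 < k"
  shows "(\<integral>\<^sup>+th. ennreal (exp (- k * (th - m)\<^sup>2)) \<partial>lborel) = ennreal (sqrt (pi / k))"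
proof -
  define sd where "sd = sqrt (1 / (2 * k))"
  have sd: "0 < sd" "sd\<^sup>2 = 1 / (2 * k)" using assms by (auto simp: sd_def)
  have e: "exp (- k * (th - m)\<^sup>2) = sqrt (pi / k) * normal_density m sd th" for th
  proof -
    have "2 * pi * sd\<^sup>2 = pi / k" using sd assms by simp
    moreover have "- (th - m)\<^sup>2 / (2 * sd\<^sup>2) = - k * (th - m)\<^sup>2" using sd assms by simp
    ultimately show ?thesis unfolding normal_density_def using assms by simp
  qed
  have "(\<integral>\<^sup>+th. ennreal (exp (- k * (th - m)\<^sup>2)) \<partial>lborel) = ennreal (LINT th|lborel. exp (- k * (th - m)\<^sup>2))"
    unfolding e using assms sd by (intro nn_integral_eq_integral) auto
  also have "(LINT th|lborel. exp (- k * (th - m)\<^sup>2)) = sqrt (pi / k)"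
    unfolding e using sd assms by simp
  finally show ?thesis .
qed

lemma abs_exp_minus_one_le:
  fixes z :: real
  assumes "\<bar>z\<bar> \<le> e" "e \<le> 1 / 2"
  shows "\<bar>exp z - 1\<bar> \<le> 2 * e"
proof -
  have "norm (exp z) \<le> 1 + 2 * norm z" by (rule exp_bound_lemma) (use assms in simp)
  then have "exp z - 1 \<le> 2 * e" using assms by simp
  moreover have "- (exp z - 1) \<le> 2 * e" using exp_ge_add_one_self[of z] assms by linarith
  ultimately show ?thesis by (simp only: abs_le_iff)
qed

text \<open>The errors in the exponent on the window of radius \<open>r\<close>: the shift
  \<open>de\<close> of the centre, the third-order terms, and \<open>N\<close> in place of
  \<open>n\<close>.\<close>

abbreviation "laplace_err n N th0 r de \<equiv> n * r * de / th0\<^sup>2 + 10 * (n * r ^ 3 / th0 ^ 3) + (n - N) * r\<^sup>2 / (th0 :: real)\<^sup>2"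

abbreviation "gauss_peak n th0 ta0 th \<equiv> exp (- (n / (4 * th0\<^sup>2)) * (th - ta0)\<^sup>2 :: real)"

text \<open>With \<open>u = (ta - th) / th\<close> and \<open>a = (th - ta0) / th0\<close> the
  exponents are \<open>n * a^2 / 4\<close> and, up to a cubic error, \<open>N * u^2 / 4\<close>. The
  deviations nearly cancel: \<open>a + u\<close> is of the order of the shift plus the square of the
  window, so the squares are close.\<close>

lemma laplace_exponent:
  fixes n N th th0 ta ta0 r de :: real
  assumes t0: "0 < th0" and r: "0 < r" "r \<le> th0 / 8" and N: "0 \<le> N" "N \<le> n"
    and d: "\<bar>ta - ta0\<bar> \<le> de" "\<bar>ta0 - th0\<bar> \<le> r / 4" "de \<le> r / 4" and t: "\<bar>th - th0\<bar> \<le> r"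
  shows "\<bar>n / (4 * th0\<^sup>2) * (th - ta0)\<^sup>2 - N / 2 * divh (ta / th)\<bar>
    \<le> laplace_err n N th0 r de"
proof -
  define R where "R = r / th0"
  define D where "D = de / th0"
  define u where "u = (ta - th) / th"
  define a where "a = (th - ta0) / th0"
  have th: "7 / 8 * th0 \<le> th" "0 < th" using t r t0 by linarith+
  have R: "0 < R" "R \<le> 1 / 8" using r t0 by (auto simp: R_def divide_le_eq)
  have D: "0 \<le> D" using d(1) t0 by (simp add: D_def)
  have tt: "\<bar>ta - th\<bar> \<le> 3 / 2 * r" using d t by linarith
  have u: "\<bar>u\<bar> \<le> 2 * R"
  proof -
    have "\<bar>u\<bar> \<le> (3 / 2 * r) / (7 / 8 * th0)" unfolding u_def abs_divide
      using tt th t0 r by (intro frac_le) auto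
    also have "\<dots> \<le> 2 * R" using r t0 by (simp add: R_def field_simps)
    finally show ?thesis .
  qed
  have a: "\<bar>a\<bar> \<le> 2 * R"
  proof -
    have "\<bar>th - ta0\<bar> \<le> 2 * r" using d t by linarith
    then have "\<bar>th - ta0\<bar> / th0 \<le> 2 * r / th0" using t0 by (intro divide_right_mono) auto
    then show ?thesis using t0 by (simp add: a_def R_def)
  qed
  have au: "\<bar>a + u\<bar> \<le> D + 2 * R\<^sup>2"
  proof -
    \<comment> \<open>The first term is the shift of the centre; the second is a product of two
      deviations of the order of the window.\<close>
    have e: "a + u = (ta - ta0) / th0 + (ta - th) / th * ((th0 - th) / th0)"
      unfolding a_def u_def using t0 th by (simp add: field_simps)
    have x1: "\<bar>(ta - ta0) / th0\<bar> \<le> D" unfolding D_def abs_divide using d t0 by (simp add: divide_right_mono)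
   have "\<bar>(th0 - th) / th0\<bar> \<le> R" unfolding R_def abs_divide using t t0 by (simp add: divide_right_mono)
    then have "\<bar>(ta - th) / th * ((th0 - th) / th0)\<bar> \<le> (2 * R) * R"
      unfolding abs_mult u_def[symmetric] using u R by (intro mult_mono) auto
    then have x2: "\<bar>(ta - th) / th * ((th0 - th) / th0)\<bar> \<le> 2 * R\<^sup>2" by (simp only: power2_eq_square mult.assoc)
    show ?thesis unfolding e using abs_triangle_ineq add_mono[OF x1 x2] by (rule order_trans)
  qed
  have "\<bar>a\<^sup>2 - u\<^sup>2\<bar> = \<bar>a + u\<bar> * \<bar>a - u\<bar>" by (simp add: abs_mult[symmetric] power2_eq_square algebra_simps)
  also have "\<dots> \<le> (D + 2 * R\<^sup>2) * (4 * R)" using au a u D R by (intro mult_mono) auto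
  finally have a2: "\<bar>a\<^sup>2 - u\<^sup>2\<bar> \<le> (D + 2 * R\<^sup>2) * (4 * R)" .
  have u2: "u\<^sup>2 \<le> 4 * R\<^sup>2" using power_mono[OF u, of 2] by (simp add: power_mult_distrib)
  have u3: "\<bar>u\<bar> ^ 3 \<le> 8 * R ^ 3" using power_mono[OF u, of 3] by (simp add: power_mult_distrib)
  have h: "\<bar>divh (ta / th) - u\<^sup>2 / 2\<bar> \<le> 16 * R ^ 3"
  proof -
    have "ta / th = 1 + u" using th by (simp add: u_def field_simps)
    moreover have "\<bar>u\<bar> \<le> 1 / 2" using u R by linarith
    ultimately show ?thesis using divh_cubic[of u] u3 by simp
  qed
  have e: "n / (4 * th0\<^sup>2) * (th - ta0)\<^sup>2 - N / 2 * divh (ta / th)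
     = n / 4 * (a\<^sup>2 - u\<^sup>2) + (n - N) / 4 * u\<^sup>2 - N / 2 * (divh (ta / th) - u\<^sup>2 / 2)"
    using t0 by (simp add: a_def power_divide field_simps)
  have n: "0 \<le> n" using N by simp
  have 1: "\<bar>n / 4 * (a\<^sup>2 - u\<^sup>2)\<bar> \<le> n / 4 * ((D + 2 * R\<^sup>2) * (4 * R))"
    unfolding abs_mult using a2 n by (intro mult_mono) auto
  have 2: "\<bar>(n - N) / 4 * u\<^sup>2\<bar> \<le> (n - N) / 4 * (4 * R\<^sup>2)"
    unfolding abs_mult using u2 N by (intro mult_mono) auto
  have 3: "\<bar>N / 2 * (divh (ta / th) - u\<^sup>2 / 2)\<bar> \<le> n / 2 * (16 * R ^ 3)"
    unfolding abs_mult using h N by (intro mult_mono) auto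
  have "\<bar>n / (4 * th0\<^sup>2) * (th - ta0)\<^sup>2 - N / 2 * divh (ta / th)\<bar>
    \<le> n / 4 * ((D + 2 * R\<^sup>2) * (4 * R)) + (n - N) / 4 * (4 * R\<^sup>2) + n / 2 * (16 * R ^ 3)"
    unfolding e using 1 2 3 by linarith
  also have "\<dots> = n * R * D + 10 * (n * R ^ 3) + (n - N) * R\<^sup>2"
    by (simp add: field_simps power2_eq_square power3_eq_cube)
  also have "\<dots> = laplace_err n N th0 r de"
    by (simp add: R_def D_def power_divide power2_eq_square power3_eq_cube)
  finally show ?thesis .
qed

text \<open>Four regimes. Within \<open>r\<close> of \<open>th0\<close> the exponents agree and the
  error is relative to the Gaussian. From there to the ends of \<open>{th0 / 2<..<2 * th0}\<close>
  the quadratic lower bound of \<open>divh\<close> and the bound \<open>B\<close> apply. Beyond,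
  \<open>divh\<close> is at least 1/64 and \<open>rh\<close> is kept, to be integrated. The last
  term is the Gaussian itself off the window.\<close>

lemma laplace_fiber_pointwise:
  fixes n N th th0 ta ta0 r de L B e rh :: real
  assumes t0: "0 < th0" and r: "0 < r" "r \<le> th0 / 8" and N: "n / 2 \<le> N" "N \<le> n" "0 \<le> n"
    and d: "\<bar>ta - ta0\<bar> \<le> de" "\<bar>ta0 - th0\<bar> \<le> r / 4" "de \<le> r / 4"
    and rh0: "0 < th \<Longrightarrow> 0 \<le> rh"
    and rh1: "th0 / 2 < th \<Longrightarrow> th < 2 * th0 \<Longrightarrow> exp (- (L * \<bar>th - th0\<bar>)) \<le> rh \<and> rh \<le> exp (L * \<bar>th - th0\<bar>)"
    and rh2: "th0 / 2 < th \<Longrightarrow> th < 2 * th0 \<Longrightarrow> rh \<le> B"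
    and L: "0 \<le> L" and e: "e \<le> 1 / 2"
    and e_ge: "L * r + laplace_err n N th0 r de \<le> e"
  shows "\<bar>indicator {0<..} th * (exp (- (N / 2) * divh (ta / th)) * rh) - gauss_peak n th0 ta0 th\<bar>
    \<le> 2 * e * gauss_peak n th0 ta0 th
      + B * exp (- (n * r\<^sup>2 / (512 * th0\<^sup>2))) * indicator {th0 / 2<..<2 * th0} th
      + exp (- (n / 256)) * (indicator {0<..} th * rh)
      + exp (- (n * r\<^sup>2 / (32 * th0\<^sup>2))) * exp (- (n / (8 * th0\<^sup>2)) * (th - ta0)\<^sup>2)"
    (is "\<bar>?f - ?g\<bar> \<le> ?A + ?B + ?C + ?D")
proof -
  have N0: "0 \<le> N" using N by linarith
  have e0: "0 \<le> e"
  proof -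
    have "0 \<le> de" using d(1) by linarith
    then have "0 \<le> L * r + laplace_err n N th0 r de"
      using L r N t0 by (intro add_nonneg_nonneg mult_nonneg_nonneg divide_nonneg_nonneg) auto
    then show ?thesis using e_ge by linarith
  qed
  have t34: "3 / 4 * th0 \<le> ta" "ta \<le> 5 / 4 * th0" using d r by linarith+
  have A0: "0 \<le> ?A" using e0 by simp
  have C0: "0 \<le> ?C" using rh0 by (simp split: split_indicator)
  have D0: "0 \<le> ?D" by simp
  have B0: "0 \<le> ?B"
  proof (cases "th \<in> {th0 / 2<..<2 * th0}")
    case True
    then have "exp (- (L * \<bar>th - th0\<bar>)) \<le> rh" "rh \<le> B" using rh1 rh2 by auto
    moreover have "0 < exp (- (L * \<bar>th - th0\<bar>))" by simp
    ultimately have "0 \<le> B" by linarith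
    then show ?thesis by simp
  qed simp
  show ?thesis
  proof (cases "\<bar>th - th0\<bar> \<le> r")
    case True
    then have th: "th0 / 2 < th" "th < 2 * th0" "0 < th" using r t0 by linarith+
    note rh = conjunct1[OF rh1[OF th(1,2)]] conjunct2[OF rh1[OF th(1,2)]]
    have rhp: "0 < rh" using rh(1) by (rule less_le_trans[rotated]) simp
    define z where "z = n / (4 * th0\<^sup>2) * (th - ta0)\<^sup>2 - N / 2 * divh (ta / th) + ln rh"
    have "L * \<bar>th - th0\<bar> \<le> L * r" using True L by (intro mult_left_mono) auto
    moreover have "\<bar>ln rh\<bar> \<le> L * \<bar>th - th0\<bar>"
    proof -
      have "ln rh \<le> ln (exp (L * \<bar>th - th0\<bar>))" using rh(2) rhp by (subst ln_le_cancel_iff) auto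
      moreover have "ln (exp (- (L * \<bar>th - th0\<bar>))) \<le> ln rh" using rh(1) rhp by (subst ln_le_cancel_iff) auto
      ultimately show ?thesis unfolding ln_exp by linarith
    qed
    ultimately have "\<bar>z\<bar> \<le> e" unfolding z_def
      using laplace_exponent[OF t0 r N0 N(2) d True] e_ge by linarith
    then have z: "\<bar>exp z - 1\<bar> \<le> 2 * e" using e by (rule abs_exp_minus_one_le)
    have "?f = ?g * exp z"
    proof -
      have ez: "exp z = exp (n / (4 * th0\<^sup>2) * (th - ta0)\<^sup>2) * exp (- (N / 2) * divh (ta / th)) * rh"
        unfolding z_def diff_conv_add_uminus exp_add using rhp by simp
      have g1: "?g * exp (n / (4 * th0\<^sup>2) * (th - ta0)\<^sup>2) = 1" by (simp add: exp_minus)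
      have "?g * exp z = exp (- (N / 2) * divh (ta / th)) * rh"
        unfolding ez mult.assoc[symmetric] g1 mult_1_left ..
      then show ?thesis using th by simp
    qed
    then have "?f - ?g = ?g * (exp z - 1)" by (simp add: right_diff_distrib)
    then have "\<bar>?f - ?g\<bar> = ?g * \<bar>exp z - 1\<bar>" by (simp add: abs_mult)
    also have "\<dots> \<le> ?g * (2 * e)" using z by (intro mult_left_mono) auto
    also have "\<dots> = ?A" by (rule mult.commute)
    also have "\<dots> \<le> ?A + ?B" using B0 by (rule add_increasing2) simp
    also have "\<dots> \<le> ?A + ?B + ?C" using C0 by (rule add_increasing2) simp
    also have "\<dots> \<le> ?A + ?B + ?C + ?D" using D0 by (rule add_increasing2) simp
    finally show ?thesis .
  next
    case False
    \<comment> \<open>One half of the exponent gives the small factor, the other half is kept for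
      integrability.\<close>
    have gD: "?g \<le> ?D"
    proof -
      have far: "3 / 4 * r \<le> \<bar>th - ta0\<bar>" using False d by linarith
      have "(3 / 4 * r)\<^sup>2 \<le> (th - ta0)\<^sup>2" using power_mono[OF far, of 2] r by simp
      moreover have "(3 / 4 * r)\<^sup>2 = 9 / 16 * r\<^sup>2" by (simp add: power2_eq_square)
      ultimately have sq: "r\<^sup>2 / 4 \<le> (th - ta0)\<^sup>2" using zero_le_power2[of r] by linarith
      have "n * r\<^sup>2 / (32 * th0\<^sup>2) = n / (8 * th0\<^sup>2) * (r\<^sup>2 / 4)" by simp
      also have "\<dots> \<le> n / (8 * th0\<^sup>2) * (th - ta0)\<^sup>2" using sq N by (intro mult_left_mono) auto
      finally have "n * r\<^sup>2 / (32 * th0\<^sup>2) \<le> n / (8 * th0\<^sup>2) * (th - ta0)\<^sup>2" .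
      moreover have "n / (4 * th0\<^sup>2) * (th - ta0)\<^sup>2 = n / (8 * th0\<^sup>2) * (th - ta0)\<^sup>2 + n / (8 * th0\<^sup>2) * (th - ta0)\<^sup>2"
        by (simp add: field_simps)
      ultimately show ?thesis unfolding exp_add[symmetric] by simp
    qed
    have f0: "0 \<le> ?f" using rh0 by (simp split: split_indicator)
    have fBC: "?f \<le> ?B + ?C"
    proof (cases "th \<in> {th0 / 2<..<2 * th0}")
      case True
      then have th: "th0 / 2 < th" "th < 2 * th0" "0 < th" using t0 by auto
      have rhB: "0 \<le> rh" "rh \<le> B" using rh0 rh2 th by auto
      have x: "0 < ta / th" "ta / th \<le> 4" using t34 th t0 by (auto simp: divide_le_eq)
      \<comment> \<open>\<open>ta\<close> is within \<open>r / 2\<close> of \<open>th0\<close>, so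
        \<open>th\<close> stays at least \<open>r / 2\<close> away from it;
        \<open>th < 2 * th0\<close> turns this into a relative distance.\<close>
      have "r / (4 * th0) \<le> \<bar>ta / th - 1\<bar>"
      proof -
        have far: "r / 2 \<le> \<bar>ta - th\<bar>" using False d by linarith
        have "r / (4 * th0) = (r / 2) / (2 * th0)" by simp
        also have "\<dots> \<le> \<bar>ta - th\<bar> / th" using far th by (intro frac_le) auto
        also have "\<dots> = \<bar>(ta - th) / th\<bar>" using th by simp
        also have "(ta - th) / th = ta / th - 1" using th by (simp add: diff_divide_distrib)
        finally show ?thesis .
      qed
      then have "(r / (4 * th0))\<^sup>2 \<le> (ta / th - 1)\<^sup>2" using power_mono[of "r / (4 * th0)" "\<bar>ta / th - 1\<bar>" 2] r t0 by simp
      then have h: "r\<^sup>2 / (128 * th0\<^sup>2) \<le> divh (ta / th)" using divh_lower[OF x] by (simp add: power_divide power_mult_distrib)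
      have "n * r\<^sup>2 / (512 * th0\<^sup>2) = n / 2 / 2 * (r\<^sup>2 / (128 * th0\<^sup>2))" by simp
      also have "\<dots> \<le> N / 2 * divh (ta / th)" using h N N0 by (intro mult_mono) auto
      finally have "exp (- (N / 2) * divh (ta / th)) * rh \<le> exp (- (n * r\<^sup>2 / (512 * th0\<^sup>2))) * B"
        using rhB by (intro mult_mono) auto
      then show ?thesis using th C0 by (simp add: mult.commute)
    next
      case out: False
      show ?thesis
      proof (cases "0 < th")
        case True
        have "ta / th \<le> 5 / 8 \<or> 3 / 2 \<le> ta / th"
        proof (cases "th \<le> th0 / 2")
          case True
          then have "3 / 2 * th \<le> ta" using t34 by linarith
          then show ?thesis using \<open>0 < th\<close> by (simp add: le_divide_eq)
        next
          case False
          then have "2 * th0 \<le> th" using out by auto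
          then have "ta \<le> 5 / 8 * th" using t34 by linarith
          then show ?thesis using \<open>0 < th\<close> by (simp add: divide_le_eq)
        qed
        then have "1 / 64 \<le> divh (ta / th)" using t34 t0 True by (intro divh_far) auto
        then have "n / 2 / 2 * (1 / 64) \<le> N / 2 * divh (ta / th)" using N N0 by (intro mult_mono) auto
        then have "exp (- (N / 2) * divh (ta / th)) * rh \<le> exp (- (n / 256)) * rh"
          using rh0[OF True] by (intro mult_right_mono) auto
        then show ?thesis using True B0 by simp
      qed (use B0 in simp)
    qed
    have "\<bar>?f - ?g\<bar> \<le> ?f + ?g" using f0 exp_ge_zero[of "- (n / (4 * th0\<^sup>2)) * (th - ta0)\<^sup>2"] by linarith
    then show ?thesis using fBC gD A0 by linarith
  qed
qed

lemma laplace_fiber: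
  fixes n N th0 ta ta0 r de L B e J :: real and rh :: "real \<Rightarrow> real"
  assumes t0: "0 < th0" and r: "0 < r" "r \<le> th0 / 8" and N: "n / 2 \<le> N" "N \<le> n" "0 < n"
    and d: "\<bar>ta - ta0\<bar> \<le> de" "\<bar>ta0 - th0\<bar> \<le> r / 4" "de \<le> r / 4"
    and rhm: "(\<lambda>th. indicator {0<..} th * rh th) \<in> borel_measurable borel"
    and rh0: "\<And>th. 0 < th \<Longrightarrow> 0 \<le> rh th"
    and rh1: "\<And>th. th0 / 2 < th \<Longrightarrow> th < 2 * th0 \<Longrightarrow> exp (- (L * \<bar>th - th0\<bar>)) \<le> rh th \<and> rh th \<le> exp (L * \<bar>th - th0\<bar>)"
    and rh2: "\<And>th. th0 / 2 < th \<Longrightarrow> th < 2 * th0 \<Longrightarrow> rh th \<le> B"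
    and J: "(\<integral>\<^sup>+th\<in>{0<..}. ennreal (rh th) \<partial>lborel) \<le> ennreal J" "0 \<le> J"
    and L: "0 \<le> L" and B: "0 \<le> B" and e: "0 \<le> e" "e \<le> 1 / 2"
    and e_ge: "L * r + laplace_err n N th0 r de \<le> e"
  shows "(\<integral>\<^sup>+th. ennreal \<bar>indicator {0<..} th * (exp (- (N / 2) * divh (ta / th)) * rh th) - gauss_peak n th0 ta0 th\<bar> \<partial>lborel)
    \<le> ennreal (2 * e * sqrt (4 * pi * th0\<^sup>2 / n) + 2 * th0 * B * exp (- (n * r\<^sup>2 / (512 * th0\<^sup>2)))
        + J * exp (- (n / 256)) + 2 * sqrt (4 * pi * th0\<^sup>2 / n) * exp (- (n * r\<^sup>2 / (32 * th0\<^sup>2))))"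
proof -
  let ?b = "sqrt (4 * pi * th0\<^sup>2 / n)"
  let ?f = "\<lambda>th. indicator {0<..} th * (exp (- (N / 2) * divh (ta / th)) * rh th)"
  let ?g = "\<lambda>th. gauss_peak n th0 ta0 th" and ?h = "\<lambda>th. exp (- (n / (8 * th0\<^sup>2)) * (th - ta0)\<^sup>2)"
  let ?E1 = "exp (- (n * r\<^sup>2 / (512 * th0\<^sup>2)))" and ?E2 = "exp (- (n / 256))" and ?E3 = "exp (- (n * r\<^sup>2 / (32 * th0\<^sup>2)))"
  have "(\<integral>\<^sup>+th. ennreal \<bar>?f th - ?g th\<bar> \<partial>lborel)
    \<le> (\<integral>\<^sup>+th. ennreal (2 * e) * ennreal (?g th) + ennreal (B * ?E1) * indicator {th0 / 2<..<2 * th0} th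
        + ennreal ?E2 * ennreal (indicator {0<..} th * rh th) + ennreal ?E3 * ennreal (?h th) \<partial>lborel)"
  proof (rule nn_integral_mono)
    fix th
    have i0: "0 \<le> indicator {0<..} th * rh th" using rh0 by (simp split: split_indicator)
    have "ennreal \<bar>?f th - ?g th\<bar>
      \<le> ennreal (2 * e * ?g th + B * ?E1 * indicator {th0 / 2<..<2 * th0} th + ?E2 * (indicator {0<..} th * rh th) + ?E3 * ?h th)"
      using N by (intro ennreal_leI laplace_fiber_pointwise[where L=L and de=de] t0 r N d rh0 rh1 rh2 L e(2) e_ge) auto
    also have "\<dots> = ennreal (2 * e) * ennreal (?g th) + ennreal (B * ?E1) * ennreal (indicator {th0 / 2<..<2 * th0} th)
        + ennreal ?E2 * ennreal (indicator {0<..} th * rh th) + ennreal ?E3 * ennreal (?h th)"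
      using e B i0 by (simp only: ennreal_plus ennreal_mult' mult_nonneg_nonneg add_nonneg_nonneg exp_ge_zero zero_le_numeral indicator_pos_le)
    finally show "ennreal \<bar>?f th - ?g th\<bar>
      \<le> ennreal (2 * e) * ennreal (?g th) + ennreal (B * ?E1) * indicator {th0 / 2<..<2 * th0} th
        + ennreal ?E2 * ennreal (indicator {0<..} th * rh th) + ennreal ?E3 * ennreal (?h th)"
      by (simp only: ennreal_indicator)
  qed
  also have "\<dots> = ennreal (2 * e) * (\<integral>\<^sup>+th. ennreal (?g th) \<partial>lborel) + ennreal (B * ?E1) * emeasure lborel {th0 / 2<..<2 * th0}
        + ennreal ?E2 * (\<integral>\<^sup>+th. ennreal (indicator {0<..} th * rh th) \<partial>lborel) + ennreal ?E3 * (\<integral>\<^sup>+th. ennreal (?h th) \<partial>lborel)"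
    using rhm by (simp add: nn_integral_add nn_integral_cmult)
  also have "(\<integral>\<^sup>+th. ennreal (?g th) \<partial>lborel) = ennreal ?b"
    using N t0 by (subst nn_integral_gauss) (auto simp: mult_ac)
  also have "(\<integral>\<^sup>+th. ennreal (?h th) \<partial>lborel) = ennreal (sqrt (8 * pi * th0\<^sup>2 / n))"
    using N t0 by (subst nn_integral_gauss) (auto simp: mult_ac)
  also have "emeasure lborel {th0 / 2<..<2 * th0} = ennreal (3 / 2 * th0)" using t0 by simp
  also have "(\<integral>\<^sup>+th. ennreal (indicator {0<..} th * rh th) \<partial>lborel) = (\<integral>\<^sup>+th\<in>{0<..}. ennreal (rh th) \<partial>lborel)"
    by (intro nn_integral_cong) (auto split: split_indicator)
  also have "ennreal (2 * e) * ennreal ?b + ennreal (B * ?E1) * ennreal (3 / 2 * th0)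
      + ennreal ?E2 * (\<integral>\<^sup>+th\<in>{0<..}. ennreal (rh th) \<partial>lborel) + ennreal ?E3 * ennreal (sqrt (8 * pi * th0\<^sup>2 / n))
    \<le> ennreal (2 * e) * ennreal ?b + ennreal (B * ?E1) * ennreal (2 * th0)
      + ennreal ?E2 * ennreal J + ennreal ?E3 * ennreal (2 * ?b)"
  proof (intro add_mono mult_left_mono J order_refl ennreal_leI)
    have "sqrt (8 * pi * th0\<^sup>2 / n) \<le> sqrt (4 * (4 * pi * th0\<^sup>2 / n))"
      using N by (intro real_sqrt_le_mono) (simp add: divide_right_mono)
    also have "\<dots> = 2 * ?b" by (simp only: real_sqrt_mult real_sqrt_four)
    finally show "sqrt (8 * pi * th0\<^sup>2 / n) \<le> 2 * ?b" .
  qed (use t0 in auto)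
  also have "\<dots> = ennreal (2 * e * ?b + B * ?E1 * (2 * th0) + ?E2 * J + ?E3 * (2 * ?b))"
    using e B J t0 N by (simp add: ennreal_plus ennreal_mult')
  also have "2 * e * ?b + B * ?E1 * (2 * th0) + ?E2 * J + ?E3 * (2 * ?b)
    = 2 * e * ?b + 2 * th0 * B * ?E1 + J * ?E2 + 2 * ?b * ?E3" by simp
  finally show ?thesis .
qed

text \<open>The integral over \<open>th\<close> comes first. For \<open>al\<close> in the range it
  is the estimate of \<open>laplace_fiber\<close> times \<open>w al\<close>. Elsewhere nothing is
  approximated: \<open>F\<close> and \<open>G\<close> are bounded by their own masses, using that
  the exponential factor is at most 1 and that the prior in \<open>th\<close> integrates to
  1.\<close>

lemma laplace_joint:
  fixes n N th0 ta0 r de L B e J X al1 al2 :: real and W t a :: "real \<Rightarrow> real" and c :: "real \<Rightarrow> real \<Rightarrow> real"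
  defines "b \<equiv> sqrt (4 * pi * th0\<^sup>2 / n)"
  defines "F \<equiv> (\<lambda>x. indicator ({0<..} \<times> {0<..}) x * (W (snd x) * exp (- (N / 2) * divh (t (snd x) / fst x)) * c (fst x) (snd x) * a (snd x)))"
  defines "w \<equiv> (\<lambda>al. indicator {0<..} al * (W al * c th0 al * a al))"
  defines "G \<equiv> (\<lambda>x. exp (- (n / (4 * th0\<^sup>2)) * (fst x - ta0)\<^sup>2) * w (snd x))"
  defines "K \<equiv> 2 * e * b + 2 * th0 * B * exp (- (n * r\<^sup>2 / (512 * th0\<^sup>2)))
        + J * exp (- (n / 256)) + 2 * b * exp (- (n * r\<^sup>2 / (32 * th0\<^sup>2)))"
  assumes t0: "0 < th0" and r: "0 < r" "r \<le> th0 / 8" and N: "n / 2 \<le> N" "N \<le> n" "0 < n"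
    and d: "\<bar>ta0 - th0\<bar> \<le> r / 4" "de \<le> r / 4"
    and al: "0 < al1"
    and tau: "\<And>al. al1 \<le> al \<Longrightarrow> al \<le> al2 \<Longrightarrow> \<bar>t al - ta0\<bar> \<le> de"
    and tpos: "\<And>al. 0 < al \<Longrightarrow> 0 < t al"
    and Fm: "F \<in> borel_measurable lborel2"
    and wm: "w \<in> borel_measurable borel"
    and Wm: "(\<lambda>al. indicator {0<..} al * (W al * a al)) \<in> borel_measurable borel"
    and W0: "\<And>al. 0 < al \<Longrightarrow> 0 \<le> W al" and a0: "\<And>al. 0 < al \<Longrightarrow> 0 \<le> a al"
    and c0: "\<And>th al. 0 < th \<Longrightarrow> 0 < al \<Longrightarrow> 0 \<le> c th al" and cpos: "\<And>al. 0 < al \<Longrightarrow> 0 < c th0 al"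
    and cm: "\<And>al. 0 < al \<Longrightarrow> (\<lambda>th. indicator {0<..} th * c th al) \<in> borel_measurable borel"
    and c1: "\<And>al. 0 < al \<Longrightarrow> (\<integral>\<^sup>+th\<in>{0<..}. ennreal (c th al) \<partial>lborel) = 1"
    and rh1: "\<And>th al. al1 \<le> al \<Longrightarrow> al \<le> al2 \<Longrightarrow> th0 / 2 < th \<Longrightarrow> th < 2 * th0 \<Longrightarrow>
       exp (- (L * \<bar>th - th0\<bar>)) \<le> c th al / c th0 al \<and> c th al / c th0 al \<le> exp (L * \<bar>th - th0\<bar>)"
    and rh2: "\<And>th al. al1 \<le> al \<Longrightarrow> al \<le> al2 \<Longrightarrow> th0 / 2 < th \<Longrightarrow> th < 2 * th0 \<Longrightarrow> c th al / c th0 al \<le> B"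
    and J: "\<And>al. al1 \<le> al \<Longrightarrow> al \<le> al2 \<Longrightarrow> 1 / c th0 al \<le> J" "0 \<le> J"
    and L: "0 \<le> L" and B: "0 \<le> B" and e: "0 \<le> e" "e \<le> 1 / 2"
    and e_ge: "L * r + laplace_err n N th0 r de \<le> e"
    and X: "(\<integral>\<^sup>+al\<in>{0<..} - {al1..al2}. ennreal (W al * a al) \<partial>lborel) \<le> ennreal X"
      "(\<integral>\<^sup>+al\<in>{0<..} - {al1..al2}. ennreal (w al) \<partial>lborel) \<le> ennreal X"
  shows "(\<integral>\<^sup>+x. ennreal \<bar>F x - G x\<bar> \<partial>lborel2)
    \<le> ennreal K * (\<integral>\<^sup>+al. ennreal (w al) \<partial>lborel) + ennreal X + ennreal b * ennreal X"
proof -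
  let ?r = "\<lambda>al th. exp (- (N / 2) * divh (t al / th)) * (c th al / c th0 al)"
  let ?E = "\<lambda>th al. ennreal \<bar>F (th, al) - G (th, al)\<bar>"
  let ?X = "{0<..} - {al1..al2}"
  have b0: "0 \<le> b" unfolding b_def using N by simp
  have N0: "0 \<le> N" using N by linarith
  have w0: "0 \<le> w al" for al using W0 c0[OF t0] a0 by (auto simp: w_def split: split_indicator)
  have K0: "0 \<le> K" unfolding K_def using e b0 B J(2) t0 by (intro add_nonneg_nonneg mult_nonneg_nonneg) auto
  let ?g = "\<lambda>th. gauss_peak n th0 ta0 th"
  have gb: "(\<integral>\<^sup>+th. ennreal (?g th) \<partial>lborel) = ennreal b"
    unfolding b_def using N t0 by (subst nn_integral_gauss) (auto simp: mult_ac)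
  have Gm: "G \<in> borel_measurable lborel2" unfolding G_def using wm by measurable
  have inner: "(\<integral>\<^sup>+th. ?E th al \<partial>lborel)
     \<le> ennreal K * ennreal (w al) + ennreal (W al * a al) * indicator ?X al
       + ennreal b * (ennreal (w al) * indicator ?X al)" for al
  proof -
    consider "al \<le> 0" | "al1 \<le> al" "al \<le> al2" "0 < al" | "0 < al" "al \<notin> {al1..al2}" using al by fastforce
    then show ?thesis
    proof cases
      case 1
      then have "F (th, al) - G (th, al) = 0" for th by (simp add: F_def G_def w_def indicator_def)
      then show ?thesis by simp
    next
      case 2
      note cp = cpos[OF 2(3)]
      have "F (th, al) - G (th, al) = w al * (indicator {0<..} th * ?r al th - ?g th)" for th
        using 2(3) cp by (simp add: F_def G_def w_def indicator_def right_diff_distrib)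
      then have "(\<integral>\<^sup>+th. ?E th al \<partial>lborel) =
        (\<integral>\<^sup>+th. ennreal (w al) * ennreal \<bar>indicator {0<..} th * ?r al th - ?g th\<bar> \<partial>lborel)"
        using w0 by (simp add: abs_mult ennreal_mult')
      also have "\<dots> = ennreal (w al) * (\<integral>\<^sup>+th. ennreal \<bar>indicator {0<..} th * ?r al th - ?g th\<bar> \<partial>lborel)"
      proof (rule nn_integral_cmult)
        have "(\<lambda>th. (indicator {0<..} th * c th al) * (exp (- (N / 2) * divh (t al / th)) / c th0 al)) \<in> borel_measurable borel"
          using cm[OF 2(3)] unfolding divh_def by measurable
        then show "(\<lambda>th. ennreal \<bar>indicator {0<..} th * ?r al th - ?g th\<bar>) \<in> borel_measurable lborel"
          by (simp add: mult_ac)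
      qed
      also have "\<dots> \<le> ennreal (w al) * ennreal K" unfolding K_def b_def
      proof (intro mult_left_mono laplace_fiber[where rh="\<lambda>th. c th al / c th0 al" and de=de and L=L] t0 r N d tau[OF 2(1,2)] rh1[OF 2(1,2)] rh2[OF 2(1,2)] L B e e_ge J(2))
        have "(\<lambda>th. (indicator {0<..} th * c th al) / c th0 al) \<in> borel_measurable borel"
          using cm[OF 2(3)] by measurable
        then show "(\<lambda>th. indicator {0<..} th * (c th al / c th0 al)) \<in> borel_measurable borel" by simp
        show "0 \<le> c th al / c th0 al" if "0 < th" for th using c0[OF that 2(3)] cp by simp
        have "(\<integral>\<^sup>+th\<in>{0<..}. ennreal (c th al / c th0 al) \<partial>lborel) = (\<integral>\<^sup>+th. ennreal (1 / c th0 al) * (ennreal (c th al) * indicator {0<..} th) \<partial>lborel)"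
        proof (rule nn_integral_cong)
          fix th
          have "ennreal (c th al / c th0 al) = ennreal (1 / c th0 al) * ennreal (c th al)" if "0 < th"
            using ennreal_mult[of "1 / c th0 al" "c th al"] c0[OF that 2(3)] cp by simp
          then show "ennreal (c th al / c th0 al) * indicator {0<..} th = ennreal (1 / c th0 al) * (ennreal (c th al) * indicator {0<..} th)"
            by (auto split: split_indicator)
        qed
        also have "\<dots> = ennreal (1 / c th0 al) * (\<integral>\<^sup>+th\<in>{0<..}. ennreal (c th al) \<partial>lborel)"
        proof (rule nn_integral_cmult)
          have "(\<lambda>th. ennreal (indicator {0<..} th * c th al)) \<in> borel_measurable lborel" using cm[OF 2(3)] by simp
          also have "(\<lambda>th. ennreal (indicator {0<..} th * c th al)) = (\<lambda>th. ennreal (c th al) * indicator {0<..} th)"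
            by (auto split: split_indicator)
          finally show "(\<lambda>th. ennreal (c th al) * indicator {0<..} th) \<in> borel_measurable lborel" .
        qed
        also have "\<dots> = ennreal (1 / c th0 al)" unfolding c1[OF 2(3)] by simp
        also have "\<dots> \<le> ennreal J" by (intro ennreal_leI J 2)
        finally show "(\<integral>\<^sup>+th\<in>{0<..}. ennreal (c th al / c th0 al) \<partial>lborel) \<le> ennreal J" .
      qed (assumption | rule zero_le)+
      finally show ?thesis by (simp add: mult.commute add_increasing2)
    next
      case 3
      have "(\<integral>\<^sup>+th. ?E th al \<partial>lborel)
        \<le> (\<integral>\<^sup>+th. ennreal (W al * a al) * (ennreal (c th al) * indicator {0<..} th) + ennreal (w al) * ennreal (?g th) \<partial>lborel)"
      proof (rule nn_integral_mono)
        fix th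
        have G: "0 \<le> G (th, al)" "ennreal (G (th, al)) = ennreal (w al) * ennreal (?g th)"
          using w0 by (auto simp: G_def ennreal_mult''[symmetric] mult.commute)
        have F: "0 \<le> F (th, al)" "F (th, al) \<le> W al * a al * (indicator {0<..} th * c th al)"
        proof -
          show "0 \<le> F (th, al)" using W0[OF 3(1)] a0[OF 3(1)] c0[OF _ 3(1)] by (auto simp: F_def split: split_indicator)
          show "F (th, al) \<le> W al * a al * (indicator {0<..} th * c th al)"
          proof (cases "0 < th")
            case True
            have "0 \<le> divh (t al / th)" using tpos[OF 3(1)] True by (intro divh_nonneg) simp
            then have "exp (- (N / 2) * divh (t al / th)) \<le> 1" using N0 by simp
            then have "(W al * a al * c th al) * exp (- (N / 2) * divh (t al / th)) \<le> (W al * a al * c th al) * 1"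
              using W0[OF 3(1)] a0[OF 3(1)] c0[OF True 3(1)] by (intro mult_left_mono) auto
            moreover have "F (th, al) = (W al * a al * c th al) * exp (- (N / 2) * divh (t al / th))"
              using True 3(1) by (simp add: F_def)
            ultimately show ?thesis using True by simp
          qed (simp add: F_def)
        qed
        have "?E th al \<le> ennreal (W al * a al * (indicator {0<..} th * c th al) + G (th, al))"
          using F G(1) by (intro ennreal_leI) linarith
        also have "\<dots> = ennreal (W al * a al) * (ennreal (c th al) * indicator {0<..} th) + ennreal (G (th, al))"
          using W0[OF 3(1)] a0[OF 3(1)] c0[OF _ 3(1)] G(1)
          by (cases "0 < th") (simp_all add: ennreal_plus ennreal_mult')
        finally show "?E th al \<le> ennreal (W al * a al) * (ennreal (c th al) * indicator {0<..} th) + ennreal (w al) * ennreal (?g th)"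
          unfolding G(2) .
      qed
      also have "\<dots> = ennreal (W al * a al) * (\<integral>\<^sup>+th\<in>{0<..}. ennreal (c th al) \<partial>lborel) + ennreal (w al) * (\<integral>\<^sup>+th. ennreal (?g th) \<partial>lborel)"
      proof -
        have "(\<lambda>th. ennreal (indicator {0<..} th * c th al)) \<in> borel_measurable lborel" using cm[OF 3(1)] by simp
        also have "(\<lambda>th. ennreal (indicator {0<..} th * c th al)) = (\<lambda>th. ennreal (c th al) * indicator {0<..} th)"
          by (auto split: split_indicator)
        finally have m: "(\<lambda>th. ennreal (c th al) * indicator {0<..} th) \<in> borel_measurable lborel" .
        then show ?thesis by (subst nn_integral_add) (simp_all add: nn_integral_cmult)
      qed
      also have "\<dots> = ennreal (W al * a al) + ennreal b * ennreal (w al)"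
        unfolding c1[OF 3(1)] gb by (simp add: mult.commute)
      finally show ?thesis using 3 by (simp add: add.assoc add_increasing)
    qed
  qed
  have "(\<integral>\<^sup>+x. ennreal \<bar>F x - G x\<bar> \<partial>lborel2) = (\<integral>\<^sup>+al. \<integral>\<^sup>+th. ?E th al \<partial>lborel \<partial>lborel)"
    by (rule lborel_pair.nn_integral_snd[symmetric]) (use Fm Gm in measurable)
  also have "\<dots> \<le> (\<integral>\<^sup>+al. ennreal K * ennreal (w al) + ennreal (W al * a al) * indicator ?X al
       + ennreal b * (ennreal (w al) * indicator ?X al) \<partial>lborel)"
    by (intro nn_integral_mono inner)
  also have "\<dots> = ennreal K * (\<integral>\<^sup>+al. ennreal (w al) \<partial>lborel) + (\<integral>\<^sup>+al\<in>?X. ennreal (W al * a al) \<partial>lborel)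
       + ennreal b * (\<integral>\<^sup>+al\<in>?X. ennreal (w al) \<partial>lborel)"
  proof -
    have "(\<lambda>al. ennreal (indicator {0<..} al * (W al * a al)) * indicator ?X al) \<in> borel_measurable lborel"
      using Wm by measurable
    also have "(\<lambda>al. ennreal (indicator {0<..} al * (W al * a al)) * indicator ?X al)
      = (\<lambda>al. ennreal (W al * a al) * indicator ?X al)" by (auto split: split_indicator)
    finally have m1: "(\<lambda>al. ennreal (W al * a al) * indicator ?X al) \<in> borel_measurable lborel" .
    have m2: "(\<lambda>al. ennreal (w al)) \<in> borel_measurable lborel" using wm by simp
    have m3: "(\<lambda>al. ennreal (w al) * indicator ?X al) \<in> borel_measurable lborel" using wm by measurable
    show ?thesis using m1 m2 m3
      by (subst nn_integral_add, measurable, simp, subst nn_integral_add, measurable) (simp_all add: nn_integral_cmult)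
  qed
  also have "\<dots> \<le> ennreal K * (\<integral>\<^sup>+al. ennreal (w al) \<partial>lborel) + ennreal X + ennreal b * ennreal X"
    by (intro add_mono mult_left_mono X order_refl) auto
  finally show ?thesis .
qed

section \<open>The prior, and the tails in the inverse length scale\<close>

locale prior =
  fixes th0 al0 s ka1 ka2 C1 C2 C3 cl cu :: real and c :: "real \<Rightarrow> real \<Rightarrow> real" and a :: "real \<Rightarrow> real"
  assumes pos: "0 < th0" "0 < al0" "0 < s" "0 < ka1" "0 < ka2"
    and c_nonneg: "\<And>th al. 0 < th \<Longrightarrow> 0 < al \<Longrightarrow> 0 \<le> c th al"
    and c_proper: "\<And>al. 0 < al \<Longrightarrow> (\<integral>\<^sup>+th\<in>{0<..}. ennreal (c th al) \<partial>lborel) = 1"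
    and c_C1: "\<And>al. 0 < al \<Longrightarrow> (\<lambda>th. c th al) C1_differentiable_on {0<..}"
    and c_cont: "\<And>th. 0 < th \<Longrightarrow> continuous_on {0<..} (\<lambda>al. c th al)"
    and c_pos: "\<And>al. 0 < al \<Longrightarrow> 0 < c th0 al"
    and C: "0 < C1" "0 < C2" "0 < C3" "C1 + C2 < 1 / 2" "C3 < 1"
    and c_deriv: "\<forall>\<^sub>F n in sequentially. \<forall>al\<in>{real n powr - ka1..real n powr ka2}. \<forall>th\<in>{th0 / 2<..<2 * th0}.
        \<bar>deriv (\<lambda>t. ln (c t al)) th\<bar> \<le> real n powr C1"
    and c_ratio: "\<forall>\<^sub>F n in sequentially. \<forall>al\<in>{real n powr - ka1..real n powr ka2}. \<forall>th\<in>{th0 / 2<..<2 * th0}.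
        c th al / c th0 al \<le> real n powr C2"
    and c_inf: "\<forall>\<^sub>F n in sequentially. \<forall>al\<in>{real n powr - ka1..real n powr ka2}. - (real n powr C3) \<le> ln (c th0 al)"
    and a_nonneg: "\<And>al. 0 < al \<Longrightarrow> 0 \<le> a al"
    and a_cont: "continuous_on {0<..} a"
    and a_pos: "0 < a al0"
    and ca_finite: "(\<integral>\<^sup>+al\<in>{0<..}. ennreal (c th0 al * a al) \<partial>lborel) < \<infinity>"
    and cl: "cl < s * ka1" and cu: "cu < s * ka2"
    and tail_lower: "\<forall>\<^sub>F n in sequentially. \<forall>f\<in>{a, \<lambda>al. c th0 al * a al}.
        (\<integral>\<^sup>+al\<in>{0<..<real n powr - ka1}. ennreal (al powr (- real n * s) * f al) \<partial>lborel) \<le> ennreal (exp (cl * real n * ln (real n)))"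
    and tail_upper: "\<forall>\<^sub>F n in sequentially. \<forall>f\<in>{a, \<lambda>al. c th0 al * a al}.
        (\<integral>\<^sup>+al\<in>{real n powr ka2<..}. ennreal (al powr (real n * s) * f al) \<partial>lborel) \<le> ennreal (exp (cu * real n * ln (real n)))"
begin

abbreviation "lo n \<equiv> real n powr - ka1"
abbreviation "hi n \<equiv> real n powr ka2"

text \<open>At a zero of the density its derivative vanishes as well (the zero is a minimum).\<close>

lemma c_ratio_bounds:
  assumes al: "0 < al" and L: "0 \<le> L" "\<And>th. th \<in> {th0 / 2<..<2 * th0} \<Longrightarrow> \<bar>deriv (\<lambda>t. ln (c t al)) th\<bar> \<le> L"
    and th: "th0 / 2 < th" "th < 2 * th0"
  shows "exp (- (L * \<bar>th - th0\<bar>)) \<le> c th al / c th0 al \<and> c th al / c th0 al \<le> exp (L * \<bar>th - th0\<bar>)"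
proof -
  define g where "g = (\<lambda>t. c t al)"
  obtain D where D: "\<And>t. 0 < t \<Longrightarrow> (g has_real_derivative D t) (at t)"
    using c_C1[OF al] unfolding C1_differentiable_on_def g_def
    by (auto simp: has_real_derivative_iff_has_vector_derivative)
  have g0: "0 \<le> g t" if "0 < t" for t using c_nonneg[OF that al] by (simp add: g_def)
  have DL: "\<bar>D t\<bar> \<le> L * g t" if t: "th0 / 2 < t" "t < 2 * th0" for t
  proof -
    have tp: "0 < t" using t pos by linarith
    show ?thesis
    proof (cases "g t = 0")
      case True
      have "D t = 0"
      proof (rule DERIV_local_min[OF D[OF tp] tp], intro allI impI)
        fix y assume "\<bar>t - y\<bar> < t"
        then have "0 < y" by linarith
        then show "g t \<le> g y" using g0 True by simp
      qed
      then show ?thesis using True by simp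
    next
      case False
      then have gp: "0 < g t" using g0[OF tp] by simp
      have "((\<lambda>t. ln (g t)) has_real_derivative D t / g t) (at t)"
        using D[OF tp] gp by (auto intro!: derivative_eq_intros)
      then have "deriv (\<lambda>t. ln (g t)) t = D t / g t" by (rule DERIV_imp_deriv)
      then have "\<bar>D t / g t\<bar> \<le> L" using L(2)[of t] t by (simp add: g_def)
      then show ?thesis using gp by (simp add: abs_divide divide_le_eq)
    qed
  qed
  \<comment> \<open>Gronwall's argument: \<open>g t * exp (L * t)\<close> increases and
    \<open>g t * exp (- (L * t))\<close> decreases. It avoids the logarithm of \<open>g\<close>,
    which may vanish away from \<open>th0\<close>.\<close>
  have up: "g x * exp (L * x) \<le> g y * exp (L * y)" if xy: "th0 / 2 < x" "x \<le> y" "y < 2 * th0" for x y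
  proof (rule DERIV_nonneg_imp_nondecreasing[OF xy(2)])
    fix t assume t: "x \<le> t" "t \<le> y"
    then have t': "th0 / 2 < t" "t < 2 * th0" "0 < t" using xy pos by linarith+
    have "((\<lambda>t. g t * exp (L * t)) has_real_derivative (D t + L * g t) * exp (L * t)) (at t)"
      using D[OF t'(3)] by (auto intro!: derivative_eq_intros simp: algebra_simps)
    moreover have "0 \<le> (D t + L * g t) * exp (L * t)" using DL[OF t'(1,2)] by (intro mult_nonneg_nonneg) auto
    ultimately show "\<exists>y. ((\<lambda>t. g t * exp (L * t)) has_real_derivative y) (at t) \<and> 0 \<le> y" by blast
  qed
  have down: "g y * exp (- (L * y)) \<le> g x * exp (- (L * x))" if xy: "th0 / 2 < x" "x \<le> y" "y < 2 * th0" for x y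
  proof (rule DERIV_nonpos_imp_nonincreasing[OF xy(2)])
    fix t assume t: "x \<le> t" "t \<le> y"
    then have t': "th0 / 2 < t" "t < 2 * th0" "0 < t" using xy pos by linarith+
    have "((\<lambda>t. g t * exp (- (L * t))) has_real_derivative (D t - L * g t) * exp (- (L * t))) (at t)"
      using D[OF t'(3)] by (auto intro!: derivative_eq_intros simp: algebra_simps)
    moreover have "(D t - L * g t) * exp (- (L * t)) \<le> 0" using DL[OF t'(1,2)] by (intro mult_nonpos_nonneg) auto
    ultimately show "\<exists>y. ((\<lambda>t. g t * exp (- (L * t))) has_real_derivative y) (at t) \<and> y \<le> 0" by blast
  qed
  have e1: "exp (L * (x - y)) \<le> u / v" if "v * exp (L * x) \<le> u * exp (L * y)" "0 < v" for x y u v :: real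
    using that by (simp add: right_diff_distrib exp_diff field_simps)
  have e2: "u / v \<le> exp (L * (y - x))" if "u * exp (- (L * y)) \<le> v * exp (- (L * x))" "0 < v" for x y u v :: real
    using that by (simp add: right_diff_distrib exp_diff exp_minus field_simps)
  have gp: "0 < g th0" using c_pos[OF al] by (simp add: g_def)
  have t0: "th0 / 2 < th0" "th0 < 2 * th0" using pos by auto
  show ?thesis unfolding g_def[symmetric, THEN fun_cong]
  proof (cases "th0 \<le> th")
    case True
    then have ab: "L * \<bar>th - th0\<bar> = L * (th - th0)" "- (L * \<bar>th - th0\<bar>) = L * (th0 - th)" by (simp_all add: algebra_simps)
    show "exp (- (L * \<bar>th - th0\<bar>)) \<le> g th / g th0 \<and> g th / g th0 \<le> exp (L * \<bar>th - th0\<bar>)"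
      unfolding ab(2) unfolding ab(1) using e1[OF up[OF t0(1) True th(2)] gp] e2[OF down[OF t0(1) True th(2)] gp] ..
  next
    case False
    then have le: "th \<le> th0" by simp
    then have ab: "L * \<bar>th - th0\<bar> = L * (th0 - th)" "- (L * \<bar>th - th0\<bar>) = L * (th - th0)" by (simp_all add: algebra_simps)
    have 1: "exp (L * (th - th0)) \<le> g th / g th0"
    proof -
      have "exp (L * (th - th0)) * g th0 \<le> g th"
        using down[OF th(1) le t0(2)] by (simp add: right_diff_distrib exp_diff exp_minus field_simps)
      then show ?thesis using gp by (simp add: le_divide_eq)
    qed
    have 2: "g th / g th0 \<le> exp (L * (th0 - th))"
    proof -
      have "g th \<le> exp (L * (th0 - th)) * g th0"
        using up[OF th(1) le t0(2)] by (simp add: right_diff_distrib exp_diff exp_minus field_simps)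
      then show ?thesis using gp by (simp add: divide_le_eq)
    qed
    show "exp (- (L * \<bar>th - th0\<bar>)) \<le> g th / g th0 \<and> g th / g th0 \<le> exp (L * \<bar>th - th0\<bar>)"
      unfolding ab(2) unfolding ab(1) using 1 2 ..
  qed
qed

text \<open>The only regularity of a log-likelihood in \<open>al\<close> that is used, with \<open>k\<close> observations.\<close>

definition log_lip :: "nat \<Rightarrow> (real \<Rightarrow> real) \<Rightarrow> bool" where
  "log_lip k l \<longleftrightarrow> (\<forall>x>0. \<forall>y>0. \<bar>l x - l y\<bar> \<le> real k * s * \<bar>ln (x / y)\<bar>)"

lemma log_lipD: "log_lip k l \<Longrightarrow> 0 < x \<Longrightarrow> 0 < y \<Longrightarrow> \<bar>l x - l y\<bar> \<le> real k * s * \<bar>ln (x / y)\<bar>"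
  by (simp add: log_lip_def)

lemma log_lip_cont:
  assumes "log_lip k l"
  shows "continuous_on {0<..} l"
  unfolding continuous_on_eq_continuous_at[OF open_greaterThan]
proof
  fix y :: real assume y: "y \<in> {0<..}"
  have "((\<lambda>x. l x - l y) \<longlongrightarrow> 0) (at y)"
  proof (rule Lim_null_comparison)
    have "((\<lambda>x. real k * s * \<bar>ln (x / y)\<bar>) \<longlongrightarrow> real k * s * \<bar>ln (y / y)\<bar>) (at y)"
      using y by (intro tendsto_intros) auto
    then show "((\<lambda>x. real k * s * \<bar>ln (x / y)\<bar>) \<longlongrightarrow> 0) (at y)" using y by simp
    have "\<forall>\<^sub>F x in at y. x \<in> {0<..}" by (rule eventually_at_in_open'[OF open_greaterThan y])
    then show "\<forall>\<^sub>F x in at y. norm (l x - l y) \<le> real k * s * \<bar>ln (x / y)\<bar>"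
      by eventually_elim (use y log_lipD[OF assms] in auto)
  qed
  then show "isCont l y" unfolding isCont_def by (simp add: LIM_zero_iff)
qed

definition weight :: "(real \<Rightarrow> real) \<Rightarrow> real \<Rightarrow> real" where
  "weight l al = indicator {0<..} al * (exp (l al) * c th0 al * a al)"

lemma ind_measurable:
  fixes f :: "real \<Rightarrow> real"
  assumes "continuous_on {0<..} f"
  shows "(\<lambda>al. indicator {0<..} al * f al) \<in> borel_measurable borel"
  using borel_measurable_continuous_on_indicator[OF borel_open[OF open_greaterThan] assms] by simp

lemma weight_measurable:
  assumes "log_lip k l"
  shows "weight l \<in> borel_measurable borel"
  unfolding weight_def[abs_def]
  by (intro ind_measurable continuous_intros log_lip_cont[OF assms] c_cont a_cont) (rule pos)

lemma exp_measurable: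
  assumes "log_lip k l"
  shows "(\<lambda>al. indicator {0<..} al * (exp (l al) * a al)) \<in> borel_measurable borel"
  by (intro ind_measurable continuous_intros log_lip_cont[OF assms] a_cont)

lemma weight_nonneg: "0 \<le> weight l al"
  using c_nonneg[OF pos(1)] a_nonneg by (auto simp: weight_def split: split_indicator)

text \<open>The Lipschitz bound, exponentiated, is a power of \<open>al\<close>: the one that the
  tail condition on the prior integrates.\<close>

lemma exp_tail_below:
  assumes l: "log_lip k l" and al: "0 < al" "al \<le> x"
  shows "exp (l al) \<le> exp (l x) * x powr (real k * s) * al powr (- real k * s)"
proof -
  have x: "0 < x" using al by simp
  have "\<bar>ln (al / x)\<bar> = ln x - ln al" using al x by (simp add: ln_div)
  then have "l al \<le> l x + real k * s * (ln x - ln al)" using log_lipD[OF l al(1) x] by auto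
  then have "exp (l al) \<le> exp (l x + real k * s * ln x + - (real k * s) * ln al)" by (simp add: algebra_simps)
  also have "\<dots> = exp (l x) * x powr (real k * s) * al powr (- real k * s)"
    unfolding exp_add using al x by (simp add: powr_def)
  finally show ?thesis .
qed

lemma exp_tail_above:
  assumes l: "log_lip k l" and al: "0 < x" "x \<le> al"
  shows "exp (l al) \<le> exp (l x) * x powr (- real k * s) * al powr (real k * s)"
proof -
  have x: "0 < al" using al by simp
  have "\<bar>ln (al / x)\<bar> = ln al - ln x" using al x by (simp add: ln_div)
  then have "l al \<le> l x + real k * s * (ln al - ln x)" using log_lipD[OF l x al(1)] by auto
  then have "exp (l al) \<le> exp (l x + - (real k * s) * ln x + real k * s * ln al)" by (simp add: algebra_simps)
  also have "\<dots> = exp (l x) * x powr (- real k * s) * al powr (real k * s)"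
    unfolding exp_add using al x by (simp add: powr_def)
  finally show ?thesis .
qed

text \<open>On an interval of length of order \<open>1 / k\<close> to the right of
  \<open>al0\<close> the log-likelihood changes by a bounded amount and the prior stays away from 0.
  The loss is only polynomial in \<open>k\<close>, negligible against exponentially small tails, and
  one \<open>z\<close> serves all \<open>l\<close>.\<close>

lemma weight_integral_lower: obtains z where "0 < z"
  "\<And>k l. log_lip k l \<Longrightarrow> 1 \<le> k \<Longrightarrow> ennreal (z / real k * exp (l al0)) \<le> (\<integral>\<^sup>+al. ennreal (weight l al) \<partial>lborel)"
proof -
  define f where "f = (\<lambda>al. c th0 al * a al)"
  have f0: "0 < f al0" using c_pos[OF pos(2)] a_pos by (simp add: f_def)
  have "continuous_on {0<..} f" unfolding f_def by (intro continuous_intros c_cont a_cont) (rule pos)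
  then have "isCont f al0" using pos(2) by (simp add: continuous_on_eq_continuous_at[OF open_greaterThan])
  then have "(f \<longlongrightarrow> f al0) (at al0)" by (simp add: isCont_def)
  then have "\<forall>\<^sub>F x in at al0. f al0 / 2 < f x" by (rule order_tendstoD) (use f0 in simp)
  then obtain e where e: "0 < e" "\<And>x. x \<noteq> al0 \<Longrightarrow> dist x al0 < e \<Longrightarrow> f al0 / 2 < f x"
    unfolding eventually_at by auto
  define d where "d = e / 2"
  have d: "0 < d" "\<And>x. al0 \<le> x \<Longrightarrow> x \<le> al0 + d \<Longrightarrow> f al0 / 2 \<le> f x"
  proof -
    show "0 < d" using e by (simp add: d_def)
    fix x assume "al0 \<le> x" "x \<le> al0 + d"
    then show "f al0 / 2 \<le> f x" using e(2)[of x] e(1) f0 by (cases "x = al0") (auto simp: dist_real_def d_def)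
  qed
  define z where "z = f al0 / 2 * exp (- (s * d / al0)) * d"
  show ?thesis
  proof (rule that[of z])
    show "0 < z" using f0 d by (simp add: z_def)
    fix k :: nat and l assume l: "log_lip k l" and k: "1 \<le> k"
    have k0: "0 < real k" using k by simp
    have "ennreal (z / real k * exp (l al0)) = (\<integral>\<^sup>+al. ennreal (f al0 / 2 * exp (- (s * d / al0)) * exp (l al0)) * indicator {al0..al0 + d / k} al \<partial>lborel)"
    proof -
      have "(\<integral>\<^sup>+al. ennreal (f al0 / 2 * exp (- (s * d / al0)) * exp (l al0)) * indicator {al0..al0 + d / k} al \<partial>lborel)
        = ennreal (f al0 / 2 * exp (- (s * d / al0)) * exp (l al0)) * ennreal (d / k)"
        using d k by (subst nn_integral_cmult_indicator) auto
      also have "\<dots> = ennreal (f al0 / 2 * exp (- (s * d / al0)) * exp (l al0) * (d / k))"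
        using f0 d k by (intro ennreal_mult[symmetric]) auto
      finally show ?thesis by (simp add: z_def mult_ac)
    qed
    also have "\<dots> \<le> (\<integral>\<^sup>+al. ennreal (weight l al) \<partial>lborel)"
    proof (rule nn_integral_mono)
      fix al
      show "ennreal (f al0 / 2 * exp (- (s * d / al0)) * exp (l al0)) * indicator {al0..al0 + d / k} al \<le> ennreal (weight l al)"
      proof (cases "al \<in> {al0..al0 + d / k}")
        case True
        have "d / real k \<le> d / 1" using d k by (intro divide_left_mono) auto
        then have al: "al0 \<le> al" "al \<le> al0 + d" "0 < al" using True pos by auto
        have "ln (al / al0) \<le> al / al0 - 1" using al pos by (intro ln_le_minus_one) auto
        also have "\<dots> \<le> d / k / al0" using True pos by (simp add: field_simps)
        finally have "real k * s * ln (al / al0) \<le> real k * s * (d / k / al0)" using pos by (intro mult_left_mono) auto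
        also have "\<dots> = s * d / al0" using k0 by simp
        finally have le: "real k * s * \<bar>ln (al / al0)\<bar> \<le> s * d / al0" using al pos by simp
        have "\<bar>l al - l al0\<bar> \<le> s * d / al0" using log_lipD[OF l al(3) pos(2)] le by linarith
        then have ex: "exp (- (s * d / al0)) * exp (l al0) \<le> exp (l al)" unfolding exp_add[symmetric] by simp
        have "f al0 / 2 * (exp (- (s * d / al0)) * exp (l al0)) \<le> f al * exp (l al)"
          using ex d(2)[OF al(1,2)] f0 by (intro mult_mono) auto
        then have "f al0 / 2 * exp (- (s * d / al0)) * exp (l al0) \<le> weight l al"
          using al by (simp add: weight_def f_def mult_ac)
        then show ?thesis using True by (simp add: ennreal_leI)
      qed simp
    qed
    finally show "ennreal (z / real k * exp (l al0)) \<le> (\<integral>\<^sup>+al. ennreal (weight l al) \<partial>lborel)" .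
  qed
qed

end

context prior
begin

text \<open>The first bounds the mass of the posterior outside the range, where \<open>th\<close> is
  integrated out; the second bounds that of the limit law, where \<open>th\<close> is set to
  \<open>th0\<close>.\<close>

abbreviation "densities \<equiv> {a, \<lambda>al. c th0 al * a al}"

lemma densities:
  assumes "f \<in> densities"
  shows "0 < al \<Longrightarrow> 0 \<le> f al" "continuous_on {0<..} f"
  using assms c_nonneg[OF pos(1)] a_nonneg by (auto intro!: continuous_intros c_cont a_cont pos)

lemma nn_integral_cmult_le:
  assumes A: "A \<in> sets borel" "A \<subseteq> {0<..}" and Q: "0 \<le> Q" and f: "f \<in> densities"
    and le: "\<And>al. al \<in> A \<Longrightarrow> g al \<le> Q * (al powr r * f al)"
    and I: "(\<integral>\<^sup>+al\<in>A. ennreal (al powr r * f al) \<partial>lborel) \<le> ennreal R"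
  shows "(\<integral>\<^sup>+al\<in>A. ennreal (g al) \<partial>lborel) \<le> ennreal (Q * R)"
proof -
  let ?f = "\<lambda>al. al powr r * f al"
  have "(\<lambda>al. indicator {0<..} al * ?f al) \<in> borel_measurable borel"
    by (intro ind_measurable continuous_intros densities(2)[OF f]) auto
  then have "(\<lambda>al. ennreal (indicator {0<..} al * ?f al) * indicator A al) \<in> borel_measurable lborel"
    using A(1) by measurable
  also have "(\<lambda>al. ennreal (indicator {0<..} al * ?f al) * indicator A al) = (\<lambda>al. ennreal (?f al) * indicator A al)"
    using A(2) by (intro ext) (auto simp: subset_iff split: split_indicator)
  finally have m: "(\<lambda>al. ennreal (?f al) * indicator A al) \<in> borel_measurable lborel" .
  have "(\<integral>\<^sup>+al\<in>A. ennreal (g al) \<partial>lborel) \<le> (\<integral>\<^sup>+al. ennreal Q * (ennreal (?f al) * indicator A al) \<partial>lborel)"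
  proof (rule nn_integral_mono)
    fix al
    have "ennreal (g al) \<le> ennreal Q * ennreal (?f al)" if "al \<in> A"
      using ennreal_leI[OF le[OF that]] by (simp only: ennreal_mult'[OF Q])
    then show "ennreal (g al) * indicator A al \<le> ennreal Q * (ennreal (?f al) * indicator A al)"
      by (cases "al \<in> A") simp_all
  qed
  also have "\<dots> = ennreal Q * (\<integral>\<^sup>+al\<in>A. ennreal (?f al) \<partial>lborel)" by (rule nn_integral_cmult[OF m])
  also have "\<dots> \<le> ennreal Q * ennreal R" by (intro mult_left_mono I) simp
  also have "\<dots> = ennreal (Q * R)" by (rule ennreal_mult'[symmetric, OF Q])
  finally show ?thesis .
qed

lemma tail_bounds:
  assumes l: "log_lip n l" and n: "0 < n" and f: "f \<in> densities" and R: "0 \<le> R1" "0 \<le> R2"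
    and tl: "(\<integral>\<^sup>+al\<in>{0<..<lo n}. ennreal (al powr (- real n * s) * f al) \<partial>lborel) \<le> ennreal R1"
    and tu: "(\<integral>\<^sup>+al\<in>{hi n<..}. ennreal (al powr (real n * s) * f al) \<partial>lborel) \<le> ennreal R2"
  shows "(\<integral>\<^sup>+al\<in>{0<..} - {lo n..hi n}. ennreal (exp (l al) * f al) \<partial>lborel)
    \<le> ennreal (exp (l (lo n)) * lo n powr (real n * s) * R1 + exp (l (hi n)) * hi n powr (- real n * s) * R2)"
proof -
  let ?g = "\<lambda>al. exp (l al) * f al"
  have lh: "0 < lo n" "0 < hi n" "lo n \<le> hi n" using n pos by (auto intro!: powr_mono)
  note hp = less_trans[OF lh(2)]
  have m: "(\<lambda>al. ennreal (?g al) * indicator A al) \<in> borel_measurable lborel" if "A \<in> sets borel" "A \<subseteq> {0<..}" for A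
  proof -
    have "(\<lambda>al. indicator {0<..} al * ?g al) \<in> borel_measurable borel"
      by (intro ind_measurable continuous_intros log_lip_cont[OF l] densities(2)[OF f])
    then have "(\<lambda>al. ennreal (indicator {0<..} al * ?g al) * indicator A al) \<in> borel_measurable lborel"
      using that(1) by measurable
    also have "(\<lambda>al. ennreal (indicator {0<..} al * ?g al) * indicator A al) = (\<lambda>al. ennreal (?g al) * indicator A al)"
      using that(2) by (intro ext) (auto simp: subset_iff split: split_indicator)
    finally show ?thesis .
  qed
  have "(\<integral>\<^sup>+al\<in>{0<..} - {lo n..hi n}. ennreal (?g al) \<partial>lborel)
      = (\<integral>\<^sup>+al. ennreal (?g al) * indicator {0<..<lo n} al + ennreal (?g al) * indicator {hi n<..} al \<partial>lborel)"
    using lh(1,3) less_imp_le[OF hp] by (intro nn_integral_cong) (fastforce split: split_indicator)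
  also have "\<dots> = (\<integral>\<^sup>+al\<in>{0<..<lo n}. ennreal (?g al) \<partial>lborel) + (\<integral>\<^sup>+al\<in>{hi n<..}. ennreal (?g al) \<partial>lborel)"
    using hp by (intro nn_integral_add m) auto
  also have "\<dots> \<le> ennreal ((exp (l (lo n)) * lo n powr (real n * s)) * R1) + ennreal ((exp (l (hi n)) * hi n powr (- real n * s)) * R2)"
  proof (intro add_mono)
    show "(\<integral>\<^sup>+al\<in>{0<..<lo n}. ennreal (?g al) \<partial>lborel) \<le> ennreal ((exp (l (lo n)) * lo n powr (real n * s)) * R1)"
    proof (rule nn_integral_cmult_le[OF _ _ _ f _ tl])
      fix al assume A: "al \<in> {0<..<lo n}"
      then have "exp (l al) \<le> exp (l (lo n)) * lo n powr (real n * s) * al powr (- real n * s)" by (intro exp_tail_below[OF l]) auto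
      then show "?g al \<le> (exp (l (lo n)) * lo n powr (real n * s)) * (al powr (- real n * s) * f al)"
        unfolding mult.assoc[symmetric] using A by (intro mult_right_mono densities(1)[OF f]) auto
    qed auto
    show "(\<integral>\<^sup>+al\<in>{hi n<..}. ennreal (?g al) \<partial>lborel) \<le> ennreal ((exp (l (hi n)) * hi n powr (- real n * s)) * R2)"
    proof (rule nn_integral_cmult_le[OF _ _ _ f _ tu])
      fix al assume A: "al \<in> {hi n<..}"
      then have "exp (l al) \<le> exp (l (hi n)) * hi n powr (- real n * s) * al powr (real n * s)"
        using lh(2) by (intro exp_tail_above[OF l]) simp_all
      then show "?g al \<le> (exp (l (hi n)) * hi n powr (- real n * s)) * (al powr (real n * s) * f al)"
        unfolding mult.assoc[symmetric] using A hp by (intro mult_right_mono densities(1)[OF f]) simp_all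
    qed (use hp in auto)
  qed
  also have "\<dots> = ennreal (exp (l (lo n)) * lo n powr (real n * s) * R1 + exp (l (hi n)) * hi n powr (- real n * s) * R2)"
    using R by (intro ennreal_plus[symmetric]) auto
  finally show ?thesis .
qed

text \<open>At the lower endpoint the prior condition and the power of the endpoint combine to
  \<open>exp (- n * (s * ka1 - cl) * ln n)\<close>, and similarly above. The gap is positive, so
  this beats the \<open>exp (2 * n)\<close> of the likelihood; the constant 4 leaves an exponent of
  at most \<open>- 2 * n\<close>, with room for adding the two tails.\<close>

lemma tails_small:
  "\<forall>\<^sub>F n in sequentially. \<forall>l. log_lip n l \<longrightarrow> l (lo n) \<le> 2 * real n \<longrightarrow> l (hi n) \<le> 2 * real n \<longrightarrow>
     (\<forall>f\<in>densities. (\<integral>\<^sup>+al\<in>{0<..} - {lo n..hi n}. ennreal (exp (l al) * f al) \<partial>lborel) \<le> ennreal (exp (- real n)))"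
proof -
  have ev: "\<forall>\<^sub>F n in sequentially. 4 \<le> k * ln (real n)" if "0 < k" for k :: real
  proof -
    have "filterlim (\<lambda>n. k * ln (real n)) at_top sequentially" using that by real_asymp
    then show ?thesis unfolding filterlim_at_top by blast
  qed
  have p: "0 < s * ka1 - cl" "0 < s * ka2 - cu" using cl cu by simp_all
  show ?thesis using tail_lower tail_upper ev[OF p(1)] ev[OF p(2)] eventually_ge_at_top[of 2]
  proof eventually_elim
    case (elim n)
    have n: "2 \<le> real n" "0 < n" using elim(5) by simp_all
    have small: "exp m * real n powr (y * (real n * s)) * exp (u * real n * ln (real n)) \<le> 1 / 2 * exp (- real n)"
      if "m \<le> 2 * real n" "4 \<le> (- (s * y) - u) * ln (real n)" for m y u
    proof -
      have "real n powr (y * (real n * s)) = exp (y * (real n * s) * ln (real n))" using n by (simp add: powr_def)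
      then have "exp m * real n powr (y * (real n * s)) * exp (u * real n * ln (real n))
        = exp (m + y * (real n * s) * ln (real n) + u * real n * ln (real n))" unfolding exp_add by simp
      also have "m + y * (real n * s) * ln (real n) + u * real n * ln (real n) = m - real n * ((- (s * y) - u) * ln (real n))"
        by (simp add: algebra_simps)
      also have "exp \<dots> \<le> exp (- real n + - real n)"
      proof -
        have "real n * 4 \<le> real n * ((- (s * y) - u) * ln (real n))" using that(2) by (intro mult_left_mono) auto
        then show ?thesis using that(1) by simp
      qed
      also have "\<dots> = exp (- real n) * exp (- real n)" by (rule exp_add)
      also have "\<dots> \<le> 1 / 2 * exp (- real n)"
      proof (intro mult_right_mono)
        have "2 \<le> exp (real n)" using exp_ge_add_one_self[of "real n"] n by linarith
        then show "exp (- real n) \<le> 1 / 2" by (simp add: exp_minus field_simps)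
      qed simp
      finally show ?thesis .
    qed
    show ?case
    proof (intro allI impI ballI)
      fix l f assume l: "log_lip n l" "l (lo n) \<le> 2 * real n" "l (hi n) \<le> 2 * real n" and f: "f \<in> densities"
      have "exp (l (lo n)) * lo n powr (real n * s) * exp (cl * real n * ln (real n)) \<le> 1 / 2 * exp (- real n)"
        "exp (l (hi n)) * hi n powr (- real n * s) * exp (cu * real n * ln (real n)) \<le> 1 / 2 * exp (- real n)"
        using small[OF l(2), of "- ka1" cl] small[OF l(3), of "- ka2" cu] elim(3,4) by (simp_all add: powr_powr)
      then have "exp (l (lo n)) * lo n powr (real n * s) * exp (cl * real n * ln (real n))
        + exp (l (hi n)) * hi n powr (- real n * s) * exp (cu * real n * ln (real n)) \<le> exp (- real n)" by linarith
      from ennreal_leI[OF this] show "(\<integral>\<^sup>+al\<in>{0<..} - {lo n..hi n}. ennreal (exp (l al) * f al) \<partial>lborel) \<le> ennreal (exp (- real n))"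
        by (rule order_trans[OF tail_bounds[OF l(1) n(2) f _ _ bspec[OF elim(1) f] bspec[OF elim(2) f]], rotated 2]) auto
    qed
  qed
qed

lemma log_lip_mono: "log_lip k l \<Longrightarrow> k \<le> n \<Longrightarrow> log_lip n l"
  unfolding log_lip_def
proof (intro allI impI)
  fix x y :: real
  assume l: "\<forall>x>0. \<forall>y>0. \<bar>l x - l y\<bar> \<le> real k * s * \<bar>ln (x / y)\<bar>" and n: "k \<le> n" and xy: "0 < x" "0 < y"
  have "real k * s * \<bar>ln (x / y)\<bar> \<le> real n * s * \<bar>ln (x / y)\<bar>" using n pos by (intro mult_right_mono) auto
  then show "\<bar>l x - l y\<bar> \<le> real n * s * \<bar>ln (x / y)\<bar>" using l xy by (meson order_trans)
qed

text \<open>The tail conditions hold only for large \<open>n\<close>, but a function that is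
  \<open>log_lip k\<close> is also \<open>log_lip n\<close> for every larger \<open>n\<close>. So
  one large \<open>n\<close> settles the tails for each \<open>k\<close>, small samples included; on
  the compact middle piece the likelihood is bounded and the prior integrable.\<close>

lemma weight_integral_finite:
  assumes l: "log_lip k l"
  shows "(\<integral>\<^sup>+al. ennreal (weight l al) \<partial>lborel) < \<infinity>"
proof -
  let ?f = "\<lambda>al. c th0 al * a al" and ?n = "\<lambda>A. \<integral>\<^sup>+al\<in>A. ennreal (weight l al) \<partial>lborel"
  have f: "?f \<in> densities" by simp
  obtain n where n: "k \<le> n" "0 < n"
    and tl: "(\<integral>\<^sup>+al\<in>{0<..<lo n}. ennreal (al powr (- real n * s) * ?f al) \<partial>lborel) \<le> ennreal (exp (cl * real n * ln (real n)))"
    and tu: "(\<integral>\<^sup>+al\<in>{hi n<..}. ennreal (al powr (real n * s) * ?f al) \<partial>lborel) \<le> ennreal (exp (cu * real n * ln (real n)))"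
    using eventually_happens[OF eventually_conj[OF eventually_ge_at_top[of "max k 1"] eventually_conj[OF tail_lower tail_upper]]] by auto
  note ln = log_lip_mono[OF l n(1)]
  have w: "weight l al = exp (l al) * ?f al" if "0 < al" for al using that by (simp add: weight_def)
  have lh: "0 < lo n" "0 < hi n" using n by auto
  have lp: "al \<in> {lo n..hi n} \<Longrightarrow> 0 < al" for al using less_le_trans[OF lh(1)] by simp
  have "?n ({0<..} - {lo n..hi n}) = (\<integral>\<^sup>+al\<in>{0<..} - {lo n..hi n}. ennreal (exp (l al) * ?f al) \<partial>lborel)"
    by (intro nn_integral_cong) (auto simp: weight_def mult.assoc split: split_indicator)
  also have "\<dots> < \<infinity>" using tail_bounds[OF ln n(2) f _ _ tl tu] by (simp add: le_less_trans)
  finally have 1: "?n ({0<..} - {lo n..hi n}) < \<infinity>" .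
  obtain R where R: "(\<integral>\<^sup>+al\<in>{0<..}. ennreal (?f al) \<partial>lborel) = ennreal R"
    using ca_finite by (metis ennreal_cases infinity_ennreal_def less_irrefl)
  define Q where "Q = exp (l 1 + real n * s * (\<bar>ln (lo n)\<bar> + \<bar>ln (hi n)\<bar>))"
  have le: "weight l al \<le> Q * ?f al" if A: "al \<in> {lo n..hi n}" for al
  proof -
    have ap: "0 < al" using A by (rule lp)
    have "ln (lo n) \<le> ln al" "ln al \<le> ln (hi n)"
      using A ln_le_cancel_iff[OF lh(1) ap] ln_le_cancel_iff[OF ap lh(2)] by (simp_all del: ln_powr)
    then have "real n * s * \<bar>ln al\<bar> \<le> real n * s * (\<bar>ln (lo n)\<bar> + \<bar>ln (hi n)\<bar>)" using pos by (intro mult_left_mono) auto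
    then have "exp (l al) \<le> Q" unfolding Q_def using log_lipD[OF ln ap, of 1] by simp
    then show ?thesis unfolding w[OF ap] using densities(1)[OF f ap] by (rule mult_right_mono)
  qed
  have "?n {lo n..hi n} \<le> (\<integral>\<^sup>+al\<in>{0<..}. ennreal (Q * ?f al) \<partial>lborel)"
  proof (rule nn_integral_mono)
    fix al
    show "ennreal (weight l al) * indicator {lo n..hi n} al \<le> ennreal (Q * ?f al) * indicator {0<..} al"
      using ennreal_leI[OF le[of al]] lp[of al] by (cases "al \<in> {lo n..hi n}") simp_all
  qed
  also have "\<dots> \<le> ennreal (Q * R)"
  proof (rule nn_integral_cmult_le[where f="?f" and r=0])
    show "(\<integral>\<^sup>+al\<in>{0<..}. ennreal (al powr 0 * ?f al) \<partial>lborel) \<le> ennreal R"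
      unfolding R[symmetric] by (intro nn_integral_mono) (auto split: split_indicator)
  qed (auto simp: Q_def)
  finally have 2: "?n {lo n..hi n} < \<infinity>" by (simp add: le_less_trans)
  have m: "(\<lambda>al. ennreal (weight l al) * indicator A al) \<in> borel_measurable lborel" if "A \<in> sets borel" for A
    using weight_measurable[OF l] that by measurable
  have "(\<integral>\<^sup>+al. ennreal (weight l al) \<partial>lborel) \<le> (\<integral>\<^sup>+al. ennreal (weight l al) * indicator ({0<..} - {lo n..hi n}) al
      + ennreal (weight l al) * indicator {lo n..hi n} al \<partial>lborel)"
    by (intro nn_integral_mono) (auto simp: weight_def split: split_indicator)
  also have "\<dots> = ?n ({0<..} - {lo n..hi n}) + ?n {lo n..hi n}" by (intro nn_integral_add m) auto
  also have "\<dots> < \<infinity>" using 1 2 by (simp add: ennreal_add_less_top)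
  finally show ?thesis .
qed

end

lemma prob_space_normalized:
  assumes f: "integrable M f" "\<And>x. 0 \<le> f x" "0 < (LINT x|M. f x)"
  shows "prob_space (normalized_measure M f)"
proof
  have "emeasure (normalized_measure M f) (space (normalized_measure M f))
    = (\<integral>\<^sup>+x. ennreal (f x / (LINT x|M. f x)) * indicator (space M) x \<partial>M)"
    unfolding normalized_measure_def space_density using f(1) by (intro emeasure_density sets.top) simp
  also have "\<dots> = (\<integral>\<^sup>+x. ennreal (f x / (LINT x|M. f x)) \<partial>M)"
    by (simp cong: nn_integral_cong)
  also have "\<dots> = ennreal (LINT x|M. f x / (LINT x|M. f x))"
    using f by (intro nn_integral_eq_integral) auto
  also have "\<dots> = 1" using f(3) by simp
  finally show "emeasure (normalized_measure M f) (space (normalized_measure M f)) = 1" .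
qed

context prior
begin

lemma weight_shift: "weight (\<lambda>al. l al - A) al = exp (- A) * weight l al"
  by (simp add: weight_def exp_diff exp_minus field_simps)

lemma log_lip_shift: "log_lip k l \<Longrightarrow> log_lip k (\<lambda>al. l al - A)"
  by (simp add: log_lip_def)

lemma weight_integrable:
  assumes "log_lip k l"
  shows "integrable lborel (weight l)" "0 < (LINT al|lborel. weight l al)"
    "(\<integral>\<^sup>+al. ennreal (weight l al) \<partial>lborel) = ennreal (LINT al|lborel. weight l al)"
proof -
  show i: "integrable lborel (weight l)"
    using weight_integral_finite[OF assms] weight_measurable[OF assms]
    by (intro integrableI_nonneg) (auto simp: weight_nonneg)
  show e: "(\<integral>\<^sup>+al. ennreal (weight l al) \<partial>lborel) = ennreal (LINT al|lborel. weight l al)"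
    using i weight_nonneg by (intro nn_integral_eq_integral) auto
  obtain z where z: "0 < z" "\<And>k l. log_lip k l \<Longrightarrow> 1 \<le> k \<Longrightarrow> ennreal (z / real k * exp (l al0)) \<le> (\<integral>\<^sup>+al. ennreal (weight l al) \<partial>lborel)"
    by (rule weight_integral_lower) blast
  have "ennreal (z / real (max k 1) * exp (l al0)) \<le> ennreal (LINT al|lborel. weight l al)"
    unfolding e[symmetric] by (intro z log_lip_mono[OF assms]) auto
  moreover have "0 < z / real (max k 1) * exp (l al0)" using z by simp
  ultimately show "0 < (LINT al|lborel. weight l al)" by (simp add: ennreal_le_iff2)
qed

lemma normalized_weight:
  assumes "log_lip k l"
  shows "normalized_measure lborel (weight l) = density lborel (\<lambda>al. ennreal (weight l al / (LINT al|lborel. weight l al)))"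
    and "prob_space (normalized_measure lborel (weight l))"
proof -
  show "normalized_measure lborel (weight l) = density lborel (\<lambda>al. ennreal (weight l al / (LINT al|lborel. weight l al)))"
    by (simp add: normalized_measure_def)
  show "prob_space (normalized_measure lborel (weight l))"
    by (intro prob_space_normalized weight_integrable[OF assms] weight_nonneg)
qed

text \<open>The limit law has the density \<open>g\<close>, and \<open>b * Z\<close> is the mass of
  its unnormalised version: \<open>b\<close> is the Gaussian integral, \<open>Z\<close> that of the
  weight. Dividing by \<open>exp (l al0)\<close> fixes the scale in which the error is
  measured.\<close>

lemma tv_from_L1:
  fixes n :: nat and l :: "real \<Rightarrow> real" and ta0 eps :: real and F :: "real \<times> real \<Rightarrow> real"
  defines "b \<equiv> sqrt (4 * pi * th0\<^sup>2 / n)"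
  defines "Z \<equiv> (LINT al|lborel. weight (\<lambda>al. l al - l al0) al)"
  assumes n: "1 \<le> n" and l: "log_lip n l"
    and F: "F \<in> borel_measurable lborel2" "\<And>x. 0 \<le> F x"
    and e: "0 \<le> eps" "eps < 1"
    and L1: "(\<integral>\<^sup>+x. ennreal (abs (exp (- l al0) * F x - gauss_peak n th0 ta0 (fst x) * weight (\<lambda>al. l al - l al0) (snd x))) \<partial>lborel2) \<le> ennreal (eps * (b * Z))"
  shows "tv_dist (normalized_measure lborel2 F) (normal_law ta0 (2 * th0\<^sup>2 / n) \<Otimes>\<^sub>M normalized_measure lborel (weight l)) \<le> 2 * eps" (is "tv_dist _ ?T \<le> _")
    and "integrable lborel2 F" and "0 < (LINT x|lborel2. F x)"
proof -
  define sd where "sd = sqrt (2 * th0\<^sup>2 / n)"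
  have n0: "0 < real n" using n by simp
  have v: "0 < 2 * th0\<^sup>2 / n" using n0 pos by simp
  then have sd: "0 < sd" "sd\<^sup>2 = 2 * th0\<^sup>2 / n" by (auto simp: sd_def)
  have b: "0 < b" unfolding b_def using n0 pos by simp
  let ?l = "\<lambda>al. l al - l al0"
  note w = weight_integrable[OF log_lip_shift[OF l, of "l al0"]]
  have Z: "0 < Z" unfolding Z_def by (rule w(2))
  define g where "g = (\<lambda>x. normal_density ta0 sd (fst x) * (weight ?l (snd x) / Z))"
  have nd: "normal_density ta0 sd th = gauss_peak n th0 ta0 th / b" for th
  proof -
    have "2 * pi * sd\<^sup>2 = 4 * pi * th0\<^sup>2 / n" unfolding sd(2) by simp
    moreover have "- (th - ta0)\<^sup>2 / (2 * sd\<^sup>2) = - (n / (4 * th0\<^sup>2)) * (th - ta0)\<^sup>2"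
      unfolding sd(2) using n0 by simp
    ultimately show ?thesis unfolding normal_density_def b_def by simp
  qed
  have wm: "weight ?l \<in> borel_measurable borel" by (rule weight_measurable[OF log_lip_shift[OF l]])
  have nw: "normalized_measure lborel (weight l) = density lborel (\<lambda>al. ennreal (weight ?l al / Z))"
  proof -
    have "weight ?l al / Z = weight l al / (LINT al|lborel. weight l al)" for al
      unfolding Z_def weight_shift by simp
    then show ?thesis unfolding normalized_weight(1)[OF l] by simp
  qed
  have target: "?T = density lborel2 (\<lambda>x. ennreal (g x))"
  proof -
    have "normal_law ta0 (2 * th0\<^sup>2 / n) = density lborel (\<lambda>x. ennreal (normal_density ta0 sd x))"
      using v by (simp add: normal_law_def sd_def)
    moreover have "density lborel (\<lambda>x. ennreal (normal_density ta0 sd x)) \<Otimes>\<^sub>M density lborel (\<lambda>al. ennreal (weight ?l al / Z))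
      = density lborel2 (\<lambda>(x, y). ennreal (normal_density ta0 sd x) * ennreal (weight ?l y / Z))"
    proof (rule pair_measure_density)
      show "sigma_finite_measure (density lborel (\<lambda>al. ennreal (weight ?l al / Z)))"
        unfolding nw[symmetric] by (intro prob_space_imp_sigma_finite normalized_weight(2)[OF l])
    qed (use wm in \<open>auto intro: sigma_finite_lborel\<close>)
    moreover have "(\<lambda>(x, y). ennreal (normal_density ta0 sd x) * ennreal (weight ?l y / Z)) = (\<lambda>x. ennreal (g x))"
      by (intro ext) (simp only: g_def case_prod_unfold ennreal_mult'[OF normal_density_nonneg])
    ultimately show ?thesis unfolding nw by simp
  qed
  have pT: "prob_space ?T"
    by (intro prob_space_pair prob_space_normal_law normalized_weight(2)[OF l])
  have g0: "0 \<le> g x" for x using Z by (simp add: g_def weight_nonneg)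
  have gm: "g \<in> borel_measurable lborel2" unfolding g_def using wm by measurable
  have g1: "(\<integral>\<^sup>+x. ennreal (g x) \<partial>lborel2) = 1"
  proof -
    have "(\<integral>\<^sup>+x. ennreal (g x) \<partial>lborel2) = emeasure (density lborel2 (\<lambda>x. ennreal (g x))) (space lborel2)"
    proof -
      have "emeasure (density lborel2 (\<lambda>x. ennreal (g x))) (space lborel2)
        = (\<integral>\<^sup>+x. ennreal (g x) * indicator (space lborel2) x \<partial>lborel2)"
        using measurable_compose[OF gm measurable_ennreal] sets.top by (rule emeasure_density)
      then show ?thesis by (simp cong: nn_integral_cong)
    qed
    also have "\<dots> = 1" using prob_space.emeasure_space_1[OF pT] unfolding target by simp
    finally show ?thesis .
  qed
  have gi: "integrable lborel2 g"
    using g1 gm g0 by (intro integrableI_nonneg) auto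
  have gI: "(LINT x|lborel2. g x) = 1"
    using g1 gm g0 by (simp add: integral_eq_nn_integral)
  define k where "k = exp (- l al0) / (b * Z)"
  have k: "0 < k" using b Z by (simp add: k_def)
  have L1': "(\<integral>\<^sup>+x. ennreal \<bar>k * F x - g x\<bar> \<partial>lborel2) \<le> ennreal eps"
  proof -
    let ?D = "\<lambda>x. exp (- l al0) * F x - gauss_peak n th0 ta0 (fst x) * weight ?l (snd x)"
    have "k * F x - g x = 1 / (b * Z) * ?D x" for x
      unfolding k_def g_def nd by (simp add: right_diff_distrib)
    then have "ennreal \<bar>k * F x - g x\<bar> = ennreal (1 / (b * Z)) * ennreal \<bar>?D x\<bar>" for x
      using b Z by (simp add: abs_mult ennreal_mult'[symmetric])
    then have "(\<integral>\<^sup>+x. ennreal \<bar>k * F x - g x\<bar> \<partial>lborel2) = (\<integral>\<^sup>+x. ennreal (1 / (b * Z)) * ennreal \<bar>?D x\<bar> \<partial>lborel2)"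
      by simp
    also have "\<dots> = ennreal (1 / (b * Z)) * (\<integral>\<^sup>+x. ennreal \<bar>?D x\<bar> \<partial>lborel2)"
      proof (rule nn_integral_cmult)
      have "(\<lambda>x. gauss_peak n th0 ta0 (fst x) * weight ?l (snd x)) \<in> borel_measurable lborel2"
        using wm by measurable
      then show "(\<lambda>x. ennreal \<bar>?D x\<bar>) \<in> borel_measurable lborel2"
        using borel_measurable_diff[OF borel_measurable_times[OF borel_measurable_const F(1)]]
        by (intro measurable_compose[OF _ measurable_ennreal] borel_measurable_abs)
    qed
    also have "\<dots> \<le> ennreal (1 / (b * Z)) * ennreal (eps * (b * Z))" by (intro mult_left_mono L1) simp
    also have "\<dots> = ennreal (1 / (b * Z) * (eps * (b * Z)))" using b Z by (intro ennreal_mult'[symmetric]) simp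
    also have "1 / (b * Z) * (eps * (b * Z)) = eps" using b Z by simp
    finally show ?thesis .
  qed
  note tv = tv_dist_normalized[OF F(1) F(2) gi g0 gI k L1' e]
  show "tv_dist (normalized_measure lborel2 F) ?T \<le> 2 * eps"
    unfolding target by (rule tv(1))
  show "integrable lborel2 F" "0 < (LINT x|lborel2. F x)" by (rule tv(2), rule tv(3))
qed

end

lemma tv_dist_nonneg:
  assumes "prob_space M" "prob_space N"
  shows "0 \<le> tv_dist M N"
proof -
  have "\<bar>measure M {} - measure N {}\<bar> \<le> tv_dist M N"
    using prob_space.prob_le_1[OF assms(1)] prob_space.prob_le_1[OF assms(2)] by (intro tv_dist_upper) auto
  then show ?thesis by simp
qed

lemma distr_pair_snd:
  assumes "prob_space N" "prob_space Q" "sets Q = sets borel"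
  shows "distr (N \<Otimes>\<^sub>M Q) borel snd = Q"
proof (rule measure_eqI)
  interpret N: prob_space N by fact
  interpret Q: prob_space Q by fact
  fix A assume "A \<in> sets (distr (N \<Otimes>\<^sub>M Q) borel snd)"
  then have A: "A \<in> sets borel" "A \<in> sets Q" by (simp_all add: assms)
  have m: "snd \<in> measurable (N \<Otimes>\<^sub>M Q) borel" using assms(3) by (simp cong: measurable_cong_sets)
  have "snd -` A \<inter> space (N \<Otimes>\<^sub>M Q) = space N \<times> A"
    using sets.sets_into_space[OF A(2)] by (auto simp: space_pair_measure)
  then have "emeasure (distr (N \<Otimes>\<^sub>M Q) borel snd) A = emeasure (N \<Otimes>\<^sub>M Q) (space N \<times> A)"
    using emeasure_distr[OF m A(1)] by simp
  also have "\<dots> = emeasure Q A"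
    using Q.emeasure_pair_measure_Times[OF sets.top A(2), of N] N.emeasure_space_1 by simp
  finally show "emeasure (distr (N \<Otimes>\<^sub>M Q) borel snd) A = emeasure Q A" .
qed (simp add: assms)

text \<open>Projections do not increase the distance, and the projections of a product are its
  factors. Membership in the interval also records the nonnegativity that a sandwich argument
  needs.\<close>

lemma tv_dist_marginals:
  fixes J :: "(real \<times> real) measure"
  assumes J: "prob_space J" "sets J = sets (borel \<Otimes>\<^sub>M borel)" and N: "prob_space N" "sets N = sets borel"
    and Q: "prob_space Q" "sets Q = sets borel"
  shows "tv_dist (distr J borel fst) N \<in> {0..tv_dist J (N \<Otimes>\<^sub>M Q)}" "tv_dist (distr J borel snd) Q \<in> {0..tv_dist J (N \<Otimes>\<^sub>M Q)}"
proof -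
  interpret J: prob_space J by fact
  interpret Q: prob_space Q by fact
  interpret NQ: prob_space "N \<Otimes>\<^sub>M Q" by (rule prob_space_pair[OF N(1) Q(1)])
  have sets: "sets J = sets (N \<Otimes>\<^sub>M Q)"
    unfolding J(2) by (rule sets_pair_measure_cong[symmetric, OF N(2) Q(2)])
  have meas: "fst \<in> measurable J borel" "snd \<in> measurable J borel"
    "fst \<in> measurable (N \<Otimes>\<^sub>M Q) borel" "snd \<in> measurable (N \<Otimes>\<^sub>M Q) borel"
    using J(2) sets by (simp_all cong: measurable_cong_sets)
  have "distr (N \<Otimes>\<^sub>M Q) borel fst = distr (N \<Otimes>\<^sub>M Q) N fst"
    by (rule distr_cong) (simp_all add: N)
  then have fstN: "distr (N \<Otimes>\<^sub>M Q) borel fst = N" using Q.distr_pair_fst by simp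
  note sndQ = distr_pair_snd[OF N(1) Q]
  have 1: "tv_dist (distr J borel f) (distr (N \<Otimes>\<^sub>M Q) borel f) \<in> {0..tv_dist J (N \<Otimes>\<^sub>M Q)}"
    if "f \<in> measurable J borel" "f \<in> measurable (N \<Otimes>\<^sub>M Q) borel" for f :: "real \<times> real \<Rightarrow> real"
    using that sets by (auto intro!: tv_dist_distr_le tv_dist_nonneg J.prob_space_distr NQ.prob_space_distr)
  show "tv_dist (distr J borel fst) N \<in> {0..tv_dist J (N \<Otimes>\<^sub>M Q)}" "tv_dist (distr J borel snd) Q \<in> {0..tv_dist J (N \<Otimes>\<^sub>M Q)}"
    using 1[OF meas(1,3)] 1[OF meas(2,4)] unfolding fstN sndQ .
qed

text \<open>With the window \<open>n powr (et - 1/2)\<close> the orders are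
  \<open>C1 + et - 1/2\<close>, \<open>et - 1/48\<close>, \<open>3 * et - 1/2\<close> and
  \<open>2 * et - 1\<close>, all negative. The second one is where -25/48 has to lie below
  -1/2.\<close>

lemma laplace_rate:
  assumes "0 < (et::real)" "et \<le> 1/100" "C1 + et < (1/2::real)" "0 < C1" "0 < th0"
  shows "(\<lambda>n. real n powr C1 * real n powr (et - 1/2) + (real n * real n powr (et - 1/2) * (2 * real n powr (-25/48)) / th0\<^sup>2
    + 10 * (real n * (real n powr (et - 1/2)) ^ 3 / th0 ^ 3) + real p * (real n powr (et - 1/2))\<^sup>2 / th0\<^sup>2)) \<longlonglongrightarrow> 0"
proof -
  have "(\<lambda>n. real n powr C1 * real n powr (et - 1/2)) \<longlonglongrightarrow> 0" using assms by real_asymp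
  moreover have "(\<lambda>n. real n * real n powr (et - 1/2) * (2 * real n powr (-25/48)) / th0\<^sup>2) \<longlonglongrightarrow> 0" using assms by real_asymp
  moreover have "(\<lambda>n. 10 * (real n * (real n powr (et - 1/2)) ^ 3 / th0 ^ 3)) \<longlonglongrightarrow> 0" using assms by real_asymp
  moreover have "(\<lambda>n. (real n powr (et - 1/2))\<^sup>2) \<longlonglongrightarrow> 0" using assms by real_asymp
  then have "(\<lambda>n. real p * (real n powr (et - 1/2))\<^sup>2 / th0\<^sup>2) \<longlonglongrightarrow> real p * 0 / th0\<^sup>2"
    using assms by (intro tendsto_intros) auto
  ultimately have "(\<lambda>n. real n powr C1 * real n powr (et - 1/2) + (real n * real n powr (et - 1/2) * (2 * real n powr (-25/48)) / th0\<^sup>2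
    + 10 * (real n * (real n powr (et - 1/2)) ^ 3 / th0 ^ 3) + real p * (real n powr (et - 1/2))\<^sup>2 / th0\<^sup>2)) \<longlonglongrightarrow> 0 + (0 + 0 + real p * 0 / th0\<^sup>2)"
    by (intro tendsto_add)
  then show ?thesis by simp
qed

section \<open>Convergence of the posterior\<close>

context prior
begin

text \<open>The log-likelihood \<open>l\<close> and the REML \<open>t\<close> are abstract: the
  limit is proved without reference to the Matern model.\<close>

definition post :: "real \<Rightarrow> (real \<Rightarrow> real) \<Rightarrow> (real \<Rightarrow> real) \<Rightarrow> real \<times> real \<Rightarrow> real" where
  "post N l t x = indicator ({0<..} \<times> {0<..}) x *
     (exp (l (snd x)) * exp (- (N / 2) * divh (t (snd x) / fst x)) * c (fst x) (snd x) * a (snd x))"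

lemma post_nonneg: "0 \<le> post N l t x"
  using c_nonneg a_nonneg by (auto simp: post_def split: split_indicator)

lemma post_measurable:
  assumes l: "log_lip k l" and t: "continuous_on {0<..} t"
  shows "post N l t \<in> borel_measurable lborel2"
proof -
  have c1: "(\<lambda>x. indicator ({0<..} \<times> {0<..}) x * c (fst x) (snd x)) \<in> borel_measurable lborel2"
  proof -
    have "continuous_on {0<..} (\<lambda>th. c th al)" if "0 < al" for al
      by (rule C1_differentiable_imp_continuous_on[OF c_C1[OF that]])
    then have "(\<lambda>(th, al). indicat_real ({0<..} \<times> {0<..}) (th, al) * c th al) \<in> borel_measurable lborel2"
      by (rule sup_measurable_Caratheodory[OF _ c_cont])
    then show ?thesis by (simp add: case_prod_unfold)
  qed
  have t1: "(\<lambda>al. indicator {0<..} al * t al) \<in> borel_measurable borel" by (rule ind_measurable[OF t])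
  have e: "post N l t = (\<lambda>x. (indicator {0<..} (snd x) * (exp (l (snd x)) * a (snd x)))
      * exp (- (N / 2) * divh ((indicator {0<..} (snd x) * t (snd x)) / fst x)) * (indicator ({0<..} \<times> {0<..}) x * c (fst x) (snd x)))"
    by (intro ext) (auto simp: post_def split: split_indicator)
  have "(\<lambda>x. indicator {0<..} (snd x) * (exp (l (snd x)) * a (snd x))) \<in> borel_measurable lborel2"
    using exp_measurable[OF l] by measurable
  moreover have "(\<lambda>x. exp (- (N / 2) * divh ((indicator {0<..} (snd x) * t (snd x)) / fst x))) \<in> borel_measurable lborel2"
    unfolding divh_def using t1 by measurable
  ultimately show ?thesis unfolding e by (rule borel_measurable_times[OF borel_measurable_times c1])
qed

abbreviation "posterior n p l t \<equiv> normalized_measure lborel2 (post (real n - real p) l t)"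

abbreviation "limit_law n l t \<equiv> normal_law (t al0) (2 * th0\<^sup>2 / real n) \<Otimes>\<^sub>M normalized_measure lborel (weight l)"

abbreviation "normalizable f \<equiv> integrable lborel2 f \<and> 0 < (LINT x|lborel2. f x)"

text \<open>The window is wider than \<open>n powr (- 1/2)\<close>, so that the Gaussian mass
  outside is smaller than any power of \<open>n\<close>, yet narrow enough for the errors in the
  exponent. The total error is measured against \<open>b * Z\<close>. Here \<open>Z\<close> may be
  as small as \<open>z / n\<close>, but only the exponentially small tail terms have to make up for
  that.\<close>

lemma post_limit:
  fixes l t :: "nat \<Rightarrow> real \<Rightarrow> real" and p :: nat and R :: real
  assumes tpos: "\<And>n al. p < n \<Longrightarrow> 0 < al \<Longrightarrow> 0 < t n al"
    and tc: "\<And>n. p < n \<Longrightarrow> continuous_on {0<..} (t n)"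
    and l: "\<And>n. p < n \<Longrightarrow> log_lip n (l n)"
    and close: "\<forall>\<^sub>F n in sequentially. \<forall>al\<in>{lo n..hi n}. \<bar>t n al - t n al0\<bar> \<le> 2 * real n powr (-25/48)"
    and conv: "\<forall>\<^sub>F n in sequentially. \<bar>t n al0 - th0\<bar> \<le> R * ln (real n) / sqrt (real n)"
    and ends: "\<forall>\<^sub>F n in sequentially. l n (lo n) - l n al0 \<le> 2 * real n \<and> l n (hi n) - l n al0 \<le> 2 * real n"
  shows "(\<lambda>n. tv_dist (posterior n p (l n) (t n)) (limit_law n (l n) (t n))) \<longlonglongrightarrow> 0"
    and "\<forall>\<^sub>F n in sequentially. normalizable (post (real n - real p) (l n) (t n))"
proof -
  let ?r = "\<lambda>n. ln (real n) / sqrt (real n)"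
  \<comment> \<open>Below 1/48 for the shift of the centre, and below \<open>1/2 - C1\<close> for
    the slope of the log prior.\<close>
  define et where "et = min (1 / 100) ((1 / 2 - C1) / 2)"
  have et: "0 < et" "et \<le> 1 / 100" "C1 + et < 1 / 2" using C by (auto simp: et_def min_def field_simps)
  define r where "r = (\<lambda>n. real n powr (et - 1/2))"
  define de where "de = (\<lambda>n. 2 * real n powr (-25/48))"
  define e where "e = (\<lambda>n. real n powr C1 * r n + (real n * r n * de n / th0\<^sup>2 + 10 * (real n * r n ^ 3 / th0 ^ 3) + real p * (r n)\<^sup>2 / th0\<^sup>2))"
  define b where "b = (\<lambda>n. sqrt (4 * pi * th0\<^sup>2 / real n))"
  define E1 where "E1 = (\<lambda>n. exp (- (real n * (r n)\<^sup>2 / (512 * th0\<^sup>2))))"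
  define E3 where "E3 = (\<lambda>n. exp (- (real n * (r n)\<^sup>2 / (32 * th0\<^sup>2))))"
  define K where "K = (\<lambda>n. 2 * e n * b n + 2 * th0 * real n powr C2 * E1 n + exp (real n powr C3) * exp (- (real n / 256)) + 2 * b n * E3 n)"
  obtain z where z: "0 < z" "\<And>k l. log_lip k l \<Longrightarrow> 1 \<le> k \<Longrightarrow> ennreal (z / real k * exp (l al0)) \<le> (\<integral>\<^sup>+al. ennreal (weight l al) \<partial>lborel)"
    by (rule weight_integral_lower) blast
  define q where "q = (\<lambda>n. (2 * e n + 2 * th0 * real n powr C2 * E1 n / b n + exp (real n powr C3) * exp (- (real n / 256)) / b n + 2 * E3 n)
     + (1 + b n) * exp (- real n) / (b n * (z / real n)))"
  have lim_e: "e \<longlonglongrightarrow> 0" unfolding e_def r_def de_def by (rule laplace_rate[OF et C(1) pos(1)])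
  have lim_q: "q \<longlonglongrightarrow> 0"
  proof -
    have "(\<lambda>n. 2 * th0 * real n powr C2 * E1 n / b n) \<longlonglongrightarrow> 0" unfolding E1_def b_def r_def using et(1,2) C(2) pos(1) by real_asymp
    moreover have "(\<lambda>n. exp (real n powr C3) * exp (- (real n / 256)) / b n) \<longlonglongrightarrow> 0" unfolding b_def using C(3,5) pos(1) by real_asymp
    moreover have "(\<lambda>n. 2 * E3 n) \<longlonglongrightarrow> 0" unfolding E3_def r_def using et(1,2) pos(1) by real_asymp
    moreover have "(\<lambda>n. (1 + b n) * exp (- real n) / (b n * (z / real n))) \<longlonglongrightarrow> 0" unfolding b_def using z(1) pos(1) by real_asymp
    ultimately have "q \<longlonglongrightarrow> (2 * 0 + 0 + 0 + 0) + 0" unfolding q_def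
      by (intro tendsto_add tendsto_mult tendsto_const lim_e)
    then show ?thesis by simp
  qed
  have lim_r: "r \<longlonglongrightarrow> 0" unfolding r_def using et(1,2) by real_asymp
  have ev_r: "\<forall>\<^sub>F n in sequentially. r n < th0 / 8" using lim_r by (rule order_tendstoD) (use pos in simp)
  have ev_e: "\<forall>\<^sub>F n in sequentially. e n < 1 / 2" using lim_e by (rule order_tendstoD) simp
  have ev_q: "\<forall>\<^sub>F n in sequentially. q n < 1" using lim_q by (rule order_tendstoD) simp
  have ev_d: "\<forall>\<^sub>F n in sequentially. de n / r n < 1 / 4"
  proof (rule order_tendstoD)
    show "(\<lambda>n. de n / r n) \<longlonglongrightarrow> 0" unfolding de_def r_def using et(1,2) by real_asymp
  qed simp
  have ev_c: "\<forall>\<^sub>F n in sequentially. \<bar>R\<bar> * (?r n / r n) < 1 / 4"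
  proof (rule order_tendstoD)
    have "(\<lambda>n. ?r n / r n) \<longlonglongrightarrow> 0" unfolding r_def using et(1,2) by real_asymp
    then show "(\<lambda>n. \<bar>R\<bar> * (?r n / r n)) \<longlonglongrightarrow> 0" by (rule tendsto_mult_right_zero)
  qed simp
  have main: "\<forall>\<^sub>F n in sequentially.
     tv_dist (posterior n p (l n) (t n)) (limit_law n (l n) (t n)) \<le> 2 * q n \<and>
     normalizable (post (real n - real p) (l n) (t n))"
    using close conv ends c_deriv c_ratio c_inf tails_small ev_r ev_e ev_q ev_d ev_c eventually_ge_at_top[of "2 * p + 2"]
  proof eventually_elim
    case (elim n)
    have n: "p < n" "1 \<le> n" "0 < real n" "1 \<le> real n" using elim(13) by auto
    have N: "real n / 2 \<le> real n - real p" "real n - real p \<le> real n" using elim(13) by auto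
    have r0: "0 < r n" using n by (simp add: r_def)
    have de0: "0 < de n" using n by (simp add: de_def)
    have b0: "0 < b n" using n pos by (simp add: b_def)
    have e0: "0 \<le> e n" unfolding e_def using r0 de0 pos by (intro add_nonneg_nonneg mult_nonneg_nonneg divide_nonneg_nonneg) auto
    have d1: "de n \<le> r n / 4" using elim(11) r0 by (simp add: divide_less_eq)
    have d2: "\<bar>t n al0 - th0\<bar> \<le> r n / 4"
    proof -
      have "0 \<le> ?r n" using n by simp
      then have "R * ?r n \<le> \<bar>R\<bar> * ?r n" by (intro mult_right_mono) auto
      also have "\<dots> = (\<bar>R\<bar> * (?r n / r n)) * r n" using r0 by simp
      also have "\<dots> \<le> 1 / 4 * r n" using elim(12) r0 by (intro mult_right_mono) auto
      finally have "R * ?r n \<le> r n / 4" by simp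
      moreover have "R * ?r n = R * ln (real n) / sqrt (real n)" by simp
      ultimately show ?thesis using elim(2) by linarith
    qed
    \<comment> \<open>Normalised to 0 at \<open>al0\<close>, so that the tail and mass bounds become
      absolute.\<close>
    define l' where "l' = (\<lambda>al. l n al - l n al0)"
    have ll: "log_lip n (l n)" by (rule l[OF n(1)])
    have ll': "log_lip n l'" unfolding l'_def by (rule log_lip_shift[OF ll])
    have lop: "0 < lo n" using n by simp
    have "\<forall>f\<in>densities. (\<integral>\<^sup>+al\<in>{0<..} - {lo n..hi n}. ennreal (exp (l' al) * f al) \<partial>lborel) \<le> ennreal (exp (- real n))"
      using elim(7) ll' elim(3) by (auto simp: l'_def)
    then have tails: "(\<integral>\<^sup>+al\<in>{0<..} - {lo n..hi n}. ennreal (exp (l' al) * a al) \<partial>lborel) \<le> ennreal (exp (- real n))"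
      "(\<integral>\<^sup>+al\<in>{0<..} - {lo n..hi n}. ennreal (exp (l' al) * (c th0 al * a al)) \<partial>lborel) \<le> ennreal (exp (- real n))" by auto
    have w: "weight l' = (\<lambda>al. indicator {0<..} al * (exp (l' al) * c th0 al * a al))" by (intro ext) (simp add: weight_def)
    have P: "exp (- l n al0) * post N (l n) (t n) x = post N l' (t n) x" for x N
      by (simp add: post_def l'_def exp_diff exp_minus field_simps)
    have joint: "(\<integral>\<^sup>+x. ennreal \<bar>post (real n - real p) l' (t n) x - gauss_peak n th0 (t n al0) (fst x) * weight l' (snd x)\<bar> \<partial>lborel2)
      \<le> ennreal (K n) * (\<integral>\<^sup>+al. ennreal (weight l' al) \<partial>lborel) + ennreal (exp (- real n)) + ennreal (b n) * ennreal (exp (- real n))"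
      unfolding post_def w K_def b_def E1_def E3_def
    proof (rule laplace_joint[where de="de n" and L="real n powr C1" and ?al1.0="lo n" and ?al2.0="hi n"])
      show "(\<lambda>x. indicator ({0<..} \<times> {0<..}) x * (exp (l' (snd x)) * exp (- ((real n - real p) / 2) * divh (t n (snd x) / fst x)) * c (fst x) (snd x) * a (snd x)))
         \<in> borel_measurable lborel2"
        using post_measurable[OF ll' tc[OF n(1)]] unfolding post_def[abs_def] .
      show "(\<lambda>al. indicator {0<..} al * (exp (l' al) * c th0 al * a al)) \<in> borel_measurable borel"
        using weight_measurable[OF ll'] unfolding w .
      show "(\<lambda>al. indicator {0<..} al * (exp (l' al) * a al)) \<in> borel_measurable borel" by (rule exp_measurable[OF ll'])
      show "(\<lambda>th. indicator {0<..} th * c th al) \<in> borel_measurable borel" if "0 < al" for al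
        by (intro ind_measurable C1_differentiable_imp_continuous_on[OF c_C1[OF that]])
      show "\<bar>t n al - t n al0\<bar> \<le> de n" if "lo n \<le> al" "al \<le> hi n" for al
        using elim(1) that by (auto simp: de_def)
      show "exp (- (real n powr C1 * \<bar>th - th0\<bar>)) \<le> c th al / c th0 al \<and> c th al / c th0 al \<le> exp (real n powr C1 * \<bar>th - th0\<bar>)"
        if "lo n \<le> al" "al \<le> hi n" "th0 / 2 < th" "th < 2 * th0" for th al
        using that elim(4) less_le_trans[OF lop that(1)] by (intro c_ratio_bounds) auto
      show "c th al / c th0 al \<le> real n powr C2" if "lo n \<le> al" "al \<le> hi n" "th0 / 2 < th" "th < 2 * th0" for th al
        using elim(5) that by auto
      show "1 / c th0 al \<le> exp (real n powr C3)" if "lo n \<le> al" "al \<le> hi n" for al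
      proof -
        have cp: "0 < c th0 al" using less_le_trans[OF lop that(1)] by (rule c_pos)
        have "- (real n powr C3) \<le> ln (c th0 al)" using elim(6) that by auto
        then have "exp (- (real n powr C3)) \<le> c th0 al" using cp by (simp add: ln_ge_iff)
        then show ?thesis using cp by (simp add: exp_minus field_simps)
      qed
      show "real n powr C1 * r n + (real n * r n * de n / th0\<^sup>2 + 10 * (real n * r n ^ 3 / th0 ^ 3) + (real n - (real n - real p)) * (r n)\<^sup>2 / th0\<^sup>2) \<le> e n"
        by (simp add: e_def)
      show "(\<integral>\<^sup>+al\<in>{0<..} - {lo n..hi n}. ennreal (indicator {0<..} al * (exp (l' al) * c th0 al * a al)) \<partial>lborel) \<le> ennreal (exp (- real n))"
        using tails(2) by (rule order_trans[rotated]) (intro nn_integral_mono, auto simp: mult.assoc split: split_indicator)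
    qed (use pos r0 elim(8,9) N n d1 d2 lop tails(1) e0 in \<open>auto intro: tpos c_nonneg c_pos c_proper a_nonneg\<close>)
    define Z where "Z = (LINT al|lborel. weight l' al)"
    note wi = weight_integrable[OF ll', folded Z_def]
    have Zz: "z / real n \<le> Z"
    proof -
      have "ennreal (z / real n * exp (l' al0)) \<le> ennreal Z" unfolding wi(3)[symmetric] by (rule z(2)[OF ll' n(2)])
      then show ?thesis using wi(2) by (simp add: l'_def)
    qed
    have K0: "0 \<le> K n" unfolding K_def E1_def E3_def using e0 b0 pos by (intro add_nonneg_nonneg mult_nonneg_nonneg) auto
    have q0: "0 \<le> q n" unfolding q_def E1_def E3_def using e0 b0 pos z(1) by (intro add_nonneg_nonneg mult_nonneg_nonneg divide_nonneg_nonneg) auto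
    have zn: "0 < z / real n" using z(1) n by simp
    \<comment> \<open>The first term scales with \<open>Z\<close>; the tail terms do not, and for
      them the lower bound \<open>z / n\<close> of \<open>Z\<close> is used.\<close>
    have "K n * Z + exp (- real n) + b n * exp (- real n) \<le> q n * (b n * Z)"
    proof -
      define y where "y = b n * (z / real n)"
      define A where "A = 2 * e n + 2 * th0 * real n powr C2 * E1 n / b n + exp (real n powr C3) * exp (- (real n / 256)) / b n + 2 * E3 n"
      define D where "D = (1 + b n) * exp (- real n) / y"
      have y: "0 < y" "y \<le> b n * Z" unfolding y_def by (rule mult_pos_pos[OF b0 zn], rule mult_left_mono[OF Zz less_imp_le[OF b0]])
      have qAD: "q n = A + D" by (simp add: q_def A_def D_def y_def)
      have KA: "K n = A * b n" using b0 by (simp add: K_def A_def distrib_right)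
      have "exp (- real n) + b n * exp (- real n) = (1 + b n) * exp (- real n)" by (simp add: distrib_right)
      also have "\<dots> = D * y" using y(1) by (simp add: D_def)
      also have "\<dots> \<le> D * (b n * Z)" using y b0 by (intro mult_left_mono) (auto simp: D_def)
      finally show ?thesis unfolding qAD KA by (simp add: distrib_right mult.assoc)
    qed
    moreover have "ennreal (K n) * ennreal Z + ennreal (exp (- real n)) + ennreal (b n) * ennreal (exp (- real n))
       = ennreal (K n * Z + exp (- real n) + b n * exp (- real n))"
      using K0 b0 wi(2) by (simp add: ennreal_plus ennreal_mult')
    ultimately have L1: "(\<integral>\<^sup>+x. ennreal \<bar>exp (- l n al0) * post (real n - real p) (l n) (t n) x - gauss_peak n th0 (t n al0) (fst x) * weight l' (snd x)\<bar> \<partial>lborel2)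
      \<le> ennreal (q n * (b n * Z))"
      using joint unfolding P wi(3) by (metis (no_types, lifting) ennreal_leI order_trans)
    show ?case
      using tv_from_L1[OF n(2) ll post_measurable[OF ll tc[OF n(1)]] post_nonneg q0 elim(10) L1[unfolded l'_def Z_def b_def]] by blast
  qed
  show "(\<lambda>n. tv_dist (posterior n p (l n) (t n)) (limit_law n (l n) (t n))) \<longlonglongrightarrow> 0"
  proof (rule tendsto_sandwich[of "\<lambda>_. 0" _ _ "\<lambda>n. 2 * q n"])
    show "\<forall>\<^sub>F n in sequentially. tv_dist (posterior n p (l n) (t n)) (limit_law n (l n) (t n)) \<le> 2 * q n"
      using main by (rule eventually_mono) blast
    show "(\<lambda>n. 2 * q n) \<longlonglongrightarrow> 0" using tendsto_mult[OF tendsto_const lim_q, of 2] by simp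
    show "\<forall>\<^sub>F n in sequentially. 0 \<le> tv_dist (posterior n p (l n) (t n)) (limit_law n (l n) (t n))"
      using main eventually_gt_at_top[of p]
    proof eventually_elim
      case (elim n)
      then show ?case
        by (intro tv_dist_nonneg prob_space_normalized prob_space_pair prob_space_normal_law normalized_weight(2)[OF l] post_nonneg) auto
    qed
  qed simp
  show "\<forall>\<^sub>F n in sequentially. normalizable (post (real n - real p) (l n) (t n))"
    using main by (rule eventually_mono) blast
qed

end

section \<open>The limit theorem\<close>

text \<open>Linear independence is a property of the set of columns, so repetitions are excluded
  first: they would leave fewer than \<open>k\<close> distinct vectors and a smaller rank.\<close>

lemma full_rank_mult_vec_inj:
  fixes A :: "real mat"
  assumes A: "A \<in> carrier_mat n k" and rank: "vec_space.rank n A = k"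
    and v: "v \<in> carrier_vec k" "A *\<^sub>v v = 0\<^sub>v n"
  shows "v = 0\<^sub>v k"
proof (rule ccontr)
  assume v0: "v \<noteq> 0\<^sub>v k"
  interpret V: vec_space "TYPE(real)" n .
  have dist: "distinct (cols A)"
  proof (rule ccontr)
    assume "\<not> distinct (cols A)"
    then have lt: "card (set (cols A)) < k" using A card_distinct[of "cols A"] card_length[of "cols A"] by (metis cols_length carrier_matD(2) le_neq_implies_less)
    obtain U where U: "maximal U (\<lambda>T. T \<subseteq> set (cols A) \<and> V.lin_indpt T)"
      using maximal_exists[of "(\<lambda>T. T \<subseteq> set (cols A) \<and> V.lin_indpt T)" "card (set (cols A))" "{}"]
      by (meson List.finite_set card_mono empty_iff empty_subsetI V.finite_lin_indpt2 rev_finite_subset)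
    then have "V.rank A = card U" by (rule V.rank_card_indpt[OF A])
    also have "\<dots> \<le> card (set (cols A))" using U by (intro card_mono) (auto simp: maximal_def)
    finally show False using lt rank by simp
  qed
  show False using V.lin_depI[OF A v(1) v0 v(2) dist] V.full_rank_lin_indpt[OF A rank dist] by simp
qed

text \<open>The powers of \<open>al0\<close> in the variance factor and in the scaled matrix cancel,
  which leaves \<open>sg2\<close> times the correlation matrix.\<close>

lemma gaussian_vector_of_process:
  fixes x :: "nat \<Rightarrow> 'a::euclidean_space"
  assumes P: "prob_space P" and GP: "centered_gaussian_process P S (\<lambda>u v. sg2 * matern nu al0 (u - v)) X"
    and pos: "0 < nu" "0 < sg2" "0 < al0"
    and x: "x ` {..<n} \<subseteq> S" "inj_on x {..<n}"
  shows "gaussian_vector P n (scaled_mat nu n x al0) (sg2 * al0 powr (2 * nu)) (\<lambda>om. Matrix.vec n (\<lambda>i. X (x i) om))"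
proof -
  interpret prob_space P by (rule P)
  interpret pts: matern_points nu n x by unfold_locales (use pos x in auto)
  show ?thesis
  proof
    show "pd_mat n (scaled_mat nu n x al0)" by (rule pts.pd_S[OF pos(3)])
    show "0 < sg2 * al0 powr (2 * nu)" using pos by simp
    show "(\<lambda>om. Matrix.vec n (\<lambda>i. X (x i) om) $ i) \<in> borel_measurable P" if "i < n" for i
      using GP x(1) that by (auto simp: centered_gaussian_process_def gaussian_process_def)
    fix v :: "real vec" assume v: "v \<in> carrier_vec n"
    have "v \<bullet> Matrix.vec n (\<lambda>i. X (x i) om) = (\<Sum>i<n. v $ i * X (x i) om)" for om
      by (simp add: scalar_prod_def lessThan_atLeast0)
    moreover have "(\<Sum>i<n. \<Sum>j<n. v $ i * v $ j * (sg2 * matern nu al0 (x i - x j))) = sg2 * al0 powr (2 * nu) * (qf (scaled_mat nu n x al0) v)"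
    proof -
      have "al0 powr (2 * nu) * al0 powr (- 2 * nu) = 1" using pos by (simp add: powr_add[symmetric])
      then have "sg2 * al0 powr (2 * nu) * (qf (scaled_mat nu n x al0) v) = sg2 * (qf (corr_mat nu n x al0) v)"
        unfolding pts.quad_S_R[OF v] by (simp add: mult.assoc[symmetric])
      also have "\<dots> = sg2 * (\<Sum>i<n. \<Sum>j<n. v $ i * v $ j * corr_mat nu n x al0 $$ (i, j))"
        by (subst quad_eq_sum[OF corr_mat_carrier v]) simp
      also have "\<dots> = (\<Sum>i<n. \<Sum>j<n. v $ i * v $ j * (sg2 * matern nu al0 (x i - x j)))"
        by (simp add: sum_distrib_left corr_mat_def mult_ac)
      finally show ?thesis ..
    qed
    ultimately show "distr P borel (\<lambda>om. v \<bullet> Matrix.vec n (\<lambda>i. X (x i) om)) = normal_law 0 (sg2 * al0 powr (2 * nu) * (qf (scaled_mat nu n x al0) v))"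
      using gaussian_process_linear(1)[OF P GP x, of "\<lambda>i. v $ i"] by simp
  qed simp
qed

section \<open>Identification with the restricted likelihood\<close>

context
  fixes nu :: real and p n :: nat and m :: "nat \<Rightarrow> 'a::euclidean_space \<Rightarrow> real" and Om :: "real mat" and x :: "nat \<Rightarrow> 'a"
  assumes G: "matern_gls n p (design_mat p m n x) Om nu x"
begin

interpretation G: matern_gls n p "design_mat p m n x" Om nu x by (rule G)

lemma quad_form_eq_q: "quad_form nu p m Om n x y al = G.q al y"
  by (simp add: quad_form_def G.q_def Q_mat_def Q_of_def gls_mat_def gls_of_def Let_def)

lemma reml_eq_tau: "reml nu p m Om n x y al = G.tau y al / (real n - real p)"
  by (simp add: reml_def quad_form_eq_q G.tau_def)

lemma ln_dets:
  assumes "0 < al"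
  shows "ln (mdet (corr_mat nu n x al)) + ln (mdet (gls_mat nu p m Om n x al)) = ln (G.D al)"
proof -
  have g: "gls_mat nu p m Om n x al = G.G (G.R al)" by (simp add: gls_mat_def gls_of_def Let_def)
  show ?thesis unfolding G.D_def detprod_def g
    using pd_mat_det_pos[OF G.pd_R[OF assms]] pd_mat_det_pos[OF G.gls_pd[OF G.pd_R[OF assms]]]
    by (simp add: ln_mult)
qed

lemma profile_loglik_eq_ell:
  assumes "0 < al"
  shows "profile_loglik nu p m Om n x y al = G.ell y al"
  unfolding profile_loglik_def G.ell_def quad_form_eq_q ln_dets[OF assms, symmetric] by (simp add: algebra_simps)

text \<open>With the variance \<open>th / al powr (2 * nu)\<close> the powers of \<open>al\<close>
  and the quadratic form combine into the REML; what does not involve \<open>th\<close> is the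
  profile likelihood.\<close>

lemma restricted_loglik_eq:
  assumes "0 < al" "0 < th" "p < n" "0 < G.q al y"
  shows "restricted_loglik nu p m Om n x y (th / al powr (2 * nu)) al
    = G.ell y al - (real n - real p) / 2 * divh (G.tau y al / (real n - real p) / th)"
proof -
  define N where "N = real n - real p"
  define A where "A = al powr (2 * nu)"
  define Q where "Q = G.q al y"
  have N: "0 < N" using assms by (simp add: N_def)
  have A: "0 < A" using assms by (simp add: A_def)
  have Q: "0 < Q" using assms by (simp add: Q_def)
  have 1: "ln (th / A) = ln th - ln A" using A assms by (simp add: ln_div)
  have 2: "ln (A * Q / N / th) = ln A + ln Q - ln N - ln th" using A Q N assms by (simp add: ln_div ln_mult)
  have 3: "ln (Q / N) = ln Q - ln N" using Q N by (simp add: ln_div)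
  have 4: "N / 2 * (A * Q / N / th) = 1 / (2 * (th / A)) * Q" using A N assms by (simp add: field_simps)
  have "N / 2 * divh (A * Q / N / th) = N / 2 * (A * Q / N / th) - N / 2 - N / 2 * (ln A + ln Q - ln N - ln th)"
    unfolding divh_def 2 by (simp add: algebra_simps)
  then have 5: "N / 2 * divh (A * Q / N / th) = 1 / (2 * (th / A)) * Q - N / 2 - N / 2 * (ln A + ln Q - ln N - ln th)"
    unfolding 4 .
  show ?thesis
    unfolding restricted_loglik_def G.ell_def quad_form_eq_q ln_dets[OF assms(1), symmetric] G.tau_def
      N_def[symmetric] A_def[symmetric] Q_def[symmetric] 5 1 3
    by (simp add: field_simps)
qed

end

theorem theorem2:
  fixes T \<nu> \<sigma>\<^sub>0_sq \<alpha>\<^sub>0 \<theta>\<^sub>0 :: real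
    and p :: nat
    and S :: "(real ^ 'd::finite) set"
    and m :: "nat \<Rightarrow> real ^ 'd \<Rightarrow> real"
    and \<beta>\<^sub>0 :: "real vec"
    and \<Omega> :: "real mat"
    and s :: "nat \<Rightarrow> nat \<Rightarrow> real ^ 'd"
    and P :: "'w measure"
    and X Y :: "real ^ 'd \<Rightarrow> 'w \<Rightarrow> real"
    and y :: "nat \<Rightarrow> 'w \<Rightarrow> real vec"
    and \<pi>\<^sub>c :: "real \<Rightarrow> real \<Rightarrow> real"
    and \<pi>\<^sub>a :: "real \<Rightarrow> real"
    and C\<^sub>1 C\<^sub>2 C\<^sub>3 c_lower c_upper :: real
  assumes dim: "CARD('d) \<in> {1, 2, 3}"
    and pos: "0 < T" "0 < \<nu>" "0 < \<sigma>\<^sub>0_sq" "0 < \<alpha>\<^sub>0" "1 \<le> p"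
    and domain: "S = cbox 0 (\<chi> i. T)"
    and theta0: "\<theta>\<^sub>0 = \<sigma>\<^sub>0_sq * \<alpha>\<^sub>0 powr (2 * \<nu>)"
    \<comment> \<open>true process and observations\<close>
    and prob: "prob_space P"
    and GP: "centered_gaussian_process P S (\<lambda>u v. \<sigma>\<^sub>0_sq * matern \<nu> \<alpha>\<^sub>0 (u - v)) X"
    and beta0: "\<beta>\<^sub>0 \<in> carrier_vec p"
    and Y: "\<And>u \<omega>. Y u \<omega> = scalar_prod (Matrix.vec p (\<lambda>j. m j u)) \<beta>\<^sub>0 + X u \<omega>"
    and points: "\<And>n. s n ` {..<n} \<subseteq> S" "\<And>n. inj_on (s n) {..<n}"
    and y: "\<And>n \<omega>. y n \<omega> = Matrix.vec n (\<lambda>i. Y (s n i) \<omega>)"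
    \<comment> \<open>condition (1)\<close>
    and sobolev: "\<And>j. j < p \<Longrightarrow> in_sobolev_W2 (\<nu> + real CARD('d) / 2) S (m j)"
    and rank: "\<And>n. p \<le> n \<Longrightarrow> vec_space.rank n (design_mat p m n (s n)) = p"
    \<comment> \<open>condition (2)\<close>
    and Omega: "psd_mat p \<Omega>"
    and c_nonneg: "\<And>\<theta> \<alpha>. 0 < \<theta> \<Longrightarrow> 0 < \<alpha> \<Longrightarrow> 0 \<le> \<pi>\<^sub>c \<theta> \<alpha>"
    and c_proper: "\<And>\<alpha>. 0 < \<alpha> \<Longrightarrow> (\<integral>\<^sup>+\<theta>\<in>{0<..}. ennreal (\<pi>\<^sub>c \<theta> \<alpha>) \<partial>lborel) = 1"
    and c_C1: "\<And>\<alpha>. 0 < \<alpha> \<Longrightarrow> (\<lambda>\<theta>. \<pi>\<^sub>c \<theta> \<alpha>) C1_differentiable_on {0<..}"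
    and c_cont: "\<And>\<theta>. 0 < \<theta> \<Longrightarrow> continuous_on {0<..} (\<lambda>\<alpha>. \<pi>\<^sub>c \<theta> \<alpha>)"
    and c_pos: "\<And>\<alpha>. 0 < \<alpha> \<Longrightarrow> 0 < \<pi>\<^sub>c \<theta>\<^sub>0 \<alpha>"
    \<comment> \<open>condition (3)\<close>
    and C: "0 < C\<^sub>1" "0 < C\<^sub>2" "0 < C\<^sub>3" "C\<^sub>1 + C\<^sub>2 < 1 / 2" "C\<^sub>3 < 1"
    and c_deriv: "eventually (\<lambda>n.
        (SUP \<alpha>\<in>{alpha_lower CARD('d) \<nu> n..alpha_upper CARD('d) \<nu> n}. SUP \<theta>\<in>{\<theta>\<^sub>0 / 2<..<2 * \<theta>\<^sub>0}.
           ereal \<bar>deriv (\<lambda>t. ln (\<pi>\<^sub>c t \<alpha>)) \<theta>\<bar>) \<le> ereal (real n powr C\<^sub>1)) sequentially"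
    and c_ratio: "eventually (\<lambda>n.
        (SUP \<alpha>\<in>{alpha_lower CARD('d) \<nu> n..alpha_upper CARD('d) \<nu> n}. SUP \<theta>\<in>{\<theta>\<^sub>0 / 2<..<2 * \<theta>\<^sub>0}.
           ereal (\<pi>\<^sub>c \<theta> \<alpha> / \<pi>\<^sub>c \<theta>\<^sub>0 \<alpha>)) \<le> ereal (real n powr C\<^sub>2)) sequentially"
    and c_inf: "eventually (\<lambda>n.
        (INF \<alpha>\<in>{alpha_lower CARD('d) \<nu> n..alpha_upper CARD('d) \<nu> n}.
           ereal (ln (\<pi>\<^sub>c \<theta>\<^sub>0 \<alpha>))) \<ge> ereal (- (real n powr C\<^sub>3))) sequentially"
    \<comment> \<open>condition (4)\<close>
    and a_nonneg: "\<And>\<alpha>. 0 < \<alpha> \<Longrightarrow> 0 \<le> \<pi>\<^sub>a \<alpha>"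
    and a_proper: "(\<integral>\<^sup>+\<alpha>\<in>{0<..}. ennreal (\<pi>\<^sub>a \<alpha>) \<partial>lborel) = 1"
    and a_cont: "continuous_on {0<..} \<pi>\<^sub>a"
    and a_pos: "0 < \<pi>\<^sub>a \<alpha>\<^sub>0"
    and ca_finite: "(\<integral>\<^sup>+\<alpha>\<in>{0<..}. ennreal (\<pi>\<^sub>c \<theta>\<^sub>0 \<alpha> * \<pi>\<^sub>a \<alpha>) \<partial>lborel) < \<infinity>"
    and c_lower: "0 < c_lower" "c_lower < (\<nu> + real CARD('d) / 2) * kappa_lower CARD('d) \<nu>"
    and c_upper: "0 < c_upper" "c_upper < (\<nu> + real CARD('d) / 2) * kappa_upper CARD('d) \<nu>"
    and tail_lower: "eventually (\<lambda>n. max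
        (\<integral>\<^sup>+\<alpha>\<in>{0<..<alpha_lower CARD('d) \<nu> n}.
           ennreal (\<alpha> powr (- real n * (\<nu> + real CARD('d) / 2)) * \<pi>\<^sub>a \<alpha>) \<partial>lborel)
        (\<integral>\<^sup>+\<alpha>\<in>{0<..<alpha_lower CARD('d) \<nu> n}.
           ennreal (\<alpha> powr (- real n * (\<nu> + real CARD('d) / 2)) * \<pi>\<^sub>c \<theta>\<^sub>0 \<alpha> * \<pi>\<^sub>a \<alpha>) \<partial>lborel)
        \<le> ennreal (exp (c_lower * real n * ln (real n)))) sequentially"
    and tail_upper: "eventually (\<lambda>n. max
        (\<integral>\<^sup>+\<alpha>\<in>{alpha_upper CARD('d) \<nu> n<..}.
           ennreal (\<alpha> powr (real n * (\<nu> + real CARD('d) / 2)) * \<pi>\<^sub>a \<alpha>) \<partial>lborel)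
        (\<integral>\<^sup>+\<alpha>\<in>{alpha_upper CARD('d) \<nu> n<..}.
           ennreal (\<alpha> powr (real n * (\<nu> + real CARD('d) / 2)) * \<pi>\<^sub>c \<theta>\<^sub>0 \<alpha> * \<pi>\<^sub>a \<alpha>) \<partial>lborel)
        \<le> ennreal (exp (c_upper * real n * ln (real n)))) sequentially"
  shows "(AE \<omega> in P. (\<lambda>n. tv_dist (joint_posterior \<nu> p m \<Omega> \<pi>\<^sub>c \<pi>\<^sub>a n (s n) (y n \<omega>))
            (normal_law (reml \<nu> p m \<Omega> n (s n) (y n \<omega>) \<alpha>\<^sub>0) (2 * \<theta>\<^sub>0\<^sup>2 / real n)
               \<Otimes>\<^sub>M profile_posterior \<nu> p m \<Omega> \<pi>\<^sub>c \<pi>\<^sub>a \<theta>\<^sub>0 n (s n) (y n \<omega>))) \<longlonglongrightarrow> 0)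
    \<and> (\<forall>n\<ge>p. AE \<omega> in P. profile_posterior_well_defined \<nu> p m \<Omega> \<pi>\<^sub>c \<pi>\<^sub>a \<theta>\<^sub>0 n (s n) (y n \<omega>))
    \<and> (AE \<omega> in P. (\<lambda>n. tv_dist (distr (joint_posterior \<nu> p m \<Omega> \<pi>\<^sub>c \<pi>\<^sub>a n (s n) (y n \<omega>)) borel fst)
            (normal_law (reml \<nu> p m \<Omega> n (s n) (y n \<omega>) \<alpha>\<^sub>0) (2 * \<theta>\<^sub>0\<^sup>2 / real n))) \<longlonglongrightarrow> 0)
    \<and> (AE \<omega> in P. (\<lambda>n. tv_dist (distr (joint_posterior \<nu> p m \<Omega> \<pi>\<^sub>c \<pi>\<^sub>a n (s n) (y n \<omega>)) borel snd)
            (profile_posterior \<nu> p m \<Omega> \<pi>\<^sub>c \<pi>\<^sub>a \<theta>\<^sub>0 n (s n) (y n \<omega>))) \<longlonglongrightarrow> 0)"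
proof -
  interpret prob_space P by (rule prob)
  let ?d = "CARD('d)" and ?s = "\<nu> + real CARD('d) / 2"
  let ?kl = "kappa_lower ?d \<nu>" and ?ku = "kappa_upper ?d \<nu>"
  have d: "1 \<le> ?d" "?d \<le> 3" using dim by auto
  have dim_eq: "DIM(real ^ 'd) = ?d" by simp
  define M where "M = (\<lambda>n. design_mat p m n (s n))"
  define xv where "xv = (\<lambda>n w. Matrix.vec n (\<lambda>i. X (s n i) w))"
  have t0: "0 < \<theta>\<^sub>0" using pos theta0 by simp
  have Mc: "M n \<in> carrier_mat n p" for n by (simp add: M_def design_mat_def)
  have gls: "matern_gls n p (M n) \<Omega> \<nu> (s n)" if n: "p \<le> n" for n
  proof (intro matern_gls.intro gls.intro matern_points.intro)
    show "b = 0\<^sub>v p" if "b \<in> carrier_vec p" "M n *\<^sub>v b = 0\<^sub>v n" for b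
      using Mc that unfolding M_def by (intro full_rank_mult_vec_inj[OF _ rank[OF n]]) auto
  qed (use Mc Omega pos points in auto)
  have gauss: "gaussian_vector P n (scaled_mat \<nu> n (s n) \<alpha>\<^sub>0) \<theta>\<^sub>0 (xv n)" for n
    unfolding xv_def theta0 by (rule gaussian_vector_of_process[OF prob GP pos(2,3,4) points])
  interpret MR: matern_regression P \<nu> \<alpha>\<^sub>0 \<theta>\<^sub>0 T ?kl ?ku p M \<Omega> s xv \<beta>\<^sub>0
  proof (rule matern_regression.intro[OF prob matern_regression_axioms.intro])
    show "\<bar>inner (s n j) e\<bar> \<le> T" if "j < n" "e \<in> Basis" for n j e
    proof -
      have "s n j \<in> cbox 0 (\<chi> i. T)" using points(1)[of n] that(1) unfolding domain by auto
      then have "0 \<le> inner (s n j) e" "inner (s n j) e \<le> inner (\<chi> i. T) e"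
        using that(2) by (auto simp: mem_box)
      moreover have "inner ((\<chi> i. T) :: real ^ 'd) e = T"
        using that(2) by (auto simp: Basis_vec_def inner_axis)
      ultimately show ?thesis by simp
    qed
  qed (use pos t0 d gls gauss beta0 kappa_lower_bounds[OF pos(2) d] kappa_upper_bounds[OF pos(2) d] in auto)
  have y_eq: "y n w = MR.Y n w" for n w
  proof (intro eq_vecI)
    fix i assume "i < dim_vec (MR.Y n w)"
    then have i: "i < n" by (simp add: xv_def)
    then have "Matrix.row (M n) i = Matrix.vec p (\<lambda>j. m j (s n i))" by (intro eq_vecI) (auto simp: M_def design_mat_def)
    then show "y n w $ i = MR.Y n w $ i" using i Mc[of n] by (simp add: y Y xv_def)
  qed (use Mc[of n] in \<open>simp add: y xv_def\<close>)
  have kap: "alpha_lower ?d \<nu> n = real n powr - ?kl" "alpha_upper ?d \<nu> n = real n powr ?ku" for n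
    by (simp_all add: alpha_lower_def alpha_upper_def)
  interpret PR: prior \<theta>\<^sub>0 \<alpha>\<^sub>0 ?s "?kl" "?ku" C\<^sub>1 C\<^sub>2 C\<^sub>3 c_lower c_upper \<pi>\<^sub>c \<pi>\<^sub>a
  proof
    show "0 < ?s" using pos by (simp add: add_pos_nonneg)
    show "0 < ?kl" "0 < ?ku"
      by (rule MR.kl(1), rule MR.ku(1))
    show "\<forall>\<^sub>F n in sequentially. \<forall>al\<in>{real n powr - ?kl..real n powr ?ku}. \<forall>th\<in>{\<theta>\<^sub>0 / 2<..<2 * \<theta>\<^sub>0}.
        \<bar>deriv (\<lambda>t. ln (\<pi>\<^sub>c t al)) th\<bar> \<le> real n powr C\<^sub>1"
      using c_deriv by (rule eventually_mono) (simp add: SUP_le_iff kap)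
    show "\<forall>\<^sub>F n in sequentially. \<forall>al\<in>{real n powr - ?kl..real n powr ?ku}. \<forall>th\<in>{\<theta>\<^sub>0 / 2<..<2 * \<theta>\<^sub>0}.
        \<pi>\<^sub>c th al / \<pi>\<^sub>c \<theta>\<^sub>0 al \<le> real n powr C\<^sub>2"
      using c_ratio by (rule eventually_mono) (simp add: SUP_le_iff kap)
    show "\<forall>\<^sub>F n in sequentially. \<forall>al\<in>{real n powr - ?kl..real n powr ?ku}. - (real n powr C\<^sub>3) \<le> ln (\<pi>\<^sub>c \<theta>\<^sub>0 al)"
      using c_inf by (rule eventually_mono) (simp add: le_INF_iff kap)
    show "\<forall>\<^sub>F n in sequentially. \<forall>f\<in>{\<pi>\<^sub>a, \<lambda>al. \<pi>\<^sub>c \<theta>\<^sub>0 al * \<pi>\<^sub>a al}.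
        (\<integral>\<^sup>+al\<in>{0<..<real n powr - ?kl}. ennreal (al powr (- real n * ?s) * f al) \<partial>lborel) \<le> ennreal (exp (c_lower * real n * ln (real n)))"
      using tail_lower by (rule eventually_mono) (simp add: kap mult.assoc)
    show "\<forall>\<^sub>F n in sequentially. \<forall>f\<in>{\<pi>\<^sub>a, \<lambda>al. \<pi>\<^sub>c \<theta>\<^sub>0 al * \<pi>\<^sub>a al}.
        (\<integral>\<^sup>+al\<in>{real n powr ?ku<..}. ennreal (al powr (real n * ?s) * f al) \<partial>lborel) \<le> ennreal (exp (c_upper * real n * ln (real n)))"
      using tail_upper by (rule eventually_mono) (simp add: kap mult.assoc)
  qed (assumption | rule t0 pos(4) c_nonneg c_proper c_C1 c_cont c_pos C a_nonneg a_cont a_pos ca_finite c_lower(2) c_upper(2))+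
  have lip: "PR.log_lip n (MR.elln n w)" if n: "p \<le> n" and q: "p < n \<longrightarrow> (\<forall>al>0. 0 < MR.qn n w al)" for n w
    unfolding PR.log_lip_def
    using matern_gls.ell_lipschitz[OF gls[OF n] MR.Y_carrier[OF n] n] q by (simp add: dim_eq)
  define t where "t = (\<lambda>w n al. MR.taun n w al / (real n - real p))"
  define J where "J = (\<lambda>w n. joint_posterior \<nu> p m \<Omega> \<pi>\<^sub>c \<pi>\<^sub>a n (s n) (y n w))"
  define NL where "NL = (\<lambda>w n. normal_law (reml \<nu> p m \<Omega> n (s n) (y n w) \<alpha>\<^sub>0) (2 * \<theta>\<^sub>0\<^sup>2 / real n))"
  define PP where "PP = (\<lambda>w n. profile_posterior \<nu> p m \<Omega> \<pi>\<^sub>c \<pi>\<^sub>a \<theta>\<^sub>0 n (s n) (y n w))"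
  have reml_eq: "reml \<nu> p m \<Omega> n (s n) (y n w) al = t w n al" if "p \<le> n" for n w al
    unfolding t_def y_eq M_def by (rule reml_eq_tau[OF gls[OF that, unfolded M_def]])
  have q_eq: "quad_form \<nu> p m \<Omega> n (s n) (y n w) al = MR.qn n w al" if "p \<le> n" for n w al
    unfolding y_eq M_def by (rule quad_form_eq_q[OF gls[OF that, unfolded M_def]])
  \<comment> \<open>The normalising constant of the conditional prior. It cancels in the profile
    posterior once it is positive, which follows from \<open>weight\<close> with the zero
    log-likelihood.\<close>
  define Zc where "Zc = (LINT a:{0<..}|lborel. \<pi>\<^sub>c \<theta>\<^sub>0 a * \<pi>\<^sub>a a)"
  have Zc: "0 < Zc"
  proof -
    have "PR.log_lip 0 (\<lambda>_. 0)" by (simp add: PR.log_lip_def)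
    from PR.weight_integrable(2)[OF this] show ?thesis
      by (simp add: PR.weight_def[abs_def] Zc_def set_lebesgue_integral_def)
  qed
  have weight_eq: "profile_weight \<nu> p m \<Omega> \<pi>\<^sub>c \<pi>\<^sub>a \<theta>\<^sub>0 n (s n) (y n w) = (\<lambda>al. PR.weight (MR.elln n w) al / Zc)" (is "?w = _") if n: "p \<le> n" for n w
  proof
    fix al
    show "?w al = PR.weight (MR.elln n w) al / Zc"
    proof (cases "0 < al")
      case True
      have "profile_loglik \<nu> p m \<Omega> n (s n) (y n w) al = MR.elln n w al"
        unfolding y_eq M_def by (rule profile_loglik_eq_ell[OF gls[OF n, unfolded M_def] True])
      then show ?thesis by (simp add: profile_weight_def PR.weight_def cond_prior_alpha_def Zc_def)
    qed (simp add: profile_weight_def PR.weight_def)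
  qed
  have profile_eq: "PP w n = normalized_measure lborel (PR.weight (MR.elln n w))" if n: "p \<le> n" for n w
    unfolding PP_def profile_posterior_def normalized_measure_def weight_eq[OF n] using Zc by simp
  have joint_eq: "J w n = PR.posterior n p (MR.elln n w) (t w n)"
    if n: "p < n" and q: "\<forall>al>0. 0 < MR.qn n w al" for n w
  proof -
    let ?rl = "\<lambda>th al. restricted_loglik \<nu> p m \<Omega> n (s n) (y n w) (th / al powr (2 * \<nu>)) al"
    have "(\<lambda>(th, al). indicat_real ({0<..} \<times> {0<..}) (th, al) *
          (exp (?rl th al) * \<pi>\<^sub>c th al * \<pi>\<^sub>a al))
      = PR.post (real n - real p) (MR.elln n w) (t w n)"
    proof
      fix z :: "real \<times> real"
      obtain th al where z: "z = (th, al)" by (cases z)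
      show "(case z of (th, al) \<Rightarrow> indicat_real ({0<..} \<times> {0<..}) (th, al) *
          (exp (?rl th al) * \<pi>\<^sub>c th al * \<pi>\<^sub>a al))
        = PR.post (real n - real p) (MR.elln n w) (t w n) z"
      proof (cases "0 < th \<and> 0 < al")
        case True
        have "?rl th al
          = MR.elln n w al - (real n - real p) / 2 * divh (t w n al / th)"
          unfolding y_eq M_def t_def using True q
          by (intro restricted_loglik_eq[OF gls[OF less_imp_le[OF n], unfolded M_def] _ _ n]) (auto simp: M_def)
        then have "exp (?rl th al)
          = exp (MR.elln n w al) * exp (- ((real n - real p) / 2) * divh (t w n al / th))"
          by (simp only: diff_conv_add_uminus exp_add mult_minus_left)
        then show ?thesis unfolding z by (simp add: PR.post_def)
      qed (auto simp: z PR.post_def)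
    qed
    then show ?thesis by (simp add: J_def joint_posterior_def)
  qed
  have regular: "AE w in P. MR.regular_path w" by (rule MR.AE_regular_path)
  have limit: "(\<lambda>n. tv_dist (PR.posterior n p (MR.elln n w) (t w n)) (PR.limit_law n (MR.elln n w) (t w n))) \<longlonglongrightarrow> 0
    \<and> (\<forall>\<^sub>F n in sequentially. PR.normalizable (PR.post (real n - real p) (MR.elln n w) (t w n)))"
    if reg: "MR.regular_path w" for w
  proof -
    have q: "0 < MR.qn n w al" if "p < n" "0 < al" for n al using reg that by (simp add: MR.regular_path_def)
    note R = reg[unfolded MR.regular_path_def]
    have 1: "0 < t w n al" if n: "p < n" and a: "0 < al" for n al
      using q[OF n a] a n by (simp add: t_def matern_gls.tau_def[OF gls[OF less_imp_le[OF n]]])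
    have 2: "continuous_on {0<..} (t w n)" if n: "p < n" for n
    proof -
      interpret G: matern_gls n p "M n" \<Omega> \<nu> "s n" by (rule gls) (use n in simp)
      \<comment> \<open>\<open>real 2 * ?s\<close> is \<open>2 * \<nu> + d\<close>, the sum of the
        two rates of \<open>ln q\<close>; the 2 is not a sample size. The aim is continuity of the
        REML in \<open>al\<close>.\<close>
      have "PR.log_lip 2 (\<lambda>al. ln (MR.qn n w al))"
        unfolding PR.log_lip_def
      proof (intro allI impI)
        fix a b :: real assume ab: "0 < a" "0 < b"
        have lb: "ln (b / a) = - ln (a / b)" and la: "ln (a / b) = - ln (b / a)" using ab by (simp_all add: ln_div)
        have mx: "max (real ?d * u) (2 * \<nu> * - u) \<le> real 2 * ?s * \<bar>u\<bar>" for u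
        proof -
          have "real ?d * u \<le> real ?d * \<bar>u\<bar>" by (rule mult_left_mono) auto
          moreover have "2 * \<nu> * - u \<le> 2 * \<nu> * \<bar>u\<bar>" by (rule mult_left_mono) (use pos in auto)
          moreover have "0 \<le> real ?d * \<bar>u\<bar>" "0 \<le> 2 * \<nu> * \<bar>u\<bar>" using pos by auto
          moreover have "real 2 * ?s * \<bar>u\<bar> = 2 * \<nu> * \<bar>u\<bar> + real ?d * \<bar>u\<bar>" by (simp add: algebra_simps)
          ultimately show ?thesis by linarith
        qed
        note Yc = MR.Y_carrier[OF less_imp_le[OF n], of w]
        have "ln (MR.qn n w a) \<le> ln (MR.qn n w b) + real 2 * ?s * \<bar>ln (a / b)\<bar>"
          using G.ln_q_le[OF ab Yc q[OF n ab(1)] q[OF n ab(2)]] mx[of "ln (a / b)"] unfolding lb dim_eq by linarith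
        moreover have "ln (MR.qn n w b) \<le> ln (MR.qn n w a) + real 2 * ?s * \<bar>ln (a / b)\<bar>"
          using G.ln_q_le[OF ab(2,1) Yc q[OF n ab(2)] q[OF n ab(1)]] mx[of "ln (b / a)"] unfolding la abs_minus_cancel dim_eq by linarith
        ultimately show "\<bar>ln (MR.qn n w a) - ln (MR.qn n w b)\<bar> \<le> real 2 * ?s * \<bar>ln (a / b)\<bar>" by linarith
      qed
      then have "continuous_on {0<..} (\<lambda>al. al powr (2 * \<nu>) * exp (ln (MR.qn n w al)) / (real n - real p))"
        using n by (intro continuous_intros PR.log_lip_cont) auto
      then show ?thesis
        by (rule continuous_on_eq) (use q n in \<open>auto simp: t_def G.tau_def\<close>)
    qed
    have 3: "PR.log_lip n (MR.elln n w)" if "p < n" for n by (rule lip) (use that q in auto)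
    \<comment> \<open>From \<open>n powr (23/48)\<close> to \<open>2 * n powr (-25/48)\<close>,
      dividing by \<open>n - p\<close>, which is at least \<open>n / 2\<close>.\<close>
    have 4: "\<forall>\<^sub>F n in sequentially. \<forall>al\<in>{PR.lo n..PR.hi n}. \<bar>t w n al - t w n \<alpha>\<^sub>0\<bar> \<le> 2 * real n powr (-25/48)"
    proof -
      have "\<forall>\<^sub>F n in sequentially. \<forall>al\<in>{PR.lo n..PR.hi n}. \<bar>MR.taun n w al - MR.taun n w \<alpha>\<^sub>0\<bar> \<le> real n powr (23/48)" using R by blast
      then show ?thesis using eventually_ge_at_top[of "2 * p + 1"]
      proof eventually_elim
        case (elim n)
        have n: "real n / 2 \<le> real n - real p" "0 < real n" using elim(2) by auto
        show ?case
        proof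
          fix al assume "al \<in> {PR.lo n..PR.hi n}"
          then have le: "\<bar>MR.taun n w al - MR.taun n w \<alpha>\<^sub>0\<bar> \<le> real n powr (23/48)" using elim(1) by blast
          have "\<bar>t w n al - t w n \<alpha>\<^sub>0\<bar> = \<bar>MR.taun n w al - MR.taun n w \<alpha>\<^sub>0\<bar> / (real n - real p)"
            using n by (simp add: t_def diff_divide_distrib[symmetric] abs_divide)
          also have "\<dots> \<le> real n powr (23/48) / (real n / 2)" using le n by (intro frac_le) auto
          also have "\<dots> = 2 * (real n powr (23/48) / real n powr 1)" using n by simp
          also have "\<dots> = 2 * real n powr (-25/48)" by (subst powr_diff[symmetric]) simp
          finally show "\<bar>t w n al - t w n \<alpha>\<^sub>0\<bar> \<le> 2 * real n powr (-25/48)" .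
        qed
      qed
    qed
    \<comment> \<open>\<open>8 = 2 * (3 + 1)\<close>: 3 from the deviation of \<open>tau\<close>, 1
      from the correction for the \<open>p\<close> lost degrees of freedom, 2 from dividing by
      \<open>n - p\<close> and not by \<open>n\<close>.\<close>
    have 5: "\<forall>\<^sub>F n in sequentially. \<bar>t w n \<alpha>\<^sub>0 - \<theta>\<^sub>0\<bar> \<le> (8 * \<theta>\<^sub>0) * ln (real n) / sqrt (real n)"
    proof -
      have c2: "\<forall>\<^sub>F n in sequentially. \<bar>MR.taun n w \<alpha>\<^sub>0 - \<theta>\<^sub>0 * real n\<bar> \<le> 3 * \<theta>\<^sub>0 * ln (real n) * sqrt (real n)" using R by blast
      have "(\<lambda>n. real p / (ln (real n) * sqrt (real n))) \<longlonglongrightarrow> 0" by real_asymp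
      then have "\<forall>\<^sub>F n in sequentially. real p / (ln (real n) * sqrt (real n)) < 1" by (rule order_tendstoD) simp
      then show ?thesis using c2 eventually_ge_at_top[of "2 * p + 2"]
      proof eventually_elim
        case (elim n)
        have n: "real n / 2 \<le> real n - real p" "0 < real n" "1 < real n" using elim(3) by auto
        define u where "u = ln (real n) * sqrt (real n)"
        have u: "0 < u" using n by (simp add: u_def)
        have pu: "real p \<le> u" using elim(1) u unfolding u_def[symmetric] by (simp add: divide_less_eq)
        have "t w n \<alpha>\<^sub>0 - \<theta>\<^sub>0 = (MR.taun n w \<alpha>\<^sub>0 - \<theta>\<^sub>0 * real n + \<theta>\<^sub>0 * real p) / (real n - real p)"
          using n by (simp add: t_def field_simps)
        then have "\<bar>t w n \<alpha>\<^sub>0 - \<theta>\<^sub>0\<bar> = \<bar>MR.taun n w \<alpha>\<^sub>0 - \<theta>\<^sub>0 * real n + \<theta>\<^sub>0 * real p\<bar> / (real n - real p)"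
          using n by (simp add: abs_divide)
        also have "\<dots> \<le> (4 * \<theta>\<^sub>0 * u) / (real n / 2)"
        proof (rule frac_le)
          have "\<theta>\<^sub>0 * real p \<le> \<theta>\<^sub>0 * u" "0 \<le> \<theta>\<^sub>0 * real p" using pu t0 by (auto intro!: mult_left_mono)
          moreover have "\<bar>MR.taun n w \<alpha>\<^sub>0 - \<theta>\<^sub>0 * real n\<bar> \<le> 3 * (\<theta>\<^sub>0 * u)"
            using elim(2) by (simp add: u_def mult.assoc)
          ultimately show "\<bar>MR.taun n w \<alpha>\<^sub>0 - \<theta>\<^sub>0 * real n + \<theta>\<^sub>0 * real p\<bar> \<le> 4 * \<theta>\<^sub>0 * u"
            unfolding mult.assoc by linarith
        qed (use n u t0 in auto)
        also have "\<dots> = 8 * \<theta>\<^sub>0 * ln (real n) * (sqrt (real n) / real n)" by (simp add: u_def)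
        also have "sqrt (real n) / real n = 1 / sqrt (real n)" using n by (simp add: real_div_sqrt field_simps)
        finally show ?case by simp
      qed
    qed
    have 6: "\<forall>\<^sub>F n in sequentially. MR.elln n w (PR.lo n) - MR.elln n w \<alpha>\<^sub>0 \<le> 2 * real n \<and> MR.elln n w (PR.hi n) - MR.elln n w \<alpha>\<^sub>0 \<le> 2 * real n"
      using R by blast
    show ?thesis
      by (rule conjI[OF PR.post_limit[of p "t w" "\<lambda>n. MR.elln n w", OF 1 2 3 4 5 6]])
  qed
  have main: "(\<lambda>n. tv_dist (J w n) (NL w n \<Otimes>\<^sub>M PP w n)) \<longlonglongrightarrow> 0
    \<and> (\<lambda>n. tv_dist (distr (J w n) borel fst) (NL w n)) \<longlonglongrightarrow> 0
    \<and> (\<lambda>n. tv_dist (distr (J w n) borel snd) (PP w n)) \<longlonglongrightarrow> 0" if reg: "MR.regular_path w" for w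
  proof -
    have q: "\<forall>al>0. 0 < MR.qn n w al" if "p < n" for n using reg that by (simp add: MR.regular_path_def)
    \<comment> \<open>The identification of the posterior needs \<open>p < n\<close>; the limits see
      only large \<open>n\<close>.\<close>
    have eqs: "\<forall>\<^sub>F n in sequentially. J w n = PR.posterior n p (MR.elln n w) (t w n)
       \<and> NL w n = normal_law (t w n \<alpha>\<^sub>0) (2 * \<theta>\<^sub>0\<^sup>2 / real n) \<and> PP w n = normalized_measure lborel (PR.weight (MR.elln n w))"
      using eventually_gt_at_top[of p]
      by eventually_elim (simp add: NL_def joint_eq q reml_eq profile_eq)
    have lim: "(\<lambda>n. tv_dist (J w n) (NL w n \<Otimes>\<^sub>M PP w n)) \<longlonglongrightarrow> 0"
      by (rule Lim_transform_eventually[OF conjunct1[OF limit[OF reg]]]) (use eqs in eventually_elim, simp)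
    have "\<forall>\<^sub>F n in sequentially. tv_dist (distr (J w n) borel fst) (NL w n) \<in> {0..tv_dist (J w n) (NL w n \<Otimes>\<^sub>M PP w n)}
       \<and> tv_dist (distr (J w n) borel snd) (PP w n) \<in> {0..tv_dist (J w n) (NL w n \<Otimes>\<^sub>M PP w n)}"
      using eqs conjunct2[OF limit[OF reg]] eventually_gt_at_top[of p]
    proof eventually_elim
      case (elim n)
      have "prob_space (J w n)" using elim by (auto intro!: prob_space_normalized PR.post_nonneg)
      moreover have "prob_space (NL w n)" using elim by (auto intro!: prob_space_normal_law)
      moreover have "prob_space (PP w n)" using elim q by (auto intro!: PR.normalized_weight(2)[of n] lip)
      moreover have "sets (J w n) = sets (borel \<Otimes>\<^sub>M borel)" "sets (NL w n) = sets borel" "sets (PP w n) = sets borel"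
        using elim(1) by (simp_all add: normalized_measure_def)
      ultimately show ?case using tv_dist_marginals by blast
    qed
    then have ev: "\<forall>\<^sub>F n in sequentially. 0 \<le> tv_dist (distr (J w n) borel fst) (NL w n)"
      "\<forall>\<^sub>F n in sequentially. tv_dist (distr (J w n) borel fst) (NL w n) \<le> tv_dist (J w n) (NL w n \<Otimes>\<^sub>M PP w n)"
      "\<forall>\<^sub>F n in sequentially. 0 \<le> tv_dist (distr (J w n) borel snd) (PP w n)"
      "\<forall>\<^sub>F n in sequentially. tv_dist (distr (J w n) borel snd) (PP w n) \<le> tv_dist (J w n) (NL w n \<Otimes>\<^sub>M PP w n)"
      unfolding eventually_conj_iff atLeastAtMost_iff by blast+
    show ?thesis
      using lim tendsto_sandwich[OF ev(1,2) tendsto_const lim] tendsto_sandwich[OF ev(3,4) tendsto_const lim] by blast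
  qed
  \<comment> \<open>For \<open>n = p\<close> the quadratic form carries the factor 0, so its
    positivity is required only for \<open>p < n\<close>; the Lipschitz bound, and with it
    integrability, holds in both cases.\<close>
  have wd: "AE w in P. profile_posterior_well_defined \<nu> p m \<Omega> \<pi>\<^sub>c \<pi>\<^sub>a \<theta>\<^sub>0 n (s n) (y n w)" if n: "p \<le> n" for n
  proof -
    have "AE w in P. p < n \<longrightarrow> (\<forall>al>0. 0 < MR.qn n w al)"
      using MR.AE_qn_pos[of n] by (cases "p < n") auto
    then show ?thesis
    proof eventually_elim
      case (elim w)
      note w = PR.weight_integrable(1,2)[OF lip[OF n elim]]
      show ?case unfolding profile_posterior_well_defined_def weight_eq[OF n] q_eq[OF n]
        using elim w Zc by simp
    qed
  qed
  have fin: "AE w in P. (\<lambda>n. tv_dist (J w n) (NL w n \<Otimes>\<^sub>M PP w n)) \<longlonglongrightarrow> 0"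
    "AE w in P. (\<lambda>n. tv_dist (distr (J w n) borel fst) (NL w n)) \<longlonglongrightarrow> 0"
    "AE w in P. (\<lambda>n. tv_dist (distr (J w n) borel snd) (PP w n)) \<longlonglongrightarrow> 0"
    by (rule eventually_mono[OF regular], drule main, elim conjE, assumption)+
  show ?thesis
    by (intro conjI allI impI wd fin[unfolded J_def NL_def PP_def])
qed

end
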